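(* Let $R=\mathfrak A^3_{C_p}(g,f)$ be the Radford algebra, $C_p=\langle g\rangle$, $f(g)=1$, and let $C_n=\langle h\rangle$ be a cyclic group of order $n$. Every matched pair of Hopf algebras $(k[C_n],R,\triangleright,\triangleleft)$ is determined by a scalar $\alpha\in k$ through $$g\triangleleft h=g,\qquad x\triangleleft h=x+\alpha(1-g),$$ with the following alternatives: (1) if $p\nmid n$, necessarily $\alpha=0$; (2) if $p\mid n$, every $\alpha\in k$ occurs. The corresponding bicrossed product $E_\alpha=k[C_n]\bowtie R$ is generated by $g,h,x$ with relations $$g^p=1,\quad h^n=1,\quad gh=hg,\quad x^p=x,\quad gx-xg=g(1-g),\quad xh-hx=\alpha h(1-g),$$ and coalgebra structure $\Delta(g)=g\otimes g$, $\Delta(h)=h\otimes h$, $\Delta(x)=x\otimes 1+g\otimes x$. Equivalently, $$E_\alpha\cong\mathfrak A^3_{C_n\times C_p}(g,F_\alpha),\qquad F_\alpha(h^ig^j)=j-i\alpha.$$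
   Context: $k$ is an algebraically closed field of characteristic $p>0$; all algebras, tensor products etc. are over $k$. A third-type datum is a triple $(G,g,f)$ where $G$ is a finite group, $g\in Z(G)$, $f:G\to(k,+)$ is a group homomorphism with $f(g)=1$, and $(f(t)^p-f(t))(1-g^p)=0$ in $k[G]$ for all $t\in G$. The Hopf algebra $\mathfrak A^3_G(g,f)$ is generated as an algebra by the group algebra $k[G]$ and an element $x$ subject to $tx-xt=f(t)\,t(1-g)$ for $t\in G$ and $x^p=x$, with $\Delta(t)=t\otimes t$, $\varepsilon(t)=1$, $S(t)=t^{-1}$ for $t\in G$, and $\Delta(x)=x\otimes 1+g\otimes x$, $\varepsilon(x)=0$, $S(x)=-g^{-1}x$. It has basis $\{tx^i\mid t\in G,\ 0\le i<p\}$. The Radford algebra $R$ is the case $G=C_p=\langle g\rangle$ cyclic of order $p$, $f(g^j)=j\in\mathbb F_p\subseteq k$. A matched pair of Hopf algebras $(A,H,\triangleright,\triangleleft)$ consists of a left action $\triangleright:H\otimes A\to A$ making $A$ a left $H$-module coalgebra and a right action $\triangleleft:H\otimes A\to H$ making $H$ a right $A$-module coalgebra such that: $u\triangleright 1=\varepsilon(u)1$, $1\triangleleft a=\varepsilon(a)1$; $u\triangleright(ab)=(u_{(1)}\triangleright a_{(1)})((u_{(2)}\triangleleft a_{(2)})\triangleright b)$; $(uv)\triangleleft a=(u\triangleleft(v_{(1)}\triangleright a_{(1)}))(v_{(2)}\triangleleft a_{(2)})$; $u_{(1)}\triangleleft a_{(1)}\otimes u_{(2)}\triangleright a_{(2)}=u_{(2)}\triangleleft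 a_{(2)}\otimes u_{(1)}\triangleright a_{(1)}$. The bicrossed product $A\bowtie H$ is the tensor coalgebra $A\otimes H$ with multiplication $(a\bowtie u)(b\bowtie v)=a(u_{(1)}\triangleright b_{(1)})\bowtie(u_{(2)}\triangleleft b_{(2)})v$. *)

theory Defs
  imports
    "HOL-Computational_Algebra.Polynomial"
    "HOL-Library.Poly_Mapping"
    "HOL-Algebra.Module"
    "HOL-Algebra.QuotRing"
    "HOL-Algebra.Generated_Groups"
begin

text \<open>
  The ground field is a type \<open>'k\<close> of class \<open>field\<close>. Groups, algebras and Hopf algebras are
  HOL-Algebra records with explicit carriers, so that they may depend on parameters.
\<close>

section \<open>Algebras over the ground field\<close>

definition base_alg :: "('k::field, 'k) module" where
  "base_alg = \<lparr>carrier = UNIV, mult = (*), one = 1, zero = 0, add = (+), smult = (*)\<rparr>"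

locale k_algebra =
  fixes A :: "('k::field, 'a, 'm) module_scheme" (structure)
  assumes ring_A: "ring A"
    and module_A: "module (base_alg :: ('k, 'k) module) A"
    and smult_mult_left: "\<lbrakk>a \<in> carrier A; b \<in> carrier A\<rbrakk> \<Longrightarrow> (c \<odot> a) \<otimes> b = c \<odot> (a \<otimes> b)"
    and smult_mult_right: "\<lbrakk>a \<in> carrier A; b \<in> carrier A\<rbrakk> \<Longrightarrow> a \<otimes> (c \<odot> b) = c \<odot> (a \<otimes> b)"

definition linear_map ::
  "('k::field, 'a, 'm) module_scheme \<Rightarrow> ('k, 'b, 'n) module_scheme \<Rightarrow> ('a \<Rightarrow> 'b) \<Rightarrow> bool" where
  "linear_map V W \<phi> \<longleftrightarrow>
     \<phi> \<in> carrier V \<rightarrow> carrier W \<and>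
     (\<forall>a\<in>carrier V. \<forall>b\<in>carrier V. \<phi> (a \<oplus>\<^bsub>V\<^esub> b) = \<phi> a \<oplus>\<^bsub>W\<^esub> \<phi> b) \<and>
     (\<forall>c. \<forall>a\<in>carrier V. \<phi> (c \<odot>\<^bsub>V\<^esub> a) = c \<odot>\<^bsub>W\<^esub> \<phi> a)"

definition bilinear_map ::
  "('k::field, 'a, 'm) module_scheme \<Rightarrow> ('k, 'b, 'n) module_scheme \<Rightarrow> ('k, 'c, 'o) module_scheme
    \<Rightarrow> ('a \<Rightarrow> 'b \<Rightarrow> 'c) \<Rightarrow> bool" where
  "bilinear_map U V W \<beta> \<longleftrightarrow>
     (\<forall>u\<in>carrier U. linear_map V W (\<beta> u)) \<and> (\<forall>v\<in>carrier V. linear_map U W (\<lambda>u. \<beta> u v))"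

definition alg_hom ::
  "('k::field, 'a, 'm) module_scheme \<Rightarrow> ('k, 'b, 'n) module_scheme \<Rightarrow> ('a \<Rightarrow> 'b) \<Rightarrow> bool" where
  "alg_hom A B \<phi> \<longleftrightarrow> \<phi> \<in> ring_hom A B \<and> linear_map A B \<phi>"

definition op_alg :: "('k, 'a, 'm) module_scheme \<Rightarrow> ('k, 'a, 'm) module_scheme" where
  "op_alg A = A\<lparr>mult := (\<lambda>a b. b \<otimes>\<^bsub>A\<^esub> a)\<rparr>"

abbreviation delta :: "'m \<Rightarrow> 'm \<Rightarrow>\<^sub>0 'k::field" where
  "delta m \<equiv> Poly_Mapping.single m 1"

definition monoid_algebra :: "('m, 'n) monoid_scheme \<Rightarrow> ('k::field, 'm \<Rightarrow>\<^sub>0 'k) module" where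
  "monoid_algebra M =
     \<lparr>carrier = {a. Poly_Mapping.keys a \<subseteq> carrier M},
      mult = (\<lambda>a b. \<Sum>s\<in>Poly_Mapping.keys a. \<Sum>t\<in>Poly_Mapping.keys b.
        Poly_Mapping.single (s \<otimes>\<^bsub>M\<^esub> t) (Poly_Mapping.lookup a s * Poly_Mapping.lookup b t)),
      one = delta \<one>\<^bsub>M\<^esub>,
      zero = 0,
      add = (+),
      smult = (\<lambda>c. Poly_Mapping.map ((*) c))\<rparr>"

text \<open>Scalars act on the coset \<open>I +> a\<close> by \<open>c \<odot> (I +> a) = I +> (c \<odot> a)\<close>.\<close>

definition quot_alg :: "('k::field, 'a, 'm) module_scheme \<Rightarrow> 'a set \<Rightarrow> ('k, 'a set) module" where
  "quot_alg A I = ring.extend (A Quot I)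
     \<lparr>smult = (\<lambda>c X. \<Union>a\<in>X. I +>\<^bsub>A\<^esub> (c \<odot>\<^bsub>A\<^esub> a))\<rparr>"

subsection \<open>Presentations by generators and relations\<close>

definition free_algebra :: "'x set \<Rightarrow> ('k::field, 'x list \<Rightarrow>\<^sub>0 'k) module" where
  "free_algebra X = monoid_algebra \<lparr>carrier = lists X, mult = (@), one = []\<rparr>"

abbreviation var :: "'x \<Rightarrow> 'x list \<Rightarrow>\<^sub>0 'k::field" where
  "var y \<equiv> delta [y]"

definition eval_word :: "('k::field, 'a, 'm) module_scheme \<Rightarrow> ('x \<Rightarrow> 'a) \<Rightarrow> 'x list \<Rightarrow> 'a" where
  "eval_word A v w = foldr (\<lambda>y b. v y \<otimes>\<^bsub>A\<^esub> b) w \<one>\<^bsub>A\<^esub>"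

definition free_ext ::
  "('k::field, 'a, 'm) module_scheme \<Rightarrow> ('x \<Rightarrow> 'a) \<Rightarrow> ('x list \<Rightarrow>\<^sub>0 'k) \<Rightarrow> 'a" where
  "free_ext A v a =
     (\<Oplus>\<^bsub>A\<^esub>w\<in>Poly_Mapping.keys a. Poly_Mapping.lookup a w \<odot>\<^bsub>A\<^esub> eval_word A v w)"

definition rel_ideal :: "'x set \<Rightarrow> ('x list \<Rightarrow>\<^sub>0 'k::field) set \<Rightarrow> ('x list \<Rightarrow>\<^sub>0 'k) set" where
  "rel_ideal X rels = Idl\<^bsub>free_algebra X\<^esub> rels"

definition presented_algebra ::
  "'x set \<Rightarrow> ('x list \<Rightarrow>\<^sub>0 'k::field) set \<Rightarrow> ('k, ('x list \<Rightarrow>\<^sub>0 'k) set) module" where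
  "presented_algebra X rels = quot_alg (free_algebra X) (rel_ideal X rels)"

text \<open>
  The algebra map out of a presented algebra with prescribed values on the generators: the value
  at a coset is the common value of the map \<open>free_ext A v\<close> on its representatives
  (meaningful when \<open>v\<close> respects the relations).
\<close>

definition presented_ext ::
  "('k::field, 'a, 'm) module_scheme \<Rightarrow> ('x \<Rightarrow> 'a) \<Rightarrow> ('x list \<Rightarrow>\<^sub>0 'k) set \<Rightarrow> 'a" where
  "presented_ext A v C = the_elem (free_ext A v ` C)"

definition has_presentation ::
  "('k::field, 'a, 'm) module_scheme \<Rightarrow> 'x set \<Rightarrow> ('x \<Rightarrow> 'a) \<Rightarrow> ('x list \<Rightarrow>\<^sub>0 'k) set \<Rightarrow> bool" where
  "has_presentation A X v rels \<longleftrightarrow>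
     k_algebra A \<and> v ` X \<subseteq> carrier A \<and>
     free_ext A v ` carrier (free_algebra X) = carrier A \<and>
     {a \<in> carrier (free_algebra X). free_ext A v a = \<zero>\<^bsub>A\<^esub>} = rel_ideal X rels"

section \<open>Tensor products\<close>

text \<open>
  \<open>monoid_algebra (A \<times>\<times> B)\<close> is the free vector space on \<open>carrier A \<times> carrier B\<close>. Dividing by the
  subspace spanned by the bilinearity relators gives the tensor product; this subspace is an ideal
  for the multiplication \<open>(a, b) (a', b') = (a a', b b')\<close>, and the quotient carries the usual
  multiplication of the tensor product of two algebras.
\<close>

definition tensor_relators ::
  "('k::field, 'a, 'm) module_scheme \<Rightarrow> ('k, 'b, 'n) module_scheme \<Rightarrow> (('a \<times> 'b) \<Rightarrow>\<^sub>0 'k) set" where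
  "tensor_relators A B =
     {delta (a \<oplus>\<^bsub>A\<^esub> a', b) - delta (a, b) - delta (a', b) | a a' b.
        a \<in> carrier A \<and> a' \<in> carrier A \<and> b \<in> carrier B} \<union>
     {delta (a, b \<oplus>\<^bsub>B\<^esub> b') - delta (a, b) - delta (a, b') | a b b'.
        a \<in> carrier A \<and> b \<in> carrier B \<and> b' \<in> carrier B} \<union>
     {delta (c \<odot>\<^bsub>A\<^esub> a, b) - Poly_Mapping.single (a, b) c | c a b.
        a \<in> carrier A \<and> b \<in> carrier B} \<union>
     {delta (a, c \<odot>\<^bsub>B\<^esub> b) - Poly_Mapping.single (a, b) c | c a b.
        a \<in> carrier A \<and> b \<in> carrier B}"

definition tensor_null ::
  "('k::field, 'a, 'm) module_scheme \<Rightarrow> ('k, 'b, 'n) module_scheme \<Rightarrow> (('a \<times> 'b) \<Rightarrow>\<^sub>0 'k) set" where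
  "tensor_null A B =
     \<Inter>{N. submodule N (base_alg :: ('k, 'k) module) (monoid_algebra (A \<times>\<times> B)) \<and>
          tensor_relators A B \<subseteq> N}"

definition tensor ::
  "('k::field, 'a, 'm) module_scheme \<Rightarrow> ('k, 'b, 'n) module_scheme
    \<Rightarrow> ('k, (('a \<times> 'b) \<Rightarrow>\<^sub>0 'k) set) module" where
  "tensor A B = quot_alg (monoid_algebra (A \<times>\<times> B)) (tensor_null A B)"

definition pure ::
  "('k::field, 'a, 'm) module_scheme \<Rightarrow> ('k, 'b, 'n) module_scheme \<Rightarrow> 'a \<Rightarrow> 'b
    \<Rightarrow> (('a \<times> 'b) \<Rightarrow>\<^sub>0 'k) set" where
  "pure A B a b = tensor_null A B +>\<^bsub>monoid_algebra (A \<times>\<times> B)\<^esub> delta (a, b)"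

text \<open>
  \<open>tlift V \<beta>\<close> is the linear map into \<open>V\<close> induced by a bilinear \<open>\<beta>\<close>: it sends the class of
  \<open>\<Sum> c (a, b)\<close> to \<open>\<Sum> c \<odot> \<beta> a b\<close>. Sweedler notation is rendered with it: for \<open>\<beta>\<close> bilinear,
  \<open>tlift V \<beta> (comult H u)\<close> is \<open>\<beta> u\<^sub>(\<^sub>1\<^sub>) u\<^sub>(\<^sub>2\<^sub>)\<close>.
\<close>

definition tlift ::
  "('k::field, 'c, 'm) module_scheme \<Rightarrow> ('a \<Rightarrow> 'b \<Rightarrow> 'c) \<Rightarrow> (('a \<times> 'b) \<Rightarrow>\<^sub>0 'k) set \<Rightarrow> 'c" where
  "tlift V \<beta> T = the_elem
     ((\<lambda>t. \<Oplus>\<^bsub>V\<^esub>ab\<in>Poly_Mapping.keys t. Poly_Mapping.lookup t ab \<odot>\<^bsub>V\<^esub> \<beta> (fst ab) (snd ab)) ` T)"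

section \<open>Hopf algebras\<close>

record (overloaded) ('k::field, 'a) hopf = "('k, 'a) module" +
  comult :: "'a \<Rightarrow> (('a \<times> 'a) \<Rightarrow>\<^sub>0 'k) set"
  counit :: "'a \<Rightarrow> 'k"
  antipode :: "'a \<Rightarrow> 'a"

locale hopf_algebra = k_algebra H for H :: "('k::field, 'a, 'm) hopf_scheme" (structure) +
  assumes comult_hom: "alg_hom H (tensor H H) (comult H)"
    and counit_hom: "alg_hom H base_alg (counit H)"
    and antipode_linear: "linear_map H H (antipode H)"
    and coassoc: "u \<in> carrier H \<Longrightarrow>
      tlift (tensor H (tensor H H)) (\<lambda>a b. pure H (tensor H H) a (comult H b)) (comult H u) =
      tlift (tensor H (tensor H H)) (\<lambda>a b.
        tlift (tensor H (tensor H H)) (\<lambda>c d. pure H (tensor H H) c (pure H H d b))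
          (comult H a)) (comult H u)"
    and counit_left: "u \<in> carrier H \<Longrightarrow> tlift H (\<lambda>a b. counit H a \<odot> b) (comult H u) = u"
    and counit_right: "u \<in> carrier H \<Longrightarrow> tlift H (\<lambda>a b. counit H b \<odot> a) (comult H u) = u"
    and antipode_left: "u \<in> carrier H \<Longrightarrow>
      tlift H (\<lambda>a b. antipode H a \<otimes> b) (comult H u) = counit H u \<odot> \<one>"
    and antipode_right: "u \<in> carrier H \<Longrightarrow>
      tlift H (\<lambda>a b. a \<otimes> antipode H b) (comult H u) = counit H u \<odot> \<one>"

definition hopf_iso ::
  "('k::field, 'a, 'm) hopf_scheme \<Rightarrow> ('k, 'b, 'n) hopf_scheme \<Rightarrow> ('a \<Rightarrow> 'b) set" where
  "hopf_iso H K = {\<phi>. alg_hom H K \<phi> \<and> bij_betw \<phi> (carrier H) (carrier K) \<and>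
     (\<forall>u\<in>carrier H.
        comult K (\<phi> u) = tlift (tensor K K) (\<lambda>a b. pure K K (\<phi> a) (\<phi> b)) (comult H u) \<and>
        counit K (\<phi> u) = counit H u \<and>
        antipode K (\<phi> u) = \<phi> (antipode H u))}"

definition group_hopf :: "('g, 'm) monoid_scheme \<Rightarrow> ('k::field, 'g \<Rightarrow>\<^sub>0 'k) hopf" where
  "group_hopf G = (let A = monoid_algebra G in module.extend A
     \<lparr>comult = (\<lambda>a. \<Oplus>\<^bsub>tensor A A\<^esub>t\<in>Poly_Mapping.keys a.
        Poly_Mapping.lookup a t \<odot>\<^bsub>tensor A A\<^esub> pure A A (delta t) (delta t)),
      counit = (\<lambda>a. \<Sum>t\<in>Poly_Mapping.keys a. Poly_Mapping.lookup a t),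
      antipode = (\<lambda>a. \<Sum>t\<in>Poly_Mapping.keys a.
        Poly_Mapping.single (inv\<^bsub>G\<^esub> t) (Poly_Mapping.lookup a t))\<rparr>)"

section \<open>Matched pairs and bicrossed products\<close>

locale left_module_coalgebra =
  fixes H :: "('k::field, 'h, 'm) hopf_scheme" and A :: "('k, 'a, 'n) hopf_scheme"
    and act :: "'h \<Rightarrow> 'a \<Rightarrow> 'a"
  assumes act_bilinear: "bilinear_map H A A act"
    and act_one: "a \<in> carrier A \<Longrightarrow> act \<one>\<^bsub>H\<^esub> a = a"
    and act_mult: "\<lbrakk>u \<in> carrier H; v \<in> carrier H; a \<in> carrier A\<rbrakk> \<Longrightarrow>
      act (u \<otimes>\<^bsub>H\<^esub> v) a = act u (act v a)"
    and act_comult: "\<lbrakk>u \<in> carrier H; a \<in> carrier A\<rbrakk> \<Longrightarrow>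
      comult A (act u a) =
      tlift (tensor A A) (\<lambda>u1 u2.
        tlift (tensor A A) (\<lambda>a1 a2. pure A A (act u1 a1) (act u2 a2)) (comult A a)) (comult H u)"
    and act_counit: "\<lbrakk>u \<in> carrier H; a \<in> carrier A\<rbrakk> \<Longrightarrow>
      counit A (act u a) = counit H u * counit A a"

locale right_module_coalgebra =
  fixes A :: "('k::field, 'a, 'm) hopf_scheme" and H :: "('k, 'h, 'n) hopf_scheme"
    and act :: "'h \<Rightarrow> 'a \<Rightarrow> 'h"
  assumes act_bilinear: "bilinear_map H A H act"
    and act_one: "u \<in> carrier H \<Longrightarrow> act u \<one>\<^bsub>A\<^esub> = u"
    and act_mult: "\<lbrakk>u \<in> carrier H; a \<in> carrier A; b \<in> carrier A\<rbrakk> \<Longrightarrow>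
      act u (a \<otimes>\<^bsub>A\<^esub> b) = act (act u a) b"
    and act_comult: "\<lbrakk>u \<in> carrier H; a \<in> carrier A\<rbrakk> \<Longrightarrow>
      comult H (act u a) =
      tlift (tensor H H) (\<lambda>u1 u2.
        tlift (tensor H H) (\<lambda>a1 a2. pure H H (act u1 a1) (act u2 a2)) (comult A a)) (comult H u)"
    and act_counit: "\<lbrakk>u \<in> carrier H; a \<in> carrier A\<rbrakk> \<Longrightarrow>
      counit H (act u a) = counit H u * counit A a"

locale matched_pair =
  A: hopf_algebra A + H: hopf_algebra H +
  l: left_module_coalgebra H A lact + r: right_module_coalgebra A H ract
  for A :: "('k::field, 'a, 'm) hopf_scheme" and H :: "('k, 'h, 'n) hopf_scheme"
    and lact :: "'h \<Rightarrow> 'a \<Rightarrow> 'a" (infix \<open>\<triangleright>\<close> 75)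
    and ract :: "'h \<Rightarrow> 'a \<Rightarrow> 'h" (infix \<open>\<triangleleft>\<close> 75) +
  assumes lact_unit: "u \<in> carrier H \<Longrightarrow> u \<triangleright> \<one>\<^bsub>A\<^esub> = counit H u \<odot>\<^bsub>A\<^esub> \<one>\<^bsub>A\<^esub>"
    and ract_unit: "a \<in> carrier A \<Longrightarrow> \<one>\<^bsub>H\<^esub> \<triangleleft> a = counit A a \<odot>\<^bsub>H\<^esub> \<one>\<^bsub>H\<^esub>"
    and lact_mult: "\<lbrakk>u \<in> carrier H; a \<in> carrier A; b \<in> carrier A\<rbrakk> \<Longrightarrow>
      u \<triangleright> (a \<otimes>\<^bsub>A\<^esub> b) =
      tlift A (\<lambda>u1 u2.
        tlift A (\<lambda>a1 a2. (u1 \<triangleright> a1) \<otimes>\<^bsub>A\<^esub> ((u2 \<triangleleft> a2) \<triangleright> b)) (comult A a)) (comult H u)"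
    and ract_mult: "\<lbrakk>u \<in> carrier H; v \<in> carrier H; a \<in> carrier A\<rbrakk> \<Longrightarrow>
      (u \<otimes>\<^bsub>H\<^esub> v) \<triangleleft> a =
      tlift H (\<lambda>v1 v2.
        tlift H (\<lambda>a1 a2. (u \<triangleleft> (v1 \<triangleright> a1)) \<otimes>\<^bsub>H\<^esub> (v2 \<triangleleft> a2)) (comult A a)) (comult H v)"
    and actions_compat: "\<lbrakk>u \<in> carrier H; a \<in> carrier A\<rbrakk> \<Longrightarrow>
      tlift (tensor H A) (\<lambda>u1 u2.
        tlift (tensor H A) (\<lambda>a1 a2. pure H A (u1 \<triangleleft> a1) (u2 \<triangleright> a2)) (comult A a)) (comult H u) =
      tlift (tensor H A) (\<lambda>u1 u2.
        tlift (tensor H A) (\<lambda>a1 a2. pure H A (u2 \<triangleleft> a2) (u1 \<triangleright> a1)) (comult A a)) (comult H u)"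

definition bicrossed_mult ::
  "('k::field, 'a, 'm) hopf_scheme \<Rightarrow> ('k, 'h, 'n) hopf_scheme
    \<Rightarrow> ('h \<Rightarrow> 'a \<Rightarrow> 'a) \<Rightarrow> ('h \<Rightarrow> 'a \<Rightarrow> 'h)
    \<Rightarrow> (('a \<times> 'h) \<Rightarrow>\<^sub>0 'k) set \<Rightarrow> (('a \<times> 'h) \<Rightarrow>\<^sub>0 'k) set \<Rightarrow> (('a \<times> 'h) \<Rightarrow>\<^sub>0 'k) set" where
  "bicrossed_mult A H lact ract S T = (let W = tensor A H in
     tlift W (\<lambda>a u. tlift W (\<lambda>b v.
       tlift W (\<lambda>u1 u2. tlift W (\<lambda>b1 b2.
         pure A H (a \<otimes>\<^bsub>A\<^esub> lact u1 b1) (ract u2 b2 \<otimes>\<^bsub>H\<^esub> v)) (comult A b)) (comult H u)) T) S)"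

text \<open>
  The elements of \<open>tensor W W\<close> depend only on the vector space \<open>W\<close>, not on its multiplication, so
  the comultiplication of the tensor coalgebra is also one on the bicrossed product. The antipode
  is the standard one, \<open>S (a \<bowtie> u) = (1 \<bowtie> S u) (S a \<bowtie> 1)\<close>.
\<close>

definition bicrossed_product ::
  "('k::field, 'a, 'm) hopf_scheme \<Rightarrow> ('k, 'h, 'n) hopf_scheme
    \<Rightarrow> ('h \<Rightarrow> 'a \<Rightarrow> 'a) \<Rightarrow> ('h \<Rightarrow> 'a \<Rightarrow> 'h) \<Rightarrow> ('k, (('a \<times> 'h) \<Rightarrow>\<^sub>0 'k) set) hopf" where
  "bicrossed_product A H lact ract =
    (let W = tensor A H; m = bicrossed_mult A H lact ract in
     module.extend (W\<lparr>mult := m\<rparr>)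
     \<lparr>comult = tlift (tensor W W) (\<lambda>a u.
        tlift (tensor W W) (\<lambda>a1 a2. tlift (tensor W W) (\<lambda>u1 u2.
          pure W W (pure A H a1 u1) (pure A H a2 u2)) (comult H u)) (comult A a)),
      counit = tlift base_alg (\<lambda>a u. counit A a * counit H u),
      antipode = tlift W (\<lambda>a u.
        m (pure A H \<one>\<^bsub>A\<^esub> (antipode H u)) (pure A H (antipode A a) \<one>\<^bsub>H\<^esub>))\<rparr>)"

section \<open>Hopf algebras of the third type\<close>

definition third_type_datum :: "('g, 'm) monoid_scheme \<Rightarrow> 'g \<Rightarrow> ('g \<Rightarrow> 'k::field) \<Rightarrow> bool" where
  "third_type_datum G g f \<longleftrightarrow>
     group G \<and> finite (carrier G) \<and>
     g \<in> carrier G \<and> (\<forall>t\<in>carrier G. g \<otimes>\<^bsub>G\<^esub> t = t \<otimes>\<^bsub>G\<^esub> g) \<and>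
     f \<in> hom G (add_monoid (base_alg :: ('k, 'k) module)) \<and> f g = 1 \<and>
     (\<forall>t\<in>carrier G. let kG = monoid_algebra G in
        (f t ^ CHAR('k) - f t) \<odot>\<^bsub>kG\<^esub> (\<one>\<^bsub>kG\<^esub> \<ominus>\<^bsub>kG\<^esub> delta g [^]\<^bsub>kG\<^esub> CHAR('k)) = \<zero>\<^bsub>kG\<^esub>)"

datatype 'g third_gen = Elt 'g | Xgen

definition third_gens :: "('g, 'm) monoid_scheme \<Rightarrow> 'g third_gen set" where
  "third_gens G = insert Xgen (Elt ` carrier G)"

definition third_rels ::
  "('g, 'm) monoid_scheme \<Rightarrow> 'g \<Rightarrow> ('g \<Rightarrow> 'k::field) \<Rightarrow> ('g third_gen list \<Rightarrow>\<^sub>0 'k) set" where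
  "third_rels G g f = (let F = free_algebra (third_gens G) in
     {var (Elt \<one>\<^bsub>G\<^esub>) \<ominus>\<^bsub>F\<^esub> \<one>\<^bsub>F\<^esub>} \<union>
     {var (Elt s) \<otimes>\<^bsub>F\<^esub> var (Elt t) \<ominus>\<^bsub>F\<^esub> var (Elt (s \<otimes>\<^bsub>G\<^esub> t)) | s t.
        s \<in> carrier G \<and> t \<in> carrier G} \<union>
     {(var (Elt t) \<otimes>\<^bsub>F\<^esub> var Xgen \<ominus>\<^bsub>F\<^esub> var Xgen \<otimes>\<^bsub>F\<^esub> var (Elt t)) \<ominus>\<^bsub>F\<^esub>
        f t \<odot>\<^bsub>F\<^esub> (var (Elt t) \<otimes>\<^bsub>F\<^esub> (\<one>\<^bsub>F\<^esub> \<ominus>\<^bsub>F\<^esub> var (Elt g))) | t. t \<in> carrier G} \<union>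
     {var Xgen [^]\<^bsub>F\<^esub> CHAR('k) \<ominus>\<^bsub>F\<^esub> var Xgen})"

definition third_alg ::
  "('g, 'm) monoid_scheme \<Rightarrow> 'g \<Rightarrow> ('g \<Rightarrow> 'k::field)
    \<Rightarrow> ('k, ('g third_gen list \<Rightarrow>\<^sub>0 'k) set) module" where
  "third_alg G g f = presented_algebra (third_gens G) (third_rels G g f)"

definition third_elt ::
  "('g, 'm) monoid_scheme \<Rightarrow> 'g \<Rightarrow> ('g \<Rightarrow> 'k::field) \<Rightarrow> 'g third_gen
    \<Rightarrow> ('g third_gen list \<Rightarrow>\<^sub>0 'k) set" where
  "third_elt G g f y =
     rel_ideal (third_gens G) (third_rels G g f) +>\<^bsub>free_algebra (third_gens G)\<^esub> var y"

definition third_hopf ::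
  "('g, 'm) monoid_scheme \<Rightarrow> 'g \<Rightarrow> ('g \<Rightarrow> 'k::field)
    \<Rightarrow> ('k, ('g third_gen list \<Rightarrow>\<^sub>0 'k) set) hopf" where
  "third_hopf G g f =
    (let A = third_alg G g f; e = (\<lambda>t. third_elt G g f (Elt t)); x = third_elt G g f Xgen in
     module.extend A
     \<lparr>comult = presented_ext (tensor A A) (\<lambda>y. case y of
          Elt t \<Rightarrow> pure A A (e t) (e t)
        | Xgen \<Rightarrow> pure A A x \<one>\<^bsub>A\<^esub> \<oplus>\<^bsub>tensor A A\<^esub> pure A A (e g) x),
      counit = presented_ext base_alg (\<lambda>y. case y of Elt t \<Rightarrow> 1 | Xgen \<Rightarrow> 0),
      antipode = presented_ext (op_alg A) (\<lambda>y. case y of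
          Elt t \<Rightarrow> e (inv\<^bsub>G\<^esub> t)
        | Xgen \<Rightarrow> \<ominus>\<^bsub>A\<^esub> (e (inv\<^bsub>G\<^esub> g) \<otimes>\<^bsub>A\<^esub> x))\<rparr>)"

section \<open>The parameter of a matched pair and the relations of the bicrossed product\<close>

definition has_parameter ::
  "'c \<Rightarrow> 'd \<Rightarrow> ('d third_gen \<Rightarrow> 'r) \<Rightarrow> ('k::field, 'r, 'm) module_scheme
    \<Rightarrow> ('r \<Rightarrow> ('c \<Rightarrow>\<^sub>0 'k) \<Rightarrow> 'r) \<Rightarrow> 'k \<Rightarrow> bool" where
  "has_parameter h g e R ract \<alpha> \<longleftrightarrow>
     ract (e (Elt g)) (delta h) = e (Elt g) \<and>
     ract (e Xgen) (delta h) = e Xgen \<oplus>\<^bsub>R\<^esub> \<alpha> \<odot>\<^bsub>R\<^esub> (\<one>\<^bsub>R\<^esub> \<ominus>\<^bsub>R\<^esub> e (Elt g))"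

datatype bicrossed_gen = Gen_g | Gen_h | Gen_x

definition bicrossed_rels :: "nat \<Rightarrow> nat \<Rightarrow> 'k::field \<Rightarrow> (bicrossed_gen list \<Rightarrow>\<^sub>0 'k) set" where
  "bicrossed_rels p n \<alpha> =
    (let F = free_algebra UNIV; g = var Gen_g; h = var Gen_h; x = var Gen_x in
     {g [^]\<^bsub>F\<^esub> p \<ominus>\<^bsub>F\<^esub> \<one>\<^bsub>F\<^esub>,
      h [^]\<^bsub>F\<^esub> n \<ominus>\<^bsub>F\<^esub> \<one>\<^bsub>F\<^esub>,
      g \<otimes>\<^bsub>F\<^esub> h \<ominus>\<^bsub>F\<^esub> h \<otimes>\<^bsub>F\<^esub> g,
      x [^]\<^bsub>F\<^esub> p \<ominus>\<^bsub>F\<^esub> x,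
      (g \<otimes>\<^bsub>F\<^esub> x \<ominus>\<^bsub>F\<^esub> x \<otimes>\<^bsub>F\<^esub> g) \<ominus>\<^bsub>F\<^esub> g \<otimes>\<^bsub>F\<^esub> (\<one>\<^bsub>F\<^esub> \<ominus>\<^bsub>F\<^esub> g),
      (x \<otimes>\<^bsub>F\<^esub> h \<ominus>\<^bsub>F\<^esub> h \<otimes>\<^bsub>F\<^esub> x) \<ominus>\<^bsub>F\<^esub> \<alpha> \<odot>\<^bsub>F\<^esub> (h \<otimes>\<^bsub>F\<^esub> (\<one>\<^bsub>F\<^esub> \<ominus>\<^bsub>F\<^esub> g))})"

end

theory Submission
  imports Defs
begin

text \<open>
  Let \<open>R\<close> be the Radford algebra with group-like generator \<open>g\<close> and skew primitive generator \<open>x\<close>, and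
  let \<open>C\<close> be a finite cyclic group with generator \<open>h\<close>.

  Rigidity. For a group element \<open>t\<close> of \<open>C\<close>, the last axiom of a matched pair at \<open>x\<close> and \<open>t\<close> is an
  identity in \<open>R \<otimes> k[C]\<close>. Since \<open>t\<close> acts bijectively on \<open>R\<close>, this identity becomes a linear relation
  between \<open>1\<close>, \<open>g\<close> and \<open>x\<close>, which are linearly independent; hence the left action is trivial
  (\<open>lact_generators\<close>, \<open>lact_trivial\<close>). The axioms on products and on comultiplications then say
  that \<open>t\<close> acts from the right by a Hopf algebra automorphism of \<open>R\<close>. The group-like elements of \<open>R\<close> are the powers of
  \<open>g\<close>, and the \<open>(1, g)\<close>-primitive elements are the combinations of \<open>x\<close> and \<open>1 - g\<close>
  (\<open>grouplike_imp_elt\<close>, \<open>skew_primitive_form\<close>). As the relation \<open>g x - x g = g (1 - g)\<close> forbids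
  rescaling \<open>x\<close>, the element \<open>t\<close> fixes \<open>g\<close> and sends \<open>x\<close> to \<open>x + c (1 - g)\<close> (\<open>ract_form\<close>). The scalar
  \<open>c\<close> is additive in \<open>t\<close>, so the pair is determined by the scalar \<open>\<alpha>\<close> of \<open>h\<close>, and \<open>n \<alpha> = 0\<close>
  (\<open>parameter_torsion\<close>). In characteristic \<open>p\<close> this means \<open>\<alpha> = 0\<close> unless \<open>p\<close> divides \<open>n\<close>.

  Existence. Because \<open>g\<^sup>p = 1\<close>, every substitution \<open>x \<mapsto> x + c (1 - g)\<close> respects \<open>x\<^sup>p = x\<close> and extends to a
  Hopf algebra automorphism (\<open>shift\<close>, \<open>comult_shift\<close>). If \<open>n \<alpha> = 0\<close>, then \<open>h\<^sup>i \<mapsto> i \<alpha>\<close> is a character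
  \<open>\<chi>\<close> of \<open>C\<close>, and letting \<open>t\<close> act with \<open>c = \<chi> t\<close> gives a matched pair (\<open>matched_pair_twist\<close>).

  The product. With \<open>F (c, d) = f d - \<chi> c\<close> one obtains a third-type datum on the product group
  (\<open>datum_F\<close>). The map \<open>Phi\<close> that multiplies the images of \<open>k[C]\<close> and \<open>R\<close> in the algebra of this datum
  is bijective because it sends a basis to a basis, and it is multiplicative because that algebra
  has the commutation rule of the bicrossed product (\<open>emb_iota\<close>). So the bicrossed product is a
  third-type Hopf algebra (\<open>hopf_iso_Phi\<close>). The presentation by \<open>g\<close>, \<open>h\<close> and \<open>x\<close> is checked on the
  third-type side, by mutually inverse maps between the presented algebras (\<open>presentation_B\<close>).

  Bases. All this depends on a basis of third-type algebras. In place of the powers of \<open>x\<close> it uses the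
  rising factorials \<open>x (x + 1) \<dots> (x + m - 1)\<close>: the one of length \<open>p\<close> is \<open>x\<^sup>p - x\<close> (\<open>rising_CHAR\<close>), and
  they satisfy a skew Vandermonde identity (\<open>rising_skew_sum\<close>), which gives both a binomial formula
  for the comultiplication (\<open>comult_bas\<close>) and the compatibility of \<open>x\<^sup>p = x\<close> with the comultiplication
  and with the substitutions above. Linear independence comes from an action on the functions
  on the group in which \<open>x\<close> depends on a scalar of the prime field (\<open>third_rep_fun_op\<close>).
\<close>

section \<open>Algebras and linear maps\<close>

lemma base_alg_simps [simp]:
  "carrier base_alg = UNIV" "mult base_alg = (*)" "one base_alg = 1"
  "zero base_alg = 0" "add base_alg = (+)" "smult base_alg = (*)"
  by (simp_all add: base_alg_def)

lemma cring_base_alg: "cring (base_alg :: ('k::field, 'k) module)"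
  by (rule cringI; (rule abelian_groupI comm_monoidI)?)
     (auto simp: algebra_simps intro: exI[of _ "- x" for x] add.left_inverse)

lemma module_base_alg: "module base_alg (base_alg :: ('k::field, 'k) module)"
  by (rule moduleI[OF cring_base_alg]) (auto simp: algebra_simps cring_base_alg cring.axioms(1) ring.is_abelian_group)

lemma k_algebra_base_alg [simp]: "k_algebra (base_alg :: ('k::field, 'k) module)"
  by (rule k_algebra.intro) (simp_all add: module_base_alg cring.axioms(1)[OF cring_base_alg])

lemma finsum_base_alg [simp]: "finsum base_alg f S = sum f S"
proof -
  interpret cring "base_alg :: ('a, 'a) module" by (rule cring_base_alg)
  show ?thesis
    by (induction S rule: infinite_finite_induct) auto
qed

sublocale k_algebra \<subseteq> ring A
  by (rule ring_A)

context k_algebra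
begin

lemma smult_closed [simp, intro]: "a \<in> carrier A \<Longrightarrow> c \<odot> a \<in> carrier A"
  using module.smult_closed[OF module_A] by simp

lemma smult_add_left: "a \<in> carrier A \<Longrightarrow> (c + d) \<odot> a = c \<odot> a \<oplus> d \<odot> a"
  using module.smult_l_distr[OF module_A] by simp

lemma smult_add_right: "a \<in> carrier A \<Longrightarrow> b \<in> carrier A \<Longrightarrow> c \<odot> (a \<oplus> b) = c \<odot> a \<oplus> c \<odot> b"
  using module.smult_r_distr[OF module_A] by simp

lemma smult_smult: "a \<in> carrier A \<Longrightarrow> c \<odot> (d \<odot> a) = (c * d) \<odot> a"
  using module.smult_assoc1[OF module_A] by simp

lemma smult_one [simp]: "a \<in> carrier A \<Longrightarrow> 1 \<odot> a = a"
  using module.smult_one[OF module_A] by simp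

lemma smult_zero_left [simp]: "a \<in> carrier A \<Longrightarrow> 0 \<odot> a = \<zero>"
  using module.smult_l_null[OF module_A] by simp

lemma smult_zero_right [simp]: "c \<odot> \<zero> = \<zero>"
  using module.smult_r_null[OF module_A] by simp

lemma smult_minus_one: "a \<in> carrier A \<Longrightarrow> (- 1) \<odot> a = \<ominus> a"
  using smult_add_left[of a "-1" 1] by (intro minus_equality[symmetric]) simp_all

lemma minus_eq_smult: "a \<in> carrier A \<Longrightarrow> b \<in> carrier A \<Longrightarrow> a \<ominus> b = a \<oplus> (- 1) \<odot> b"
  by (simp add: smult_minus_one minus_eq)

lemma smult_minus_right: "a \<in> carrier A \<Longrightarrow> c \<odot> (\<ominus> a) = (- c) \<odot> a"
  by (simp add: smult_minus_one[symmetric] smult_smult)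

lemma smult_minus_left: "a \<in> carrier A \<Longrightarrow> (- c) \<odot> a = \<ominus> (c \<odot> a)"
  using smult_smult[of a "-1" c] by (simp add: smult_minus_one)

lemma smult_eq_zeroD: "c \<odot> a = \<zero> \<Longrightarrow> a \<in> carrier A \<Longrightarrow> c \<noteq> 0 \<Longrightarrow> a = \<zero>"
  using smult_smult[of a "inverse c" c] by simp

lemma smult_finsum:
  "f \<in> S \<rightarrow> carrier A \<Longrightarrow> c \<odot> finsum A f S = (\<Oplus>i\<in>S. c \<odot> f i)"
  by (induction S rule: infinite_finite_induct) (auto simp: smult_add_right Pi_def)

lemma abelian_group_A: "abelian_group A" ..

end

subsection \<open>Linear maps\<close>

lemma linear_mapI:
  assumes "\<And>a. a \<in> carrier V \<Longrightarrow> \<phi> a \<in> carrier W"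
    and "\<And>a b. a \<in> carrier V \<Longrightarrow> b \<in> carrier V \<Longrightarrow> \<phi> (a \<oplus>\<^bsub>V\<^esub> b) = \<phi> a \<oplus>\<^bsub>W\<^esub> \<phi> b"
    and "\<And>c a. a \<in> carrier V \<Longrightarrow> \<phi> (c \<odot>\<^bsub>V\<^esub> a) = c \<odot>\<^bsub>W\<^esub> \<phi> a"
  shows "linear_map V W \<phi>"
  using assms by (auto simp: linear_map_def)

lemma linear_map_closed: "linear_map V W \<phi> \<Longrightarrow> a \<in> carrier V \<Longrightarrow> \<phi> a \<in> carrier W"
  and linear_map_add: "linear_map V W \<phi> \<Longrightarrow> a \<in> carrier V \<Longrightarrow> b \<in> carrier V \<Longrightarrow>
    \<phi> (a \<oplus>\<^bsub>V\<^esub> b) = \<phi> a \<oplus>\<^bsub>W\<^esub> \<phi> b"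
  and linear_map_smult: "linear_map V W \<phi> \<Longrightarrow> a \<in> carrier V \<Longrightarrow> \<phi> (c \<odot>\<^bsub>V\<^esub> a) = c \<odot>\<^bsub>W\<^esub> \<phi> a"
  by (auto simp: linear_map_def)

lemma linear_map_zero:
  assumes "linear_map V W \<phi>" "k_algebra V" "k_algebra W"
  shows "\<phi> \<zero>\<^bsub>V\<^esub> = \<zero>\<^bsub>W\<^esub>"
proof -
  interpret V: k_algebra V by fact
  interpret W: k_algebra W by fact
  have "\<phi> (0 \<odot>\<^bsub>V\<^esub> \<zero>\<^bsub>V\<^esub>) = 0 \<odot>\<^bsub>W\<^esub> \<phi> \<zero>\<^bsub>V\<^esub>"
    by (rule linear_map_smult[OF assms(1)]) simp
  then show ?thesis
    using linear_map_closed[OF assms(1) V.zero_closed] by simp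
qed

lemma linear_map_uminus:
  assumes "linear_map V W \<phi>" "k_algebra V" "k_algebra W" "a \<in> carrier V"
  shows "\<phi> (\<ominus>\<^bsub>V\<^esub> a) = \<ominus>\<^bsub>W\<^esub> \<phi> a"
proof -
  interpret V: k_algebra V by fact
  interpret W: k_algebra W by fact
  show ?thesis
    using linear_map_smult[OF assms(1,4), of "-1"] assms(4) linear_map_closed[OF assms(1,4)]
    by (simp add: V.smult_minus_one W.smult_minus_one)
qed

lemma linear_map_minus:
  assumes "linear_map V W \<phi>" "k_algebra V" "k_algebra W" "a \<in> carrier V" "b \<in> carrier V"
  shows "\<phi> (a \<ominus>\<^bsub>V\<^esub> b) = \<phi> a \<ominus>\<^bsub>W\<^esub> \<phi> b"
proof -
  interpret V: k_algebra V by fact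
  interpret W: k_algebra W by fact
  show ?thesis
    using assms by (simp add: a_minus_def linear_map_add[OF assms(1)] linear_map_uminus[OF assms(1-3)])
qed

lemma linear_map_finsum:
  assumes "linear_map V W \<phi>" "k_algebra V" "k_algebra W" "f \<in> S \<rightarrow> carrier V"
  shows "\<phi> (finsum V f S) = (\<Oplus>\<^bsub>W\<^esub>i\<in>S. \<phi> (f i))"
proof -
  interpret V: k_algebra V by fact
  interpret W: k_algebra W by fact
  show ?thesis using assms(4)
  proof (induction S rule: infinite_finite_induct)
    case (infinite S)
    then show ?case using linear_map_zero[OF assms(1-3)] by simp
  next
    case empty
    then show ?case using linear_map_zero[OF assms(1-3)] by simp
  next
    case (insert x S)
    have "f x \<in> carrier V" "f \<in> S \<rightarrow> carrier V" using insert by auto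
    then show ?case using insert linear_map_closed[OF assms(1)]
      by (subst V.finsum_insert)
         (auto simp: linear_map_add[OF assms(1)] Pi_def)
  qed
qed

text \<open>Syntax-directed rules that establish linearity of an expression in one of its variables.\<close>

named_theorems lin

lemma linear_map_id [lin]: "linear_map V V (\<lambda>x. x)"
  by (simp add: linear_map_def)

lemma linear_map_compose: "linear_map U V \<phi> \<Longrightarrow> linear_map V W \<psi> \<Longrightarrow> linear_map U W (\<lambda>x. \<psi> (\<phi> x))"
  by (auto simp: linear_map_def Pi_def)

lemma linear_map_const_zero: "k_algebra W \<Longrightarrow> linear_map V W (\<lambda>_. \<zero>\<^bsub>W\<^esub>)"
proof -
  assume "k_algebra W"
  then interpret W: k_algebra W .
  show ?thesis by (rule linear_mapI) simp_all
qed

lemma linear_map_plus [lin]: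
  assumes "k_algebra W" "linear_map V W \<phi>" "linear_map V W \<psi>"
  shows "linear_map V W (\<lambda>x. \<phi> x \<oplus>\<^bsub>W\<^esub> \<psi> x)"
proof -
  interpret W: k_algebra W by fact
  show ?thesis
    by (rule linear_mapI)
       (simp_all add: linear_map_closed[OF assms(2)] linear_map_closed[OF assms(3)]
        linear_map_add[OF assms(2)] linear_map_add[OF assms(3)] linear_map_smult[OF assms(2)]
        linear_map_smult[OF assms(3)] W.smult_add_right W.a_ac)
qed

lemma linear_map_smult_const [lin]:
  assumes "k_algebra W" "linear_map V W \<phi>"
  shows "linear_map V W (\<lambda>x. c \<odot>\<^bsub>W\<^esub> \<phi> x)"
proof -
  interpret W: k_algebra W by fact
  show ?thesis
    by (rule linear_mapI)
       (simp_all add: linear_map_closed[OF assms(2)] linear_map_add[OF assms(2)]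
         linear_map_smult[OF assms(2)] W.smult_add_right W.smult_smult mult.commute)
qed

lemma linear_map_smult_fun [lin]:
  assumes "k_algebra W" "linear_map V base_alg \<phi>" "w \<in> carrier W"
  shows "linear_map V W (\<lambda>x. \<phi> x \<odot>\<^bsub>W\<^esub> w)"
proof -
  interpret W: k_algebra W by fact
  show ?thesis
    using linear_map_add[OF assms(2)] linear_map_smult[OF assms(2)]
    by (intro linear_mapI) (simp_all add: assms(3) W.smult_add_left W.smult_smult)
qed

lemma linear_map_mult_left [lin]:
  assumes "k_algebra W" "linear_map V W \<phi>" "w \<in> carrier W"
  shows "linear_map V W (\<lambda>x. \<phi> x \<otimes>\<^bsub>W\<^esub> w)"
proof -
  interpret W: k_algebra W by fact
  show ?thesis
    by (intro linear_mapI) (simp_all add: assms(3) linear_map_closed[OF assms(2)]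
      linear_map_add[OF assms(2)] linear_map_smult[OF assms(2)] W.l_distr W.smult_mult_left)
qed

lemma linear_map_mult_right [lin]:
  assumes "k_algebra W" "linear_map V W \<phi>" "w \<in> carrier W"
  shows "linear_map V W (\<lambda>x. w \<otimes>\<^bsub>W\<^esub> \<phi> x)"
proof -
  interpret W: k_algebra W by fact
  show ?thesis
    by (intro linear_mapI) (simp_all add: assms(3) linear_map_closed[OF assms(2)]
      linear_map_add[OF assms(2)] linear_map_smult[OF assms(2)] W.r_distr W.smult_mult_right)
qed

lemma linear_map_base_mult [lin]:
  "linear_map V base_alg \<phi> \<Longrightarrow> linear_map V base_alg (\<lambda>x. \<phi> x * c)"
  "linear_map V base_alg \<phi> \<Longrightarrow> linear_map V base_alg (\<lambda>x. c * \<phi> x)"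
  by (auto simp: linear_map_def algebra_simps)

lemma bilinear_mapI:
  assumes "\<And>u. u \<in> carrier U \<Longrightarrow> linear_map V W (\<lambda>v. \<beta> u v)"
    and "\<And>v. v \<in> carrier V \<Longrightarrow> linear_map U W (\<lambda>u. \<beta> u v)"
  shows "bilinear_map U V W \<beta>"
  using assms by (simp add: bilinear_map_def)

lemma bilinear_mapD:
  assumes "bilinear_map U V W \<beta>"
  shows "u \<in> carrier U \<Longrightarrow> linear_map V W (\<lambda>v. \<beta> u v)"
    and "v \<in> carrier V \<Longrightarrow> linear_map U W (\<lambda>u. \<beta> u v)"
  using assms by (simp_all add: bilinear_map_def)

lemma bilinear_map_closed:
  "bilinear_map U V W \<beta> \<Longrightarrow> u \<in> carrier U \<Longrightarrow> v \<in> carrier V \<Longrightarrow> \<beta> u v \<in> carrier W"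
  by (rule linear_map_closed[OF bilinear_mapD(1)])

lemma bilinear_map_linear_comp:
  assumes "bilinear_map U V W \<beta>"
  shows "linear_map Z V \<phi> \<Longrightarrow> u \<in> carrier U \<Longrightarrow> linear_map Z W (\<lambda>z. \<beta> u (\<phi> z))"
    and "linear_map Z' U \<psi> \<Longrightarrow> v \<in> carrier V \<Longrightarrow> linear_map Z' W (\<lambda>z. \<beta> (\<psi> z) v)"
  using linear_map_compose[OF _ bilinear_mapD(1)[OF assms]]
    linear_map_compose[OF _ bilinear_mapD(2)[OF assms]] by blast+

lemma alg_homI:
  assumes "linear_map A B \<phi>"
    and "\<And>a b. a \<in> carrier A \<Longrightarrow> b \<in> carrier A \<Longrightarrow> \<phi> (a \<otimes>\<^bsub>A\<^esub> b) = \<phi> a \<otimes>\<^bsub>B\<^esub> \<phi> b"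
    and "\<phi> \<one>\<^bsub>A\<^esub> = \<one>\<^bsub>B\<^esub>"
  shows "alg_hom A B \<phi>"
  using assms by (auto simp: alg_hom_def linear_map_def ring_hom_def)

lemma alg_homD:
  assumes "alg_hom A B \<phi>"
  shows "linear_map A B \<phi>"
    and "a \<in> carrier A \<Longrightarrow> b \<in> carrier A \<Longrightarrow> \<phi> (a \<otimes>\<^bsub>A\<^esub> b) = \<phi> a \<otimes>\<^bsub>B\<^esub> \<phi> b"
    and "\<phi> \<one>\<^bsub>A\<^esub> = \<one>\<^bsub>B\<^esub>"
    and "a \<in> carrier A \<Longrightarrow> \<phi> a \<in> carrier B"
  using assms by (auto simp: alg_hom_def linear_map_def ring_hom_def)

lemma alg_hom_compose: "alg_hom A B \<phi> \<Longrightarrow> alg_hom B C \<psi> \<Longrightarrow> alg_hom A C (\<lambda>x. \<psi> (\<phi> x))"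
  by (rule alg_homI)
     (auto intro: linear_map_compose dest: alg_homD simp: alg_homD(2,3,4))

lemma alg_hom_pow:
  assumes "alg_hom A B \<phi>" "k_algebra A" "k_algebra B" "a \<in> carrier A"
  shows "\<phi> (a [^]\<^bsub>A\<^esub> (n::nat)) = \<phi> a [^]\<^bsub>B\<^esub> n"
proof -
  interpret A: k_algebra A by fact
  interpret B: k_algebra B by fact
  show ?thesis
    by (induction n) (simp_all add: alg_homD[OF assms(1)] assms(4))
qed

subsection \<open>Linear extension\<close>

text \<open>Both the evaluation of noncommutative polynomials and the maps on tensor products are linear
  extensions of functions on a basis; this is their common form.\<close>

definition lin_ext :: "('k::field, 'a, 'm) module_scheme \<Rightarrow> ('i \<Rightarrow> 'a) \<Rightarrow> ('i \<Rightarrow>\<^sub>0 'k) \<Rightarrow> 'a" where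
  "lin_ext V b a = (\<Oplus>\<^bsub>V\<^esub>i\<in>Poly_Mapping.keys a. Poly_Mapping.lookup a i \<odot>\<^bsub>V\<^esub> b i)"

lemma free_ext_lin_ext: "free_ext A v = lin_ext A (eval_word A v)"
  by (rule ext) (simp add: free_ext_def lin_ext_def)

lemma tlift_lin_ext: "tlift V \<beta> T = the_elem (lin_ext V (\<lambda>ab. \<beta> (fst ab) (snd ab)) ` T)"
  by (simp add: tlift_def lin_ext_def)

lemma monoid_algebra_simps [simp]:
  "carrier (monoid_algebra M) = {a. Poly_Mapping.keys a \<subseteq> carrier M}"
  "one (monoid_algebra M) = delta \<one>\<^bsub>M\<^esub>"
  "zero (monoid_algebra M) = 0" "add (monoid_algebra M) = (+)"
  "smult (monoid_algebra M) = (\<lambda>c. Poly_Mapping.map ((*) c))"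
  by (simp_all add: monoid_algebra_def)

lemma lookup_map_mult [simp]:
  "Poly_Mapping.lookup (Poly_Mapping.map ((*) (c::'k::field)) a) i = c * Poly_Mapping.lookup a i"
  by (simp add: Poly_Mapping.map.rep_eq when_def)

lemma map_mult_single [simp]:
  "Poly_Mapping.map ((*) (c::'k::field)) (Poly_Mapping.single i d) = Poly_Mapping.single i (c * d)"
  by (rule poly_mapping_eqI) (simp add: lookup_single when_def)

lemma keys_map_mult: "Poly_Mapping.keys (Poly_Mapping.map ((*) (c::'k::field)) a) \<subseteq> Poly_Mapping.keys a"
  by (auto simp: in_keys_iff)

lemma map_mult_laws:
  fixes a b :: "'i \<Rightarrow>\<^sub>0 'k::field"
  shows "Poly_Mapping.map ((*) (c + d)) a = Poly_Mapping.map ((*) c) a + Poly_Mapping.map ((*) d) a"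
    and "Poly_Mapping.map ((*) c) (a + b) = Poly_Mapping.map ((*) c) a + Poly_Mapping.map ((*) c) b"
    and "Poly_Mapping.map ((*) (c * d)) a = Poly_Mapping.map ((*) c) (Poly_Mapping.map ((*) d) a)"
    and "Poly_Mapping.map ((*) 1) a = a"
    and "Poly_Mapping.map ((*) 0) a = 0"
    and "Poly_Mapping.map ((*) (-1)) a = - a"
  by (rule poly_mapping_eqI, simp add: lookup_add algebra_simps)+

lemma keys_add_subset: "Poly_Mapping.keys a \<subseteq> S \<Longrightarrow> Poly_Mapping.keys b \<subseteq> S \<Longrightarrow> Poly_Mapping.keys (a + b) \<subseteq> S"
  using Poly_Mapping.keys_add[of a b] by blast

lemma monoid_algebra_abelian_group: "abelian_group (monoid_algebra M :: ('k::field, 'm \<Rightarrow>\<^sub>0 'k) module)"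
proof (rule abelian_groupI)
  fix x :: "'m \<Rightarrow>\<^sub>0 'k" assume "x \<in> carrier (monoid_algebra M)"
  then show "\<exists>y\<in>carrier (monoid_algebra M). y \<oplus>\<^bsub>monoid_algebra M\<^esub> x = \<zero>\<^bsub>monoid_algebra M\<^esub>"
    by (intro bexI[of _ "- x"]) (auto simp: in_keys_iff)
qed (simp_all add: keys_add_subset add_ac)

lemma monoid_algebra_module: "module base_alg (monoid_algebra M :: ('k::field, 'm \<Rightarrow>\<^sub>0 'k) module)"
  by (rule moduleI[OF cring_base_alg monoid_algebra_abelian_group])
     (auto simp: map_mult_laws dest: subsetD[OF keys_map_mult])

lemma lin_ext_superset:
  assumes "k_algebra V" "finite S" "Poly_Mapping.keys a \<subseteq> S" "b \<in> S \<rightarrow> carrier V"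
  shows "lin_ext V b a = (\<Oplus>\<^bsub>V\<^esub>i\<in>S. Poly_Mapping.lookup a i \<odot>\<^bsub>V\<^esub> b i)"
proof -
  interpret V: k_algebra V by fact
  show ?thesis
    unfolding lin_ext_def
    by (rule V.add.finprod_mono_neutral_cong_left)
       (use assms in \<open>auto simp: in_keys_iff Pi_def\<close>)
qed

lemma lin_ext_single:
  "k_algebra V \<Longrightarrow> b i \<in> carrier V \<Longrightarrow> lin_ext V b (Poly_Mapping.single i c) = c \<odot>\<^bsub>V\<^esub> b i"
  by (subst lin_ext_superset[of V "{i}"])
     (auto simp: abelian_monoid.finsum_insert abelian_monoid.finsum_empty abelian_group.axioms
       k_algebra.abelian_group_A abelian_monoid.r_zero k_algebra.smult_closed)

lemma linear_map_lin_ext: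
  fixes V :: "('k::field, 'a, 'm) module_scheme"
  assumes "k_algebra V" "b \<in> carrier M \<rightarrow> carrier V"
  shows "linear_map (monoid_algebra M) V (lin_ext V b)"
proof -
  interpret V: k_algebra V by fact
  show ?thesis
  proof (rule linear_mapI)
    fix x :: "_ \<Rightarrow>\<^sub>0 'k" assume x: "x \<in> carrier (monoid_algebra M)"
    then show "lin_ext V b x \<in> carrier V"
      unfolding lin_ext_def using assms(2) by (intro V.finsum_closed) auto
    fix c
    have "lin_ext V b (c \<odot>\<^bsub>monoid_algebra M\<^esub> x) =
        (\<Oplus>\<^bsub>V\<^esub>i\<in>Poly_Mapping.keys x. (c * Poly_Mapping.lookup x i) \<odot>\<^bsub>V\<^esub> b i)"
      using x assms keys_map_mult[of c x] by (subst lin_ext_superset[of V "Poly_Mapping.keys x"]) auto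
    also have "\<dots> = c \<odot>\<^bsub>V\<^esub> lin_ext V b x"
      unfolding lin_ext_def using x assms(2)
      by (subst V.smult_finsum) (auto intro!: V.finsum_cong' simp: V.smult_smult Pi_def subset_iff)
    finally show "lin_ext V b (c \<odot>\<^bsub>monoid_algebra M\<^esub> x) = c \<odot>\<^bsub>V\<^esub> lin_ext V b x" .
  next
    fix x y :: "_ \<Rightarrow>\<^sub>0 'k" assume x: "x \<in> carrier (monoid_algebra M)" and y: "y \<in> carrier (monoid_algebra M)"
    define S where "S = Poly_Mapping.keys x \<union> Poly_Mapping.keys y"
    have S: "finite S" "Poly_Mapping.keys x \<subseteq> S" "Poly_Mapping.keys y \<subseteq> S" "b \<in> S \<rightarrow> carrier V"
      "Poly_Mapping.keys (x + y) \<subseteq> S"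
      using x y assms(2) Poly_Mapping.keys_add[of x y] by (auto simp: S_def)
    have "lin_ext V b (x \<oplus>\<^bsub>monoid_algebra M\<^esub> y) =
        (\<Oplus>\<^bsub>V\<^esub>i\<in>S. Poly_Mapping.lookup x i \<odot>\<^bsub>V\<^esub> b i \<oplus>\<^bsub>V\<^esub> Poly_Mapping.lookup y i \<odot>\<^bsub>V\<^esub> b i)"
      using S by (simp add: lin_ext_superset[OF assms(1) S(1)] lookup_add)
        (rule V.finsum_cong'; auto simp: V.smult_add_left Pi_def)
    also have "\<dots> = lin_ext V b x \<oplus>\<^bsub>V\<^esub> lin_ext V b y"
      unfolding lin_ext_superset[OF assms(1) S(1,2,4)] lin_ext_superset[OF assms(1) S(1,3,4)]
      by (rule V.finsum_addf) (use S(4) in auto)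
    finally show "lin_ext V b (x \<oplus>\<^bsub>monoid_algebra M\<^esub> y) = lin_ext V b x \<oplus>\<^bsub>V\<^esub> lin_ext V b y" .
  qed
qed

lemma monoid_algebra_induct [consumes 1, case_names zero single add]:
  fixes a :: "'m \<Rightarrow>\<^sub>0 'k::field"
  assumes "a \<in> carrier (monoid_algebra M)"
    and zero: "P 0"
    and single: "\<And>m c. m \<in> carrier M \<Longrightarrow> P (Poly_Mapping.single m c)"
    and add: "\<And>a b. a \<in> carrier (monoid_algebra M) \<Longrightarrow> b \<in> carrier (monoid_algebra M) \<Longrightarrow> P a \<Longrightarrow> P b \<Longrightarrow> P (a + b)"
  shows "P a"
proof -
  have "Poly_Mapping.keys a \<subseteq> carrier M" using assms(1) by simp
  then show ?thesis
  proof (induction "card (Poly_Mapping.keys a)" arbitrary: a)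
    case 0
    then show ?case using zero by simp
  next
    case (Suc n)
    then obtain m where m: "m \<in> Poly_Mapping.keys a" by (metis card.empty ex_in_conv nat.distinct(1))
    define a' where "a' = a - Poly_Mapping.single m (Poly_Mapping.lookup a m)"
    have keys: "Poly_Mapping.keys a' = Poly_Mapping.keys a - {m}"
      by (auto simp: a'_def in_keys_iff lookup_minus lookup_single when_def split: if_splits)
    have "P a'" using Suc m by (intro Suc(1)) (auto simp: keys)
    moreover have "P (Poly_Mapping.single m (Poly_Mapping.lookup a m))"
      using single m Suc(3) by blast
    ultimately have "P (a' + Poly_Mapping.single m (Poly_Mapping.lookup a m))"
      using m Suc(3) keys by (intro add) auto
    then show ?case by (simp add: a'_def)
  qed
qed

lemma linear_map_eq_on_monoid_algebra:
  assumes "linear_map (monoid_algebra M) V \<phi>" "linear_map (monoid_algebra M) V \<psi>"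
    and "\<And>m. m \<in> carrier M \<Longrightarrow> \<phi> (delta m) = \<psi> (delta m)"
    and "a \<in> carrier (monoid_algebra M)" and V: "k_algebra V"
  shows "\<phi> a = \<psi> a"
  using assms(4)
proof (induction rule: monoid_algebra_induct)
  case zero
  interpret V: k_algebra V by fact
  have "\<phi> (0 \<odot>\<^bsub>monoid_algebra M\<^esub> 0) = 0 \<odot>\<^bsub>V\<^esub> \<phi> 0" "\<psi> (0 \<odot>\<^bsub>monoid_algebra M\<^esub> 0) = 0 \<odot>\<^bsub>V\<^esub> \<psi> 0"
    using linear_map_smult[OF assms(1), of 0 0] linear_map_smult[OF assms(2), of 0 0] by simp_all
  then show ?case
    using linear_map_closed[OF assms(1), of 0] linear_map_closed[OF assms(2), of 0]
    by (simp add: map_mult_laws)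
next
  case (single m c)
  then show ?case
    using linear_map_smult[OF assms(1), of "delta m" c] linear_map_smult[OF assms(2), of "delta m" c]
      assms(3)[of m] by simp
next
  case (add a b)
  then show ?case using linear_map_add[OF assms(1)] linear_map_add[OF assms(2)] by simp
qed

lemma ring_cong:
  assumes "ring A"
    and "carrier A' = carrier A" "mult A' = mult A" "one A' = one A" "zero A' = zero A" "add A' = add A"
  shows "ring A'"
proof -
  interpret A: ring A by fact
  show ?thesis
    by (rule ringI; (rule abelian_groupI Group.monoidI)?)
       (use A.a_assoc A.a_comm A.m_assoc A.l_distr A.r_distr A.a_inv_closed A.l_neg in
         \<open>auto simp: assms(2-)\<close>)
qed

lemma k_algebra_cong:
  assumes "k_algebra A"
    and "carrier A' = carrier A" "mult A' = mult A" "one A' = one A" "zero A' = zero A" "add A' = add A"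
    and "smult A' = smult A"
  shows "k_algebra A'"
proof -
  interpret A: k_algebra A by fact
  have R: "ring A'" by (rule ring_cong[OF A.ring_A]) (use assms in auto)
  have "module base_alg A'"
    by (rule moduleI[OF cring_base_alg ring.is_abelian_group[OF R]])
       (simp_all add: assms(2-) A.smult_add_left A.smult_add_right A.smult_smult)
  with R show ?thesis
    by (simp add: k_algebra_def assms(2-) A.smult_mult_left A.smult_mult_right)
qed

section \<open>Monoid algebras\<close>

lemma monoid_algebra_mult_superset:
  fixes a b :: "'m \<Rightarrow>\<^sub>0 'k::field"
  assumes "finite S" "Poly_Mapping.keys a \<subseteq> S" "finite T" "Poly_Mapping.keys b \<subseteq> T"
  shows "a \<otimes>\<^bsub>monoid_algebra M\<^esub> b = (\<Sum>s\<in>S. \<Sum>t\<in>T.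
    Poly_Mapping.single (s \<otimes>\<^bsub>M\<^esub> t) (Poly_Mapping.lookup a s * Poly_Mapping.lookup b t))"
proof -
  have "a \<otimes>\<^bsub>monoid_algebra M\<^esub> b = (\<Sum>s\<in>Poly_Mapping.keys a. \<Sum>t\<in>T.
      Poly_Mapping.single (s \<otimes>\<^bsub>M\<^esub> t) (Poly_Mapping.lookup a s * Poly_Mapping.lookup b t))"
    unfolding monoid_algebra_def
    by simp (intro sum.cong refl sum.mono_neutral_left assms; auto simp: in_keys_iff)
  also have "\<dots> = (\<Sum>s\<in>S. \<Sum>t\<in>T.
    Poly_Mapping.single (s \<otimes>\<^bsub>M\<^esub> t) (Poly_Mapping.lookup a s * Poly_Mapping.lookup b t))"
    by (intro sum.mono_neutral_left assms) (auto simp: in_keys_iff)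
  finally show ?thesis .
qed

lemma monoid_algebra_distrib:
  fixes a b c :: "'m \<Rightarrow>\<^sub>0 'k::field"
  shows "(a + b) \<otimes>\<^bsub>monoid_algebra M\<^esub> c = a \<otimes>\<^bsub>monoid_algebra M\<^esub> c + b \<otimes>\<^bsub>monoid_algebra M\<^esub> c"
    and "c \<otimes>\<^bsub>monoid_algebra M\<^esub> (a + b) = c \<otimes>\<^bsub>monoid_algebra M\<^esub> a + c \<otimes>\<^bsub>monoid_algebra M\<^esub> b"
proof -
  let ?S = "Poly_Mapping.keys a \<union> Poly_Mapping.keys b"
  have S: "finite ?S" "Poly_Mapping.keys (a + b) \<subseteq> ?S" by (simp_all add: Poly_Mapping.keys_add)
  show "(a + b) \<otimes>\<^bsub>monoid_algebra M\<^esub> c = a \<otimes>\<^bsub>monoid_algebra M\<^esub> c + b \<otimes>\<^bsub>monoid_algebra M\<^esub> c"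
    using S by (simp add: monoid_algebra_mult_superset[of ?S _ "Poly_Mapping.keys c"] lookup_add
      distrib_right single_add sum.distrib)
  show "c \<otimes>\<^bsub>monoid_algebra M\<^esub> (a + b) = c \<otimes>\<^bsub>monoid_algebra M\<^esub> a + c \<otimes>\<^bsub>monoid_algebra M\<^esub> b"
    using S by (simp add: monoid_algebra_mult_superset[of "Poly_Mapping.keys c" _ ?S] lookup_add
      distrib_left single_add sum.distrib)
qed

lemma monoid_algebra_mult_single:
  fixes c d :: "'k::field"
  shows "Poly_Mapping.single s c \<otimes>\<^bsub>monoid_algebra M\<^esub> Poly_Mapping.single t d =
    Poly_Mapping.single (s \<otimes>\<^bsub>M\<^esub> t) (c * d)"
  by (subst monoid_algebra_mult_superset[of "{s}" _ "{t}"]) auto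

lemma monoid_algebra_mult_zero [simp]:
  fixes a :: "'m \<Rightarrow>\<^sub>0 'k::field"
  shows "0 \<otimes>\<^bsub>monoid_algebra M\<^esub> a = 0" "a \<otimes>\<^bsub>monoid_algebra M\<^esub> 0 = 0"
  by (simp_all add: monoid_algebra_def)

lemma map_mult_sum:
  "Poly_Mapping.map ((*) (c::'k::field)) (sum f S) = (\<Sum>i\<in>S. Poly_Mapping.map ((*) c) (f i))"
  by (induction S rule: infinite_finite_induct) (auto simp: map_mult_laws intro: poly_mapping_eqI)

lemma monoid_algebra_mult_smult:
  fixes a b :: "'m \<Rightarrow>\<^sub>0 'k::field"
  shows "Poly_Mapping.map ((*) c) a \<otimes>\<^bsub>monoid_algebra M\<^esub> b =
      Poly_Mapping.map ((*) c) (a \<otimes>\<^bsub>monoid_algebra M\<^esub> b)"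
    and "a \<otimes>\<^bsub>monoid_algebra M\<^esub> Poly_Mapping.map ((*) c) b =
      Poly_Mapping.map ((*) c) (a \<otimes>\<^bsub>monoid_algebra M\<^esub> b)"
  by (simp_all add: monoid_algebra_mult_superset[of "Poly_Mapping.keys a" _ "Poly_Mapping.keys b"]
     keys_map_mult map_mult_sum mult_ac)

lemma k_algebra_monoid_algebra:
  assumes "Group.monoid M"
  shows "k_algebra (monoid_algebra M :: ('k::field, 'm \<Rightarrow>\<^sub>0 'k) module)"
proof -
  interpret M: Group.monoid M by fact
  let ?A = "monoid_algebra M :: ('k::field, 'm \<Rightarrow>\<^sub>0 'k) module"
  have closed: "a \<otimes>\<^bsub>?A\<^esub> b \<in> carrier ?A" if "a \<in> carrier ?A" "b \<in> carrier ?A" for a b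
    using that(1)
  proof (induction rule: monoid_algebra_induct)
    case (single s c)
    show ?case using that(2)
    proof (induction rule: monoid_algebra_induct)
      case (single t d)
      then show ?case using \<open>s \<in> carrier M\<close> by (auto simp: monoid_algebra_mult_single)
    next
      case (add a b)
      then show ?case by (simp add: monoid_algebra_distrib keys_add_subset)
    qed simp
  next
    case (add a b)
    then show ?case by (simp add: monoid_algebra_distrib keys_add_subset)
  qed simp
  have one: "\<one>\<^bsub>?A\<^esub> \<otimes>\<^bsub>?A\<^esub> a = a \<and> a \<otimes>\<^bsub>?A\<^esub> \<one>\<^bsub>?A\<^esub> = a" if "a \<in> carrier ?A" for a
    using that
    by (induction rule: monoid_algebra_induct) (simp_all add: monoid_algebra_mult_single monoid_algebra_distrib)
  have assoc: "(a \<otimes>\<^bsub>?A\<^esub> b) \<otimes>\<^bsub>?A\<^esub> c = a \<otimes>\<^bsub>?A\<^esub> (b \<otimes>\<^bsub>?A\<^esub> c)"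
    if "a \<in> carrier ?A" "b \<in> carrier ?A" "c \<in> carrier ?A" for a b c
    using that(1)
  proof (induction rule: monoid_algebra_induct)
    case (single r x)
    show ?case using that(2)
    proof (induction rule: monoid_algebra_induct)
      case (single s y)
      show ?case using that(3)
      proof (induction rule: monoid_algebra_induct)
        case (single t z)
        then show ?case using \<open>r \<in> carrier M\<close> \<open>s \<in> carrier M\<close>
          by (auto simp: monoid_algebra_mult_single M.m_assoc mult.assoc)
      qed (simp_all add: monoid_algebra_distrib)
    qed (simp_all add: monoid_algebra_distrib)
  qed (simp_all add: monoid_algebra_distrib)
  have R: "ring ?A"
    by (rule ringI[OF monoid_algebra_abelian_group]; (rule Group.monoidI)?)
       (use closed one assoc in \<open>simp_all add: monoid_algebra_distrib\<close>)
  show ?thesis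
    by (rule k_algebra.intro[OF R monoid_algebra_module]) (simp_all add: monoid_algebra_mult_smult)
qed

lemma lin_ext_alg_hom:
  fixes B :: "('k::field, 'b, 'n) module_scheme"
  assumes "k_algebra B" and b: "b \<in> carrier M \<rightarrow> carrier B"
    and one: "b \<one>\<^bsub>M\<^esub> = \<one>\<^bsub>B\<^esub>" and M: "Group.monoid M"
    and mult: "\<And>s t. s \<in> carrier M \<Longrightarrow> t \<in> carrier M \<Longrightarrow> b (s \<otimes>\<^bsub>M\<^esub> t) = b s \<otimes>\<^bsub>B\<^esub> b t"
  shows "alg_hom (monoid_algebra M) B (lin_ext B b)"
proof (rule alg_homI)
  interpret B: k_algebra B by fact
  interpret M: Group.monoid M by fact
  interpret A: k_algebra "monoid_algebra M :: ('k, _) module" by (rule k_algebra_monoid_algebra[OF M])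
  show lin: "linear_map (monoid_algebra M) B (lin_ext B b)"
    by (rule linear_map_lin_ext) fact+
  note closed = linear_map_closed[OF lin] and add = linear_map_add[OF lin]
  show "lin_ext B b \<one>\<^bsub>monoid_algebra M\<^esub> = \<one>\<^bsub>B\<^esub>"
    by (simp add: lin_ext_single one assms(1))
  have lin_zero: "lin_ext B b 0 = \<zero>\<^bsub>B\<^esub>" by (simp add: lin_ext_def)
  fix x y :: "_ \<Rightarrow>\<^sub>0 'k"
  assume x: "x \<in> carrier (monoid_algebra M)" and y: "y \<in> carrier (monoid_algebra M)"
  show "lin_ext B b (x \<otimes>\<^bsub>monoid_algebra M\<^esub> y) = lin_ext B b x \<otimes>\<^bsub>B\<^esub> lin_ext B b y"
    using x
  proof (induction rule: monoid_algebra_induct)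
    case zero
    then show ?case using closed[OF y] by (simp add: lin_zero)
  next
    case (add x x')
    then show ?case using closed linear_map_add[OF lin] y
      linear_map_add[OF lin A.m_closed[OF add(1) y] A.m_closed[OF add(2) y]]
      by (simp add: monoid_algebra_distrib B.l_distr)
  next
    case (single s c)
    then have s: "Poly_Mapping.single s c \<in> carrier (monoid_algebra M)" by simp
    note bs = funcset_mem[OF b single]
    show ?case using y
    proof (induction rule: monoid_algebra_induct)
      case zero
      then show ?case using closed[OF s] by (simp add: lin_zero)
    next
      case (add x x')
      then show ?case using closed s linear_map_add[OF lin]
        linear_map_add[OF lin A.m_closed[OF s add(1)] A.m_closed[OF s add(2)]]
        by (simp add: monoid_algebra_distrib B.r_distr)
    next
      case (single t d)
      then show ?case using \<open>s \<in> carrier M\<close> bs funcset_mem[OF b single]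
        by (simp add: monoid_algebra_mult_single lin_ext_single assms(1) mult B.smult_mult_left
           B.smult_mult_right B.smult_smult mult.commute)
    qed
  qed
qed

section \<open>Quotient algebras\<close>

locale k_algebra_ideal = k_algebra A + ideal I A for A :: "('k::field, 'a, 'm) module_scheme" (structure) and I
begin

abbreviation "Q \<equiv> quot_alg A I"

lemma quot_alg_simps:
  "carrier Q = (\<lambda>a. I +> a) ` carrier A" "one Q = I +> \<one>" "zero Q = I"
  "add Q = set_add A" "mult Q = rcoset_mult A I"
  by (auto simp: quot_alg_def ring.defs FactRing_def A_RCOSETS_def')

lemma proj_closed: "a \<in> carrier A \<Longrightarrow> I +> a \<in> carrier Q"
  by (simp add: quot_alg_simps)

lemma ideal_smult: "a \<in> I \<Longrightarrow> c \<odot> a \<in> I"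
  using I_l_closed[of a "c \<odot> \<one>"] by (simp add: smult_mult_left a_Hcarr)

lemma proj_eq_iff: "a \<in> carrier A \<Longrightarrow> b \<in> carrier A \<Longrightarrow> I +> a = I +> b \<longleftrightarrow> a \<ominus> b \<in> I"
  using a_repr_independence'[of a b] a_rcos_self[of a] a_rcos_module_minus[OF ring_A, of b a] by metis

lemma proj_smult: assumes "a \<in> carrier A" shows "c \<odot>\<^bsub>Q\<^esub> (I +> a) = I +> (c \<odot> a)"
proof -
  have "I +> (c \<odot> b) = I +> (c \<odot> a)" if b: "b \<in> I +> a" for b
  proof -
    obtain i where i: "i \<in> I" "b = i \<oplus> a" using b by (auto simp: a_r_coset_def')
    have "c \<odot> b \<ominus> c \<odot> a = c \<odot> i"
      using i assms by (simp add: smult_add_right a_Hcarr a_minus_def a_assoc r_neg)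
    moreover have "b \<in> carrier A" using i assms a_Hcarr by simp
    ultimately show ?thesis using ideal_smult[OF i(1)] assms by (simp add: proj_eq_iff)
  qed
  moreover have "a \<in> I +> a" using assms by (rule a_rcos_self)
  ultimately have "(\<Union>b\<in>I +> a. I +> (c \<odot> b)) = I +> (c \<odot> a)" by blast
  then show ?thesis
    unfolding quot_alg_def ring.defs by simp
qed

lemma ring_Q: "ring Q"
  by (rule ring_cong[OF quotient_is_ring]) (simp_all add: quot_alg_def ring.defs)

lemma proj_add: "a \<in> carrier A \<Longrightarrow> b \<in> carrier A \<Longrightarrow> (I +> a) \<oplus>\<^bsub>Q\<^esub> (I +> b) = I +> (a \<oplus> b)"
  by (simp add: quot_alg_simps a_rcos_sum)

lemma proj_mult: "a \<in> carrier A \<Longrightarrow> b \<in> carrier A \<Longrightarrow> (I +> a) \<otimes>\<^bsub>Q\<^esub> (I +> b) = I +> (a \<otimes> b)"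
  by (simp add: quot_alg_simps rcoset_mult_add)

lemma k_algebra_Q: "k_algebra Q"
proof (rule k_algebra.intro[OF ring_Q moduleI[OF cring_base_alg ring.is_abelian_group[OF ring_Q]]])
qed (auto simp: quot_alg_simps(1) proj_smult proj_add proj_mult smult_add_left smult_add_right
   smult_smult smult_mult_left smult_mult_right)

lemma proj_alg_hom: "alg_hom A Q (\<lambda>a. I +> a)"
  by (intro alg_homI linear_mapI) (simp_all add: proj_closed proj_add proj_mult proj_smult quot_alg_simps(2))

text \<open>The element \<open>the_elem (\<phi> ` X)\<close> makes sense because \<open>\<phi>\<close> is constant on each coset \<open>X\<close>. Algebra maps
  out of presented algebras and linear maps out of tensor products are both of this form.\<close>

lemma quot_lift:
  assumes B: "k_algebra B" and lin: "linear_map A B \<phi>" and ker: "\<And>a. a \<in> I \<Longrightarrow> \<phi> a = \<zero>\<^bsub>B\<^esub>"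
  shows "a \<in> carrier A \<Longrightarrow> the_elem (\<phi> ` (I +> a)) = \<phi> a"
    and "linear_map Q B (\<lambda>C. the_elem (\<phi> ` C))"
    and "alg_hom A B \<phi> \<Longrightarrow> alg_hom Q B (\<lambda>C. the_elem (\<phi> ` C))"
proof -
  interpret B: k_algebra B by fact
  have eval: "the_elem (\<phi> ` (I +> a)) = \<phi> a" if "a \<in> carrier A" for a
  proof -
    have "\<phi> b = \<phi> a" if "b \<in> I +> a" for b
      using that \<open>a \<in> carrier A\<close> linear_map_add[OF lin] ker linear_map_closed[OF lin]
      by (auto simp: a_r_coset_def' a_Hcarr)
    moreover have "a \<in> I +> a" using that by (rule a_rcos_self)
    ultimately have "\<phi> ` (I +> a) = {\<phi> a}" by blast
    then show ?thesis by simp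
  qed
  then show "a \<in> carrier A \<Longrightarrow> the_elem (\<phi> ` (I +> a)) = \<phi> a" .
  show lin': "linear_map Q B (\<lambda>C. the_elem (\<phi> ` C))"
  proof (rule linear_mapI)
    fix C c assume "C \<in> carrier Q"
    then obtain a where a: "a \<in> carrier A" "C = I +> a" by (auto simp: quot_alg_simps(1))
    show "the_elem (\<phi> ` C) \<in> carrier B"
      using linear_map_closed[OF lin a(1)] by (simp add: a eval)
    show "the_elem (\<phi> ` (c \<odot>\<^bsub>Q\<^esub> C)) = c \<odot>\<^bsub>B\<^esub> the_elem (\<phi> ` C)"
      using linear_map_smult[OF lin a(1)] by (simp add: a proj_smult eval)
  next
    fix C D assume "C \<in> carrier Q" "D \<in> carrier Q"
    then obtain a b where a: "a \<in> carrier A" "C = I +> a" "b \<in> carrier A" "D = I +> b"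
      by (auto simp: quot_alg_simps(1))
    show "the_elem (\<phi> ` (C \<oplus>\<^bsub>Q\<^esub> D)) = the_elem (\<phi> ` C) \<oplus>\<^bsub>B\<^esub> the_elem (\<phi> ` D)"
      using linear_map_add[OF lin a(1,3)] by (simp add: a proj_add eval)
  qed
  show "alg_hom Q B (\<lambda>C. the_elem (\<phi> ` C))" if "alg_hom A B \<phi>"
  proof (rule alg_homI[OF lin'])
    show "the_elem (\<phi> ` \<one>\<^bsub>Q\<^esub>) = \<one>\<^bsub>B\<^esub>"
      by (simp add: quot_alg_simps(2) eval alg_homD(3)[OF that])
    fix C D assume "C \<in> carrier Q" "D \<in> carrier Q"
    then obtain a b where a: "a \<in> carrier A" "C = I +> a" "b \<in> carrier A" "D = I +> b"
      by (auto simp: quot_alg_simps(1))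
    show "the_elem (\<phi> ` (C \<otimes>\<^bsub>Q\<^esub> D)) = the_elem (\<phi> ` C) \<otimes>\<^bsub>B\<^esub> the_elem (\<phi> ` D)"
      using alg_homD(2)[OF that a(1,3)] by (simp add: a proj_mult eval)
  qed
qed

end

section \<open>Presented algebras\<close>

lemma monoid_lists: "Group.monoid \<lparr>carrier = lists X, mult = (@), one = []\<rparr>"
  by (rule Group.monoidI) auto

lemma k_algebra_free_algebra: "k_algebra (free_algebra X)"
  unfolding free_algebra_def by (rule k_algebra_monoid_algebra[OF monoid_lists])

lemma free_algebra_simps:
  "carrier (free_algebra X) = {a. Poly_Mapping.keys a \<subseteq> lists X}"
  "one (free_algebra X) = delta []" "zero (free_algebra X) = 0" "add (free_algebra X) = (+)"
  "smult (free_algebra X) = (\<lambda>c. Poly_Mapping.map ((*) c))"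
  by (simp_all add: free_algebra_def)

lemma eval_word_simps [simp]:
  "eval_word A v [] = \<one>\<^bsub>A\<^esub>" "eval_word A v (y # w) = v y \<otimes>\<^bsub>A\<^esub> eval_word A v w"
  by (simp_all add: eval_word_def)

lemma free_ext_alg_hom:
  assumes "k_algebra A" and v: "v ` X \<subseteq> carrier A"
  shows "alg_hom (free_algebra X) A (free_ext A v)"
proof -
  interpret A: k_algebra A by fact
  have closed: "eval_word A v w \<in> carrier A" if "w \<in> lists X" for w
    using that v by (induction w) auto
  have "eval_word A v (w @ w') = eval_word A v w \<otimes>\<^bsub>A\<^esub> eval_word A v w'"
    if "w \<in> lists X" "w' \<in> lists X" for w w'
    using that(1)
  proof (induction w)
    case (Cons y w)
    then have "v y \<in> carrier A" "eval_word A v w \<in> carrier A" using v closed by auto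
    then show ?case using Cons closed[OF that(2)] by (simp add: A.m_assoc)
  qed (use closed that in simp)
  then show ?thesis
    unfolding free_ext_lin_ext free_algebra_def
    by (intro lin_ext_alg_hom assms(1) monoid_lists) (use closed in auto)
qed

lemma free_ext_var: "k_algebra A \<Longrightarrow> v y \<in> carrier A \<Longrightarrow> free_ext A v (var y) = v y"
proof -
  assume "k_algebra A" "v y \<in> carrier A"
  then interpret A: k_algebra A by simp
  show ?thesis using \<open>v y \<in> carrier A\<close>
    by (simp add: free_ext_lin_ext lin_ext_single A.k_algebra_axioms)
qed

text \<open>An algebra map out of a free algebra is determined by its values on the variables. In particular
  the projection onto a presented algebra is the evaluation at the generators.\<close>

lemma free_ext_unique:
  assumes A: "k_algebra A" and \<psi>: "alg_hom (free_algebra X) A \<psi>" and a: "a \<in> carrier (free_algebra X)"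
  shows "\<psi> a = free_ext A (\<lambda>y. \<psi> (var y)) a"
proof (rule linear_map_eq_on_monoid_algebra[of "\<lparr>carrier = lists X, mult = (@), one = []\<rparr>" A])
  let ?F = "free_algebra X"
  interpret A: k_algebra A by fact
  have vc: "var y \<in> carrier ?F" if "y \<in> X" for y using that by (simp add: free_algebra_simps)
  have v: "(\<lambda>y. \<psi> (var y)) ` X \<subseteq> carrier A" using alg_homD(4)[OF \<psi> vc] by blast
  note h = alg_homD[OF free_ext_alg_hom[OF A v]]
  show "linear_map (monoid_algebra \<lparr>carrier = lists X, mult = (@), one = []\<rparr>) A (free_ext A (\<lambda>y. \<psi> (var y)))"
    using h(1) by (simp add: free_algebra_def)
  show "linear_map (monoid_algebra \<lparr>carrier = lists X, mult = (@), one = []\<rparr>) A \<psi>"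
    using alg_homD(1)[OF \<psi>] by (simp add: free_algebra_def)
  fix w assume "w \<in> carrier \<lparr>carrier = lists X, mult = (@), one = []\<rparr>"
  then have "w \<in> lists X" by simp
  then show "\<psi> (delta w) = free_ext A (\<lambda>y. \<psi> (var y)) (delta w)"
  proof (induction w)
    case Nil
    then show ?case
      using alg_homD(3)[OF \<psi>] h(3) by (simp add: free_algebra_simps)
  next
    case (Cons y w)
    have y: "y \<in> X" and w: "delta w \<in> carrier ?F" using Cons by (auto simp: free_algebra_simps)
    have split: "delta (y # w) = var y \<otimes>\<^bsub>?F\<^esub> delta w"
      by (simp add: free_algebra_def monoid_algebra_mult_single)
    show ?case
      unfolding split
      using alg_homD(2)[OF \<psi> vc[OF y] w] h(2)[OF vc[OF y] w] Cons
        free_ext_var[of A "\<lambda>y. \<psi> (var y)" y, OF A alg_homD(4)[OF \<psi> vc[OF y]]]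
      by simp
  qed
qed (use a in \<open>auto simp: A free_algebra_def\<close>)

locale presentation =
  fixes X :: "'x set" and rels :: "('x list \<Rightarrow>\<^sub>0 'k::field) set"
  assumes rels_carrier: "rels \<subseteq> carrier (free_algebra X)"
begin

abbreviation "F \<equiv> free_algebra X :: ('k, 'x list \<Rightarrow>\<^sub>0 'k) module"
abbreviation "P \<equiv> presented_algebra X rels"

lemma ideal_rel: "ideal (rel_ideal X rels) F"
  unfolding rel_ideal_def
  by (rule ring.genideal_ideal[OF k_algebra.ring_A[OF k_algebra_free_algebra] rels_carrier])

sublocale FI: k_algebra_ideal F "rel_ideal X rels"
  by (intro k_algebra_ideal.intro k_algebra_free_algebra ideal_rel)

definition gen :: "'x \<Rightarrow> ('x list \<Rightarrow>\<^sub>0 'k) set" where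
  "gen y = rel_ideal X rels +>\<^bsub>F\<^esub> var y"

lemma k_algebra_P: "k_algebra P"
  unfolding presented_algebra_def by (rule FI.k_algebra_Q)

lemma proj_hom: "alg_hom F P (\<lambda>a. rel_ideal X rels +>\<^bsub>F\<^esub> a)"
  unfolding presented_algebra_def by (rule FI.proj_alg_hom)

lemma carrier_P: "carrier P = (\<lambda>a. rel_ideal X rels +>\<^bsub>F\<^esub> a) ` carrier F"
  unfolding presented_algebra_def by (rule FI.quot_alg_simps(1))

lemma var_closed: "y \<in> X \<Longrightarrow> var y \<in> carrier F"
  by (simp add: free_algebra_simps)

lemma gen_closed: "y \<in> X \<Longrightarrow> gen y \<in> carrier P"
  unfolding gen_def by (rule alg_homD(4)[OF proj_hom var_closed])

lemma proj_rel: "r \<in> rels \<Longrightarrow> rel_ideal X rels +>\<^bsub>F\<^esub> r = \<zero>\<^bsub>P\<^esub>"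
  unfolding presented_algebra_def FI.quot_alg_simps
  using ring.genideal_self[OF k_algebra.ring_A[OF k_algebra_free_algebra] rels_carrier]
  by (auto simp: rel_ideal_def[symmetric] FI.a_rcos_const)

lemma presented_ext:
  assumes A: "k_algebra A" and v: "v ` X \<subseteq> carrier A"
    and rels: "\<And>r. r \<in> rels \<Longrightarrow> free_ext A v r = \<zero>\<^bsub>A\<^esub>"
  shows "alg_hom P A (presented_ext A v)"
    and "a \<in> carrier F \<Longrightarrow> presented_ext A v (rel_ideal X rels +>\<^bsub>F\<^esub> a) = free_ext A v a"
    and "y \<in> X \<Longrightarrow> presented_ext A v (gen y) = v y"
proof -
  interpret A: k_algebra A by fact
  note hom = free_ext_alg_hom[OF A v]
  have "ideal {a \<in> carrier F. free_ext A v a = \<zero>\<^bsub>A\<^esub>} F"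
  proof -
    interpret h: ring_hom_ring F A "free_ext A v"
      using hom by (intro ring_hom_ringI2 A.ring_A k_algebra.ring_A[OF k_algebra_free_algebra])
                   (simp add: alg_hom_def)
    show ?thesis using h.kernel_is_ideal unfolding a_kernel_def' .
  qed
  then have ker: "rel_ideal X rels \<subseteq> {a \<in> carrier F. free_ext A v a = \<zero>\<^bsub>A\<^esub>}"
    unfolding rel_ideal_def
    by (rule ring.genideal_minimal[OF k_algebra.ring_A[OF k_algebra_free_algebra]])
       (use rels rels_carrier in blast)
  have ext: "presented_ext A v = (\<lambda>C. the_elem (free_ext A v ` C))"
    by (rule ext) (simp add: presented_ext_def)
  show "alg_hom P A (presented_ext A v)"
    unfolding ext presented_algebra_def
    by (rule FI.quot_lift(3)[OF A alg_homD(1)[OF hom] _ hom]) (use ker in blast)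
  show eval: "presented_ext A v (rel_ideal X rels +>\<^bsub>F\<^esub> a) = free_ext A v a" if "a \<in> carrier F" for a
    unfolding ext by (rule FI.quot_lift(1)[OF A alg_homD(1)[OF hom] _ that]) (use ker in blast)
  show "presented_ext A v (gen y) = v y" if "y \<in> X"
  proof -
    have "v y \<in> carrier A" using v that by blast
    then show ?thesis
      unfolding gen_def using eval[OF var_closed[OF that]] free_ext_var[OF A, of v y] by simp
  qed
qed

lemma free_ext_gen: "a \<in> carrier F \<Longrightarrow> free_ext P gen a = rel_ideal X rels +>\<^bsub>F\<^esub> a"
  unfolding gen_def[abs_def] by (rule free_ext_unique[OF k_algebra_P proj_hom, symmetric])

text \<open>A presented algebra is spanned by the words in its generators, which may be built up by
  multiplication from the left or from the right.\<close>

lemma presented_induct_left [consumes 1, case_names one gen add smult]: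
  assumes "u \<in> carrier P"
    and one: "Q \<one>\<^bsub>P\<^esub>"
    and gen: "\<And>y u. y \<in> X \<Longrightarrow> u \<in> carrier P \<Longrightarrow> Q u \<Longrightarrow> Q (gen y \<otimes>\<^bsub>P\<^esub> u)"
    and add: "\<And>u v. u \<in> carrier P \<Longrightarrow> v \<in> carrier P \<Longrightarrow> Q u \<Longrightarrow> Q v \<Longrightarrow> Q (u \<oplus>\<^bsub>P\<^esub> v)"
    and smult: "\<And>c u. u \<in> carrier P \<Longrightarrow> Q u \<Longrightarrow> Q (c \<odot>\<^bsub>P\<^esub> u)"
  shows "Q u"
proof -
  interpret P: k_algebra P by (rule k_algebra_P)
  note h = alg_homD[OF proj_hom]
  let ?\<pi> = "\<lambda>a. rel_ideal X rels +>\<^bsub>F\<^esub> a"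
  have word: "Q (?\<pi> (delta w))" if "w \<in> lists X" for w
    using that
  proof (induction w)
    case Nil
    then show ?case using one h(3) by (simp add: free_algebra_simps)
  next
    case (Cons y w)
    have w: "delta w \<in> carrier F" using Cons by (auto simp: free_algebra_simps)
    have "?\<pi> (delta (y # w)) = gen y \<otimes>\<^bsub>P\<^esub> ?\<pi> (delta w)"
      using h(2)[OF var_closed[OF Cons(1)] w]
      by (simp add: gen_def free_algebra_def monoid_algebra_mult_single)
    then show ?case using gen[OF Cons(1) h(4)[OF w]] Cons by simp
  qed
  obtain a where a: "a \<in> carrier F" "u = ?\<pi> a" using assms(1) by (auto simp: carrier_P)
  from a(1) have "a \<in> carrier (monoid_algebra \<lparr>carrier = lists X, mult = (@), one = []\<rparr>)"
    by (simp add: free_algebra_def)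
  then have "Q (?\<pi> a)"
  proof (induction rule: monoid_algebra_induct)
    case zero
    have "?\<pi> 0 = 0 \<odot>\<^bsub>P\<^esub> \<one>\<^bsub>P\<^esub>"
      using linear_map_zero[OF h(1) k_algebra_free_algebra k_algebra_P] by (simp add: free_algebra_simps)
    then show ?case using smult[OF P.one_closed one, of 0] by metis
  next
    case (single w c)
    then have "delta w \<in> carrier F" by (simp add: free_algebra_simps)
    from linear_map_smult[OF h(1) this, of c] show ?case
      using smult[OF h(4)[OF \<open>delta w \<in> carrier F\<close>] word] single by (simp add: free_algebra_simps)
  next
    case (add a b)
    then have "a \<in> carrier F" "b \<in> carrier F" by (simp_all add: free_algebra_simps)
    then show ?case
      using assms(4)[OF h(4) h(4)] linear_map_add[OF h(1), of a b] add by (simp add: free_algebra_simps)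
  qed
  then show ?thesis by (simp add: a)
qed

lemma presented_induct_right [consumes 1, case_names one gen add smult]:
  assumes "u \<in> carrier P"
    and one: "Q \<one>\<^bsub>P\<^esub>"
    and gen: "\<And>y u. y \<in> X \<Longrightarrow> u \<in> carrier P \<Longrightarrow> Q u \<Longrightarrow> Q (u \<otimes>\<^bsub>P\<^esub> gen y)"
    and add: "\<And>u v. u \<in> carrier P \<Longrightarrow> v \<in> carrier P \<Longrightarrow> Q u \<Longrightarrow> Q v \<Longrightarrow> Q (u \<oplus>\<^bsub>P\<^esub> v)"
    and smult: "\<And>c u. u \<in> carrier P \<Longrightarrow> Q u \<Longrightarrow> Q (c \<odot>\<^bsub>P\<^esub> u)"
  shows "Q u"
proof -
  interpret P: k_algebra P by (rule k_algebra_P)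
  have "\<forall>a\<in>carrier P. Q a \<longrightarrow> Q (a \<otimes>\<^bsub>P\<^esub> u)"
    using assms(1)
  proof (induction rule: presented_induct_left)
    case (gen y u)
    then show ?case by (auto simp: P.m_assoc[symmetric] gen_closed intro: assms(3))
  next
    case (add u v)
    then show ?case by (auto simp: P.r_distr intro: assms(4))
  next
    case (smult c u)
    then show ?case by (auto simp: P.smult_mult_right intro: assms(5))
  qed auto
  then have "Q (\<one>\<^bsub>P\<^esub> \<otimes>\<^bsub>P\<^esub> u)" using one by blast
  then show ?thesis using assms(1) by simp
qed

lemma alg_hom_eqI:
  assumes "alg_hom P A \<phi>" "alg_hom P A \<psi>" "\<And>y. y \<in> X \<Longrightarrow> \<phi> (gen y) = \<psi> (gen y)" "u \<in> carrier P"
  shows "\<phi> u = \<psi> u"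
  using assms(4)
proof (induction rule: presented_induct_left)
  case one
  then show ?case by (simp add: alg_homD(3)[OF assms(1)] alg_homD(3)[OF assms(2)])
next
  case (gen y u)
  then show ?case by (simp add: alg_homD(2)[OF assms(1)] alg_homD(2)[OF assms(2)] gen_closed assms(3))
next
  case (add u v)
  then show ?case by (simp add: linear_map_add[OF alg_homD(1)[OF assms(1)]] linear_map_add[OF alg_homD(1)[OF assms(2)]])
next
  case (smult c u)
  then show ?case by (simp add: linear_map_smult[OF alg_homD(1)[OF assms(1)]] linear_map_smult[OF alg_homD(1)[OF assms(2)]])
qed

end

text \<open>The evaluation at \<open>v\<close> factors through the presented algebra, and \<open>\<rho>\<close> inverts the factor. So the
  kernel of the evaluation is the relation ideal.\<close>

lemma (in presentation) has_presentationI: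
  assumes A: "k_algebra A" and v: "v ` X \<subseteq> carrier A"
    and rels: "\<And>r. r \<in> rels \<Longrightarrow> free_ext A v r = \<zero>\<^bsub>A\<^esub>"
    and rho: "alg_hom A P \<rho>" and back_gen: "\<And>y. y \<in> X \<Longrightarrow> \<rho> (v y) = gen y"
    and surj: "\<And>u. u \<in> carrier A \<Longrightarrow> presented_ext A v (\<rho> u) = u"
  shows "has_presentation A X v rels"
proof -
  have ext: "alg_hom P A (presented_ext A v)"
    "\<And>a. a \<in> carrier F \<Longrightarrow> presented_ext A v (rel_ideal X rels +>\<^bsub>F\<^esub> a) = free_ext A v a"
    "\<And>y. y \<in> X \<Longrightarrow> presented_ext A v (gen y) = v y"
    using presented_ext[OF A v] rels by blast+
  note h = alg_homD[OF free_ext_alg_hom[OF A v]]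
  have back_ext: "\<rho> (presented_ext A v u) = u" if "u \<in> carrier P" for u
    by (rule alg_hom_eqI[OF alg_hom_compose[OF ext(1) rho] alg_homI[OF linear_map_id] _ that])
       (simp_all add: ext(3) back_gen)
  have "{a \<in> carrier F. free_ext A v a = \<zero>\<^bsub>A\<^esub>} = rel_ideal X rels"
  proof (intro equalityI subsetI)
    fix a assume "a \<in> {a \<in> carrier F. free_ext A v a = \<zero>\<^bsub>A\<^esub>}"
    then have a: "a \<in> carrier F" "presented_ext A v (rel_ideal X rels +>\<^bsub>F\<^esub> a) = \<zero>\<^bsub>A\<^esub>"
      by (simp_all add: ext(2))
    then have "rel_ideal X rels +>\<^bsub>F\<^esub> a = \<zero>\<^bsub>P\<^esub>"
      using back_ext[OF alg_homD(4)[OF proj_hom a(1)]] linear_map_zero[OF alg_homD(1)[OF rho] A k_algebra_P] by simp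
    then show "a \<in> rel_ideal X rels"
      using FI.a_rcos_self[OF a(1)] by (simp add: presented_algebra_def FI.quot_alg_simps)
  next
    fix a assume a: "a \<in> rel_ideal X rels"
    then have aF: "a \<in> carrier F" by (rule FI.a_Hcarr)
    have "rel_ideal X rels +>\<^bsub>F\<^esub> a = \<zero>\<^bsub>P\<^esub>"
      using a by (simp add: presented_algebra_def FI.quot_alg_simps FI.a_rcos_const)
    then have "free_ext A v a = \<zero>\<^bsub>A\<^esub>"
      using ext(2)[OF aF] linear_map_zero[OF alg_homD(1)[OF ext(1)] k_algebra_P A] by simp
    with aF show "a \<in> {a \<in> carrier F. free_ext A v a = \<zero>\<^bsub>A\<^esub>}" by simp
  qed
  moreover have "free_ext A v ` carrier F = carrier A"
  proof (intro equalityI subsetI)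
    fix u assume u: "u \<in> carrier A"
    then obtain a where a: "a \<in> carrier F" "\<rho> u = rel_ideal X rels +>\<^bsub>F\<^esub> a"
      using alg_homD(4)[OF rho] by (auto simp: carrier_P)
    then have "free_ext A v a = u" using ext(2)[OF a(1)] surj[OF u] by simp
    with a show "u \<in> free_ext A v ` carrier F" by blast
  qed (use h(4) in blast)
  ultimately show ?thesis by (simp add: has_presentation_def A v)
qed

lemma has_presentation_transport:
  assumes A: "k_algebra A" and B: "k_algebra B" and \<phi>: "alg_hom A B \<phi>" and bij: "bij_betw \<phi> (carrier A) (carrier B)"
    and v: "v ` X \<subseteq> carrier A" and pr: "has_presentation B X (\<lambda>y. \<phi> (v y)) rels"
  shows "has_presentation A X v rels"
proof -
  let ?F = "free_algebra X" and ?a = "free_ext A v" and ?b = "free_ext B (\<lambda>y. \<phi> (v y))"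
  note ha = free_ext_alg_hom[OF A v]
  have eq: "\<phi> (?a a) = ?b a" if "a \<in> carrier ?F" for a
  proof -
    have "\<phi> (?a a) = free_ext B (\<lambda>y. \<phi> (?a (var y))) a"
      by (rule free_ext_unique[OF B alg_hom_compose[OF ha \<phi>] that])
    also have "\<dots> = ?b a"
    proof -
      have "v y \<in> carrier A" if "y \<in> X" for y using v that by blast
      then have ew: "eval_word B (\<lambda>y. \<phi> (?a (var y))) w = eval_word B (\<lambda>y. \<phi> (v y)) w" if "w \<in> lists X" for w
        using that by (induction w) (simp_all add: free_ext_var[OF A])
      then have "free_ext B (\<lambda>y. \<phi> (?a (var y))) a = free_ext B (\<lambda>y. \<phi> (v y)) a"
        if "Poly_Mapping.keys a \<subseteq> lists X" for a
      proof -
        interpret B: k_algebra B by fact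
        have c: "eval_word B (\<lambda>y. \<phi> (v y)) w \<in> carrier B" if "w \<in> lists X" for w
          using that v alg_homD(4)[OF \<phi>] by (induction w) (auto intro!: B.m_closed)
        show ?thesis
          unfolding free_ext_def[of B]
          by (rule B.finsum_cong') (use that in \<open>auto simp: subset_iff ew intro!: B.smult_closed c\<close>)
      qed
      then show ?thesis using that by (simp add: free_algebra_simps)
    qed
    finally show ?thesis .
  qed
  have inj: "inj_on \<phi> (carrier A)" and im: "\<phi> ` carrier A = carrier B" using bij by (auto simp: bij_betw_def)
  have c: "?a a \<in> carrier A" if "a \<in> carrier ?F" for a by (rule alg_homD(4)[OF ha that])
  have z: "\<phi> \<zero>\<^bsub>A\<^esub> = \<zero>\<^bsub>B\<^esub>" by (rule linear_map_zero[OF alg_homD(1)[OF \<phi>] A B])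
  have "(?a a = \<zero>\<^bsub>A\<^esub>) = (?b a = \<zero>\<^bsub>B\<^esub>)" if "a \<in> carrier ?F" for a
    using inj_onD[OF inj _ c[OF that], of "\<zero>\<^bsub>A\<^esub>"] eq[OF that] z A
    by (metis k_algebra.ring_A ring.ring_simprules(2))
  then have "{a \<in> carrier ?F. ?a a = \<zero>\<^bsub>A\<^esub>} = rel_ideal X rels"
    using pr unfolding has_presentation_def by blast
  moreover have "?a ` carrier ?F = carrier A"
  proof (rule inj_on_image_eq_iff[OF inj, THEN iffD1])
    have "\<phi> ` ?a ` carrier ?F = ?b ` carrier ?F" using eq by (auto simp: image_image)
    then show "\<phi> ` ?a ` carrier ?F = \<phi> ` carrier A" using pr im by (simp add: has_presentation_def)
  qed (use c in auto)
  ultimately show ?thesis by (simp add: has_presentation_def A v)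
qed

section \<open>Tensor products\<close>

lemma submodule_monoid_algebra_iff:
  fixes M :: "('m, 'n) monoid_scheme" and N :: "('m \<Rightarrow>\<^sub>0 'k::field) set"
  shows "submodule N (base_alg :: ('k, 'k) module) (monoid_algebra M) \<longleftrightarrow>
    N \<subseteq> {a. Poly_Mapping.keys a \<subseteq> carrier M} \<and> 0 \<in> N \<and> (\<forall>a\<in>N. \<forall>b\<in>N. a + b \<in> N) \<and>
    (\<forall>c. \<forall>a\<in>N. Poly_Mapping.map ((*) c) a \<in> N)" (is "?L \<longleftrightarrow> ?R")
proof
  interpret M: module base_alg "monoid_algebra M :: ('k, 'm \<Rightarrow>\<^sub>0 'k) module"
    by (rule monoid_algebra_module)
  {
    assume ?L
    from M.submoduleE[OF this] subgroup.one_closed[OF submodule.axioms(1)[OF this]] show ?R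
      by simp
  next
    assume R: ?R
    show ?L
    proof (rule M.submoduleI)
      fix a assume a: "a \<in> N"
      then have ca: "a \<in> carrier (monoid_algebra M)" using R by auto
      moreover have m: "Poly_Mapping.map ((*) (-1)) a \<in> N" using R a by blast
      ultimately have "\<ominus>\<^bsub>monoid_algebra M\<^esub> a = - a"
        using R by (intro M.minus_equality) (auto simp: map_mult_laws)
      then show "\<ominus>\<^bsub>monoid_algebra M\<^esub> a \<in> N" using m by (simp add: map_mult_laws)
    qed (use R in auto)
  }
qed

lemma tensor_relatorsI:
  "a \<in> carrier A \<Longrightarrow> a' \<in> carrier A \<Longrightarrow> b \<in> carrier B \<Longrightarrow>
    delta (a \<oplus>\<^bsub>A\<^esub> a', b) - delta (a, b) - delta (a', b) \<in> tensor_relators A B"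
  "a \<in> carrier A \<Longrightarrow> b \<in> carrier B \<Longrightarrow> b' \<in> carrier B \<Longrightarrow>
    delta (a, b \<oplus>\<^bsub>B\<^esub> b') - delta (a, b) - delta (a, b') \<in> tensor_relators A B"
  "a \<in> carrier A \<Longrightarrow> b \<in> carrier B \<Longrightarrow>
    delta (c \<odot>\<^bsub>A\<^esub> a, b) - Poly_Mapping.single (a, b) c \<in> tensor_relators A B"
  "a \<in> carrier A \<Longrightarrow> b \<in> carrier B \<Longrightarrow>
    delta (a, c \<odot>\<^bsub>B\<^esub> b) - Poly_Mapping.single (a, b) c \<in> tensor_relators A B"
  unfolding tensor_relators_def by blast+

lemma tensor_relatorsE:
  assumes "r \<in> tensor_relators A B"
  obtains
      (1) a1 a2 b1 where "a1 \<in> carrier A" "a2 \<in> carrier A" "b1 \<in> carrier B"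
        "r = delta (a1 \<oplus>\<^bsub>A\<^esub> a2, b1) - delta (a1, b1) - delta (a2, b1)"
    | (2) a1 b1 b2 where "a1 \<in> carrier A" "b1 \<in> carrier B" "b2 \<in> carrier B"
        "r = delta (a1, b1 \<oplus>\<^bsub>B\<^esub> b2) - delta (a1, b1) - delta (a1, b2)"
    | (3) c a1 b1 where "a1 \<in> carrier A" "b1 \<in> carrier B"
        "r = delta (c \<odot>\<^bsub>A\<^esub> a1, b1) - Poly_Mapping.single (a1, b1) c"
    | (4) c a1 b1 where "a1 \<in> carrier A" "b1 \<in> carrier B"
        "r = delta (a1, c \<odot>\<^bsub>B\<^esub> b1) - Poly_Mapping.single (a1, b1) c"
  using assms unfolding tensor_relators_def by blast

locale tensor_pair = A: k_algebra A + B: k_algebra B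
  for A :: "('k::field, 'a, 'm) module_scheme" and B :: "('k, 'b, 'n) module_scheme"
begin

abbreviation "FV \<equiv> monoid_algebra (A \<times>\<times> B) :: ('k, ('a \<times> 'b) \<Rightarrow>\<^sub>0 'k) module"
abbreviation "N \<equiv> tensor_null A B"
abbreviation "T \<equiv> tensor A B"

lemma k_algebra_FV: "k_algebra FV"
  by (rule k_algebra_monoid_algebra[OF DirProd_monoid[OF A.monoid_axioms B.monoid_axioms]])

lemma FV_minus:
  assumes "x \<in> carrier FV" "y \<in> carrier FV"
  shows "x \<ominus>\<^bsub>FV\<^esub> y = x - y"
proof -
  interpret FV: k_algebra FV by (rule k_algebra_FV)
  show ?thesis
    using FV.minus_eq_smult[OF assms] by (simp add: map_mult_laws)
qed

lemma tensor_relators_carrier: "tensor_relators A B \<subseteq> carrier FV"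
proof -
  interpret FV: k_algebra FV by (rule k_algebra_FV)
  have d: "Poly_Mapping.single (a, b) c \<in> carrier FV" if "a \<in> carrier A" "b \<in> carrier B" for a b and c :: 'k
    using that by (auto split: if_splits)
  have m: "x - y \<in> carrier FV" if "x \<in> carrier FV" "y \<in> carrier FV" for x y
    using FV.minus_closed[OF that] FV_minus[OF that] by simp
  show ?thesis
    unfolding tensor_relators_def
    by (intro subsetI) (elim UnE CollectE exE conjE; hypsubst; intro m d; simp)
qed

lemma tensor_null_props:
  "N \<subseteq> carrier FV" "0 \<in> N" "a \<in> N \<Longrightarrow> b \<in> N \<Longrightarrow> a + b \<in> N"
  "a \<in> N \<Longrightarrow> Poly_Mapping.map ((*) c) a \<in> N"
  "tensor_relators A B \<subseteq> N"
proof -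
  have c: "submodule (carrier FV) (base_alg :: ('k, 'k) module) FV"
    by (rule module.carrier_is_submodule[OF monoid_algebra_module])
  then have "carrier FV \<in> {N. submodule N (base_alg :: ('k, 'k) module) FV \<and> tensor_relators A B \<subseteq> N}"
    using tensor_relators_carrier by blast
  then show "N \<subseteq> carrier FV" unfolding tensor_null_def by blast
  show "0 \<in> N" "a \<in> N \<Longrightarrow> b \<in> N \<Longrightarrow> a + b \<in> N" "a \<in> N \<Longrightarrow> Poly_Mapping.map ((*) c) a \<in> N"
    "tensor_relators A B \<subseteq> N"
    unfolding tensor_null_def submodule_monoid_algebra_iff by blast+
qed

lemma tensor_null_minimal:
  assumes "\<And>x. x \<in> I \<Longrightarrow> x \<in> carrier FV" "0 \<in> I" "\<And>x y. x \<in> I \<Longrightarrow> y \<in> I \<Longrightarrow> x + y \<in> I"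
    "\<And>c x. x \<in> I \<Longrightarrow> Poly_Mapping.map ((*) c) x \<in> I" "\<And>x. x \<in> tensor_relators A B \<Longrightarrow> x \<in> I"
  shows "N \<subseteq> I"
proof -
  have "submodule I (base_alg :: ('k, 'k) module) FV"
    unfolding submodule_monoid_algebra_iff using assms by auto
  then show ?thesis using assms(5) unfolding tensor_null_def by blast
qed

lemma delta_mult: "delta (a, b) \<otimes>\<^bsub>FV\<^esub> delta (a', b') = delta (a \<otimes>\<^bsub>A\<^esub> a', b \<otimes>\<^bsub>B\<^esub> b')"
  by (simp add: monoid_algebra_mult_single DirProd_def)

text \<open>Relators remain relators when they are multiplied by a basis vector \<open>(a, b)\<close>; hence the subspace that
  they span is an ideal, and the tensor product is a quotient algebra.\<close>

lemma relator_mult: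
  assumes r: "r \<in> tensor_relators A B" and a: "a \<in> carrier A" "b \<in> carrier B"
  shows "delta (a, b) \<otimes>\<^bsub>FV\<^esub> r \<in> tensor_relators A B" "r \<otimes>\<^bsub>FV\<^esub> delta (a, b) \<in> tensor_relators A B"
proof -
  have dist: "z \<otimes>\<^bsub>FV\<^esub> (x - y) = z \<otimes>\<^bsub>FV\<^esub> x - z \<otimes>\<^bsub>FV\<^esub> y" "(x - y) \<otimes>\<^bsub>FV\<^esub> z = x \<otimes>\<^bsub>FV\<^esub> z - y \<otimes>\<^bsub>FV\<^esub> z" for x y z
    using monoid_algebra_distrib(2)[where c = z and M = "A \<times>\<times> B" and a = "x - y" and b = y]
      monoid_algebra_distrib(1)[where c = z and M = "A \<times>\<times> B" and a = "x - y" and b = y]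
    by (simp_all add: algebra_simps)
  have single: "delta (a, b) \<otimes>\<^bsub>FV\<^esub> Poly_Mapping.single (a', b') c = Poly_Mapping.single (a \<otimes>\<^bsub>A\<^esub> a', b \<otimes>\<^bsub>B\<^esub> b') c"
    "Poly_Mapping.single (a', b') c \<otimes>\<^bsub>FV\<^esub> delta (a, b) = Poly_Mapping.single (a' \<otimes>\<^bsub>A\<^esub> a, b' \<otimes>\<^bsub>B\<^esub> b) c" for a' b' c
    by (simp_all add: monoid_algebra_mult_single DirProd_def)
  from r have "delta (a, b) \<otimes>\<^bsub>FV\<^esub> r \<in> tensor_relators A B \<and> r \<otimes>\<^bsub>FV\<^esub> delta (a, b) \<in> tensor_relators A B"
  proof (cases rule: tensor_relatorsE)
    case 1
    with a show ?thesis
      unfolding 1(4) dist single A.r_distr[OF 1(1,2) a(1)] A.l_distr[OF 1(1,2) a(1)]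
      by (simp only: tensor_relatorsI A.m_closed B.m_closed simp_thms)
  next
    case 2
    with a show ?thesis
      unfolding 2(4) dist single B.r_distr[OF 2(2,3) a(2)] B.l_distr[OF 2(2,3) a(2)]
      by (simp only: tensor_relatorsI A.m_closed B.m_closed simp_thms)
  next
    case 3
    with a show ?thesis
      unfolding 3(3) dist single A.smult_mult_left[OF 3(1) a(1)] A.smult_mult_right[OF a(1) 3(1)]
      by (simp only: tensor_relatorsI A.m_closed B.m_closed simp_thms)
  next
    case 4
    with a show ?thesis
      unfolding 4(3) dist single B.smult_mult_left[OF 4(2) a(2)] B.smult_mult_right[OF a(2) 4(2)]
      by (simp only: tensor_relatorsI A.m_closed B.m_closed simp_thms)
  qed
  then show "delta (a, b) \<otimes>\<^bsub>FV\<^esub> r \<in> tensor_relators A B" "r \<otimes>\<^bsub>FV\<^esub> delta (a, b) \<in> tensor_relators A B"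
    by auto
qed

lemma ideal_tensor_null: "ideal N FV"
proof -
  interpret FV: k_algebra FV by (rule k_algebra_FV)
  have delta: "delta (a, b) \<otimes>\<^bsub>FV\<^esub> n \<in> N \<and> n \<otimes>\<^bsub>FV\<^esub> delta (a, b) \<in> N"
    if "a \<in> carrier A" "b \<in> carrier B" "n \<in> N" for a b n
  proof -
    have "N \<subseteq> {n \<in> N. delta (a, b) \<otimes>\<^bsub>FV\<^esub> n \<in> N \<and> n \<otimes>\<^bsub>FV\<^esub> delta (a, b) \<in> N}"
      using tensor_null_props relator_mult[OF _ that(1,2)]
      by (intro tensor_null_minimal)
         (auto simp: monoid_algebra_distrib monoid_algebra_mult_smult simp del: monoid_algebra_simps)
    then show ?thesis using that(3) by blast
  qed
  have single: "Poly_Mapping.single m c \<otimes>\<^bsub>FV\<^esub> n \<in> N \<and> n \<otimes>\<^bsub>FV\<^esub> Poly_Mapping.single m c \<in> N"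
    if m_in: "m \<in> carrier (A \<times>\<times> B)" and "n \<in> N" for m c n
  proof -
    obtain a b where m: "m = (a, b)" "a \<in> carrier A" "b \<in> carrier B" using m_in by auto
    have "Poly_Mapping.single m c = Poly_Mapping.map ((*) c) (delta (a, b))" by (simp add: m)
    then show ?thesis
      using delta[OF m(2,3) that(2)] tensor_null_props(4)[of _ c] by (simp only: monoid_algebra_mult_smult simp_thms)
  qed
  have closed: "x \<otimes>\<^bsub>FV\<^esub> n \<in> N \<and> n \<otimes>\<^bsub>FV\<^esub> x \<in> N" if "x \<in> carrier FV" "n \<in> N" for x n
    using that(1)
    by (induction rule: monoid_algebra_induct)
       (use single that(2) in \<open>auto simp: monoid_algebra_distrib intro: tensor_null_props\<close>)
  have "submodule N (base_alg :: ('k, 'k) module) FV"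
    unfolding submodule_monoid_algebra_iff using tensor_null_props by auto
  then show ?thesis
    using closed by (intro idealI FV.ring_A submodule.axioms(1)) auto
qed

sublocale Q: k_algebra_ideal FV N
  by (intro k_algebra_ideal.intro k_algebra_FV ideal_tensor_null)

lemma tensor_eq_Q: "T = quot_alg FV N"
  by (simp add: tensor_def)

lemma k_algebra_tensor: "k_algebra T"
  unfolding tensor_def by (rule Q.k_algebra_Q)

lemma delta_closed: "a \<in> carrier A \<Longrightarrow> b \<in> carrier B \<Longrightarrow> delta (a, b) \<in> carrier FV"
  by simp

lemma pure_closed: "a \<in> carrier A \<Longrightarrow> b \<in> carrier B \<Longrightarrow> pure A B a b \<in> carrier T"
  unfolding pure_def tensor_eq_Q by (intro Q.proj_closed delta_closed)

lemma pure_mult: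
  "a \<in> carrier A \<Longrightarrow> b \<in> carrier B \<Longrightarrow> a' \<in> carrier A \<Longrightarrow> b' \<in> carrier B \<Longrightarrow>
    pure A B a b \<otimes>\<^bsub>T\<^esub> pure A B a' b' = pure A B (a \<otimes>\<^bsub>A\<^esub> a') (b \<otimes>\<^bsub>B\<^esub> b')"
  unfolding pure_def tensor_eq_Q
  by (subst Q.proj_mult) (auto simp: delta_mult)

lemma tensor_one: "\<one>\<^bsub>T\<^esub> = pure A B \<one>\<^bsub>A\<^esub> \<one>\<^bsub>B\<^esub>"
  unfolding pure_def tensor_eq_Q Q.quot_alg_simps by (simp add: DirProd_def)

lemma pure_linear_left: "b \<in> carrier B \<Longrightarrow> linear_map A T (\<lambda>a. pure A B a b)"
proof (rule linear_mapI)
  assume b: "b \<in> carrier B"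
  fix a c assume a: "a \<in> carrier A"
  show "pure A B a b \<in> carrier T" using a b by (rule pure_closed)
  have "delta (c \<odot>\<^bsub>A\<^esub> a, b) - Poly_Mapping.single (a, b) c \<in> N"
    using a b by (intro subsetD[OF tensor_null_props(5)] tensor_relatorsI)
  moreover have s: "delta (c \<odot>\<^bsub>A\<^esub> a, b) \<in> carrier FV" "c \<odot>\<^bsub>FV\<^esub> delta (a, b) \<in> carrier FV"
    using a b by (intro Q.smult_closed delta_closed; simp)+
  ultimately have "N +>\<^bsub>FV\<^esub> delta (c \<odot>\<^bsub>A\<^esub> a, b) = N +>\<^bsub>FV\<^esub> (c \<odot>\<^bsub>FV\<^esub> delta (a, b))"
    unfolding Q.proj_eq_iff[OF s] FV_minus[OF s] by simp
  then show "pure A B (c \<odot>\<^bsub>A\<^esub> a) b = c \<odot>\<^bsub>T\<^esub> pure A B a b"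
    unfolding pure_def tensor_eq_Q Q.proj_smult[OF delta_closed[OF a b]] .
next
  assume b: "b \<in> carrier B"
  fix a a' assume a: "a \<in> carrier A" "a' \<in> carrier A"
  have "delta (a \<oplus>\<^bsub>A\<^esub> a', b) - delta (a, b) - delta (a', b) \<in> N"
    using a b by (intro subsetD[OF tensor_null_props(5)] tensor_relatorsI)
  moreover have s: "delta (a \<oplus>\<^bsub>A\<^esub> a', b) \<in> carrier FV" "delta (a, b) \<oplus>\<^bsub>FV\<^esub> delta (a', b) \<in> carrier FV"
    using a b by (simp_all add: keys_add_subset)
  ultimately have "N +>\<^bsub>FV\<^esub> delta (a \<oplus>\<^bsub>A\<^esub> a', b) = N +>\<^bsub>FV\<^esub> (delta (a, b) \<oplus>\<^bsub>FV\<^esub> delta (a', b))"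
    unfolding Q.proj_eq_iff[OF s] FV_minus[OF s] by (simp add: diff_diff_eq)
  then show "pure A B (a \<oplus>\<^bsub>A\<^esub> a') b = pure A B a b \<oplus>\<^bsub>T\<^esub> pure A B a' b"
    unfolding pure_def tensor_eq_Q Q.proj_add[OF delta_closed[OF a(1) b] delta_closed[OF a(2) b]] .
qed

lemma pure_linear_right: "a \<in> carrier A \<Longrightarrow> linear_map B T (\<lambda>b. pure A B a b)"
proof (rule linear_mapI)
  assume a: "a \<in> carrier A"
  fix b c assume b: "b \<in> carrier B"
  show "pure A B a b \<in> carrier T" using a b by (rule pure_closed)
  have "delta (a, c \<odot>\<^bsub>B\<^esub> b) - Poly_Mapping.single (a, b) c \<in> N"
    using a b by (intro subsetD[OF tensor_null_props(5)] tensor_relatorsI)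
  moreover have s: "delta (a, c \<odot>\<^bsub>B\<^esub> b) \<in> carrier FV" "c \<odot>\<^bsub>FV\<^esub> delta (a, b) \<in> carrier FV"
    using a b by (intro Q.smult_closed delta_closed; simp)+
  ultimately have "N +>\<^bsub>FV\<^esub> delta (a, c \<odot>\<^bsub>B\<^esub> b) = N +>\<^bsub>FV\<^esub> (c \<odot>\<^bsub>FV\<^esub> delta (a, b))"
    unfolding Q.proj_eq_iff[OF s] FV_minus[OF s] by simp
  then show "pure A B a (c \<odot>\<^bsub>B\<^esub> b) = c \<odot>\<^bsub>T\<^esub> pure A B a b"
    unfolding pure_def tensor_eq_Q Q.proj_smult[OF delta_closed[OF a b]] .
next
  assume a: "a \<in> carrier A"
  fix b b' assume b: "b \<in> carrier B" "b' \<in> carrier B"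
  have "delta (a, b \<oplus>\<^bsub>B\<^esub> b') - delta (a, b) - delta (a, b') \<in> N"
    using a b by (intro subsetD[OF tensor_null_props(5)] tensor_relatorsI)
  moreover have s: "delta (a, b \<oplus>\<^bsub>B\<^esub> b') \<in> carrier FV" "delta (a, b) \<oplus>\<^bsub>FV\<^esub> delta (a, b') \<in> carrier FV"
    using a b by (simp_all add: keys_add_subset)
  ultimately have "N +>\<^bsub>FV\<^esub> delta (a, b \<oplus>\<^bsub>B\<^esub> b') = N +>\<^bsub>FV\<^esub> (delta (a, b) \<oplus>\<^bsub>FV\<^esub> delta (a, b'))"
    unfolding Q.proj_eq_iff[OF s] FV_minus[OF s] by (simp add: diff_diff_eq)
  then show "pure A B a (b \<oplus>\<^bsub>B\<^esub> b') = pure A B a b \<oplus>\<^bsub>T\<^esub> pure A B a b'"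
    unfolding pure_def tensor_eq_Q Q.proj_add[OF delta_closed[OF a b(1)] delta_closed[OF a b(2)]] .
qed

lemma tensor_induct [consumes 1, case_names pure add]:
  assumes "x \<in> carrier T"
    and pure: "\<And>a b. a \<in> carrier A \<Longrightarrow> b \<in> carrier B \<Longrightarrow> P (pure A B a b)"
    and add: "\<And>x y. x \<in> carrier T \<Longrightarrow> y \<in> carrier T \<Longrightarrow> P x \<Longrightarrow> P y \<Longrightarrow> P (x \<oplus>\<^bsub>T\<^esub> y)"
  shows "P x"
proof -
  have single: "P (N +>\<^bsub>FV\<^esub> Poly_Mapping.single m c)" if m_in: "m \<in> carrier (A \<times>\<times> B)" for m c
  proof -
    obtain a b where m: "m = (a, b)" "a \<in> carrier A" "b \<in> carrier B" using m_in by auto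
    have "N +>\<^bsub>FV\<^esub> Poly_Mapping.single m c = c \<odot>\<^bsub>T\<^esub> pure A B a b"
      unfolding pure_def tensor_eq_Q Q.proj_smult[OF delta_closed[OF m(2,3)]] by (simp add: m(1))
    also have "\<dots> = pure A B (c \<odot>\<^bsub>A\<^esub> a) b"
      using linear_map_smult[OF pure_linear_left[OF m(3)] m(2)] by simp
    finally show ?thesis using pure m by simp
  qed
  obtain t where t: "t \<in> carrier FV" "x = N +>\<^bsub>FV\<^esub> t"
    using assms(1) by (auto simp: tensor_eq_Q Q.quot_alg_simps(1))
  from t(1) have "P (N +>\<^bsub>FV\<^esub> t)"
  proof (induction rule: monoid_algebra_induct)
    case zero
    show ?case using single[of "(\<one>\<^bsub>A\<^esub>, \<one>\<^bsub>B\<^esub>)" 0] by simp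
  next
    case (add a b)
    then show ?case
      using assms(3)[of "N +>\<^bsub>FV\<^esub> a" "N +>\<^bsub>FV\<^esub> b"] Q.proj_add[OF add(1,2)] Q.proj_closed
      by (simp add: tensor_eq_Q)
  qed (rule single)
  then show ?thesis by (simp add: t)
qed

lemma linear_map_eq_on_tensor:
  assumes "linear_map T V \<phi>" "linear_map T V \<psi>"
    and "\<And>a b. a \<in> carrier A \<Longrightarrow> b \<in> carrier B \<Longrightarrow> \<phi> (pure A B a b) = \<psi> (pure A B a b)"
    and "x \<in> carrier T"
  shows "\<phi> x = \<psi> x"
  using assms(4)
  by (induction rule: tensor_induct)
     (simp_all add: assms(3) linear_map_add[OF assms(1)] linear_map_add[OF assms(2)])

lemma tlift:
  assumes V: "k_algebra V" and \<beta>: "bilinear_map A B V \<beta>"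
  shows "linear_map T V (tlift V \<beta>)"
    and "a \<in> carrier A \<Longrightarrow> b \<in> carrier B \<Longrightarrow> tlift V \<beta> (pure A B a b) = \<beta> a b"
proof -
  interpret V: k_algebra V by fact
  let ?b = "\<lambda>ab. \<beta> (fst ab) (snd ab)"
  have lin: "linear_map FV V (lin_ext V ?b)"
    by (rule linear_map_lin_ext[OF V]) (auto intro: bilinear_map_closed[OF \<beta>])
  have zero: "lin_ext V ?b 0 = \<zero>\<^bsub>V\<^esub>" by (simp add: lin_ext_def)
  have minus: "lin_ext V ?b (x - y) = lin_ext V ?b x \<ominus>\<^bsub>V\<^esub> lin_ext V ?b y" "x - y \<in> carrier FV"
    if "x \<in> carrier FV" "y \<in> carrier FV" for x y
    using linear_map_minus[OF lin k_algebra_FV V that] Q.minus_closed[OF that] by (simp_all only: FV_minus[OF that])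
  have single: "lin_ext V ?b (Poly_Mapping.single (a, b) c) = c \<odot>\<^bsub>V\<^esub> \<beta> a b" "Poly_Mapping.single (a, b) c \<in> carrier FV"
    if "a \<in> carrier A" "b \<in> carrier B" for a b and c :: 'k
    using bilinear_map_closed[OF \<beta> that] that by (simp_all add: lin_ext_single[OF V])
  note closed = bilinear_map_closed[OF \<beta>]
  have "N \<subseteq> {x \<in> carrier FV. lin_ext V ?b x = \<zero>\<^bsub>V\<^esub>}"
  proof (rule tensor_null_minimal)
    fix x assume "x \<in> tensor_relators A B"
    then show "x \<in> {x \<in> carrier FV. lin_ext V ?b x = \<zero>\<^bsub>V\<^esub>}"
    proof (cases rule: tensor_relatorsE)
      case 1
      then show ?thesis
        using linear_map_add[OF bilinear_mapD(2)[OF \<beta> 1(3)] 1(1,2)] closed[OF 1(1,3)] closed[OF 1(2,3)]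
          V.r_neg[OF V.a_closed[OF closed[OF 1(1,3)] closed[OF 1(2,3)]]]
        by (simp add: minus single a_minus_def V.a_assoc V.minus_add del: monoid_algebra_simps)
    next
      case 2
      then show ?thesis
        using linear_map_add[OF bilinear_mapD(1)[OF \<beta> 2(1)] 2(2,3)] closed[OF 2(1,2)] closed[OF 2(1,3)]
          V.r_neg[OF V.a_closed[OF closed[OF 2(1,2)] closed[OF 2(1,3)]]]
        by (simp add: minus single a_minus_def V.a_assoc V.minus_add del: monoid_algebra_simps)
    next
      case 3
      then show ?thesis
        using linear_map_smult[OF bilinear_mapD(2)[OF \<beta> 3(2)] 3(1)] closed[OF 3(1,2)]
        by (simp add: minus single V.r_neg a_minus_def del: monoid_algebra_simps)
    next
      case 4
      then show ?thesis
        using linear_map_smult[OF bilinear_mapD(1)[OF \<beta> 4(1)] 4(2)] closed[OF 4(1,2)]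
        by (simp add: minus single V.r_neg a_minus_def del: monoid_algebra_simps)
    qed
  next
    fix x y assume "x \<in> {x \<in> carrier FV. lin_ext V ?b x = \<zero>\<^bsub>V\<^esub>}" "y \<in> {x \<in> carrier FV. lin_ext V ?b x = \<zero>\<^bsub>V\<^esub>}"
    then show "x + y \<in> {x \<in> carrier FV. lin_ext V ?b x = \<zero>\<^bsub>V\<^esub>}"
      using linear_map_add[OF lin, of x y] by (simp add: keys_add_subset)
  next
    fix c x assume "x \<in> {x \<in> carrier FV. lin_ext V ?b x = \<zero>\<^bsub>V\<^esub>}"
    then show "Poly_Mapping.map ((*) c) x \<in> {x \<in> carrier FV. lin_ext V ?b x = \<zero>\<^bsub>V\<^esub>}"
      using linear_map_smult[OF lin, of x c] keys_map_mult[of c x] by auto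
  qed (auto simp: zero)
  then have ker: "lin_ext V ?b x = \<zero>\<^bsub>V\<^esub>" if "x \<in> N" for x using that by blast
  have eq: "tlift V \<beta> = (\<lambda>C. the_elem (lin_ext V ?b ` C))"
    by (rule ext) (rule tlift_lin_ext)
  show "linear_map T V (tlift V \<beta>)"
    unfolding eq tensor_eq_Q by (rule Q.quot_lift(2)[OF V lin ker])
  show "tlift V \<beta> (pure A B a b) = \<beta> a b" if "a \<in> carrier A" "b \<in> carrier B"
    using Q.quot_lift(1)[OF V lin ker delta_closed[OF that]] single(1)[OF that, of 1] closed[OF that]
    unfolding eq pure_def by simp
qed

lemma tlift_alg_hom:
  assumes V: "k_algebra V" and \<beta>: "bilinear_map A B V \<beta>"
    and one: "\<beta> \<one>\<^bsub>A\<^esub> \<one>\<^bsub>B\<^esub> = \<one>\<^bsub>V\<^esub>"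
    and mult: "\<And>a b a' b'. a \<in> carrier A \<Longrightarrow> b \<in> carrier B \<Longrightarrow> a' \<in> carrier A \<Longrightarrow> b' \<in> carrier B \<Longrightarrow>
      \<beta> (a \<otimes>\<^bsub>A\<^esub> a') (b \<otimes>\<^bsub>B\<^esub> b') = \<beta> a b \<otimes>\<^bsub>V\<^esub> \<beta> a' b'"
  shows "alg_hom T V (tlift V \<beta>)"
proof (rule alg_homI)
  interpret V: k_algebra V by fact
  interpret T: k_algebra T by (rule k_algebra_tensor)
  show lin: "linear_map T V (tlift V \<beta>)" by (rule tlift(1)[OF V \<beta>])
  show "tlift V \<beta> \<one>\<^bsub>T\<^esub> = \<one>\<^bsub>V\<^esub>" by (simp add: tensor_one tlift(2)[OF V \<beta>] one)
  note cl = linear_map_closed[OF lin] and add = linear_map_add[OF lin]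
  fix x y assume x: "x \<in> carrier T" and y: "y \<in> carrier T"
  from x show "tlift V \<beta> (x \<otimes>\<^bsub>T\<^esub> y) = tlift V \<beta> x \<otimes>\<^bsub>V\<^esub> tlift V \<beta> y"
  proof (induction rule: tensor_induct)
    case (pure a b)
    from y show ?case
    proof (induction rule: tensor_induct)
      case (pure a' b')
      then show ?case using \<open>a \<in> carrier A\<close> \<open>b \<in> carrier B\<close>
        by (simp add: pure_mult tlift(2)[OF V \<beta>] mult)
    next
      case (add x y)
      then show ?case using pure_closed[OF pure] cl by (simp add: T.r_distr linear_map_add[OF lin] V.r_distr)
    qed
  next
    case (add x x')
    then show ?case using y cl by (simp add: T.l_distr linear_map_add[OF lin] V.l_distr)
  qed
qed

lemma tlift_cong:
  assumes "x \<in> carrier T" "k_algebra V" "bilinear_map A B V \<beta>"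
    and "\<And>a b. a \<in> carrier A \<Longrightarrow> b \<in> carrier B \<Longrightarrow> \<beta> a b = \<gamma> a b"
  shows "tlift V \<beta> x = tlift V \<gamma> x"
proof -
  have "linear_map B V (\<lambda>v. \<gamma> u v)" if "u \<in> carrier A" for u
    using bilinear_mapD(1)[OF assms(3) that] assms(4)[OF that] unfolding linear_map_def
    by (simp add: Pi_def)
  moreover have "linear_map A V (\<lambda>u. \<gamma> u v)" if "v \<in> carrier B" for v
    using bilinear_mapD(2)[OF assms(3) that] assms(4)[OF _ that] unfolding linear_map_def
    by (simp add: Pi_def)
  ultimately have \<gamma>: "bilinear_map A B V \<gamma>" by (simp add: bilinear_mapI)
  show ?thesis
    by (rule linear_map_eq_on_tensor[OF tlift(1)[OF assms(2,3)] tlift(1)[OF assms(2) \<gamma>] _ assms(1)])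
       (simp add: tlift(2)[OF assms(2,3)] tlift(2)[OF assms(2) \<gamma>] assms(4))
qed

text \<open>Sweedler sums are nested applications of \<open>tlift\<close>. That they are linear in each further argument is
  the fact behind most equalities between them.\<close>

lemma tlift_param:
  assumes V: "k_algebra V" and Z: "k_algebra Z" and x: "x \<in> carrier T"
    and \<beta>: "\<And>z. z \<in> carrier Z \<Longrightarrow> bilinear_map A B V (\<beta> z)"
    and lin: "\<And>a b. a \<in> carrier A \<Longrightarrow> b \<in> carrier B \<Longrightarrow> linear_map Z V (\<lambda>z. \<beta> z a b)"
  shows "linear_map Z V (\<lambda>z. tlift V (\<beta> z) x)"
proof (rule linear_mapI)
  interpret V: k_algebra V by fact
  interpret Z: k_algebra Z by fact
  interpret T: k_algebra T by (rule k_algebra_tensor)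
  note l = tlift(1)[OF V \<beta>] and e = tlift(2)[OF V \<beta>]
  fix z assume z: "z \<in> carrier Z"
  show "tlift V (\<beta> z) x \<in> carrier V" by (rule linear_map_closed[OF l[OF z] x])
  fix c
  show "tlift V (\<beta> (c \<odot>\<^bsub>Z\<^esub> z)) x = c \<odot>\<^bsub>V\<^esub> tlift V (\<beta> z) x"
    by (rule linear_map_eq_on_tensor[OF l linear_map_smult_const[OF V l] _ x])
       (simp_all add: z e linear_map_smult[OF lin])
next
  interpret V: k_algebra V by fact
  interpret Z: k_algebra Z by fact
  note l = tlift(1)[OF V \<beta>] and e = tlift(2)[OF V \<beta>]
  fix z z' assume z: "z \<in> carrier Z" "z' \<in> carrier Z"
  show "tlift V (\<beta> (z \<oplus>\<^bsub>Z\<^esub> z')) x = tlift V (\<beta> z) x \<oplus>\<^bsub>V\<^esub> tlift V (\<beta> z') x"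
    by (rule linear_map_eq_on_tensor[OF l linear_map_plus[OF V l l] _ x])
       (simp_all add: z e linear_map_add[OF lin])
qed

end

lemma k_algebra_tensor [simp]: "k_algebra A \<Longrightarrow> k_algebra B \<Longrightarrow> k_algebra (tensor A B)"
  by (rule tensor_pair.k_algebra_tensor) (rule tensor_pair.intro)

lemma linear_map_pure [lin]:
  assumes "k_algebra A" "k_algebra B"
  shows "linear_map Z A \<phi> \<Longrightarrow> b \<in> carrier B \<Longrightarrow> linear_map Z (tensor A B) (\<lambda>z. pure A B (\<phi> z) b)"
    and "linear_map Z B \<psi> \<Longrightarrow> a \<in> carrier A \<Longrightarrow> linear_map Z (tensor A B) (\<lambda>z. pure A B a (\<psi> z))"
proof -
  interpret tensor_pair A B by (rule tensor_pair.intro) fact+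
  show "linear_map Z A \<phi> \<Longrightarrow> b \<in> carrier B \<Longrightarrow> linear_map Z (tensor A B) (\<lambda>z. pure A B (\<phi> z) b)"
    "linear_map Z B \<psi> \<Longrightarrow> a \<in> carrier A \<Longrightarrow> linear_map Z (tensor A B) (\<lambda>z. pure A B a (\<psi> z))"
    by - (rule linear_map_compose, assumption, erule pure_linear_left pure_linear_right)+
qed

lemma pure_closed [simp]:
  "k_algebra A \<Longrightarrow> k_algebra B \<Longrightarrow> a \<in> carrier A \<Longrightarrow> b \<in> carrier B \<Longrightarrow> pure A B a b \<in> carrier (tensor A B)"
  by (rule tensor_pair.pure_closed) (rule tensor_pair.intro)

lemma linear_map_tlift [lin]:
  "k_algebra A \<Longrightarrow> k_algebra B \<Longrightarrow> k_algebra V \<Longrightarrow> linear_map Z (tensor A B) \<phi> \<Longrightarrow> bilinear_map A B V \<beta> \<Longrightarrow>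
    linear_map Z V (\<lambda>z. tlift V \<beta> (\<phi> z))"
  by (rule linear_map_compose, assumption, rule tensor_pair.tlift(1)) (rule tensor_pair.intro)

lemma tlift_pure [simp]:
  "k_algebra A \<Longrightarrow> k_algebra B \<Longrightarrow> k_algebra V \<Longrightarrow> bilinear_map A B V \<beta> \<Longrightarrow> a \<in> carrier A \<Longrightarrow> b \<in> carrier B \<Longrightarrow>
    tlift V \<beta> (pure A B a b) = \<beta> a b"
  by (rule tensor_pair.tlift(2)) (rule tensor_pair.intro)

lemma tlift_closed:
  "k_algebra A \<Longrightarrow> k_algebra B \<Longrightarrow> k_algebra V \<Longrightarrow> bilinear_map A B V \<beta> \<Longrightarrow> x \<in> carrier (tensor A B) \<Longrightarrow>
    tlift V \<beta> x \<in> carrier V"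
  by (rule linear_map_closed, rule tensor_pair.tlift(1)) (rule tensor_pair.intro)

lemma tlift_add:
  "k_algebra A \<Longrightarrow> k_algebra B \<Longrightarrow> k_algebra V \<Longrightarrow> bilinear_map A B V \<beta> \<Longrightarrow> x \<in> carrier (tensor A B) \<Longrightarrow>
    y \<in> carrier (tensor A B) \<Longrightarrow> tlift V \<beta> (x \<oplus>\<^bsub>tensor A B\<^esub> y) = tlift V \<beta> x \<oplus>\<^bsub>V\<^esub> tlift V \<beta> y"
  by (rule linear_map_add, rule tensor_pair.tlift(1)) (rule tensor_pair.intro)

text \<open>The elements of a tensor product, its linear structure and its pure tensors depend only on
  the linear structure of the factors, not on their multiplication.\<close>

lemma tensor_cong_linear:
  fixes A :: "('k::field, 'a, 'm) module_scheme" and A' :: "('k, 'a, 'm') module_scheme"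
    and B :: "('k, 'b, 'n) module_scheme" and B' :: "('k, 'b, 'n') module_scheme"
  assumes "carrier A' = carrier A" "add A' = add A" "smult A' = smult A"
    and "carrier B' = carrier B" "add B' = add B" "smult B' = smult B"
  shows "tensor_null A' B' = tensor_null A B" and "pure A' B' = pure A B"
    and "carrier (tensor A' B') = carrier (tensor A B)" "add (tensor A' B') = add (tensor A B)"
    and "smult (tensor A' B') = smult (tensor A B)" "zero (tensor A' B') = zero (tensor A B)"
proof -
  have rel: "tensor_relators A' B' = tensor_relators A B"
    by (simp add: tensor_relators_def assms)
  have car: "carrier (A' \<times>\<times> B') = carrier (A \<times>\<times> B)" by (simp add: assms)
  show N: "tensor_null A' B' = tensor_null A B"
    unfolding tensor_null_def submodule_monoid_algebra_iff rel car ..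
  have r': "a_r_coset (monoid_algebra (A' \<times>\<times> B') :: ('k, _) module) = a_r_coset (monoid_algebra (A \<times>\<times> B))"
    by (intro ext) (simp add: a_r_coset_def r_coset_def)
  show "pure A' B' = pure A B" by (intro ext) (simp add: pure_def N r')
  show "carrier (tensor A' B') = carrier (tensor A B)"
    by (simp add: tensor_def quot_alg_def ring.defs FactRing_def A_RCOSETS_def' N r' assms)
  show "add (tensor A' B') = add (tensor A B)"
    by (intro ext) (simp add: tensor_def quot_alg_def ring.defs FactRing_def set_add_def' N)
  show "smult (tensor A' B') = smult (tensor A B)"
    by (intro ext) (simp add: tensor_def quot_alg_def ring.defs FactRing_def N r')
  show "zero (tensor A' B') = zero (tensor A B)"
    by (simp add: tensor_def quot_alg_def ring.defs FactRing_def N)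
qed

lemma tensor_cong:
  fixes A :: "('k::field, 'a, 'm) module_scheme" and A' :: "('k, 'a, 'm') module_scheme"
    and B :: "('k, 'b, 'n) module_scheme" and B' :: "('k, 'b, 'n') module_scheme"
  assumes "carrier A' = carrier A" "add A' = add A" "smult A' = smult A" "mult A' = mult A" "one A' = one A"
    and "carrier B' = carrier B" "add B' = add B" "smult B' = smult B" "mult B' = mult B" "one B' = one B"
  shows "tensor A' B' = tensor A B"
proof -
  have "(monoid_algebra (A' \<times>\<times> B') :: ('k, _) module) = monoid_algebra (A \<times>\<times> B)"
    by (simp add: monoid_algebra_def DirProd_def assms)
  then show ?thesis
    by (simp add: tensor_def tensor_cong_linear(1)[OF assms(1-3,6-8)])
qed

section \<open>Rising factorials in characteristic p\<close>

text \<open>Evaluation of commutative polynomials at an element of an algebra: identities between polynomials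
  over \<open>'k\<close> hold in the subalgebra generated by one element.\<close>

definition poly_eval :: "('k::field, 'a, 'm) module_scheme \<Rightarrow> 'a \<Rightarrow> 'k poly \<Rightarrow> 'a" where
  "poly_eval A a q = fold_coeffs (\<lambda>c b. c \<odot>\<^bsub>A\<^esub> \<one>\<^bsub>A\<^esub> \<oplus>\<^bsub>A\<^esub> a \<otimes>\<^bsub>A\<^esub> b) q \<zero>\<^bsub>A\<^esub>"

definition rising :: "('k::field, 'a, 'm) module_scheme \<Rightarrow> 'a \<Rightarrow> nat \<Rightarrow> 'a" where
  "rising A a m = poly_eval A a (pochhammer [:0, 1:] m)"

lemma of_nat_power_CHAR:
  assumes "prime CHAR('k::comm_ring_1)"
  shows "(of_nat n :: 'k) ^ CHAR('k) = of_nat n"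
proof (induction n)
  case 0
  then show ?case using prime_gt_0_nat[OF assms] by (simp add: power_0_left)
next
  case (Suc n)
  then show ?case using freshmans_dream[OF assms refl, of 1 "of_nat n"] by simp
qed

text \<open>In characteristic \<open>p\<close> the rising factorial of length \<open>p\<close> is the polynomial \<open>X\<^sup>p - X\<close>: both are
  monic of degree \<open>p\<close> and vanish on the prime field.\<close>

lemma pochhammer_CHAR:
  assumes p: "prime CHAR('k::field)"
  shows "pochhammer [:0, 1:] CHAR('k) = monom (1::'k) CHAR('k) - [:0, 1:]"
proof (rule poly_eqI_degree_lead_coeff)
  let ?p = "CHAR('k)"
  have deg: "degree (pochhammer [:0, 1:] m :: 'k poly) = m \<and> lead_coeff (pochhammer [:0, 1:] m :: 'k poly) = 1" for m
  proof (induction m)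
    case (Suc m)
    then have nz: "pochhammer [:0, 1::'k:] m \<noteq> 0" by auto
    have l: "[:0, 1::'k:] + of_nat m = [:of_nat m, 1:]" by (simp add: of_nat_poly)
    have d: "degree (pochhammer [:0, 1::'k:] (Suc m)) = Suc m"
      using Suc nz by (simp add: pochhammer_rec' l degree_mult_eq del: mult_pCons_left)
    moreover have "lead_coeff (pochhammer [:0, 1::'k:] (Suc m)) = 1"
      unfolding pochhammer_rec' l lead_coeff_mult using conjunct1[OF Suc] conjunct2[OF Suc] by simp
    ultimately show ?case by blast
  qed simp
  have p2: "?p \<ge> 2" using p by (simp add: prime_ge_2_nat)
  show "degree (pochhammer [:0, 1:] ?p :: 'k poly) \<le> ?p" using deg by simp
  show "degree (monom (1::'k) ?p - [:0, 1:]) \<le> ?p"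
    using p2 by (intro degree_diff_le) (auto simp: degree_monom_eq)
  show "poly.coeff (pochhammer [:0, 1:] ?p) ?p = poly.coeff (monom (1::'k) ?p - [:0, 1:]) ?p"
    using deg[of ?p] p2 by (auto simp: coeff_pCons split: nat.splits)
  show "card ((\<lambda>i. - of_nat i :: 'k) ` {..<?p}) \<ge> ?p"
  proof -
    have "inj_on (\<lambda>i. - of_nat i :: 'k) {..<?p}"
    proof (rule inj_onI)
      fix i j assume ij: "i \<in> {..<?p}" "j \<in> {..<?p}" "- of_nat i = (- of_nat j :: 'k)"
      have "i = j" if "i \<le> j" "i < ?p" "j < ?p" "of_nat i = (of_nat j :: 'k)" for i j
      proof -
        have "of_nat (j - i) = (0 :: 'k)" using that by (simp add: of_nat_diff)
        then have "?p dvd j - i" by (simp only: of_nat_eq_0_iff_char_dvd)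
        then show ?thesis using that by (auto dest!: dvd_imp_le)
      qed
      from this[of i j] this[of j i] ij show "i = j" by (cases "i \<le> j") auto
    qed
    then show ?thesis by (simp add: card_image)
  qed
  fix z :: 'k assume "z \<in> (\<lambda>i. - of_nat i) ` {..<?p}"
  then obtain i where i: "i < ?p" "z = - of_nat i" by auto
  have "poly (pochhammer [:0, 1:] m) z = pochhammer z m" for m
    by (induction m) (simp_all add: pochhammer_rec' of_nat_poly algebra_simps)
  moreover have "(- of_nat i :: 'k) ^ ?p = - of_nat i"
    by (simp add: minus_power_prime_CHAR[OF refl p] of_nat_power_CHAR[OF p])
  ultimately show "poly (pochhammer [:0, 1:] ?p) z = poly (monom 1 ?p - [:0, 1:]) z"
    using i by (simp add: poly_monom pochhammer_of_nat_eq_0_lemma)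
qed

context k_algebra
begin

lemma poly_eval_0 [simp]: "poly_eval A a 0 = \<zero>"
  by (simp add: poly_eval_def)

lemma poly_eval_pCons [simp]:
  "a \<in> carrier A \<Longrightarrow> poly_eval A a (pCons c q) = c \<odot> \<one> \<oplus> a \<otimes> poly_eval A a q"
  by (cases "c = 0 \<and> q = 0") (auto simp: poly_eval_def)

lemma poly_eval_closed [simp]: "a \<in> carrier A \<Longrightarrow> poly_eval A a q \<in> carrier A"
  by (induction q) auto

lemma poly_eval_add:
  assumes "a \<in> carrier A"
  shows "poly_eval A a (q + r) = poly_eval A a q \<oplus> poly_eval A a r"
proof (induction q arbitrary: r)
  case (pCons c q)
  show ?case
    by (cases r) (use assms pCons in \<open>simp add: smult_add_left r_distr a_ac\<close>)
qed (use assms in simp)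

lemma poly_eval_smult:
  assumes "a \<in> carrier A"
  shows "poly_eval A a (Polynomial.smult c q) = c \<odot> poly_eval A a q"
  by (induction q) (use assms in \<open>simp_all add: smult_add_right smult_smult smult_mult_right\<close>)

lemma poly_eval_mult:
  assumes "a \<in> carrier A"
  shows "poly_eval A a (q * r) = poly_eval A a q \<otimes> poly_eval A a r"
  by (induction q)
     (use assms in \<open>simp_all add: poly_eval_add poly_eval_smult l_distr smult_mult_left m_assoc\<close>)

lemma poly_eval_one [simp]: "a \<in> carrier A \<Longrightarrow> poly_eval A a 1 = \<one>"
  by (simp add: one_pCons)

lemma pow_commute_self: "a \<in> carrier A \<Longrightarrow> a \<otimes> a [^] (n::nat) = a [^] n \<otimes> a"
  by (rule group_commutes_pow[symmetric]) simp_all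

lemma poly_eval_power:
  assumes "a \<in> carrier A"
  shows "poly_eval A a (q ^ n) = poly_eval A a q [^] n"
  by (induction n) (use assms in \<open>simp_all add: poly_eval_mult pow_commute_self\<close>)

lemma poly_eval_monom: "a \<in> carrier A \<Longrightarrow> poly_eval A a (monom 1 n) = a [^] n"
  by (induction n) (simp_all add: monom_Suc monom_0 pow_commute_self)

lemma poly_eval_commute:
  assumes "a \<in> carrier A" "z \<in> carrier A" "z \<otimes> a = a \<otimes> z"
  shows "z \<otimes> poly_eval A a q = poly_eval A a q \<otimes> z"
proof (induction q)
  case (pCons c q)
  have "z \<otimes> (a \<otimes> poly_eval A a q) = a \<otimes> (poly_eval A a q \<otimes> z)"
    using assms by (simp add: m_assoc[symmetric]) (simp add: m_assoc pCons)
  then show ?case using assms by (simp add: r_distr l_distr smult_mult_left smult_mult_right m_assoc)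
qed (use assms in simp)

text \<open>Frobenius is additive on the commutative subalgebra generated by one element.\<close>

lemma affine_power_CHAR:
  assumes "prime CHAR('k)" "a \<in> carrier A"
  shows "(c \<odot> \<one> \<oplus> d \<odot> a) [^] CHAR('k) = (c ^ CHAR('k)) \<odot> \<one> \<oplus> (d ^ CHAR('k)) \<odot> (a [^] CHAR('k))"
proof -
  let ?p = "CHAR('k)"
  have p: "prime CHAR('k poly)" using assms(1) by simp
  have "[:c, d:] ^ ?p = ([:c:] + Polynomial.smult d [:0, 1:]) ^ ?p" by simp
  also have "\<dots> = [:c:] ^ ?p + Polynomial.smult (d ^ ?p) (monom 1 ?p)"
    unfolding freshmans_dream[OF p semiring_char_poly[symmetric], of "[:c:]" "Polynomial.smult d [:0, 1:]"]
      smult_power by (simp add: monom_altdef)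
  also have "[:c:] ^ ?p = [:c ^ ?p:]" by (simp add: poly_const_pow)
  finally have "poly_eval A a ([:c, d:] ^ ?p) = poly_eval A a ([:c ^ ?p:] + Polynomial.smult (d ^ ?p) (monom 1 ?p))"
    by simp
  then show ?thesis
    using assms(2) by (simp add: poly_eval_power poly_eval_add poly_eval_smult poly_eval_monom smult_mult_right)
qed

lemma rising_closed [simp]: "a \<in> carrier A \<Longrightarrow> rising A a m \<in> carrier A"
  by (simp add: rising_def)

lemma rising_0 [simp]: "a \<in> carrier A \<Longrightarrow> rising A a 0 = \<one>"
  by (simp add: rising_def)

lemma rising_Suc: "a \<in> carrier A \<Longrightarrow> rising A a (Suc m) = (a \<oplus> of_nat m \<odot> \<one>) \<otimes> rising A a m"
proof -
  assume a: "a \<in> carrier A"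
  have "[:0, 1:] + of_nat m = [:of_nat m, 1 :: 'k:]" by (simp add: of_nat_poly)
  then show ?thesis
    using a by (simp add: rising_def pochhammer_rec' poly_eval_mult a_comm del: mult_pCons_left)
qed

lemma rising_1: "a \<in> carrier A \<Longrightarrow> rising A a (Suc 0) = a"
  by (simp add: rising_Suc)

lemma rising_commute:
  "a \<in> carrier A \<Longrightarrow> z \<in> carrier A \<Longrightarrow> z \<otimes> a = a \<otimes> z \<Longrightarrow> z \<otimes> rising A a m = rising A a m \<otimes> z"
  unfolding rising_def by (rule poly_eval_commute)

lemma rising_CHAR:
  assumes "prime CHAR('k)" "a \<in> carrier A"
  shows "rising A a CHAR('k) = a [^] CHAR('k) \<ominus> a"
proof -
  have "monom (1::'k) CHAR('k) - [:0, 1:] = monom 1 CHAR('k) + Polynomial.smult (-1) [:0, 1:]" by simp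
  then have "rising A a CHAR('k) = poly_eval A a (monom 1 CHAR('k) + Polynomial.smult (-1) [:0, 1:])"
    unfolding rising_def by (simp only: pochhammer_CHAR[OF assms(1)])
  also have "\<dots> = a [^] CHAR('k) \<oplus> (-1) \<odot> a"
    using assms(2) unfolding poly_eval_add[OF assms(2)] poly_eval_smult[OF assms(2)] poly_eval_monom[OF assms(2)]
    by simp
  finally show ?thesis using assms(2) by (simp add: minus_eq_smult)
qed

lemma finsum_pascal:
  fixes T :: "nat \<Rightarrow> 'a"
  assumes T: "\<And>l. T l \<in> carrier A"
  shows "(\<Oplus>l\<in>{..m}. of_nat (m choose l) \<odot> (T l \<oplus> T (Suc l))) =
    (\<Oplus>l\<in>{..Suc m}. of_nat (Suc m choose l) \<odot> T l)"
proof -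
  have "(\<Oplus>l\<in>{..Suc m}. of_nat (Suc m choose l) \<odot> T l) =
      (\<Oplus>l\<in>{..m}. of_nat (m choose l) \<odot> T (Suc l) \<oplus> of_nat (m choose Suc l) \<odot> T (Suc l)) \<oplus> T 0"
    using T by (subst finsum_Suc2) (auto simp: smult_add_left)
  also have "\<dots> = (\<Oplus>l\<in>{..m}. of_nat (m choose l) \<odot> T (Suc l)) \<oplus>
      ((\<Oplus>l\<in>{..m}. of_nat (m choose Suc l) \<odot> T (Suc l)) \<oplus> of_nat (m choose 0) \<odot> T 0)"
    using T by (subst finsum_addf) (auto simp: a_assoc)
  also have "(\<Oplus>l\<in>{..m}. of_nat (m choose Suc l) \<odot> T (Suc l)) \<oplus> of_nat (m choose 0) \<odot> T 0 =
      (\<Oplus>l\<in>{..Suc m}. of_nat (m choose l) \<odot> T l)"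
    using T by (subst finsum_Suc2) auto
  also have "\<dots> = (\<Oplus>l\<in>{..m}. of_nat (m choose l) \<odot> T l)"
    using T by (subst finsum_Suc) (auto simp: Pi_def binomial_eq_0)
  also have "(\<Oplus>l\<in>{..m}. of_nat (m choose l) \<odot> T (Suc l)) \<oplus> (\<Oplus>l\<in>{..m}. of_nat (m choose l) \<odot> T l) =
      (\<Oplus>l\<in>{..m}. of_nat (m choose l) \<odot> T (Suc l) \<oplus> of_nat (m choose l) \<odot> T l)"
    using T by (subst finsum_addf) auto
  also have "\<dots> = (\<Oplus>l\<in>{..m}. of_nat (m choose l) \<odot> (T l \<oplus> T (Suc l)))"
    using T by (intro finsum_cong') (auto simp: smult_add_right a_comm)
  finally show ?thesis by simp
qed

text \<open>The relation says that \<open>x\<close> passes \<open>G\<close> at the cost of \<open>G\<^sup>2 - G\<close>.\<close>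

lemma skew_power:
  fixes l :: nat
  assumes c: "x \<in> carrier A" "G \<in> carrier A" and rel: "x \<otimes> G \<oplus> G = G \<otimes> x \<oplus> G \<otimes> G"
  shows "x \<otimes> G [^] l \<oplus> of_nat l \<odot> G [^] l = G [^] l \<otimes> x \<oplus> of_nat l \<odot> G [^] Suc l"
proof (induction l)
  case (Suc l)
  have GG: "G \<otimes> G [^] l = G [^] l \<otimes> G" using c by (simp add: pow_commute_self)
  have "x \<otimes> G [^] Suc l \<oplus> of_nat (Suc l) \<odot> G [^] Suc l =
      (x \<otimes> G [^] l \<oplus> of_nat l \<odot> G [^] l) \<otimes> G \<oplus> G [^] Suc l"
    using c by (simp add: smult_add_left l_distr smult_mult_left m_assoc a_ac)
  also have "\<dots> = G [^] l \<otimes> (x \<otimes> G \<oplus> G) \<oplus> of_nat l \<odot> G [^] Suc (Suc l)"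
    unfolding Suc using c by (simp add: l_distr r_distr smult_mult_left m_assoc a_ac)
  also have "\<dots> = G [^] Suc l \<otimes> x \<oplus> of_nat (Suc l) \<odot> G [^] Suc (Suc l)"
    unfolding rel using c by (simp add: r_distr smult_add_left m_assoc a_ac)
  finally show ?case .
qed (use c in simp)

text \<open>A Vandermonde identity for rising factorials. The rising factorials absorb the correction terms from
  \<open>skew_power\<close>: multiplication by the next factor turns the summand of index \<open>l\<close> into the two
  summands of index \<open>l\<close> and \<open>l + 1\<close>, so that Pascal's rule applies.\<close>

lemma rising_skew_sum:
  assumes c: "x \<in> carrier A" "G \<in> carrier A" "z \<in> carrier A"
    and rel: "x \<otimes> G \<oplus> G = G \<otimes> x \<oplus> G \<otimes> G" and zx: "z \<otimes> x = x \<otimes> z" and zG: "z \<otimes> G = G \<otimes> z"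
  shows "rising A (x \<oplus> z \<otimes> G) m =
    (\<Oplus>l\<in>{..m}. of_nat (m choose l) \<odot> (G [^] l \<otimes> (rising A x (m - l) \<otimes> rising A z l)))"
proof (induction m)
  case 0
  then show ?case using c by simp
next
  case (Suc m)
  define T where "T = (\<lambda>m l. G [^] l \<otimes> (rising A x (m - l) \<otimes> rising A z l))"
  have T: "T m l \<in> carrier A" for m l using c by (simp add: T_def)
  have step: "(x \<oplus> z \<otimes> G \<oplus> of_nat m \<odot> \<one>) \<otimes> T m l = T (Suc m) l \<oplus> T (Suc m) (Suc l)" if "l \<le> m" for l
  proof -
    have zGl: "z \<otimes> G [^] l = G [^] l \<otimes> z" for l :: nat
      by (rule group_commutes_pow[symmetric]) (use c zG in simp_all)
    have "(x \<oplus> z \<otimes> G \<oplus> of_nat m \<odot> \<one>) \<otimes> G [^] l =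
        (x \<otimes> G [^] l \<oplus> of_nat l \<odot> G [^] l) \<oplus> of_nat (m - l) \<odot> G [^] l \<oplus> G [^] Suc l \<otimes> z"
    proof -
      have "z \<otimes> G \<otimes> G [^] l = G [^] Suc l \<otimes> z"
        using c zGl[of "Suc l"] by (simp add: m_assoc pow_commute_self)
      moreover have "of_nat m \<odot> G [^] l = of_nat l \<odot> G [^] l \<oplus> of_nat (m - l) \<odot> G [^] l"
        using c that by (simp add: smult_add_left[symmetric] of_nat_diff)
      ultimately show ?thesis using c by (simp add: l_distr smult_mult_left a_ac)
    qed
    also have "\<dots> = G [^] l \<otimes> (x \<oplus> of_nat (m - l) \<odot> \<one>) \<oplus> G [^] Suc l \<otimes> (z \<oplus> of_nat l \<odot> \<one>)"
      unfolding skew_power[OF c(1,2) rel] using c by (simp add: r_distr smult_mult_right a_ac)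
    finally have eq: "(x \<oplus> z \<otimes> G \<oplus> of_nat m \<odot> \<one>) \<otimes> G [^] l = \<dots>" .
    have comm: "(z \<oplus> of_nat l \<odot> \<one>) \<otimes> rising A x (m - l) = rising A x (m - l) \<otimes> (z \<oplus> of_nat l \<odot> \<one>)"
      using c zx rising_commute[of x z "m - l"] by (simp add: l_distr r_distr smult_mult_left smult_mult_right)
    have "(x \<oplus> z \<otimes> G \<oplus> of_nat m \<odot> \<one>) \<otimes> T m l =
       (G [^] l \<otimes> (x \<oplus> of_nat (m - l) \<odot> \<one>) \<oplus> G [^] Suc l \<otimes> (z \<oplus> of_nat l \<odot> \<one>)) \<otimes>
        (rising A x (m - l) \<otimes> rising A z l)"
      unfolding T_def eq[symmetric] using c by (simp add: m_assoc)
    also have "\<dots> = G [^] l \<otimes> (((x \<oplus> of_nat (m - l) \<odot> \<one>) \<otimes> rising A x (m - l)) \<otimes> rising A z l) \<oplus>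
        G [^] Suc l \<otimes> (((z \<oplus> of_nat l \<odot> \<one>) \<otimes> rising A x (m - l)) \<otimes> rising A z l)"
      using c by (simp add: l_distr[of "G [^] l \<otimes> (x \<oplus> of_nat (m - l) \<odot> \<one>)"] m_assoc del: nat_pow_Suc)
    also have "\<dots> = T (Suc m) l \<oplus> T (Suc m) (Suc l)"
    proof -
      have "(x \<oplus> of_nat (m - l) \<odot> \<one>) \<otimes> rising A x (m - l) = rising A x (Suc m - l)"
        using c that by (simp add: rising_Suc[symmetric] Suc_diff_le del: of_nat_diff)
      moreover have "(z \<oplus> of_nat l \<odot> \<one>) \<otimes> rising A z l = rising A z (Suc l)"
        using c by (simp add: rising_Suc)
      ultimately show ?thesis
        unfolding comm T_def using c by (simp add: m_assoc del: nat_pow_Suc of_nat_diff)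
    qed
    finally show ?thesis .
  qed
  have "rising A (x \<oplus> z \<otimes> G) (Suc m) =
      (x \<oplus> z \<otimes> G \<oplus> of_nat m \<odot> \<one>) \<otimes> (\<Oplus>l\<in>{..m}. of_nat (m choose l) \<odot> T m l)"
    using c Suc by (simp add: rising_Suc T_def)
  also have "\<dots> = (\<Oplus>l\<in>{..m}. (x \<oplus> z \<otimes> G \<oplus> of_nat m \<odot> \<one>) \<otimes> (of_nat (m choose l) \<odot> T m l))"
    using c T by (subst finsum_rdistr) auto
  also have "\<dots> = (\<Oplus>l\<in>{..m}. of_nat (m choose l) \<odot> (T (Suc m) l \<oplus> T (Suc m) (Suc l)))"
    using c T step by (intro finsum_cong') (auto simp: smult_mult_right)
  also have "\<dots> = (\<Oplus>l\<in>{..Suc m}. of_nat (Suc m choose l) \<odot> T (Suc m) l)"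
    by (rule finsum_pascal) (rule T)
  finally show ?case unfolding T_def .
qed

text \<open>In the Vandermonde identity of length \<open>p\<close> the inner binomial coefficients vanish, and so does the
  term without \<open>z\<close>, because \<open>x\<^sup>p - x = 0\<close>.\<close>

lemma skew_sum_power_CHAR:
  assumes p: "prime CHAR('k)" and c: "x \<in> carrier A" "G \<in> carrier A" "z \<in> carrier A"
    and rel: "x \<otimes> G \<oplus> G = G \<otimes> x \<oplus> G \<otimes> G" and zx: "z \<otimes> x = x \<otimes> z" and zG: "z \<otimes> G = G \<otimes> z"
    and xp: "x [^] CHAR('k) = x"
  shows "(x \<oplus> z \<otimes> G) [^] CHAR('k) \<ominus> (x \<oplus> z \<otimes> G) = G [^] CHAR('k) \<otimes> (z [^] CHAR('k) \<ominus> z)"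
proof -
  let ?p = "CHAR('k)"
  define T where "T = (\<lambda>l. G [^] l \<otimes> (rising A x (?p - l) \<otimes> rising A z l))"
  have T: "T l \<in> carrier A" for l using c by (simp add: T_def)
  have "(\<Oplus>l\<in>{..?p}. of_nat (?p choose l) \<odot> T l) = (\<Oplus>l\<in>{0, ?p}. of_nat (?p choose l) \<odot> T l)"
  proof (rule add.finprod_mono_neutral_cong_right)
    fix l assume "l \<in> {..?p} - {0, ?p}"
    then have "?p dvd ?p choose l" using p prime_gt_0_nat[OF p] by (intro dvd_choose_prime) auto
    then have "of_nat (?p choose l) = (0 :: 'k)" by (simp only: of_nat_eq_0_iff_char_dvd)
    then show "of_nat (?p choose l) \<odot> T l = \<zero>" using T by simp
  qed (use T in auto)
  also have "\<dots> = T 0 \<oplus> T ?p" using T prime_gt_0_nat[OF p] by (subst finsum_insert) auto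
  also have "T 0 = \<zero>" using c xp by (simp add: T_def rising_CHAR[OF p] r_neg a_minus_def)
  finally have "rising A (x \<oplus> z \<otimes> G) ?p = T ?p"
    unfolding rising_skew_sum[OF c rel zx zG] using T[of ?p] l_zero[OF T[of ?p]] by (simp add: T_def)
  then show ?thesis using c by (simp add: rising_CHAR[OF p] T_def)
qed

lemma eq_of_minus_eq_zero: "a \<ominus> b = \<zero> \<Longrightarrow> a \<in> carrier A \<Longrightarrow> b \<in> carrier A \<Longrightarrow> a = b"
  by (metis add.inv_closed add.inv_equality a_minus_def minus_minus)

text \<open>The element is \<open>c + (x + z G)\<close> with the scalar \<open>z = - c\<close>, and Frobenius is additive for the summand \<open>c\<close>.\<close>

lemma skew_shift_power_CHAR:
  assumes p: "prime CHAR('k)" and cr: "x \<in> carrier A" "G \<in> carrier A"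
    and rel: "x \<otimes> G \<oplus> G = G \<otimes> x \<oplus> G \<otimes> G" and xp: "x [^] CHAR('k) = x"
    and c: "(c ^ CHAR('k) - c) \<odot> (\<one> \<ominus> G [^] CHAR('k)) = \<zero>"
  shows "(x \<oplus> c \<odot> (\<one> \<ominus> G)) [^] CHAR('k) = x \<oplus> c \<odot> (\<one> \<ominus> G)"
proof -
  let ?p = "CHAR('k)"
  define X where "X = x \<oplus> ((- c) \<odot> \<one>) \<otimes> G"
  have X: "X \<in> carrier A" using cr by (simp add: X_def)
  have one: "(d \<odot> \<one>) [^] ?p = (d ^ ?p) \<odot> \<one>" for d
    using affine_power_CHAR[OF p one_closed, of d 0] prime_gt_0_nat[OF p] by (simp add: zero_power)
  have "X [^] ?p \<ominus> X = G [^] ?p \<otimes> (((- c) \<odot> \<one>) [^] ?p \<ominus> (- c) \<odot> \<one>)"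
    unfolding X_def by (rule skew_sum_power_CHAR[OF p]) (use cr rel xp in \<open>simp_all add: smult_mult_left smult_mult_right\<close>)
  also have "\<dots> = (- (c ^ ?p - c)) \<odot> (G [^] ?p)"
    unfolding one using cr
    by (simp add: minus_eq_smult smult_smult smult_add_left[symmetric] smult_mult_right minus_power_prime_CHAR[OF refl p])
  finally have 1: "X [^] ?p \<ominus> X = (- (c ^ ?p - c)) \<odot> (G [^] ?p)" .
  have Y: "x \<oplus> c \<odot> (\<one> \<ominus> G) = c \<odot> \<one> \<oplus> 1 \<odot> X"
    unfolding X_def using cr by (simp add: minus_eq_smult smult_add_right smult_smult smult_mult_left a_ac)
  have "(c \<odot> \<one> \<oplus> 1 \<odot> X) [^] ?p = (c ^ ?p) \<odot> \<one> \<oplus> X [^] ?p"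
    using affine_power_CHAR[OF p X, of c 1] X by simp
  also have "X [^] ?p = X \<oplus> (- (c ^ ?p - c)) \<odot> (G [^] ?p)"
    using 1 X cr by (metis a_minus_def add.inv_closed add.m_closed add.inv_solve_right nat_pow_closed smult_closed a_comm)
  also have "(c ^ ?p) \<odot> \<one> \<oplus> (X \<oplus> (- (c ^ ?p - c)) \<odot> (G [^] ?p)) =
      (c \<odot> \<one> \<oplus> X) \<oplus> (c ^ ?p - c) \<odot> (\<one> \<ominus> G [^] ?p)"
  proof -
    have "(c ^ ?p) \<odot> \<one> = c \<odot> \<one> \<oplus> (c ^ ?p - c) \<odot> \<one>" by (simp add: smult_add_left[symmetric])
    then show ?thesis
      using X cr by (simp add: minus_eq_smult smult_add_right smult_smult a_ac)
  qed
  finally show ?thesis unfolding Y c using X by simp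
qed

text \<open>The relation gives \<open>(W F + m) W\<^sup>m = W\<^sup>m W (F + m)\<close>, so that the factors \<open>W\<close> can be collected on the left.\<close>

lemma rising_twist:
  assumes c: "F \<in> carrier A" "W \<in> carrier A" and rel: "F \<otimes> W \<oplus> \<one> = W \<otimes> F \<oplus> W"
  shows "rising A (W \<otimes> F) m = W [^] m \<otimes> rising A F m"
proof (induction m)
  case (Suc m)
  have FW: "(W \<otimes> F \<oplus> of_nat m \<odot> \<one>) \<otimes> W [^] m = W [^] Suc m \<otimes> (F \<oplus> of_nat m \<odot> \<one>)" for m :: nat
  proof (induction m)
    case (Suc m)
    have "(W \<otimes> F \<oplus> of_nat (Suc m) \<odot> \<one>) \<otimes> W [^] Suc m =
        (W \<otimes> F \<oplus> of_nat m \<odot> \<one>) \<otimes> W [^] m \<otimes> W \<oplus> W [^] m \<otimes> W"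
      using c by (simp add: smult_add_left l_distr smult_mult_left m_assoc a_ac)
    also have "\<dots> = W [^] Suc m \<otimes> (F \<otimes> W \<oplus> \<one>) \<oplus> of_nat m \<odot> (W [^] Suc m \<otimes> W)"
      unfolding Suc using c by (simp add: l_distr r_distr smult_mult_left smult_mult_right m_assoc a_ac)
    also have "\<dots> = W [^] Suc (Suc m) \<otimes> (F \<oplus> of_nat (Suc m) \<odot> \<one>)"
      unfolding rel using c by (simp add: smult_add_left r_distr smult_mult_right m_assoc a_ac)
    finally show ?case .
  qed (use c in simp)
  have "rising A (W \<otimes> F) (Suc m) = ((W \<otimes> F \<oplus> of_nat m \<odot> \<one>) \<otimes> W [^] m) \<otimes> rising A F m"
    using c Suc by (simp add: rising_Suc m_assoc)
  also have "\<dots> = W [^] Suc m \<otimes> rising A F (Suc m)"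
    unfolding FW using c by (simp add: rising_Suc m_assoc)
  finally show ?case .
qed (use c in simp)

lemma twist_power_CHAR:
  assumes p: "prime CHAR('k)"
    and c: "F \<in> carrier A" "W \<in> carrier A" and rel: "F \<otimes> W \<oplus> \<one> = W \<otimes> F \<oplus> W"
  shows "(W \<otimes> F) [^] CHAR('k) \<ominus> W \<otimes> F = W [^] CHAR('k) \<otimes> (F [^] CHAR('k) \<ominus> F)"
  using rising_twist[OF c rel, of "CHAR('k)"] c by (simp add: rising_CHAR[OF p])

end

lemma alg_hom_poly_eval:
  assumes \<phi>: "alg_hom A B \<phi>" and A: "k_algebra A" and B: "k_algebra B" and a: "a \<in> carrier A"
  shows "\<phi> (poly_eval A a q) = poly_eval B (\<phi> a) q"
proof -
  interpret A: k_algebra A by fact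
  interpret B: k_algebra B by fact
  note h = alg_homD[OF \<phi>]
  show ?thesis
  proof (induction q)
    case (pCons c q)
    then show ?case
      using a by (simp add: h(2,3,4) linear_map_add[OF h(1)] linear_map_smult[OF h(1)])
  qed (simp add: linear_map_zero[OF h(1) A B])
qed

lemma alg_hom_rising:
  assumes "alg_hom A B \<phi>" "k_algebra A" "k_algebra B" "a \<in> carrier A"
  shows "\<phi> (rising A a m) = rising B (\<phi> a) m"
  unfolding rising_def by (rule alg_hom_poly_eval[OF assms])

lemma (in k_algebra) minus_self [simp]: "a \<in> carrier A \<Longrightarrow> a \<ominus> a = \<zero>"
  by (simp add: a_minus_def r_neg)

lemma linear_map_finsum_fun [lin]:
  assumes "k_algebra W" "k_algebra V" "\<And>i. i \<in> S \<Longrightarrow> linear_map V W (\<phi> i)"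
  shows "linear_map V W (\<lambda>x. \<Oplus>\<^bsub>W\<^esub>i\<in>S. \<phi> i x)"
proof -
  interpret W: k_algebra W by fact
  interpret V: k_algebra V by fact
  show ?thesis using assms(3)
  proof (induction S rule: infinite_finite_induct)
    case (insert i S)
    have "linear_map V W (\<lambda>x. \<phi> i x \<oplus>\<^bsub>W\<^esub> (\<Oplus>\<^bsub>W\<^esub>i\<in>S. \<phi> i x))"
      using insert by (intro linear_map_plus assms(1)) auto
    moreover have "(\<Oplus>\<^bsub>W\<^esub>i\<in>insert i S. \<phi> i x) = \<phi> i x \<oplus>\<^bsub>W\<^esub> (\<Oplus>\<^bsub>W\<^esub>i\<in>S. \<phi> i x)" if "x \<in> carrier V" for x
      using insert linear_map_closed[OF insert.prems that] by (intro W.finsum_insert) auto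
    ultimately show ?case by (simp add: linear_map_def Pi_def)
  qed (simp_all add: linear_map_const_zero assms(1))
qed

section \<open>Operators on function spaces\<close>

text \<open>The multiplication is reversed composition, so that the pullback of functions along a left
  multiplication is a homomorphism.\<close>

definition fun_op_alg :: "('k::field, ('v \<Rightarrow> 'k) \<Rightarrow> 'v \<Rightarrow> 'k) module" where
  "fun_op_alg = \<lparr>carrier = {T. (\<forall>\<phi> \<psi>. T (\<lambda>v. \<phi> v + \<psi> v) = (\<lambda>v. T \<phi> v + T \<psi> v)) \<and>
       (\<forall>c \<phi>. T (\<lambda>v. c * \<phi> v) = (\<lambda>v. c * T \<phi> v))},
     mult = (\<lambda>S T \<phi>. T (S \<phi>)), one = (\<lambda>\<phi>. \<phi>), zero = (\<lambda>_ _. 0),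
     add = (\<lambda>S T \<phi> v. S \<phi> v + T \<phi> v), smult = (\<lambda>c T \<phi> v. c * T \<phi> v)\<rparr>"

lemma fun_op_alg_simps [simp]:
  "mult fun_op_alg = (\<lambda>S T \<phi>. T (S \<phi>))" "one fun_op_alg = (\<lambda>\<phi>. \<phi>)" "zero fun_op_alg = (\<lambda>_ _. 0)"
  "add fun_op_alg = (\<lambda>S T \<phi> v. S \<phi> v + T \<phi> v)" "smult fun_op_alg = (\<lambda>c T \<phi> v. c * T \<phi> v)"
  by (simp_all add: fun_op_alg_def)

lemma fun_op_algI:
  assumes "\<And>\<phi> \<psi> v. T (\<lambda>v. \<phi> v + \<psi> v) v = T \<phi> v + T \<psi> v"
    and "\<And>c \<phi> v. T (\<lambda>v. c * \<phi> v) v = c * T \<phi> v"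
  shows "T \<in> carrier fun_op_alg"
  using assms by (auto simp: fun_op_alg_def fun_eq_iff)

lemma fun_op_algD:
  assumes "T \<in> carrier fun_op_alg"
  shows "T (\<lambda>v. \<phi> v + \<psi> v) = (\<lambda>v. T \<phi> v + T \<psi> v)" "T (\<lambda>v. c * \<phi> v) = (\<lambda>v. c * T \<phi> v)"
  using assms by (auto simp: fun_op_alg_def)

lemma k_algebra_fun_op_alg: "k_algebra (fun_op_alg :: ('k::field, ('v \<Rightarrow> 'k) \<Rightarrow> 'v \<Rightarrow> 'k) module)"
proof -
  let ?E = "fun_op_alg :: ('k::field, ('v \<Rightarrow> 'k) \<Rightarrow> 'v \<Rightarrow> 'k) module"
  have ag: "abelian_group ?E"
  proof (rule abelian_groupI)
    fix T assume "T \<in> carrier ?E"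
    then show "\<exists>S\<in>carrier ?E. S \<oplus>\<^bsub>?E\<^esub> T = \<zero>\<^bsub>?E\<^esub>"
      by (intro bexI[of _ "\<lambda>\<phi> v. - T \<phi> v"] fun_op_algI) (auto simp: fun_op_algD)
  qed (auto intro!: fun_op_algI simp: fun_op_algD algebra_simps)
  have R: "ring ?E"
    by (rule ringI[OF ag]; (rule Group.monoidI)?)
       (auto intro!: fun_op_algI simp: fun_op_algD)
  show ?thesis
    by (rule k_algebra.intro[OF R moduleI[OF cring_base_alg ag]])
       (auto intro!: fun_op_algI simp: fun_op_algD algebra_simps)
qed

lemma fun_op_minus:
  fixes S T :: "('v \<Rightarrow> 'k::field) \<Rightarrow> 'v \<Rightarrow> 'k"
  assumes "S \<in> carrier fun_op_alg" "T \<in> carrier fun_op_alg"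
  shows "S \<ominus>\<^bsub>fun_op_alg\<^esub> T = (\<lambda>\<phi> v. S \<phi> v - T \<phi> v)"
  using k_algebra.minus_eq_smult[OF k_algebra_fun_op_alg assms] by simp

section \<open>Algebras of the third type\<close>

definition third_val :: "('g \<Rightarrow> 'b) \<Rightarrow> 'b \<Rightarrow> 'g third_gen \<Rightarrow> 'b" where
  "third_val e x = (\<lambda>y. case y of Elt t \<Rightarrow> e t | Xgen \<Rightarrow> x)"

lemma third_val_simps [simp]: "third_val e x (Elt t) = e t" "third_val e x Xgen = x"
  by (simp_all add: third_val_def)

locale third_type = G: group G for G :: "('g, 'm) monoid_scheme" (structure) +
  fixes g :: 'g and f :: "'g \<Rightarrow> 'k::field"
  assumes datum: "third_type_datum G g f" and prime_CHAR: "prime CHAR('k)"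
begin

lemma p_pos: "CHAR('k) > 0"
  using prime_gt_0_nat[OF prime_CHAR] .

lemma finite_G: "finite (carrier G)"
  and g_closed [simp]: "g \<in> carrier G"
  and g_central: "t \<in> carrier G \<Longrightarrow> g \<otimes> t = t \<otimes> g"
  and f_mult: "s \<in> carrier G \<Longrightarrow> t \<in> carrier G \<Longrightarrow> f (s \<otimes> t) = f s + f t"
  and f_g [simp]: "f g = 1"
  using datum by (auto simp: third_type_datum_def hom_def)

lemma f_one [simp]: "f \<one> = 0"
proof -
  have "f \<one> + f \<one> = f \<one> + 0" using f_mult[of \<one> \<one>] by simp
  then show ?thesis by (rule add_left_imp_eq)
qed

lemma f_inv: "t \<in> carrier G \<Longrightarrow> f (inv t) = - f t"
  using f_mult[of t "inv t"] by (simp add: eq_neg_iff_add_eq_0 add.commute)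

lemma delta_pow: "t \<in> carrier G \<Longrightarrow>
    delta t [^]\<^bsub>monoid_algebra G :: ('k, _) module\<^esub> (n::nat) = delta (t [^] n)"
proof -
  interpret kG: k_algebra "monoid_algebra G :: ('k, _) module"
    by (rule k_algebra_monoid_algebra) (rule G.monoid_axioms)
  show "t \<in> carrier G \<Longrightarrow> ?thesis"
    by (induction n) (simp_all add: nat_pow_def monoid_algebra_mult_single)
qed

lemma f_condition: "t \<in> carrier G \<Longrightarrow> f t ^ CHAR('k) = f t \<or> g [^] CHAR('k) = \<one>"
proof -
  assume t: "t \<in> carrier G"
  interpret kG: k_algebra "monoid_algebra G :: ('k, _) module"
    by (rule k_algebra_monoid_algebra) (rule G.monoid_axioms)
  let ?kG = "monoid_algebra G :: ('k, _) module"
  have dc: "delta s \<in> carrier ?kG" if "s \<in> carrier G" for s using that by simp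
  have "(f t ^ CHAR('k) - f t) \<odot>\<^bsub>?kG\<^esub> (\<one>\<^bsub>?kG\<^esub> \<ominus>\<^bsub>?kG\<^esub> delta (g [^] CHAR('k))) = \<zero>\<^bsub>?kG\<^esub>"
    using datum t delta_pow[OF g_closed, of "CHAR('k)"] by (simp add: third_type_datum_def Let_def)
  then have "f t ^ CHAR('k) - f t = 0 \<or> \<one>\<^bsub>?kG\<^esub> \<ominus>\<^bsub>?kG\<^esub> delta (g [^] CHAR('k)) = \<zero>\<^bsub>?kG\<^esub>"
    using kG.smult_eq_zeroD[of "f t ^ CHAR('k) - f t"] kG.minus_closed[OF kG.one_closed dc[of "g [^] CHAR('k)"]] by auto
  moreover have "delta \<one> = (delta (g [^] CHAR('k)) :: _ \<Rightarrow>\<^sub>0 'k)" if "\<one>\<^bsub>?kG\<^esub> \<ominus>\<^bsub>?kG\<^esub> delta (g [^] CHAR('k)) = \<zero>\<^bsub>?kG\<^esub>"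
    using kG.eq_of_minus_eq_zero[OF that kG.one_closed dc[of "g [^] CHAR('k)"]] by simp
  ultimately show ?thesis
    by (metis eq_iff_diff_eq_0 lookup_single_eq lookup_single_not_eq zero_neq_one)
qed

lemma third_gens_simps [simp]: "Elt t \<in> third_gens G \<longleftrightarrow> t \<in> carrier G" "Xgen \<in> third_gens G"
  by (auto simp: third_gens_def)

lemma gens_rels: "third_rels G g f \<subseteq> carrier (free_algebra (third_gens G))"
proof -
  let ?F = "free_algebra (third_gens G) :: ('k, _) module"
  interpret F: k_algebra ?F by (rule k_algebra_free_algebra)
  have v: "var (Elt t) \<in> carrier ?F" if "t \<in> carrier G" for t
    using that by (simp add: free_algebra_simps third_gens_def)
  have x: "var Xgen \<in> carrier ?F"
    by (simp add: free_algebra_simps third_gens_def)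
  show ?thesis
    unfolding third_rels_def Let_def using v x by auto
qed

sublocale P: presentation "third_gens G" "third_rels G g f"
  by unfold_locales (rule gens_rels)

abbreviation "A \<equiv> third_alg G g f"
abbreviation "e t \<equiv> third_elt G g f (Elt t)"
abbreviation "x \<equiv> third_elt G g f Xgen"

lemma third_alg_P: "third_alg G g f = P.P"
  by (simp add: third_alg_def)

lemma gen_eq: "P.gen = third_elt G g f"
  by (rule ext) (simp add: P.gen_def third_elt_def)

lemma k_algebra_A [simp]: "k_algebra A"
  unfolding third_alg_P by (rule P.k_algebra_P)

sublocale A: k_algebra A
  by (rule k_algebra_A)

text \<open>What an algebra has to contain in order to receive a map from the algebra of third type.\<close>

definition third_rep :: "('k, 'b, 'n) module_scheme \<Rightarrow> ('g \<Rightarrow> 'b) \<Rightarrow> 'b \<Rightarrow> bool" where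
  "third_rep B E X \<longleftrightarrow> (\<forall>t\<in>carrier G. E t \<in> carrier B) \<and> X \<in> carrier B \<and> E \<one> = \<one>\<^bsub>B\<^esub> \<and>
     (\<forall>s\<in>carrier G. \<forall>t\<in>carrier G. E (s \<otimes> t) = E s \<otimes>\<^bsub>B\<^esub> E t) \<and>
     (\<forall>t\<in>carrier G. E t \<otimes>\<^bsub>B\<^esub> X = X \<otimes>\<^bsub>B\<^esub> E t \<oplus>\<^bsub>B\<^esub> f t \<odot>\<^bsub>B\<^esub> (E t \<otimes>\<^bsub>B\<^esub> (\<one>\<^bsub>B\<^esub> \<ominus>\<^bsub>B\<^esub> E g))) \<and>
     X [^]\<^bsub>B\<^esub> CHAR('k) = X"

lemma third_ext:
  assumes B: "k_algebra B" and rep: "third_rep B E X"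
  shows "alg_hom A B (presented_ext B (third_val E X))"
    and "t \<in> carrier G \<Longrightarrow> presented_ext B (third_val E X) (e t) = E t"
    and "presented_ext B (third_val E X) x = X"
proof -
  interpret B: k_algebra B by fact
  interpret F: k_algebra P.F by (rule k_algebra_free_algebra)
  let ?v = "third_val E X"
  have v: "?v ` third_gens G \<subseteq> carrier B"
    using rep by (auto simp: third_gens_def third_rep_def)
  note h = alg_homD[OF free_ext_alg_hom[OF B v]]
  have FA: "k_algebra P.F" by (rule k_algebra_free_algebra)
  note hm = linear_map_minus[OF h(1) FA B] and hs = linear_map_smult[OF h(1)]
    and hp = alg_hom_pow[OF free_ext_alg_hom[OF B v] FA B]
  have ve: "var (Elt t) \<in> carrier P.F" "free_ext B ?v (var (Elt t)) = E t" "E t \<in> carrier B"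
    if "t \<in> carrier G" for t
    using that P.var_closed[of "Elt t"] free_ext_var[of B ?v "Elt t"] rep B
    by (auto simp: third_gens_def third_rep_def)
  have vx: "var Xgen \<in> carrier P.F" "free_ext B ?v (var Xgen) = X" "X \<in> carrier B"
    using P.var_closed[of "Xgen"] free_ext_var[of B ?v "Xgen"] rep B
    by (auto simp: third_gens_def third_rep_def)
  have rels: "free_ext B ?v r = \<zero>\<^bsub>B\<^esub>" if "r \<in> third_rels G g f" for r
  proof -
    from that consider "r = var (Elt \<one>) \<ominus>\<^bsub>P.F\<^esub> \<one>\<^bsub>P.F\<^esub>"
      | s t where "s \<in> carrier G" "t \<in> carrier G" "r = var (Elt s) \<otimes>\<^bsub>P.F\<^esub> var (Elt t) \<ominus>\<^bsub>P.F\<^esub> var (Elt (s \<otimes> t))"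
      | t where "t \<in> carrier G" "r = (var (Elt t) \<otimes>\<^bsub>P.F\<^esub> var Xgen \<ominus>\<^bsub>P.F\<^esub> var Xgen \<otimes>\<^bsub>P.F\<^esub> var (Elt t)) \<ominus>\<^bsub>P.F\<^esub>
        f t \<odot>\<^bsub>P.F\<^esub> (var (Elt t) \<otimes>\<^bsub>P.F\<^esub> (\<one>\<^bsub>P.F\<^esub> \<ominus>\<^bsub>P.F\<^esub> var (Elt g)))"
      | "r = var Xgen [^]\<^bsub>P.F\<^esub> CHAR('k) \<ominus>\<^bsub>P.F\<^esub> var Xgen"
      unfolding third_rels_def Let_def by blast
    then show ?thesis
    proof cases
      case 1
      then show ?thesis using rep by (simp add: hm ve h(3) third_rep_def)
    next
      case 2
      then show ?thesis using rep ve by (simp add: hm h(2) third_rep_def)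
    next
      case 3
      have "E t \<otimes>\<^bsub>B\<^esub> X = X \<otimes>\<^bsub>B\<^esub> E t \<oplus>\<^bsub>B\<^esub> f t \<odot>\<^bsub>B\<^esub> (E t \<otimes>\<^bsub>B\<^esub> (\<one>\<^bsub>B\<^esub> \<ominus>\<^bsub>B\<^esub> E g))"
        using rep 3 by (simp add: third_rep_def)
      moreover have "(a \<oplus>\<^bsub>B\<^esub> b) \<ominus>\<^bsub>B\<^esub> a \<ominus>\<^bsub>B\<^esub> b = \<zero>\<^bsub>B\<^esub>" if "a \<in> carrier B" "b \<in> carrier B" for a b
        using that by (simp add: a_minus_def B.a_assoc B.minus_add[symmetric] B.r_neg)
          (metis B.a_assoc B.a_closed B.a_comm B.a_inv_closed B.l_neg B.r_neg2)
      ultimately show ?thesis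
        using 3 ve vx by (simp add: hm hs h(2,3))
    next
      case 4
      then show ?thesis using rep vx by (simp add: hm hp third_rep_def)
    qed
  qed
  note pe = P.presented_ext[OF B v rels]
  show "alg_hom A B (presented_ext B ?v)" unfolding third_alg_P by (rule pe(1))
  show "t \<in> carrier G \<Longrightarrow> presented_ext B ?v (e t) = E t"
    using pe(3)[of "Elt t"] by (simp add: gen_eq)
  show "presented_ext B ?v x = X"
    using pe(3)[of Xgen] by (simp add: gen_eq)
qed

lemma e_closed [simp]: "t \<in> carrier G \<Longrightarrow> e t \<in> carrier A"
  and x_closed [simp]: "x \<in> carrier A"
  using P.gen_closed[of "Elt t"] P.gen_closed[of Xgen]
  by (simp_all add: gen_eq third_alg_P)

lemma third_rep_generators: "third_rep A (\<lambda>t. e t) x"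
proof -
  have FA: "k_algebra P.F" by (rule k_algebra_free_algebra)
  interpret F: k_algebra P.F by (rule FA)
  let ?\<pi> = "\<lambda>a. rel_ideal (third_gens G) (third_rels G g f) +>\<^bsub>P.F\<^esub> a"
  note h = alg_homD[OF P.proj_hom, folded third_alg_P]
  note hm = linear_map_minus[OF h(1) FA k_algebra_A] and hs = linear_map_smult[OF h(1)]
    and hp = alg_hom_pow[OF P.proj_hom[folded third_alg_P] FA k_algebra_A]
  have ve: "var (Elt t) \<in> carrier P.F" "?\<pi> (var (Elt t)) = e t" if "t \<in> carrier G" for t
    using that P.var_closed[of "Elt t"] by (auto simp: third_gens_def third_elt_def)
  have vx: "var Xgen \<in> carrier P.F" "?\<pi> (var Xgen) = x"
    using P.var_closed[of "Xgen"] by (auto simp: third_gens_def third_elt_def)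
  have rel: "?\<pi> r = \<zero>\<^bsub>A\<^esub>" if "r \<in> third_rels G g f" for r
    using P.proj_rel[OF that] by (simp add: third_alg_P)
  have 1: "e \<one> = \<one>\<^bsub>A\<^esub>"
  proof -
    have "var (Elt \<one>) \<ominus>\<^bsub>P.F\<^esub> \<one>\<^bsub>P.F\<^esub> \<in> third_rels G g f" by (simp add: third_rels_def Let_def)
    from rel[OF this] show ?thesis
      by - (rule A.eq_of_minus_eq_zero, simp_all add: hm ve h(3))
  qed
  have 2: "e (s \<otimes> t) = e s \<otimes>\<^bsub>A\<^esub> e t" if "s \<in> carrier G" "t \<in> carrier G" for s t
  proof -
    have "var (Elt s) \<otimes>\<^bsub>P.F\<^esub> var (Elt t) \<ominus>\<^bsub>P.F\<^esub> var (Elt (s \<otimes> t)) \<in> third_rels G g f"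
      using that unfolding third_rels_def Let_def by blast
    from rel[OF this] that show ?thesis
      by - (rule A.eq_of_minus_eq_zero[symmetric], simp_all add: hm ve h(2))
  qed
  have 3: "e t \<otimes>\<^bsub>A\<^esub> x = x \<otimes>\<^bsub>A\<^esub> e t \<oplus>\<^bsub>A\<^esub> f t \<odot>\<^bsub>A\<^esub> (e t \<otimes>\<^bsub>A\<^esub> (\<one>\<^bsub>A\<^esub> \<ominus>\<^bsub>A\<^esub> e g))" if "t \<in> carrier G" for t
  proof -
    have "(var (Elt t) \<otimes>\<^bsub>P.F\<^esub> var Xgen \<ominus>\<^bsub>P.F\<^esub> var Xgen \<otimes>\<^bsub>P.F\<^esub> var (Elt t)) \<ominus>\<^bsub>P.F\<^esub>
        f t \<odot>\<^bsub>P.F\<^esub> (var (Elt t) \<otimes>\<^bsub>P.F\<^esub> (\<one>\<^bsub>P.F\<^esub> \<ominus>\<^bsub>P.F\<^esub> var (Elt g))) \<in> third_rels G g f"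
      using that unfolding third_rels_def Let_def by blast
    from rel[OF this] that
    have "(e t \<otimes>\<^bsub>A\<^esub> x \<ominus>\<^bsub>A\<^esub> x \<otimes>\<^bsub>A\<^esub> e t) \<ominus>\<^bsub>A\<^esub> f t \<odot>\<^bsub>A\<^esub> (e t \<otimes>\<^bsub>A\<^esub> (\<one>\<^bsub>A\<^esub> \<ominus>\<^bsub>A\<^esub> e g)) = \<zero>\<^bsub>A\<^esub>"
      using ve vx by (simp add: hm hs h(2,3))
    then have "e t \<otimes>\<^bsub>A\<^esub> x \<ominus>\<^bsub>A\<^esub> x \<otimes>\<^bsub>A\<^esub> e t = f t \<odot>\<^bsub>A\<^esub> (e t \<otimes>\<^bsub>A\<^esub> (\<one>\<^bsub>A\<^esub> \<ominus>\<^bsub>A\<^esub> e g))"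
      using that by - (rule A.eq_of_minus_eq_zero, simp_all)
    moreover have "b \<oplus>\<^bsub>A\<^esub> (a \<ominus>\<^bsub>A\<^esub> b) = a" if "a \<in> carrier A" "b \<in> carrier A" for a b
      using that by (simp add: a_minus_def A.a_lcomm A.r_neg)
    ultimately show ?thesis
      using that by (metis A.m_closed e_closed x_closed)
  qed
  have 4: "x [^]\<^bsub>A\<^esub> CHAR('k) = x"
  proof -
    have "var Xgen [^]\<^bsub>P.F\<^esub> CHAR('k) \<ominus>\<^bsub>P.F\<^esub> var Xgen \<in> third_rels G g f"
      unfolding third_rels_def Let_def by blast
    from rel[OF this] show ?thesis
      by - (rule A.eq_of_minus_eq_zero, simp_all add: hm hp vx)
  qed
  show ?thesis using 1 2 3 4 by (simp add: third_rep_def)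
qed

lemma e_one: "e \<one> = \<one>\<^bsub>A\<^esub>"
  and e_mult: "s \<in> carrier G \<Longrightarrow> t \<in> carrier G \<Longrightarrow> e (s \<otimes> t) = e s \<otimes>\<^bsub>A\<^esub> e t"
  and e_x: "t \<in> carrier G \<Longrightarrow> e t \<otimes>\<^bsub>A\<^esub> x = x \<otimes>\<^bsub>A\<^esub> e t \<oplus>\<^bsub>A\<^esub> f t \<odot>\<^bsub>A\<^esub> (e t \<otimes>\<^bsub>A\<^esub> (\<one>\<^bsub>A\<^esub> \<ominus>\<^bsub>A\<^esub> e g))"
  and x_pow: "x [^]\<^bsub>A\<^esub> CHAR('k) = x"
  using third_rep_generators by (simp_all add: third_rep_def)

lemma third_alg_hom_eqI:
  assumes "alg_hom A B \<phi>" "alg_hom A B \<psi>" "\<And>t. t \<in> carrier G \<Longrightarrow> \<phi> (e t) = \<psi> (e t)" "\<phi> x = \<psi> x"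
    "u \<in> carrier A"
  shows "\<phi> u = \<psi> u"
proof (rule P.alg_hom_eqI[where A = B])
  show "\<phi> (P.gen y) = \<psi> (P.gen y)" if "y \<in> third_gens G" for y
    using that assms(3,4) by (cases y) (simp_all add: gen_eq)
qed (use assms in \<open>simp_all add: third_alg_P\<close>)

lemma third_induct_left [consumes 1, case_names one elt gen add smult]:
  assumes "u \<in> carrier A"
    and "Q \<one>\<^bsub>A\<^esub>" "\<And>t u. t \<in> carrier G \<Longrightarrow> u \<in> carrier A \<Longrightarrow> Q u \<Longrightarrow> Q (e t \<otimes>\<^bsub>A\<^esub> u)"
    and "\<And>u. u \<in> carrier A \<Longrightarrow> Q u \<Longrightarrow> Q (x \<otimes>\<^bsub>A\<^esub> u)"
    and "\<And>u v. u \<in> carrier A \<Longrightarrow> v \<in> carrier A \<Longrightarrow> Q u \<Longrightarrow> Q v \<Longrightarrow> Q (u \<oplus>\<^bsub>A\<^esub> v)"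
    and "\<And>c u. u \<in> carrier A \<Longrightarrow> Q u \<Longrightarrow> Q (c \<odot>\<^bsub>A\<^esub> u)"
  shows "Q u"
  using assms(1)[unfolded third_alg_P]
proof (induction rule: P.presented_induct_left)
  case (gen y u)
  then show ?case using assms(3)[of _ u] assms(4)[of u] by (cases y) (simp_all add: gen_eq third_alg_P)
qed (use assms(2,5,6) in \<open>simp_all add: third_alg_P\<close>)

lemma third_induct_right [consumes 1, case_names one elt gen add smult]:
  assumes "u \<in> carrier A"
    and "Q \<one>\<^bsub>A\<^esub>" "\<And>t u. t \<in> carrier G \<Longrightarrow> u \<in> carrier A \<Longrightarrow> Q u \<Longrightarrow> Q (u \<otimes>\<^bsub>A\<^esub> e t)"
    and "\<And>u. u \<in> carrier A \<Longrightarrow> Q u \<Longrightarrow> Q (u \<otimes>\<^bsub>A\<^esub> x)"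
    and "\<And>u v. u \<in> carrier A \<Longrightarrow> v \<in> carrier A \<Longrightarrow> Q u \<Longrightarrow> Q v \<Longrightarrow> Q (u \<oplus>\<^bsub>A\<^esub> v)"
    and "\<And>c u. u \<in> carrier A \<Longrightarrow> Q u \<Longrightarrow> Q (c \<odot>\<^bsub>A\<^esub> u)"
  shows "Q u"
  using assms(1)[unfolded third_alg_P]
proof (induction rule: P.presented_induct_right)
  case (gen y u)
  then show ?case using assms(3)[of _ u] assms(4)[of u] by (cases y) (simp_all add: gen_eq third_alg_P)
qed (use assms(2,5,6) in \<open>simp_all add: third_alg_P\<close>)

subsection \<open>A basis\<close>

text \<open>The rising factorials take the place of the powers of \<open>x\<close>: the one of length \<open>p\<close> vanishes, and the
  comultiplication of the others is a sum of binomial type.\<close>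

definition bas :: "'g \<Rightarrow> nat \<Rightarrow> ('g third_gen list \<Rightarrow>\<^sub>0 'k) set" where
  "bas t m = e t \<otimes>\<^bsub>A\<^esub> rising A x m"

lemma bas_closed [simp]: "t \<in> carrier G \<Longrightarrow> bas t m \<in> carrier A"
  by (simp add: bas_def)

lemma bas_0: "t \<in> carrier G \<Longrightarrow> bas t 0 = e t"
  by (simp add: bas_def)

lemma rising_x_p: "rising A x CHAR('k) = \<zero>\<^bsub>A\<^esub>"
  by (simp add: A.rising_CHAR[OF prime_CHAR] x_pow A.r_neg a_minus_def)

lemma x_bas:
  assumes "t \<in> carrier G"
  shows "x \<otimes>\<^bsub>A\<^esub> bas t m = bas t (Suc m) \<oplus>\<^bsub>A\<^esub> (- (of_nat m + f t)) \<odot>\<^bsub>A\<^esub> bas t m \<oplus>\<^bsub>A\<^esub> f t \<odot>\<^bsub>A\<^esub> bas (t \<otimes> g) m"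
proof -
  let ?R = "rising A x"
  have "e t \<otimes>\<^bsub>A\<^esub> x = x \<otimes>\<^bsub>A\<^esub> e t \<oplus>\<^bsub>A\<^esub> (f t \<odot>\<^bsub>A\<^esub> e t \<oplus>\<^bsub>A\<^esub> (- f t) \<odot>\<^bsub>A\<^esub> e (t \<otimes> g))"
    unfolding e_x[OF assms] using assms
    by (simp add: A.minus_eq_smult A.r_distr A.smult_add_right A.smult_mult_right A.smult_smult e_mult)
  then have "x \<otimes>\<^bsub>A\<^esub> e t = e t \<otimes>\<^bsub>A\<^esub> x \<oplus>\<^bsub>A\<^esub> ((- f t) \<odot>\<^bsub>A\<^esub> e t \<oplus>\<^bsub>A\<^esub> f t \<odot>\<^bsub>A\<^esub> e (t \<otimes> g))"
    using assms by (simp add: A.a_assoc A.smult_minus_left)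
      (simp add: A.a_lcomm A.a_assoc A.r_neg A.l_neg A.r_neg1 A.r_neg2)
  then have "x \<otimes>\<^bsub>A\<^esub> bas t m = (e t \<otimes>\<^bsub>A\<^esub> x \<oplus>\<^bsub>A\<^esub> ((- f t) \<odot>\<^bsub>A\<^esub> e t \<oplus>\<^bsub>A\<^esub> f t \<odot>\<^bsub>A\<^esub> e (t \<otimes> g))) \<otimes>\<^bsub>A\<^esub> ?R m"
    using assms by (simp add: bas_def A.m_assoc[symmetric])
  also have "\<dots> = e t \<otimes>\<^bsub>A\<^esub> (x \<otimes>\<^bsub>A\<^esub> ?R m) \<oplus>\<^bsub>A\<^esub> ((- f t) \<odot>\<^bsub>A\<^esub> bas t m \<oplus>\<^bsub>A\<^esub> f t \<odot>\<^bsub>A\<^esub> bas (t \<otimes> g) m)"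
    using assms by (simp add: A.l_distr A.smult_mult_left A.m_assoc bas_def)
  also have "x \<otimes>\<^bsub>A\<^esub> ?R m = ?R (Suc m) \<oplus>\<^bsub>A\<^esub> (- of_nat m) \<odot>\<^bsub>A\<^esub> ?R m"
    by (simp add: A.rising_Suc A.l_distr A.smult_mult_left A.a_assoc A.smult_minus_left A.r_neg)
  also have "e t \<otimes>\<^bsub>A\<^esub> (?R (Suc m) \<oplus>\<^bsub>A\<^esub> (- of_nat m) \<odot>\<^bsub>A\<^esub> ?R m) = bas t (Suc m) \<oplus>\<^bsub>A\<^esub> (- of_nat m) \<odot>\<^bsub>A\<^esub> bas t m"
    using assms by (simp add: A.r_distr A.smult_mult_right bas_def)
  finally show ?thesis
    using assms A.smult_add_left[of "bas t m" "- of_nat m" "- f t"] by (simp add: A.a_assoc)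
qed

text \<open>By \<open>x_bas\<close> the span of these elements is stable under left multiplication by \<open>x\<close>, and it is clearly
  stable under left multiplication by group elements.\<close>

lemma bas_induct [consumes 1, case_names bas add smult]:
  assumes u: "u \<in> carrier A"
    and bas: "\<And>t m. t \<in> carrier G \<Longrightarrow> m < CHAR('k) \<Longrightarrow> Q (bas t m)"
    and add: "\<And>u v. u \<in> carrier A \<Longrightarrow> v \<in> carrier A \<Longrightarrow> Q u \<Longrightarrow> Q v \<Longrightarrow> Q (u \<oplus>\<^bsub>A\<^esub> v)"
    and smult: "\<And>c u. u \<in> carrier A \<Longrightarrow> Q u \<Longrightarrow> Q (c \<odot>\<^bsub>A\<^esub> u)"
  shows "Q u"
proof -
  define spans where "spans Z \<longleftrightarrow> Z \<subseteq> carrier A \<and> (\<forall>t\<in>carrier G. \<forall>m<CHAR('k). bas t m \<in> Z) \<and>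
    (\<forall>u\<in>Z. \<forall>v\<in>Z. u \<oplus>\<^bsub>A\<^esub> v \<in> Z) \<and> (\<forall>c. \<forall>u\<in>Z. c \<odot>\<^bsub>A\<^esub> u \<in> Z)" for Z
  define S where "S = \<Inter>(Collect spans)"
  have "spans (carrier A)" by (simp add: spans_def)
  then have S: "S \<subseteq> carrier A" unfolding S_def by (intro Inter_lower) simp
  have SI: "u \<in> S" if "\<And>Z. spans Z \<Longrightarrow> u \<in> Z" for u using that by (simp add: S_def)
  have SD: "u \<in> Z" if "u \<in> S" "spans Z" for u Z using that by (simp add: S_def)
  have Sb: "bas t m \<in> S" if "t \<in> carrier G" "m < CHAR('k)" for t m
    using that by (intro SI) (simp add: spans_def)
  have Sa: "u \<oplus>\<^bsub>A\<^esub> v \<in> S" if "u \<in> S" "v \<in> S" for u v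
    using SD[OF that(1)] SD[OF that(2)] by (intro SI) (simp add: spans_def)
  have Ss: "c \<odot>\<^bsub>A\<^esub> u \<in> S" if "u \<in> S" for c u
    using SD[OF that] by (intro SI) (simp add: spans_def)
  have least: "S \<subseteq> Z" if "Z \<subseteq> carrier A" "\<And>t m. t \<in> carrier G \<Longrightarrow> m < CHAR('k) \<Longrightarrow> bas t m \<in> Z"
    "\<And>u v. u \<in> Z \<Longrightarrow> v \<in> Z \<Longrightarrow> u \<oplus>\<^bsub>A\<^esub> v \<in> Z" "\<And>c u. u \<in> Z \<Longrightarrow> c \<odot>\<^bsub>A\<^esub> u \<in> Z" for Z
    using that unfolding S_def by (intro Inter_lower) (simp add: spans_def)
  have zero: "\<zero>\<^bsub>A\<^esub> \<in> S"
    using Ss[OF Sb[OF G.one_closed p_pos], of 0] by simp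
  have Se: "S \<subseteq> {u \<in> S. e s \<otimes>\<^bsub>A\<^esub> u \<in> S}" if s: "s \<in> carrier G" for s
  proof (rule least)
    fix t m assume "t \<in> carrier G" "m < CHAR('k)"
    then show "bas t m \<in> {u \<in> S. e s \<otimes>\<^bsub>A\<^esub> u \<in> S}"
      using Sb s by (simp add: bas_def A.m_assoc[symmetric] e_mult[symmetric])
  qed (use S s in \<open>simp_all add: A.r_distr A.smult_mult_right subset_iff Sa Ss\<close>)
  have Sx: "S \<subseteq> {u \<in> S. x \<otimes>\<^bsub>A\<^esub> u \<in> S}"
  proof (rule least)
    fix t m assume t: "t \<in> carrier G" and m: "m < CHAR('k)"
    have "bas t (Suc m) \<in> S"
    proof (cases "Suc m = CHAR('k)")
      case True
      then show ?thesis using zero t rising_x_p by (simp add: bas_def)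
    qed (use m Sb t in auto)
    then show "bas t m \<in> {u \<in> S. x \<otimes>\<^bsub>A\<^esub> u \<in> S}"
      using t m by (simp add: Sb x_bas Sa Ss)
  qed (use S in \<open>simp_all add: A.r_distr A.smult_mult_right subset_iff Sa Ss\<close>)
  from u have "u \<in> S"
  proof (induction rule: third_induct_left)
    case one
    then show ?case using Sb[OF G.one_closed p_pos] by (simp add: bas_0 e_one)
  qed (use Se Sx Sa Ss in auto)
  moreover have "S \<subseteq> {u \<in> carrier A. Q u}"
    by (rule least) (simp_all add: bas add smult)
  ultimately show ?thesis by blast
qed

subsection \<open>Coordinates\<close>

text \<open>For linear independence the algebra acts on functions on \<open>G\<close>, group elements by translation and
  \<open>x\<close> by an operator that has value \<open>\<mu> \<phi> \<one>\<close> at the unit, since \<open>f\<close> vanishes there. Here \<open>\<mu>\<close> is any scalar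
  of the prime field. Outside of the carrier group elements act as the identity, so that \<open>rep_elt \<one>\<close> is
  the identity operator.\<close>

definition rep_elt :: "'g \<Rightarrow> ('g \<Rightarrow> 'k) \<Rightarrow> 'g \<Rightarrow> 'k" where
  "rep_elt s \<phi> t = (if t \<in> carrier G then \<phi> (s \<otimes> t) else \<phi> t)"

definition rep_x :: "'k \<Rightarrow> ('g \<Rightarrow> 'k) \<Rightarrow> 'g \<Rightarrow> 'k" where
  "rep_x \<mu> \<phi> t = \<mu> * \<phi> t + (if t \<in> carrier G then f t * (\<phi> (g \<otimes> t) - \<phi> t) else 0)"

text \<open>With \<open>G\<close> the translation by \<open>g\<close> and \<open>F\<close> the multiplication by \<open>f\<close>, the operator of \<open>x\<close> is
  \<open>\<mu> - (1 - G) F\<close>. By \<open>twist_power_CHAR\<close>, taking the \<open>p\<close>-th power of \<open>(1 - G) F\<close> and subtracting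
  \<open>(1 - G) F\<close> gives \<open>(1 - G\<^sup>p) (F\<^sup>p - F)\<close>, which is zero by the condition on the datum.\<close>

lemma third_rep_fun_op:
  assumes "\<mu> ^ CHAR('k) = \<mu>"
  shows "third_rep fun_op_alg rep_elt (rep_x \<mu>)"
proof -
  let ?E = "fun_op_alg :: ('k, ('g \<Rightarrow> 'k) \<Rightarrow> 'g \<Rightarrow> 'k) module"
  interpret E: k_algebra ?E by (rule k_algebra_fun_op_alg)
  have re: "rep_elt s \<in> carrier ?E" for s
    by (rule fun_op_algI) (simp_all add: rep_elt_def)
  have rx: "rep_x \<mu> \<in> carrier ?E" for \<mu>
    by (rule fun_op_algI) (simp_all add: rep_x_def algebra_simps)
  have one: "rep_elt \<one> = \<one>\<^bsub>?E\<^esub>"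
    by (auto simp: rep_elt_def fun_eq_iff)
  have mult: "rep_elt (s \<otimes> t) = rep_elt s \<otimes>\<^bsub>?E\<^esub> rep_elt t" if "s \<in> carrier G" "t \<in> carrier G" for s t
    using that by (auto simp: rep_elt_def fun_eq_iff G.m_assoc)
  have gt: "g \<otimes> (t \<otimes> s) = t \<otimes> (g \<otimes> s)" if "t \<in> carrier G" "s \<in> carrier G" for t s
    using that g_central by (metis G.m_assoc g_closed)
  have rel: "rep_elt t \<otimes>\<^bsub>?E\<^esub> rep_x \<mu> = rep_x \<mu> \<otimes>\<^bsub>?E\<^esub> rep_elt t \<oplus>\<^bsub>?E\<^esub>
      f t \<odot>\<^bsub>?E\<^esub> (rep_elt t \<otimes>\<^bsub>?E\<^esub> (\<one>\<^bsub>?E\<^esub> \<ominus>\<^bsub>?E\<^esub> rep_elt g))" if t: "t \<in> carrier G" for t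
    unfolding fun_op_minus[OF E.one_closed re]
    using t by (auto simp: fun_eq_iff rep_elt_def rep_x_def f_mult gt algebra_simps)
  \<comment> \<open>Off the carrier, \<open>Gm\<close> and \<open>Fm\<close> vanish, so that the commutation rule below holds everywhere.\<close>
  define Gm where "Gm = (\<lambda>\<phi> t. if t \<in> carrier G then \<phi> (g \<otimes> t) else (0 :: 'k))"
  define Fm where "Fm = (\<lambda>\<phi> t. if t \<in> carrier G then f t * \<phi> t else 0)"
  define W where "W = 1 \<odot>\<^bsub>?E\<^esub> \<one>\<^bsub>?E\<^esub> \<oplus>\<^bsub>?E\<^esub> (- 1) \<odot>\<^bsub>?E\<^esub> Gm"
  have GF: "Gm \<in> carrier ?E" "Fm \<in> carrier ?E"
    by (intro fun_op_algI; simp add: Gm_def Fm_def algebra_simps)+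
  then have WF: "W \<in> carrier ?E"
    unfolding W_def by blast
  have G_pow: "(Gm [^]\<^bsub>?E\<^esub> n) \<phi> t = \<phi> (g [^] n \<otimes> t)" if "t \<in> carrier G" for n :: nat and \<phi> t
    using that
  proof (induction n arbitrary: \<phi> t)
    case (Suc n)
    have "(Gm [^]\<^bsub>?E\<^esub> Suc n) \<phi> t = \<phi> (g [^] n \<otimes> (g \<otimes> t))"
      using Suc.prems Suc.IH[of "g \<otimes> t"] by (simp add: Gm_def)
    then show ?case using Suc.prems by (simp add: G.m_assoc)
  qed simp
  have F_pow: "(Fm [^]\<^bsub>?E\<^esub> n) \<phi> t = f t ^ n * \<phi> t" if "t \<in> carrier G" for n :: nat and \<phi> t
    using that by (induction n arbitrary: \<phi>) (simp_all add: Fm_def)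
  have F_off: "(Fm [^]\<^bsub>?E\<^esub> n) \<phi> t = 0" if "t \<notin> carrier G" "n > 0" for n :: nat and \<phi> t
    using that by (cases n) (simp_all add: Fm_def)
  have tw: "Fm \<otimes>\<^bsub>?E\<^esub> W \<oplus>\<^bsub>?E\<^esub> \<one>\<^bsub>?E\<^esub> = W \<otimes>\<^bsub>?E\<^esub> Fm \<oplus>\<^bsub>?E\<^esub> W"
    by (auto simp: fun_eq_iff W_def Gm_def Fm_def f_mult algebra_simps)
  have Wp: "W [^]\<^bsub>?E\<^esub> CHAR('k) = \<one>\<^bsub>?E\<^esub> \<oplus>\<^bsub>?E\<^esub> (- 1) \<odot>\<^bsub>?E\<^esub> (Gm [^]\<^bsub>?E\<^esub> CHAR('k))"
    unfolding W_def E.affine_power_CHAR[OF prime_CHAR GF(1)]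
    using E.smult_one[OF E.one_closed] by (simp only: minus_power_prime_CHAR[OF refl prime_CHAR] power_one)
  have "(W \<otimes>\<^bsub>?E\<^esub> Fm) [^]\<^bsub>?E\<^esub> CHAR('k) \<ominus>\<^bsub>?E\<^esub> W \<otimes>\<^bsub>?E\<^esub> Fm = W [^]\<^bsub>?E\<^esub> CHAR('k) \<otimes>\<^bsub>?E\<^esub> (Fm [^]\<^bsub>?E\<^esub> CHAR('k) \<ominus>\<^bsub>?E\<^esub> Fm)"
    by (rule E.twist_power_CHAR[OF prime_CHAR GF(2) WF tw])
  also have "\<dots> = \<zero>\<^bsub>?E\<^esub>"
  proof -
    have "(f t ^ CHAR('k) - f t) * (\<phi> t - \<phi> (g [^] CHAR('k) \<otimes> t)) = 0" if "t \<in> carrier G" for t \<phi>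
      using f_condition[OF that] that by auto
    then show ?thesis
      unfolding fun_op_minus[OF E.nat_pow_closed[OF GF(2)] GF(2)] Wp
      using G_pow F_pow F_off[OF _ p_pos] by (auto simp: fun_eq_iff Fm_def algebra_simps)
  qed
  finally have WFp: "(W \<otimes>\<^bsub>?E\<^esub> Fm) [^]\<^bsub>?E\<^esub> CHAR('k) = W \<otimes>\<^bsub>?E\<^esub> Fm"
    by (rule E.eq_of_minus_eq_zero) (use WF GF in blast)+
  have rep_x: "rep_x \<mu> = \<mu> \<odot>\<^bsub>?E\<^esub> \<one>\<^bsub>?E\<^esub> \<oplus>\<^bsub>?E\<^esub> (- 1) \<odot>\<^bsub>?E\<^esub> (W \<otimes>\<^bsub>?E\<^esub> Fm)"
    by (auto simp: fun_eq_iff rep_x_def W_def Gm_def Fm_def algebra_simps)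
  have "rep_x \<mu> [^]\<^bsub>?E\<^esub> CHAR('k) = rep_x \<mu>"
    unfolding rep_x E.affine_power_CHAR[OF prime_CHAR E.m_closed[OF WF GF(2)]] WFp assms
    by (simp only: minus_power_prime_CHAR[OF refl prime_CHAR] power_one)
  then show ?thesis
    unfolding third_rep_def using re rx one mult rel by blast
qed

text \<open>The function \<open>\<lambda>s. of_bool (s = t)\<close> singles out the part of \<open>u\<close> at the group element \<open>t\<close>; evaluating at
  the unit replaces \<open>x\<close> by \<open>\<mu>\<close> in it.\<close>

definition eval_at :: "'k \<Rightarrow> 'g \<Rightarrow> ('g third_gen list \<Rightarrow>\<^sub>0 'k) set \<Rightarrow> 'k" where
  "eval_at \<mu> t u = presented_ext fun_op_alg (third_val rep_elt (rep_x \<mu>)) u (\<lambda>s. of_bool (s = t)) \<one>"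

lemma eval_at_linear:
  assumes "\<mu> ^ CHAR('k) = \<mu>"
  shows "linear_map A base_alg (eval_at \<mu> t)"
  using alg_homD(1)[OF third_ext(1)[OF k_algebra_fun_op_alg third_rep_fun_op[OF assms]]]
  unfolding linear_map_def eval_at_def by auto

lemma eval_at_bas:
  assumes \<mu>: "\<mu> ^ CHAR('k) = \<mu>" and s: "s \<in> carrier G"
  shows "eval_at \<mu> t (bas s m) = of_bool (s = t) * pochhammer \<mu> m"
proof -
  let ?E = "fun_op_alg :: ('k, ('g \<Rightarrow> 'k) \<Rightarrow> 'g \<Rightarrow> 'k) module"
  interpret E: k_algebra ?E by (rule k_algebra_fun_op_alg)
  note rep = third_rep_fun_op[OF \<mu>]
  note ext = third_ext[OF k_algebra_fun_op_alg rep]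
  have rx: "rep_x \<mu> \<in> carrier ?E" using rep by (simp add: third_rep_def)
  have rx1: "rep_x \<mu> \<phi> \<one> = \<mu> * \<phi> \<one>" for \<phi> by (simp add: rep_x_def)
  have pe: "poly_eval ?E (rep_x \<mu>) q \<phi> \<one> = poly q \<mu> * \<phi> \<one>" for q \<phi>
  proof (induction q arbitrary: \<phi>)
    case (pCons c q)
    then show ?case using rx by (simp add: rx1 algebra_simps)
  qed simp
  have poly: "poly (pochhammer [:0, 1:] m) \<mu> = pochhammer \<mu> m" for m
    by (induction m) (simp_all add: pochhammer_rec' of_nat_poly algebra_simps)
  have "presented_ext ?E (third_val rep_elt (rep_x \<mu>)) (bas s m) =
      rep_elt s \<otimes>\<^bsub>?E\<^esub> rising ?E (rep_x \<mu>) m"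
    unfolding bas_def using s
    by (simp only: alg_homD(2)[OF ext(1)] e_closed A.rising_closed x_closed ext(2,3)
        alg_hom_rising[OF ext(1) k_algebra_A k_algebra_fun_op_alg])
  then show ?thesis
    using s by (simp add: eval_at_def rising_def pe poly rep_elt_def)
qed

end

text \<open>Coordinates with respect to the rising factorials are obtained from values at
  \<open>0, -1, -2, \<dots>\<close> by iterated backward differences.\<close>

definition bdiff :: "(nat \<Rightarrow> 'k::field) \<Rightarrow> nat \<Rightarrow> 'k" where
  "bdiff q n = q n - q (Suc n)"

lemma bdiff_pow_cmult: "(bdiff ^^ m) (\<lambda>n. c * q n) = (\<lambda>n. c * (bdiff ^^ m) q n)"
  by (induction m) (auto simp: bdiff_def algebra_simps)

lemma bdiff_pow_add: "(bdiff ^^ m) (\<lambda>n. q n + r n) = (\<lambda>n. (bdiff ^^ m) q n + (bdiff ^^ m) r n)"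
  by (induction m) (auto simp: bdiff_def algebra_simps)

lemma bdiff_pochhammer:
  "bdiff (\<lambda>n. pochhammer (- of_nat n :: 'k::field) l) = (\<lambda>n. of_nat l * pochhammer (- of_nat n) (l - 1))"
proof (cases l)
  case 0
  then show ?thesis by (auto simp: bdiff_def)
next
  case (Suc k)
  have a: "pochhammer (- of_nat (Suc n) :: 'k) (Suc k) = - of_nat (Suc n) * pochhammer (- of_nat n) k" for n
    by (simp add: pochhammer_rec)
  have b: "pochhammer (- of_nat n :: 'k) (Suc k) = (- of_nat n + of_nat k) * pochhammer (- of_nat n) k" for n
    by (rule pochhammer_rec')
  show ?thesis
    unfolding Suc fun_eq_iff bdiff_def a unfolding b by (simp add: algebra_simps)
qed

lemma bdiff_pow_pochhammer:
  "(bdiff ^^ m) (\<lambda>n. pochhammer (- of_nat n :: 'k::field) l) 0 = (if l = m then of_nat (fact m) else 0)"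
proof (induction m arbitrary: l)
  case 0
  then show ?case by (simp add: pochhammer_0_left)
next
  case (Suc m)
  have "(bdiff ^^ Suc m) (\<lambda>n. pochhammer (- of_nat n :: 'k) l) 0 =
      of_nat l * (bdiff ^^ m) (\<lambda>n. pochhammer (- of_nat n) (l - 1)) 0"
    by (simp only: funpow_Suc_right o_apply bdiff_pochhammer bdiff_pow_cmult)
  then show ?case using Suc by (cases l) (auto simp: algebra_simps)
qed

context third_type
begin

definition coord :: "'g \<Rightarrow> nat \<Rightarrow> ('g third_gen list \<Rightarrow>\<^sub>0 'k) set \<Rightarrow> 'k" where
  "coord t m u = (bdiff ^^ m) (\<lambda>n. eval_at (- of_nat n) t u) 0 / of_nat (fact m)"

lemma neg_of_nat_pow: "(- of_nat n :: 'k) ^ CHAR('k) = - of_nat n"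
  by (simp add: minus_power_prime_CHAR[OF refl prime_CHAR] of_nat_power_CHAR[OF prime_CHAR])

lemma fact_nonzero: "m < CHAR('k) \<Longrightarrow> of_nat (fact m) \<noteq> (0 :: 'k)"
proof -
  assume "m < CHAR('k)"
  then have "\<not> CHAR('k) dvd fact m" using prime_CHAR by (simp add: prime_dvd_fact_iff)
  then show ?thesis using of_nat_eq_0_iff_char_dvd by blast
qed

lemma coord_linear [lin]: "linear_map A base_alg (coord t m)"
proof (rule linear_mapI)
  note lin = eval_at_linear[OF neg_of_nat_pow]
  fix u v c assume u: "u \<in> carrier A"
  show "coord t m u \<in> carrier base_alg" by simp
  show "coord t m (c \<odot>\<^bsub>A\<^esub> u) = c \<odot>\<^bsub>base_alg\<^esub> coord t m u"
    using linear_map_smult[OF lin u] by (simp add: coord_def bdiff_pow_cmult)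
  assume v: "v \<in> carrier A"
  show "coord t m (u \<oplus>\<^bsub>A\<^esub> v) = coord t m u \<oplus>\<^bsub>base_alg\<^esub> coord t m v"
    using linear_map_add[OF lin u v] by (simp add: coord_def bdiff_pow_add add_divide_distrib)
qed

lemma coord_bas:
  assumes "s \<in> carrier G" "m < CHAR('k)"
  shows "coord t m (bas s l) = of_bool (s = t \<and> l = m)"
  using fact_nonzero[OF assms(2)]
  by (simp add: coord_def eval_at_bas[OF neg_of_nat_pow assms(1)] bdiff_pow_cmult bdiff_pow_pochhammer)

definition bas_ext :: "('k, 'b, 'n) module_scheme \<Rightarrow> ('g \<Rightarrow> nat \<Rightarrow> 'b) \<Rightarrow> ('g third_gen list \<Rightarrow>\<^sub>0 'k) set \<Rightarrow> 'b" where
  "bas_ext V b u = (\<Oplus>\<^bsub>V\<^esub>t\<in>carrier G. \<Oplus>\<^bsub>V\<^esub>m\<in>{..<CHAR('k)}. coord t m u \<odot>\<^bsub>V\<^esub> b t m)"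

lemma bas_ext_linear:
  assumes "k_algebra V" "\<And>t m. t \<in> carrier G \<Longrightarrow> m < CHAR('k) \<Longrightarrow> b t m \<in> carrier V"
  shows "linear_map A V (bas_ext V b)"
  unfolding bas_ext_def by (intro lin assms k_algebra_A coord_linear) simp_all

lemma bas_ext_bas:
  assumes V: "k_algebra V" and b: "\<And>t m. t \<in> carrier G \<Longrightarrow> m < CHAR('k) \<Longrightarrow> b t m \<in> carrier V"
    and s: "s \<in> carrier G" and l: "l < CHAR('k)"
  shows "bas_ext V b (bas s l) = b s l"
proof -
  interpret V: k_algebra V by fact
  have bsl: "b s l \<in> carrier V" using s l by (rule b)
  have "(\<Oplus>\<^bsub>V\<^esub>m\<in>{..<CHAR('k)}. coord t m (bas s l) \<odot>\<^bsub>V\<^esub> b t m) = (if s = t then b s l else \<zero>\<^bsub>V\<^esub>)"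
    if t: "t \<in> carrier G" for t
  proof -
    have "(\<Oplus>\<^bsub>V\<^esub>m\<in>{..<CHAR('k)}. coord t m (bas s l) \<odot>\<^bsub>V\<^esub> b t m) =
        (\<Oplus>\<^bsub>V\<^esub>m\<in>{..<CHAR('k)}. if l = m then (if s = t then b s l else \<zero>\<^bsub>V\<^esub>) else \<zero>\<^bsub>V\<^esub>)"
      using t s bsl b by (intro V.finsum_cong') (auto simp: coord_bas)
    also have "\<dots> = (if s = t then b s l else \<zero>\<^bsub>V\<^esub>)"
      using V.finsum_singleton[of l "{..<CHAR('k)}" "\<lambda>_. b s l"] bsl l by (cases "s = t") simp_all
    finally show ?thesis .
  qed
  then have "bas_ext V b (bas s l) = (\<Oplus>\<^bsub>V\<^esub>t\<in>carrier G. if s = t then b s l else \<zero>\<^bsub>V\<^esub>)"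
    unfolding bas_ext_def using bsl by (intro V.finsum_cong') auto
  also have "\<dots> = b s l"
    using V.finsum_singleton[of s "carrier G" "\<lambda>_. b s l"] bsl s finite_G by simp
  finally show ?thesis .
qed

lemma bas_linear_eqI:
  assumes \<phi>: "linear_map A V \<phi>" and \<psi>: "linear_map A V \<psi>"
    and "\<And>t m. t \<in> carrier G \<Longrightarrow> m < CHAR('k) \<Longrightarrow> \<phi> (bas t m) = \<psi> (bas t m)" and "u \<in> carrier A"
  shows "\<phi> u = \<psi> u"
  using assms(4)
  by (induction rule: bas_induct)
     (simp_all add: assms(3) linear_map_add[OF \<phi>] linear_map_add[OF \<psi>] linear_map_smult[OF \<phi>] linear_map_smult[OF \<psi>])

lemma coord_expansion: "u \<in> carrier A \<Longrightarrow> bas_ext A bas u = u"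
  by (rule bas_linear_eqI[OF bas_ext_linear linear_map_id]) (simp_all add: bas_ext_bas)

lemma coord_eqI:
  assumes u: "u \<in> carrier A" and v: "v \<in> carrier A"
    and eq: "\<And>t m. t \<in> carrier G \<Longrightarrow> m < CHAR('k) \<Longrightarrow> coord t m u = coord t m v"
  shows "u = v"
proof -
  have "bas_ext A bas u = bas_ext A bas v"
    unfolding bas_ext_def using eq
    by (intro A.finsum_cong' refl funcsetI A.finsum_closed A.smult_closed bas_closed) simp_all
  then show ?thesis unfolding coord_expansion[OF u] coord_expansion[OF v] .
qed

end

section \<open>Hopf algebras\<close>

lemma base_alg_minus [simp]: "a \<ominus>\<^bsub>base_alg\<^esub> b = (a - b :: 'k::field)"
  using k_algebra.minus_eq_smult[OF k_algebra_base_alg, of a b] by simp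

lemma base_alg_pow [simp]: "a [^]\<^bsub>base_alg\<^esub> (n::nat) = (a ^ n :: 'k::field)"
  by (induction n) (simp_all add: nat_pow_def)

lemma op_alg_simps [simp]:
  "carrier (op_alg A) = carrier A" "one (op_alg A) = one A" "zero (op_alg A) = zero A"
  "add (op_alg A) = add A" "smult (op_alg A) = smult A" "mult (op_alg A) = (\<lambda>a b. mult A b a)"
  by (simp_all add: op_alg_def)

lemma k_algebra_op_alg: assumes "k_algebra A" shows "k_algebra (op_alg A)"
proof -
  interpret A: k_algebra A by fact
  have ag: "abelian_group (op_alg A)"
    by (rule abelian_groupI) (auto simp: A.a_ac intro: bexI[of _ "a_inv A x" for x] A.l_neg)
  have R: "ring (op_alg A)"
    by (rule ringI[OF ag]; (rule Group.monoidI)?) (simp_all add: A.m_assoc A.l_distr A.r_distr)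
  show ?thesis
    by (rule k_algebra.intro[OF R moduleI[OF cring_base_alg ag]])
       (simp_all add: A.smult_add_left A.smult_add_right A.smult_smult A.smult_mult_left A.smult_mult_right)
qed

lemma op_alg_minus:
  assumes "k_algebra A" "a \<in> carrier A" "b \<in> carrier A"
  shows "a \<ominus>\<^bsub>op_alg A\<^esub> b = a \<ominus>\<^bsub>A\<^esub> b"
  using assms k_algebra.minus_eq_smult[OF k_algebra_op_alg[OF assms(1)], of a b]
  by (simp add: k_algebra.minus_eq_smult)

lemma op_alg_pow:
  assumes "k_algebra A" "a \<in> carrier A"
  shows "a [^]\<^bsub>op_alg A\<^esub> (n::nat) = a [^]\<^bsub>A\<^esub> n"
proof -
  interpret A: k_algebra A by fact
  interpret O: k_algebra "op_alg A" by (rule k_algebra_op_alg) fact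
  show ?thesis using assms(2) by (induction n) (simp_all add: A.pow_commute_self)
qed

lemma tlift_target_cong:
  fixes \<beta> :: "'x \<Rightarrow> 'y \<Rightarrow> 'v" and V :: "('k::field, 'v, 'm) module_scheme"
    and V' :: "('k, 'v, 'm') module_scheme"
  assumes "carrier V' = carrier V" "add V' = add V" "zero V' = zero V" "smult V' = smult V"
  shows "tlift V' \<beta> = tlift V \<beta>"
proof -
  have "finsum V' f S = finsum V f S" for f and S :: "('x \<times> 'y) set"
    by (simp add: finsum_def finprod_def assms)
  then show ?thesis by (intro ext) (simp add: tlift_def assms)
qed

lemma linear_map_cong:
  assumes "carrier V' = carrier V" "add V' = add V" "smult V' = smult V"
    and "carrier W' = carrier W" "add W' = add W" "smult W' = smult W"
  shows "linear_map V' W' \<phi> \<longleftrightarrow> linear_map V W \<phi>"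
  by (simp add: linear_map_def assms)

lemma bilinear_map_cong:
  assumes "carrier U' = carrier U" "add U' = add U" "smult U' = smult U"
    and "carrier V' = carrier V" "add V' = add V" "smult V' = smult V"
    and "carrier W' = carrier W" "add W' = add W" "smult W' = smult W"
  shows "bilinear_map U' V' W' \<beta> \<longleftrightarrow> bilinear_map U V W \<beta>"
  by (simp add: bilinear_map_def assms linear_map_cong[OF assms(1-3,7-9)] linear_map_cong[OF assms(4-9)])

lemma alg_hom_cong:
  assumes "carrier V' = carrier V" "add V' = add V" "smult V' = smult V" "mult V' = mult V" "one V' = one V"
    and "carrier W' = carrier W" "add W' = add W" "smult W' = smult W" "mult W' = mult W" "one W' = one W"
  shows "alg_hom V' W' \<phi> \<longleftrightarrow> alg_hom V W \<phi>"
  by (simp add: alg_hom_def ring_hom_def linear_map_def assms)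

text \<open>A common form of the multiplicativity of maps out of tensor products.\<close>

lemma tlift_mult:
  assumes A: "k_algebra A" and B: "k_algebra B" and V: "k_algebra V"
    and b1: "bilinear_map A B V \<beta>1" and b2: "bilinear_map A B V \<beta>2" and b3: "bilinear_map A B V \<beta>3"
    and mult: "\<And>a b a' b'. a \<in> carrier A \<Longrightarrow> b \<in> carrier B \<Longrightarrow> a' \<in> carrier A \<Longrightarrow> b' \<in> carrier B \<Longrightarrow>
      \<beta>3 (a \<otimes>\<^bsub>A\<^esub> a') (b \<otimes>\<^bsub>B\<^esub> b') = \<beta>1 a b \<otimes>\<^bsub>V\<^esub> \<beta>2 a' b'"
    and x: "x \<in> carrier (tensor A B)" and y: "y \<in> carrier (tensor A B)"
  shows "tlift V \<beta>3 (x \<otimes>\<^bsub>tensor A B\<^esub> y) = tlift V \<beta>1 x \<otimes>\<^bsub>V\<^esub> tlift V \<beta>2 y"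
proof -
  interpret V: k_algebra V by fact
  interpret T: tensor_pair A B using A B by (rule tensor_pair.intro)
  interpret AB: k_algebra "tensor A B" by (rule T.k_algebra_tensor)
  note cl = tlift_closed[OF A B V] and ad = tlift_add[OF A B V]
  from x show ?thesis
  proof (induction rule: T.tensor_induct)
    case (pure a b)
    from y show ?case
    proof (induction rule: T.tensor_induct)
      case (pure a' b')
      then show ?case using \<open>a \<in> carrier A\<close> \<open>b \<in> carrier B\<close>
        by (simp add: T.pure_mult tlift_pure[OF A B V b1] tlift_pure[OF A B V b2] tlift_pure[OF A B V b3] mult)
    next
      case (add y z)
      then show ?case using T.pure_closed[OF pure]
        by (simp add: AB.r_distr ad[OF b2] ad[OF b3] V.r_distr cl[OF b1] cl[OF b2])
    qed
  next
    case (add x z)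
    then show ?case using y by (simp add: AB.l_distr ad[OF b1] ad[OF b3] V.l_distr cl[OF b1] cl[OF b2])
  qed
qed

lemma pure_alg_hom:
  assumes A: "k_algebra A" and B: "k_algebra B"
  shows "alg_hom A (tensor A B) (\<lambda>a. pure A B a \<one>\<^bsub>B\<^esub>)" "alg_hom B (tensor A B) (\<lambda>b. pure A B \<one>\<^bsub>A\<^esub> b)"
proof -
  interpret T: tensor_pair A B using A B by (rule tensor_pair.intro)
  show "alg_hom A (tensor A B) (\<lambda>a. pure A B a \<one>\<^bsub>B\<^esub>)" "alg_hom B (tensor A B) (\<lambda>b. pure A B \<one>\<^bsub>A\<^esub> b)"
    by (auto intro!: alg_homI T.pure_linear_left T.pure_linear_right simp: T.pure_mult T.tensor_one)
qed

lemma (in k_algebra) cancel_middle: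
  assumes "a \<in> carrier A" "b \<in> carrier A" "u \<in> carrier A" "v \<in> carrier A" "w \<in> carrier A"
  shows "(a \<oplus> (u \<oplus> (- c) \<odot> v)) \<oplus> (b \<oplus> (c \<odot> v \<oplus> w)) = (a \<oplus> b) \<oplus> (u \<oplus> w)"
proof -
  have "(a \<oplus> (u \<oplus> (- c) \<odot> v)) \<oplus> (b \<oplus> (c \<odot> v \<oplus> w)) = (a \<oplus> b) \<oplus> (u \<oplus> w) \<oplus> ((- c) \<odot> v \<oplus> c \<odot> v)"
    using assms by (simp add: a_ac)
  then show ?thesis using assms by (simp add: smult_add_left[symmetric])
qed

lemma (in k_algebra) move_difference:
  assumes "a = b \<oplus> ((- c) \<odot> u \<oplus> c \<odot> v)" "b \<in> carrier A" "u \<in> carrier A" "v \<in> carrier A"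
  shows "b = a \<oplus> (c \<odot> u \<oplus> (- c) \<odot> v)"
proof -
  have "a \<oplus> (c \<odot> u \<oplus> (- c) \<odot> v) = b \<oplus> (((- c) \<odot> u \<oplus> c \<odot> u) \<oplus> (c \<odot> v \<oplus> (- c) \<odot> v))"
    unfolding assms(1) using assms(2-) by (simp add: a_ac)
  then show ?thesis
    using assms(2-) by (simp add: smult_add_left[symmetric])
qed

subsection \<open>Hopf algebras of the third type\<close>

context third_type
begin

abbreviation "T \<equiv> tensor A A"
abbreviation "H \<equiv> third_hopf G g f"

lemma third_hopf_simps [simp]:
  "carrier H = carrier A" "mult H = mult A" "one H = one A" "zero H = zero A" "add H = add A"
  "smult H = smult A"
  by (simp_all add: third_hopf_def Let_def module.defs)

lemma k_algebra_H [simp]: "k_algebra H"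
  by (rule k_algebra_cong[OF k_algebra_A]) simp_all

lemma tensor_H: "tensor H H = tensor A A" "tensor H T = tensor A T" "pure H H = pure A A" "pure H T = pure A T"
  by (rule tensor_cong tensor_cong_linear(2); simp)+

lemma tlift_H: "tlift H \<beta> = tlift A \<beta>"
  by (rule tlift_target_cong) simp_all

sublocale T: tensor_pair A A
  by (rule tensor_pair.intro) simp_all

lemma k_algebra_T [simp]: "k_algebra T"
  by simp

lemma g_x: "x \<otimes>\<^bsub>A\<^esub> e g \<oplus>\<^bsub>A\<^esub> e g = e g \<otimes>\<^bsub>A\<^esub> x \<oplus>\<^bsub>A\<^esub> e g \<otimes>\<^bsub>A\<^esub> e g"
proof -
  have "e g \<otimes>\<^bsub>A\<^esub> x \<oplus>\<^bsub>A\<^esub> e g \<otimes>\<^bsub>A\<^esub> e g =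
      x \<otimes>\<^bsub>A\<^esub> e g \<oplus>\<^bsub>A\<^esub> (e g \<oplus>\<^bsub>A\<^esub> (- 1) \<odot>\<^bsub>A\<^esub> (e g \<otimes>\<^bsub>A\<^esub> e g)) \<oplus>\<^bsub>A\<^esub> e g \<otimes>\<^bsub>A\<^esub> e g"
    unfolding e_x[OF g_closed] by (simp add: A.minus_eq_smult A.r_distr A.smult_mult_right)
  then show ?thesis by (simp add: A.smult_minus_one A.a_assoc A.l_neg)
qed

lemma comult_rep:
  "third_rep T (\<lambda>t. pure A A (e t) (e t)) (pure A A x \<one>\<^bsub>A\<^esub> \<oplus>\<^bsub>T\<^esub> pure A A (e g) x)"
proof -
  interpret TA: k_algebra T by simp
  note hl = pure_alg_hom(1)[OF k_algebra_A k_algebra_A] and hr = pure_alg_hom(2)[OF k_algebra_A k_algebra_A]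
  let ?p = "pure A A"
  let ?X = "?p x \<one>\<^bsub>A\<^esub>" and ?G = "?p (e g) \<one>\<^bsub>A\<^esub>" and ?Z = "?p \<one>\<^bsub>A\<^esub> x"
  have c: "?X \<in> carrier T" "?G \<in> carrier T" "?Z \<in> carrier T" by simp_all
  have ZG: "?Z \<otimes>\<^bsub>T\<^esub> ?G = ?p (e g) x" by (simp add: T.pure_mult)
  have pw: "?X [^]\<^bsub>T\<^esub> CHAR('k) = ?X" "?Z [^]\<^bsub>T\<^esub> CHAR('k) = ?Z"
    using alg_hom_pow[OF hl k_algebra_A k_algebra_T x_closed, of "CHAR('k)"]
      alg_hom_pow[OF hr k_algebra_A k_algebra_T x_closed, of "CHAR('k)"]
    by (simp_all add: x_pow)
  have "?X \<otimes>\<^bsub>T\<^esub> ?G \<oplus>\<^bsub>T\<^esub> ?G = ?G \<otimes>\<^bsub>T\<^esub> ?X \<oplus>\<^bsub>T\<^esub> ?G \<otimes>\<^bsub>T\<^esub> ?G"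
    using arg_cong[OF g_x, of "\<lambda>a. ?p a \<one>\<^bsub>A\<^esub>"]
    by (simp add: T.pure_mult linear_map_add[OF T.pure_linear_left])
  then have "(?X \<oplus>\<^bsub>T\<^esub> ?Z \<otimes>\<^bsub>T\<^esub> ?G) [^]\<^bsub>T\<^esub> CHAR('k) \<ominus>\<^bsub>T\<^esub> (?X \<oplus>\<^bsub>T\<^esub> ?Z \<otimes>\<^bsub>T\<^esub> ?G) = ?G [^]\<^bsub>T\<^esub> CHAR('k) \<otimes>\<^bsub>T\<^esub> (?Z [^]\<^bsub>T\<^esub> CHAR('k) \<ominus>\<^bsub>T\<^esub> ?Z)"
    by (rule TA.skew_sum_power_CHAR[OF prime_CHAR c]) (simp_all add: T.pure_mult pw)
  also have "\<dots> = \<zero>\<^bsub>T\<^esub>" using c by (simp add: pw)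
  finally have "(?X \<oplus>\<^bsub>T\<^esub> ?Z \<otimes>\<^bsub>T\<^esub> ?G) [^]\<^bsub>T\<^esub> CHAR('k) = ?X \<oplus>\<^bsub>T\<^esub> ?Z \<otimes>\<^bsub>T\<^esub> ?G"
    by (rule TA.eq_of_minus_eq_zero) (use c in simp_all)
  moreover have "?p (e t) (e t) \<otimes>\<^bsub>T\<^esub> (?X \<oplus>\<^bsub>T\<^esub> ?p (e g) x) = (?X \<oplus>\<^bsub>T\<^esub> ?p (e g) x) \<otimes>\<^bsub>T\<^esub> ?p (e t) (e t) \<oplus>\<^bsub>T\<^esub>
      f t \<odot>\<^bsub>T\<^esub> (?p (e t) (e t) \<otimes>\<^bsub>T\<^esub> (\<one>\<^bsub>T\<^esub> \<ominus>\<^bsub>T\<^esub> ?p (e g) (e g)))" if t: "t \<in> carrier G" for t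
  proof -
    have tx: "e t \<otimes>\<^bsub>A\<^esub> x = x \<otimes>\<^bsub>A\<^esub> e t \<oplus>\<^bsub>A\<^esub> (f t \<odot>\<^bsub>A\<^esub> e t \<oplus>\<^bsub>A\<^esub> (- f t) \<odot>\<^bsub>A\<^esub> e (t \<otimes> g))"
      unfolding e_x[OF t] using t
      by (simp add: A.minus_eq_smult A.r_distr A.smult_add_right A.smult_mult_right A.smult_smult e_mult)
    have tg: "e g \<otimes>\<^bsub>A\<^esub> e t = e (t \<otimes> g)" "e t \<otimes>\<^bsub>A\<^esub> e g = e (t \<otimes> g)" using t by (simp_all add: e_mult[symmetric] g_central)
    note pl = linear_map_add[OF T.pure_linear_left] linear_map_smult[OF T.pure_linear_left]
      linear_map_add[OF T.pure_linear_right] linear_map_smult[OF T.pure_linear_right]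
    let ?c = "f t" and ?tg = "e (t \<otimes> g)" and ?xt = "x \<otimes>\<^bsub>A\<^esub> e t"
    have "?p (e t) (e t) \<otimes>\<^bsub>T\<^esub> (?X \<oplus>\<^bsub>T\<^esub> ?p (e g) x) = ?p (e t \<otimes>\<^bsub>A\<^esub> x) (e t) \<oplus>\<^bsub>T\<^esub> ?p ?tg (e t \<otimes>\<^bsub>A\<^esub> x)"
      using t by (simp add: TA.r_distr T.pure_mult tg)
    also have "\<dots> = (?p ?xt (e t) \<oplus>\<^bsub>T\<^esub> (?c \<odot>\<^bsub>T\<^esub> ?p (e t) (e t) \<oplus>\<^bsub>T\<^esub> (- ?c) \<odot>\<^bsub>T\<^esub> ?p ?tg (e t))) \<oplus>\<^bsub>T\<^esub>
        (?p ?tg ?xt \<oplus>\<^bsub>T\<^esub> (?c \<odot>\<^bsub>T\<^esub> ?p ?tg (e t) \<oplus>\<^bsub>T\<^esub> (- ?c) \<odot>\<^bsub>T\<^esub> ?p ?tg ?tg))"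
      unfolding tx using t by (simp add: pl)
    also have "\<dots> = (?p ?xt (e t) \<oplus>\<^bsub>T\<^esub> ?p ?tg ?xt) \<oplus>\<^bsub>T\<^esub> (?c \<odot>\<^bsub>T\<^esub> ?p (e t) (e t) \<oplus>\<^bsub>T\<^esub> (- ?c) \<odot>\<^bsub>T\<^esub> ?p ?tg ?tg)"
      by (rule TA.cancel_middle) (use t in simp_all)
    also have "\<dots> = (?X \<oplus>\<^bsub>T\<^esub> ?p (e g) x) \<otimes>\<^bsub>T\<^esub> ?p (e t) (e t) \<oplus>\<^bsub>T\<^esub>
        f t \<odot>\<^bsub>T\<^esub> (?p (e t) (e t) \<otimes>\<^bsub>T\<^esub> (\<one>\<^bsub>T\<^esub> \<ominus>\<^bsub>T\<^esub> ?p (e g) (e g)))"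
      using t by (simp add: TA.l_distr TA.r_distr T.tensor_one T.pure_mult tg TA.minus_eq_smult TA.smult_add_right TA.smult_smult TA.smult_mult_right)
    finally show ?thesis .
  qed
  ultimately show ?thesis
    unfolding third_rep_def ZG T.tensor_one
    by (simp add: T.pure_mult e_mult e_one)
qed

lemma counit_rep: "third_rep base_alg (\<lambda>_. 1) 0"
  using p_pos by (simp add: third_rep_def power_0_left)

lemma inv_e: "t \<in> carrier G \<Longrightarrow> e (inv t) \<otimes>\<^bsub>A\<^esub> e t = \<one>\<^bsub>A\<^esub>" "t \<in> carrier G \<Longrightarrow> e t \<otimes>\<^bsub>A\<^esub> e (inv t) = \<one>\<^bsub>A\<^esub>"
  by (simp_all add: e_mult[symmetric] e_one)

lemma x_inv:
  assumes t: "t \<in> carrier G"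
  shows "x \<otimes>\<^bsub>A\<^esub> e (inv t) = e (inv t) \<otimes>\<^bsub>A\<^esub> x \<oplus>\<^bsub>A\<^esub> (f t \<odot>\<^bsub>A\<^esub> e (inv t) \<oplus>\<^bsub>A\<^esub> (- f t) \<odot>\<^bsub>A\<^esub> e (inv t \<otimes> g))"
proof -
  have "e (inv t) \<otimes>\<^bsub>A\<^esub> x = x \<otimes>\<^bsub>A\<^esub> e (inv t) \<oplus>\<^bsub>A\<^esub> ((- f t) \<odot>\<^bsub>A\<^esub> e (inv t) \<oplus>\<^bsub>A\<^esub> f t \<odot>\<^bsub>A\<^esub> e (inv t \<otimes> g))"
    unfolding e_x[OF G.inv_closed[OF t]] using t
    by (simp add: f_inv A.minus_eq_smult A.r_distr A.smult_add_right A.smult_mult_right A.smult_smult e_mult)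
  then show ?thesis
    by (rule A.move_difference) (use t in simp_all)
qed

lemma antipode_rep:
  "third_rep (op_alg A) (\<lambda>t. e (inv t)) (\<ominus>\<^bsub>A\<^esub> (e (inv g) \<otimes>\<^bsub>A\<^esub> x))"
proof -
  have igg: "inv g \<otimes> g = \<one>" "e (inv g \<otimes> g) = \<one>\<^bsub>A\<^esub>" by (simp_all add: e_one)
  let ?y = "e (inv g) \<otimes>\<^bsub>A\<^esub> x"
  have "x \<otimes>\<^bsub>A\<^esub> e (inv g) \<oplus>\<^bsub>A\<^esub> \<one>\<^bsub>A\<^esub> = e (inv g) \<otimes>\<^bsub>A\<^esub> x \<oplus>\<^bsub>A\<^esub> e (inv g)"
    unfolding x_inv[OF g_closed] igg by (simp add: A.a_assoc A.smult_minus_one A.l_neg e_one)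
  then have "?y [^]\<^bsub>A\<^esub> CHAR('k) \<ominus>\<^bsub>A\<^esub> ?y = e (inv g) [^]\<^bsub>A\<^esub> CHAR('k) \<otimes>\<^bsub>A\<^esub> (x [^]\<^bsub>A\<^esub> CHAR('k) \<ominus>\<^bsub>A\<^esub> x)"
    by (intro A.twist_power_CHAR[OF prime_CHAR]) simp_all
  also have "\<dots> = \<zero>\<^bsub>A\<^esub>" by (simp add: x_pow)
  finally have y: "?y [^]\<^bsub>A\<^esub> CHAR('k) = ?y" by (rule A.eq_of_minus_eq_zero) simp_all
  have "(0 \<odot>\<^bsub>A\<^esub> \<one>\<^bsub>A\<^esub> \<oplus>\<^bsub>A\<^esub> (- 1) \<odot>\<^bsub>A\<^esub> ?y) [^]\<^bsub>A\<^esub> CHAR('k) =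
      (0 ^ CHAR('k)) \<odot>\<^bsub>A\<^esub> \<one>\<^bsub>A\<^esub> \<oplus>\<^bsub>A\<^esub> ((- 1) ^ CHAR('k)) \<odot>\<^bsub>A\<^esub> (?y [^]\<^bsub>A\<^esub> CHAR('k))"
    by (rule A.affine_power_CHAR[OF prime_CHAR]) simp
  then have pw: "(\<ominus>\<^bsub>A\<^esub> ?y) [^]\<^bsub>A\<^esub> CHAR('k) = \<ominus>\<^bsub>A\<^esub> ?y"
    unfolding y using p_pos
    by (simp add: A.smult_minus_one power_0_left minus_power_prime_CHAR[OF refl prime_CHAR])
  have rel: "(\<ominus>\<^bsub>A\<^esub> ?y) \<otimes>\<^bsub>A\<^esub> e (inv t) = e (inv t) \<otimes>\<^bsub>A\<^esub> (\<ominus>\<^bsub>A\<^esub> ?y) \<oplus>\<^bsub>A\<^esub>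
      f t \<odot>\<^bsub>A\<^esub> ((\<one>\<^bsub>A\<^esub> \<ominus>\<^bsub>A\<^esub> e (inv g)) \<otimes>\<^bsub>A\<^esub> e (inv t))" if t: "t \<in> carrier G" for t
  proof -
    have gt: "inv g \<otimes> inv t = inv t \<otimes> inv g"
      using t g_central by (metis G.inv_mult_group g_closed)
    have gtg: "inv g \<otimes> (inv t \<otimes> g) = inv t"
    proof -
      have "inv t \<otimes> g = g \<otimes> inv t" using t g_central[of "inv t"] by simp
      then show ?thesis using t by (simp add: G.m_assoc[symmetric])
    qed
    have ee: "e (inv g) \<otimes>\<^bsub>A\<^esub> e (inv t) = e (inv t) \<otimes>\<^bsub>A\<^esub> e (inv g)"
      "e (inv g) \<otimes>\<^bsub>A\<^esub> e (inv t \<otimes> g) = e (inv t)"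
      using t by (simp_all add: e_mult[symmetric] gt gtg del: e_mult)
    have "?y \<otimes>\<^bsub>A\<^esub> e (inv t) = e (inv g) \<otimes>\<^bsub>A\<^esub> (x \<otimes>\<^bsub>A\<^esub> e (inv t))" using t by (simp add: A.m_assoc)
    also have "\<dots> = (e (inv g) \<otimes>\<^bsub>A\<^esub> e (inv t)) \<otimes>\<^bsub>A\<^esub> x \<oplus>\<^bsub>A\<^esub> (f t \<odot>\<^bsub>A\<^esub> (e (inv g) \<otimes>\<^bsub>A\<^esub> e (inv t)) \<oplus>\<^bsub>A\<^esub> (- f t) \<odot>\<^bsub>A\<^esub> (e (inv g) \<otimes>\<^bsub>A\<^esub> e (inv t \<otimes> g)))"
      unfolding x_inv[OF t] using t by (simp add: A.r_distr A.smult_mult_right A.m_assoc)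
    finally have "?y \<otimes>\<^bsub>A\<^esub> e (inv t) = e (inv t) \<otimes>\<^bsub>A\<^esub> ?y \<oplus>\<^bsub>A\<^esub> (f t \<odot>\<^bsub>A\<^esub> (e (inv t) \<otimes>\<^bsub>A\<^esub> e (inv g)) \<oplus>\<^bsub>A\<^esub> (- f t) \<odot>\<^bsub>A\<^esub> e (inv t))"
      unfolding ee using t by (simp add: A.m_assoc)
    then show ?thesis
      using t by (simp add: A.l_minus A.r_minus A.minus_eq_smult A.l_distr A.smult_mult_left ee(1) A.minus_add
        A.smult_add_right A.smult_smult A.smult_minus_left A.smult_minus_right A.a_ac)
  qed
  show ?thesis
    unfolding third_rep_def op_alg_pow[OF k_algebra_A A.a_inv_closed[OF A.m_closed[OF e_closed[OF G.inv_closed[OF g_closed]] x_closed]]]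
    using pw rel by (simp add: e_one e_mult[symmetric] G.inv_mult_group op_alg_minus[OF k_algebra_A])
qed

abbreviation "\<Delta> \<equiv> comult H"
abbreviation "eps \<equiv> counit H"
abbreviation "ap \<equiv> antipode H"

lemma comult_H:
  "alg_hom A T \<Delta>" "t \<in> carrier G \<Longrightarrow> \<Delta> (e t) = pure A A (e t) (e t)"
  "\<Delta> x = pure A A x \<one>\<^bsub>A\<^esub> \<oplus>\<^bsub>T\<^esub> pure A A (e g) x"
proof -
  have "\<Delta> = presented_ext T (third_val (\<lambda>t. pure A A (e t) (e t)) (pure A A x \<one>\<^bsub>A\<^esub> \<oplus>\<^bsub>T\<^esub> pure A A (e g) x))"
    unfolding third_hopf_def Let_def third_val_def by (simp add: module.defs)
  then show "alg_hom A T \<Delta>" "t \<in> carrier G \<Longrightarrow> \<Delta> (e t) = pure A A (e t) (e t)"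
    "\<Delta> x = pure A A x \<one>\<^bsub>A\<^esub> \<oplus>\<^bsub>T\<^esub> pure A A (e g) x"
    using third_ext[OF k_algebra_T comult_rep] by simp_all
qed

lemma counit_H: "alg_hom A base_alg eps" "t \<in> carrier G \<Longrightarrow> eps (e t) = 1" "eps x = 0"
proof -
  have "eps = presented_ext base_alg (third_val (\<lambda>t. 1) 0)"
    unfolding third_hopf_def Let_def third_val_def by (simp add: module.defs)
  then show "alg_hom A base_alg eps" "t \<in> carrier G \<Longrightarrow> eps (e t) = 1" "eps x = 0"
    using third_ext[OF k_algebra_base_alg counit_rep] by simp_all
qed

lemma antipode_H: "alg_hom A (op_alg A) ap" "t \<in> carrier G \<Longrightarrow> ap (e t) = e (inv t)"
  "ap x = \<ominus>\<^bsub>A\<^esub> (e (inv g) \<otimes>\<^bsub>A\<^esub> x)"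
proof -
  have "ap = presented_ext (op_alg A) (third_val (\<lambda>t. e (inv t)) (\<ominus>\<^bsub>A\<^esub> (e (inv g) \<otimes>\<^bsub>A\<^esub> x)))"
    unfolding third_hopf_def Let_def third_val_def by (simp add: module.defs)
  then show "alg_hom A (op_alg A) ap" "t \<in> carrier G \<Longrightarrow> ap (e t) = e (inv t)"
    "ap x = \<ominus>\<^bsub>A\<^esub> (e (inv g) \<otimes>\<^bsub>A\<^esub> x)"
    using third_ext[OF k_algebra_op_alg[OF k_algebra_A] antipode_rep] by simp_all
qed

lemmas comult_linear = alg_homD(1)[OF comult_H(1)]
lemmas counit_linear = alg_homD(1)[OF counit_H(1)]

lemma antipode_linear: "linear_map A A ap"
  using alg_homD(1)[OF antipode_H(1)] by (simp add: linear_map_def)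

lemmas comult_closed [simp] = linear_map_closed[OF comult_linear]
lemmas antipode_closed [simp] = linear_map_closed[OF antipode_linear]

lemma antipode_mult: "a \<in> carrier A \<Longrightarrow> b \<in> carrier A \<Longrightarrow> ap (a \<otimes>\<^bsub>A\<^esub> b) = ap b \<otimes>\<^bsub>A\<^esub> ap a"
  using alg_homD(2)[OF antipode_H(1)] by simp

lemma structure_maps_linear [lin]:
  "linear_map Z A \<phi> \<Longrightarrow> linear_map Z T (\<lambda>z. \<Delta> (\<phi> z))"
  "linear_map Z A \<phi> \<Longrightarrow> linear_map Z base_alg (\<lambda>z. eps (\<phi> z))"
  "linear_map Z A \<phi> \<Longrightarrow> linear_map Z A (\<lambda>z. ap (\<phi> z))"
  using linear_map_compose comult_linear counit_linear antipode_linear by blast+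

lemma counit_left_A: "u \<in> carrier A \<Longrightarrow> tlift A (\<lambda>a b. eps a \<odot>\<^bsub>A\<^esub> b) (\<Delta> u) = u"
proof (rule third_alg_hom_eqI[where B = A])
  have b: "bilinear_map A A A (\<lambda>a b. eps a \<odot>\<^bsub>A\<^esub> b)"
    by (intro bilinear_mapI lin; simp)
  show "alg_hom A A (\<lambda>u. tlift A (\<lambda>a b. eps a \<odot>\<^bsub>A\<^esub> b) (\<Delta> u))"
    by (rule alg_hom_compose[OF comult_H(1) T.tlift_alg_hom[OF k_algebra_A b]])
       (simp_all add: alg_homD[OF counit_H(1)] A.smult_mult_left A.smult_mult_right A.smult_smult mult.commute)
  show "alg_hom A A (\<lambda>u. u)" by (simp add: alg_homI linear_map_id)
  show "tlift A (\<lambda>a b. eps a \<odot>\<^bsub>A\<^esub> b) (\<Delta> (e t)) = e t" if "t \<in> carrier G" for t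
    using that by (simp add: comult_H T.tlift(2)[OF k_algebra_A b] counit_H)
  show "tlift A (\<lambda>a b. eps a \<odot>\<^bsub>A\<^esub> b) (\<Delta> x) = x"
    by (simp add: comult_H linear_map_add[OF T.tlift(1)[OF k_algebra_A b]] T.tlift(2)[OF k_algebra_A b] counit_H)
qed

lemma counit_right_A: "u \<in> carrier A \<Longrightarrow> tlift A (\<lambda>a b. eps b \<odot>\<^bsub>A\<^esub> a) (\<Delta> u) = u"
proof (rule third_alg_hom_eqI[where B = A])
  have b: "bilinear_map A A A (\<lambda>a b. eps b \<odot>\<^bsub>A\<^esub> a)"
    by (intro bilinear_mapI lin; simp)
  show "alg_hom A A (\<lambda>u. tlift A (\<lambda>a b. eps b \<odot>\<^bsub>A\<^esub> a) (\<Delta> u))"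
    by (rule alg_hom_compose[OF comult_H(1) T.tlift_alg_hom[OF k_algebra_A b]])
       (simp_all add: alg_homD[OF counit_H(1)] A.smult_mult_left A.smult_mult_right A.smult_smult mult.commute)
  show "alg_hom A A (\<lambda>u. u)" by (simp add: alg_homI linear_map_id)
  show "tlift A (\<lambda>a b. eps b \<odot>\<^bsub>A\<^esub> a) (\<Delta> (e t)) = e t" if "t \<in> carrier G" for t
    using that by (simp add: comult_H T.tlift(2)[OF k_algebra_A b] counit_H)
  show "tlift A (\<lambda>a b. eps b \<odot>\<^bsub>A\<^esub> a) (\<Delta> x) = x"
    using counit_H(2)[OF G.one_closed]
    by (simp add: comult_H linear_map_add[OF T.tlift(1)[OF k_algebra_A b]] T.tlift(2)[OF k_algebra_A b] counit_H(3) e_one)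
qed

lemma coassoc_A:
  assumes "u \<in> carrier A"
  shows "tlift (tensor A T) (\<lambda>a b. pure A T a (\<Delta> b)) (\<Delta> u) =
    tlift (tensor A T) (\<lambda>a b. tlift (tensor A T) (\<lambda>c d. pure A T c (pure A A d b)) (\<Delta> a)) (\<Delta> u)"
proof (rule third_alg_hom_eqI[where B = "tensor A T"])
  have V: "k_algebra (tensor A T)" by simp
  interpret V: k_algebra "tensor A T" by (rule V)
  interpret V: tensor_pair A T by (rule tensor_pair.intro) simp_all
  have b1: "bilinear_map A A (tensor A T) (\<lambda>a b. pure A T a (\<Delta> b))"
    by (intro bilinear_mapI lin; simp)
  have b2: "bilinear_map A A (tensor A T) (\<lambda>c d. pure A T c (pure A A d b))" if "b \<in> carrier A" for b
    using that by (intro bilinear_mapI lin; simp)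
  have b3: "bilinear_map A A (tensor A T) (\<lambda>a b. tlift (tensor A T) (\<lambda>c d. pure A T c (pure A A d b)) (\<Delta> a))"
  proof (rule bilinear_mapI)
    fix a assume a: "a \<in> carrier A"
    show "linear_map A (tensor A T) (\<lambda>b. tlift (tensor A T) (\<lambda>c d. pure A T c (pure A A d b)) (\<Delta> a))"
      by (rule T.tlift_param[OF V k_algebra_A comult_closed[OF a] b2], assumption, intro lin, simp_all)
  next
    fix b assume b: "b \<in> carrier A"
    show "linear_map A (tensor A T) (\<lambda>a. tlift (tensor A T) (\<lambda>c d. pure A T c (pure A A d b)) (\<Delta> a))"
      by (rule linear_map_tlift[OF k_algebra_A k_algebra_A V comult_linear b2[OF b]])
  qed
  show "alg_hom A (tensor A T) (\<lambda>u. tlift (tensor A T) (\<lambda>a b. pure A T a (\<Delta> b)) (\<Delta> u))"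
    by (rule alg_hom_compose[OF comult_H(1) T.tlift_alg_hom[OF V b1]])
       (simp_all add: alg_homD[OF comult_H(1)] V.pure_mult V.tensor_one)
  show "alg_hom A (tensor A T) (\<lambda>u. tlift (tensor A T) (\<lambda>a b. tlift (tensor A T) (\<lambda>c d. pure A T c (pure A A d b)) (\<Delta> a)) (\<Delta> u))"
  proof (rule alg_hom_compose[OF comult_H(1) T.tlift_alg_hom[OF V b3]])
    show "tlift (tensor A T) (\<lambda>c d. pure A T c (pure A A d \<one>\<^bsub>A\<^esub>)) (\<Delta> \<one>\<^bsub>A\<^esub>) = \<one>\<^bsub>tensor A T\<^esub>"
      by (simp add: alg_homD(3)[OF comult_H(1)] T.tensor_one T.tlift(2)[OF V b2] V.tensor_one)
    fix a b a' b' assume ab: "a \<in> carrier A" "b \<in> carrier A" "a' \<in> carrier A" "b' \<in> carrier A"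
    show "tlift (tensor A T) (\<lambda>c d. pure A T c (pure A A d (b \<otimes>\<^bsub>A\<^esub> b'))) (\<Delta> (a \<otimes>\<^bsub>A\<^esub> a')) =
      tlift (tensor A T) (\<lambda>c d. pure A T c (pure A A d b)) (\<Delta> a) \<otimes>\<^bsub>tensor A T\<^esub>
      tlift (tensor A T) (\<lambda>c d. pure A T c (pure A A d b')) (\<Delta> a')"
      unfolding alg_homD(2)[OF comult_H(1) ab(1,3)]
      by (rule tlift_mult[OF k_algebra_A k_algebra_A V b2 b2 b2])
         (use ab in \<open>simp_all add: V.pure_mult T.pure_mult\<close>)
  qed
  note s = T.tlift(2)[OF V b1] T.tlift(2)[OF V b2] T.tlift(2)[OF V b3] linear_map_add[OF T.tlift(1)[OF V b1]]
    linear_map_add[OF T.tlift(1)[OF V b2]] linear_map_add[OF T.tlift(1)[OF V b3]]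
  show "tlift (tensor A T) (\<lambda>a b. pure A T a (\<Delta> b)) (\<Delta> (e t)) =
      tlift (tensor A T) (\<lambda>a b. tlift (tensor A T) (\<lambda>c d. pure A T c (pure A A d b)) (\<Delta> a)) (\<Delta> (e t))"
    if "t \<in> carrier G" for t
    using that by (simp add: s comult_H)
  show "tlift (tensor A T) (\<lambda>a b. pure A T a (\<Delta> b)) (\<Delta> x) =
      tlift (tensor A T) (\<lambda>a b. tlift (tensor A T) (\<lambda>c d. pure A T c (pure A A d b)) (\<Delta> a)) (\<Delta> x)"
    by (simp add: s comult_H alg_homD(3)[OF comult_H(1)] T.tensor_one V.a_assoc
      linear_map_add[OF V.pure_linear_right])
qed (rule assms)

text \<open>The antipode axioms are not equalities of algebra maps; they follow by building up words one
  generator at a time.\<close>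

lemma antipode_left_A:
  assumes "u \<in> carrier A"
  shows "tlift A (\<lambda>a b. ap a \<otimes>\<^bsub>A\<^esub> b) (\<Delta> u) = eps u \<odot>\<^bsub>A\<^esub> \<one>\<^bsub>A\<^esub>"
proof -
  interpret TA: k_algebra T by simp
  have b: "bilinear_map A A A (\<lambda>a b. ap a \<otimes>\<^bsub>A\<^esub> b)" by (intro bilinear_mapI lin; simp)
  define M where "M = tlift A (\<lambda>a b. ap a \<otimes>\<^bsub>A\<^esub> b)"
  have linM: "linear_map T A M" and M: "\<And>a b. a \<in> carrier A \<Longrightarrow> b \<in> carrier A \<Longrightarrow> M (pure A A a b) = ap a \<otimes>\<^bsub>A\<^esub> b"
    unfolding M_def using T.tlift[OF k_algebra_A b] by simp_all
  have mult: "M (\<Delta> y \<otimes>\<^bsub>T\<^esub> Y) = eps y \<odot>\<^bsub>A\<^esub> M Y"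
    if y: "y \<in> carrier A" and pure: "\<And>c d. c \<in> carrier A \<Longrightarrow> d \<in> carrier A \<Longrightarrow> M (\<Delta> y \<otimes>\<^bsub>T\<^esub> pure A A c d) = eps y \<odot>\<^bsub>A\<^esub> (ap c \<otimes>\<^bsub>A\<^esub> d)"
      and Y: "Y \<in> carrier T" for y Y
    using Y
  proof (rule T.linear_map_eq_on_tensor[rotated 3])
    show "linear_map T A (\<lambda>Y. M (\<Delta> y \<otimes>\<^bsub>T\<^esub> Y))"
      by (rule linear_map_compose[OF _ linM]) (rule linear_map_mult_right[OF k_algebra_T linear_map_id comult_closed[OF y]])
    show "linear_map T A (\<lambda>Y. eps y \<odot>\<^bsub>A\<^esub> M Y)"
      by (rule linear_map_smult_const[OF k_algebra_A linM])
  qed (simp add: pure M)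
  have t: "M (\<Delta> (e t) \<otimes>\<^bsub>T\<^esub> Y) = eps (e t) \<odot>\<^bsub>A\<^esub> M Y" if t: "t \<in> carrier G" and Y: "Y \<in> carrier T" for t Y
  proof (rule mult[OF e_closed[OF t] _ Y])
    fix c d assume "c \<in> carrier A" "d \<in> carrier A"
    then show "M (\<Delta> (e t) \<otimes>\<^bsub>T\<^esub> pure A A c d) = eps (e t) \<odot>\<^bsub>A\<^esub> (ap c \<otimes>\<^bsub>A\<^esub> d)"
      using t inv_e(1)[OF t]
      by (simp add: comult_H(2) T.pure_mult M antipode_mult antipode_H(2) counit_H(2) A.m_assoc)
         (simp add: A.m_assoc[symmetric])
  qed
  have X: "M (\<Delta> x \<otimes>\<^bsub>T\<^esub> Y) = eps x \<odot>\<^bsub>A\<^esub> M Y" if Y: "Y \<in> carrier T" for Y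
  proof (rule mult[OF x_closed _ Y])
    fix c d assume c: "c \<in> carrier A" and d: "d \<in> carrier A"
    have "M (\<Delta> x \<otimes>\<^bsub>T\<^esub> pure A A c d) = ap c \<otimes>\<^bsub>A\<^esub> (\<ominus>\<^bsub>A\<^esub> (e (inv g) \<otimes>\<^bsub>A\<^esub> x)) \<otimes>\<^bsub>A\<^esub> d \<oplus>\<^bsub>A\<^esub> ap c \<otimes>\<^bsub>A\<^esub> e (inv g) \<otimes>\<^bsub>A\<^esub> (x \<otimes>\<^bsub>A\<^esub> d)"
      using c d by (simp add: comult_H(3) TA.l_distr T.pure_mult linear_map_add[OF linM] M antipode_mult antipode_H)
    also have "\<dots> = \<zero>\<^bsub>A\<^esub>"
      using c d by (simp add: A.m_assoc A.l_minus A.r_minus A.l_neg)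
    finally show "M (\<Delta> x \<otimes>\<^bsub>T\<^esub> pure A A c d) = eps x \<odot>\<^bsub>A\<^esub> (ap c \<otimes>\<^bsub>A\<^esub> d)"
      using c d by (simp add: counit_H(3))
  qed
  from assms have "M (\<Delta> u) = eps u \<odot>\<^bsub>A\<^esub> \<one>\<^bsub>A\<^esub>"
  proof (induction rule: third_induct_left)
    case one
    then show ?case
      using antipode_H(2)[OF G.one_closed]
      by (simp add: alg_homD(3)[OF comult_H(1)] T.tensor_one M alg_homD(3)[OF counit_H(1)] e_one)
  next
    case (elt s u)
    then show ?case
      by (simp add: alg_homD(2)[OF comult_H(1)] t alg_homD(2)[OF counit_H(1)] A.smult_smult)
  next
    case (gen u)
    then show ?case
      by (simp add: alg_homD(2)[OF comult_H(1)] X alg_homD(2)[OF counit_H(1)] A.smult_smult)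
  next
    case (add u v)
    then show ?case
      by (simp add: linear_map_add[OF comult_linear] linear_map_add[OF linM] linear_map_add[OF counit_linear] A.smult_add_left)
  next
    case (smult c u)
    then show ?case
      by (simp add: linear_map_smult[OF comult_linear] linear_map_smult[OF linM] linear_map_smult[OF counit_linear] A.smult_smult)
  qed
  then show ?thesis by (simp add: M_def)
qed

lemma antipode_right_A:
  assumes "u \<in> carrier A"
  shows "tlift A (\<lambda>a b. a \<otimes>\<^bsub>A\<^esub> ap b) (\<Delta> u) = eps u \<odot>\<^bsub>A\<^esub> \<one>\<^bsub>A\<^esub>"
proof -
  interpret TA: k_algebra T by simp
  have b: "bilinear_map A A A (\<lambda>a b. a \<otimes>\<^bsub>A\<^esub> ap b)" by (intro bilinear_mapI lin; simp)
  define M where "M = tlift A (\<lambda>a b. a \<otimes>\<^bsub>A\<^esub> ap b)"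
  have linM: "linear_map T A M" and M: "\<And>a b. a \<in> carrier A \<Longrightarrow> b \<in> carrier A \<Longrightarrow> M (pure A A a b) = a \<otimes>\<^bsub>A\<^esub> ap b"
    unfolding M_def using T.tlift[OF k_algebra_A b] by simp_all
  have mult: "M (Y \<otimes>\<^bsub>T\<^esub> \<Delta> y) = eps y \<odot>\<^bsub>A\<^esub> M Y"
    if y: "y \<in> carrier A" and pure: "\<And>c d. c \<in> carrier A \<Longrightarrow> d \<in> carrier A \<Longrightarrow> M (pure A A c d \<otimes>\<^bsub>T\<^esub> \<Delta> y) = eps y \<odot>\<^bsub>A\<^esub> (c \<otimes>\<^bsub>A\<^esub> ap d)"
      and Y: "Y \<in> carrier T" for y Y
    using Y
  proof (rule T.linear_map_eq_on_tensor[rotated 3])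
    show "linear_map T A (\<lambda>Y. M (Y \<otimes>\<^bsub>T\<^esub> \<Delta> y))"
      by (rule linear_map_compose[OF _ linM]) (rule linear_map_mult_left[OF k_algebra_T linear_map_id comult_closed[OF y]])
    show "linear_map T A (\<lambda>Y. eps y \<odot>\<^bsub>A\<^esub> M Y)"
      by (rule linear_map_smult_const[OF k_algebra_A linM])
  qed (simp add: pure M)
  have t: "M (Y \<otimes>\<^bsub>T\<^esub> \<Delta> (e t)) = eps (e t) \<odot>\<^bsub>A\<^esub> M Y" if t: "t \<in> carrier G" and Y: "Y \<in> carrier T" for t Y
  proof (rule mult[OF e_closed[OF t] _ Y])
    fix c d assume cd: "c \<in> carrier A" "d \<in> carrier A"
    have "c \<otimes>\<^bsub>A\<^esub> e t \<otimes>\<^bsub>A\<^esub> (e (inv t) \<otimes>\<^bsub>A\<^esub> ap d) = c \<otimes>\<^bsub>A\<^esub> (e t \<otimes>\<^bsub>A\<^esub> e (inv t)) \<otimes>\<^bsub>A\<^esub> ap d"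
      using cd t by (simp add: A.m_assoc)
    then show "M (pure A A c d \<otimes>\<^bsub>T\<^esub> \<Delta> (e t)) = eps (e t) \<odot>\<^bsub>A\<^esub> (c \<otimes>\<^bsub>A\<^esub> ap d)"
      using t cd inv_e(2)[OF t]
      by (simp add: comult_H(2) T.pure_mult M antipode_mult antipode_H(2) counit_H(2))
  qed
  have X: "M (Y \<otimes>\<^bsub>T\<^esub> \<Delta> x) = eps x \<odot>\<^bsub>A\<^esub> M Y" if Y: "Y \<in> carrier T" for Y
  proof (rule mult[OF x_closed _ Y])
    fix c d assume c: "c \<in> carrier A" and d: "d \<in> carrier A"
    have "e g \<otimes>\<^bsub>A\<^esub> (e (inv g) \<otimes>\<^bsub>A\<^esub> (x \<otimes>\<^bsub>A\<^esub> ap d)) = x \<otimes>\<^bsub>A\<^esub> ap d"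
      using inv_e(2)[OF g_closed] d by (simp add: A.m_assoc[symmetric])
    moreover have "ap \<one>\<^bsub>A\<^esub> = \<one>\<^bsub>A\<^esub>" using antipode_H(2)[OF G.one_closed] by (simp add: e_one)
    ultimately have "M (pure A A c d \<otimes>\<^bsub>T\<^esub> \<Delta> x) = \<zero>\<^bsub>A\<^esub>"
      using c d by (simp add: comult_H(3) TA.r_distr T.pure_mult linear_map_add[OF linM] M antipode_mult antipode_H(3)
        A.m_assoc A.l_minus A.r_minus A.r_neg)
    then show "M (pure A A c d \<otimes>\<^bsub>T\<^esub> \<Delta> x) = eps x \<odot>\<^bsub>A\<^esub> (c \<otimes>\<^bsub>A\<^esub> ap d)"
      using c d by (simp add: counit_H(3))
  qed
  from assms have "M (\<Delta> u) = eps u \<odot>\<^bsub>A\<^esub> \<one>\<^bsub>A\<^esub>"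
  proof (induction rule: third_induct_right)
    case one
    then show ?case
      using antipode_H(2)[OF G.one_closed]
      by (simp add: alg_homD(3)[OF comult_H(1)] T.tensor_one M alg_homD(3)[OF counit_H(1)] e_one)
  next
    case (elt s u)
    then show ?case
      by (simp add: alg_homD(2)[OF comult_H(1)] t alg_homD(2)[OF counit_H(1)] A.smult_smult mult.commute)
  next
    case (gen u)
    then show ?case
      by (simp add: alg_homD(2)[OF comult_H(1)] X alg_homD(2)[OF counit_H(1)] A.smult_smult mult.commute)
  next
    case (add u v)
    then show ?case
      by (simp add: linear_map_add[OF comult_linear] linear_map_add[OF linM] linear_map_add[OF counit_linear] A.smult_add_left)
  next
    case (smult c u)
    then show ?case
      by (simp add: linear_map_smult[OF comult_linear] linear_map_smult[OF linM] linear_map_smult[OF counit_linear] A.smult_smult)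
  qed
  then show ?thesis by (simp add: M_def)
qed

theorem hopf_algebra_H: "hopf_algebra H"
proof (rule hopf_algebra.intro[OF k_algebra_H], rule hopf_algebra_axioms.intro)
  show "alg_hom H (tensor H H) \<Delta>"
    using comult_H(1) alg_hom_cong[of H A T T] unfolding tensor_H by simp
  show "alg_hom H base_alg eps"
    using counit_H(1) alg_hom_cong[of H A base_alg base_alg] by simp
  show "linear_map H H ap"
    using antipode_linear linear_map_cong[of H A H A] by simp
qed (simp_all add: tensor_H tlift_H counit_left_A counit_right_A coassoc_A antipode_left_A antipode_right_A)

end

subsection \<open>Group-like and skew primitive elements\<close>

context third_type
begin

lemma e_pow: "t \<in> carrier G \<Longrightarrow> e t [^]\<^bsub>A\<^esub> (n::nat) = e (t [^] n)"
  by (induction n) (simp_all add: e_one e_mult)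

lemma bas_1: "bas \<one> (Suc 0) = x"
  by (simp add: bas_def A.rising_1 e_one)

text \<open>The comultiplication of \<open>x\<close> has the shape \<open>X + Z G\<close> of \<open>rising_skew_sum\<close> with \<open>X = x \<otimes> 1\<close>,
  \<open>G = g \<otimes> 1\<close> and \<open>Z = 1 \<otimes> x\<close>.\<close>

lemma comult_bas:
  assumes t: "t \<in> carrier G"
  shows "\<Delta> (bas t m) = (\<Oplus>\<^bsub>T\<^esub>l\<in>{..m}. of_nat (m choose l) \<odot>\<^bsub>T\<^esub> pure A A (bas (t \<otimes> g [^] l) (m - l)) (bas t l))"
proof -
  interpret TA: k_algebra T by simp
  note hl = pure_alg_hom(1)[OF k_algebra_A k_algebra_A] and hr = pure_alg_hom(2)[OF k_algebra_A k_algebra_A]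
  let ?p = "pure A A"
  let ?X = "?p x \<one>\<^bsub>A\<^esub>" and ?G = "?p (e g) \<one>\<^bsub>A\<^esub>" and ?Z = "?p \<one>\<^bsub>A\<^esub> x"
  have c: "?X \<in> carrier T" "?G \<in> carrier T" "?Z \<in> carrier T" by simp_all
  have ZG: "\<Delta> x = ?X \<oplus>\<^bsub>T\<^esub> ?Z \<otimes>\<^bsub>T\<^esub> ?G" by (simp add: T.pure_mult comult_H(3))
  have rel: "?X \<otimes>\<^bsub>T\<^esub> ?G \<oplus>\<^bsub>T\<^esub> ?G = ?G \<otimes>\<^bsub>T\<^esub> ?X \<oplus>\<^bsub>T\<^esub> ?G \<otimes>\<^bsub>T\<^esub> ?G"
    using arg_cong[OF g_x, of "\<lambda>a. ?p a \<one>\<^bsub>A\<^esub>"]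
    by (simp add: T.pure_mult linear_map_add[OF T.pure_linear_left])
  have "\<Delta> (bas t m) = ?p (e t) (e t) \<otimes>\<^bsub>T\<^esub> rising T (\<Delta> x) m"
    using t by (simp add: bas_def alg_homD(2)[OF comult_H(1)] comult_H(2) alg_hom_rising[OF comult_H(1)])
  also have "rising T (\<Delta> x) m = (\<Oplus>\<^bsub>T\<^esub>l\<in>{..m}. of_nat (m choose l) \<odot>\<^bsub>T\<^esub>
      (?G [^]\<^bsub>T\<^esub> l \<otimes>\<^bsub>T\<^esub> (rising T ?X (m - l) \<otimes>\<^bsub>T\<^esub> rising T ?Z l)))"
    unfolding ZG by (rule TA.rising_skew_sum[OF c rel]) (simp_all add: T.pure_mult)
  also have "\<dots> = (\<Oplus>\<^bsub>T\<^esub>l\<in>{..m}. of_nat (m choose l) \<odot>\<^bsub>T\<^esub> ?p (e (g [^] l) \<otimes>\<^bsub>A\<^esub> rising A x (m - l)) (rising A x l))"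
    by (intro TA.finsum_cong' refl funcsetI)
      (simp_all add: alg_hom_rising[OF hl k_algebra_A k_algebra_T x_closed, symmetric]
        alg_hom_rising[OF hr k_algebra_A k_algebra_T x_closed, symmetric]
        alg_hom_pow[OF hl k_algebra_A k_algebra_T e_closed[OF g_closed], symmetric] e_pow T.pure_mult)
  also have "?p (e t) (e t) \<otimes>\<^bsub>T\<^esub> \<dots> = (\<Oplus>\<^bsub>T\<^esub>l\<in>{..m}. ?p (e t) (e t) \<otimes>\<^bsub>T\<^esub>
      (of_nat (m choose l) \<odot>\<^bsub>T\<^esub> ?p (e (g [^] l) \<otimes>\<^bsub>A\<^esub> rising A x (m - l)) (rising A x l)))"
    using t by (intro TA.finsum_rdistr) simp_all
  also have "\<dots> = (\<Oplus>\<^bsub>T\<^esub>l\<in>{..m}. of_nat (m choose l) \<odot>\<^bsub>T\<^esub> ?p (bas (t \<otimes> g [^] l) (m - l)) (bas t l))"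
    using t by (intro TA.finsum_cong' refl funcsetI)
      (simp_all add: TA.smult_mult_right T.pure_mult bas_def e_mult A.m_assoc)
  finally show ?thesis .
qed

lemma bilinear_coord: "bilinear_map A A base_alg (\<lambda>a b. coord s i a * coord t l b)"
  by (intro bilinear_mapI lin)

abbreviation coord2 :: "'g \<Rightarrow> nat \<Rightarrow> 'g \<Rightarrow> nat \<Rightarrow> _ \<Rightarrow> 'k" where
  "coord2 s i t l \<equiv> tlift base_alg (\<lambda>a b. coord s i a * coord t l b)"

lemmas coord2_pure = T.tlift(2)[OF k_algebra_base_alg bilinear_coord]
lemmas coord2_linear = T.tlift(1)[OF k_algebra_base_alg bilinear_coord]

text \<open>The comultiplication in coordinates: each coordinate of \<open>\<Delta> u\<close> is a multiple of a single coordinate of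
  \<open>u\<close>. This turns the conditions on group-like and skew primitive elements into equations between
  scalars.\<close>

lemma coord2_comult:
  assumes u: "u \<in> carrier A" and s: "s \<in> carrier G" and t: "t \<in> carrier G" and il: "i < CHAR('k)" "l < CHAR('k)"
  shows "coord2 s i t l (\<Delta> u) =
    (if s = t \<otimes> g [^] l \<and> i + l < CHAR('k) then of_nat ((i + l) choose l) * coord t (i + l) u else 0)"
  using u
proof (induction rule: bas_induct)
  case (bas r m)
  interpret TA: k_algebra T by simp
  have "coord2 s i t l (\<Delta> (bas r m)) =
      (\<Sum>l'\<le>m. of_nat (m choose l') * (coord s i (bas (r \<otimes> g [^] l') (m - l')) * coord t l (bas r l')))"
    unfolding comult_bas[OF bas(1)] using bas
    by (simp add: linear_map_finsum[OF coord2_linear k_algebra_T k_algebra_base_alg] linear_map_smult[OF coord2_linear] coord2_pure)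
  also have "\<dots> = (\<Sum>l'\<le>m. if l' = l then (if r = t \<and> m - l = i \<and> s = t \<otimes> g [^] l then of_nat (m choose l) else 0) else 0)"
    using bas s t il by (intro sum.cong) (auto simp: coord_bas)
  also have "\<dots> = (if l \<le> m \<and> r = t \<and> m - l = i \<and> s = t \<otimes> g [^] l then of_nat (m choose l) else 0)"
    by simp
  also have "\<dots> = (if s = t \<otimes> g [^] l \<and> i + l < CHAR('k) then of_nat ((i + l) choose l) * coord t (i + l) (bas r m) else 0)"
    using bas by (auto simp: coord_bas)
  finally show ?case .
next
  case (add u v)
  then show ?case
    by (simp add: linear_map_add[OF comult_linear] linear_map_add[OF coord2_linear] linear_map_add[OF coord_linear] algebra_simps)
next
  case (smult c u)
  then show ?case
    by (simp add: linear_map_smult[OF comult_linear] linear_map_smult[OF coord2_linear] linear_map_smult[OF coord_linear] algebra_simps)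
qed

lemma coord_zero [simp]: "coord t m \<zero>\<^bsub>A\<^esub> = 0"
  using linear_map_zero[OF coord_linear k_algebra_A k_algebra_base_alg] by simp

lemma coord_e: "s \<in> carrier G \<Longrightarrow> m < CHAR('k) \<Longrightarrow> coord t m (e s) = of_bool (s = t \<and> m = 0)"
  using coord_bas[of s m t 0] by (auto simp: bas_0)

lemma CHAR_gt_1: "1 < CHAR('k)"
  using prime_gt_1_nat[OF prime_CHAR] .

lemma coord_x: "m < CHAR('k) \<Longrightarrow> coord t m x = of_bool (t = \<one> \<and> m = 1)"
  using coord_bas[of \<one> m t 1] by (auto simp: bas_1)

lemma e_inj: "s \<in> carrier G \<Longrightarrow> t \<in> carrier G \<Longrightarrow> e s = e t \<Longrightarrow> s = t"
proof -
  assume st: "s \<in> carrier G" "t \<in> carrier G" "e s = e t"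
  then have "coord s 0 (e s) = coord s 0 (e t)" by (simp only:)
  then show "s = t" unfolding coord_e[OF st(1) p_pos] coord_e[OF st(2) p_pos] by (simp split: if_splits)
qed

text \<open>The coordinates of degree zero are orthogonal idempotents of \<open>'k\<close>, and those of positive degree
  square to zero, by induction from the highest degree downwards.\<close>

theorem grouplike_imp_elt:
  assumes u: "u \<in> carrier A" "u \<noteq> \<zero>\<^bsub>A\<^esub>" and gl: "\<Delta> u = pure A A u u"
  obtains t where "t \<in> carrier G" "u = e t"
proof -
  have eq: "coord s i u * coord t l u =
      (if s = t \<otimes> g [^] l \<and> i + l < CHAR('k) then of_nat ((i + l) choose l) * coord t (i + l) u else 0)"
    if "s \<in> carrier G" "t \<in> carrier G" "i < CHAR('k)" "l < CHAR('k)" for s t i l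
    using coord2_comult[OF u(1) that] u(1) by (simp add: gl coord2_pure)
  \<comment> \<open>The highest coordinate would square to a coordinate of twice its degree.\<close>
  have high: "coord t m u = 0" if "t \<in> carrier G" "0 < m" "m < CHAR('k)" for t m
    using that
  proof (induction "CHAR('k) - m" arbitrary: m rule: less_induct)
    case less
    have "coord t m u * coord t m u = 0"
    proof (cases "m + m < CHAR('k)")
      case True
      then have "coord t (m + m) u = 0" using less.prems by (intro less.hyps) auto
      then show ?thesis using eq[of t t m m] less.prems by simp
    next
      case False
      then show ?thesis using eq[of t t m m] less.prems by simp
    qed
    then show ?case by simp
  qed
  have "\<exists>t\<in>carrier G. coord t 0 u \<noteq> 0"
  proof (rule ccontr)
    assume "\<not> ?thesis"
    then have zero: "coord t 0 u = 0" if "t \<in> carrier G" for t using that by blast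
    have "coord t m u = coord t m \<zero>\<^bsub>A\<^esub>" if "t \<in> carrier G" "m < CHAR('k)" for t m
      using high[OF that(1) _ that(2)] zero[OF that(1)] by (cases "m = 0") simp_all
    then have "u = \<zero>\<^bsub>A\<^esub>" by (rule coord_eqI[OF u(1) A.zero_closed])
    then show False using u(2) by simp
  qed
  then obtain t where t: "t \<in> carrier G" "coord t 0 u \<noteq> 0" by blast
  have one: "coord t 0 u = 1" using eq[of t t 0 0] t p_pos by simp
  have other: "coord s 0 u = 0" if "s \<in> carrier G" "s \<noteq> t" for s
    using eq[of s t 0 0] that t p_pos by simp
  have "u = e t"
  proof (rule coord_eqI[OF u(1)])
    fix s m assume "s \<in> carrier G" "m < CHAR('k)"
    then show "coord s m u = coord s m (e t)"
      using high[of s m] other[of s] one t by (cases "m = 0"; cases "s = t") (auto simp: coord_e)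
  qed (simp add: t)
  then show thesis using that t by blast
qed

text \<open>Comparing the coordinates of bidegree \<open>(m - 1, 1)\<close> shows that \<open>m\<close> times a coordinate of degree \<open>m > 1\<close>
  vanishes, and \<open>m\<close> is invertible for \<open>m < p\<close>. The bidegrees \<open>(0, 1)\<close>, \<open>(1, 0)\<close> and \<open>(0, 0)\<close> determine the
  coordinates of degree one and zero.\<close>

theorem skew_primitive_form:
  assumes u: "u \<in> carrier A" and r: "r \<in> carrier G"
    and sp: "\<Delta> u = pure A A u \<one>\<^bsub>A\<^esub> \<oplus>\<^bsub>T\<^esub> pure A A (e r) u"
  obtains a b where "u = a \<odot>\<^bsub>A\<^esub> x \<oplus>\<^bsub>A\<^esub> b \<odot>\<^bsub>A\<^esub> (\<one>\<^bsub>A\<^esub> \<ominus>\<^bsub>A\<^esub> e r)" and "a \<noteq> 0 \<Longrightarrow> r = g"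
proof -
  have eq: "(if s = t \<otimes> g [^] l \<and> i + l < CHAR('k) then of_nat ((i + l) choose l) * coord t (i + l) u else 0) =
      coord s i u * of_bool (t = \<one> \<and> l = 0) + of_bool (s = r \<and> i = 0) * coord t l u"
    if "s \<in> carrier G" "t \<in> carrier G" "i < CHAR('k)" "l < CHAR('k)" for s t i l
  proof -
    have sym: "\<one> = t \<longleftrightarrow> t = \<one>" "r = s \<longleftrightarrow> s = r" by auto
    have "coord2 s i t l (\<Delta> u) = coord s i u * of_bool (t = \<one> \<and> l = 0) + of_bool (s = r \<and> i = 0) * coord t l u"
      using u r that by (simp add: sp linear_map_add[OF coord2_linear] coord2_pure coord_e e_one[symmetric] sym)
    then show ?thesis unfolding coord2_comult[OF u that] .
  qed
  have high: "coord t m u = 0" if t: "t \<in> carrier G" and m: "1 < m" "m < CHAR('k)" for t m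
  proof -
    have "of_nat m * coord t m u = 0"
      using eq[of "t \<otimes> g" t "m - 1" 1] t m by simp
    moreover have "of_nat m \<noteq> (0 :: 'k)"
      using m of_nat_eq_0_iff_char_dvd[where ?'a = 'k, of m] by (auto dest: dvd_imp_le)
    ultimately show ?thesis by simp
  qed
  have deg1: "coord t 1 u = 0 \<or> (t = \<one> \<and> r = g)" if t: "t \<in> carrier G" for t
    using eq[of "t \<otimes> g" t 0 1] eq[of t t 1 0] t CHAR_gt_1 p_pos by (auto split: if_splits)
  have deg0: "(if s = t then coord t 0 u else 0) = coord s 0 u * of_bool (t = \<one>) + of_bool (s = r) * coord t 0 u"
    if "s \<in> carrier G" "t \<in> carrier G" for s t
    using eq[of s t 0 0] that p_pos by (cases "s = t") simp_all
  have r1: "coord \<one> 0 u = 0" if "r = \<one>"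
  proof -
    have "coord \<one> 0 u + coord \<one> 0 u = coord \<one> 0 u * 1 + 1 * coord \<one> 0 u" by simp
    also have "\<dots> = coord \<one> 0 u + 0" using deg0[of \<one> \<one>] that by (simp only: if_True of_bool_eq G.one_closed simp_thms) simp
    finally show ?thesis by (rule add_left_imp_eq)
  qed
  show thesis
  proof (rule that)
    show "coord \<one> 1 u \<noteq> 0 \<Longrightarrow> r = g" using deg1[of \<one>] by auto
    show "u = coord \<one> 1 u \<odot>\<^bsub>A\<^esub> x \<oplus>\<^bsub>A\<^esub> coord \<one> 0 u \<odot>\<^bsub>A\<^esub> (\<one>\<^bsub>A\<^esub> \<ominus>\<^bsub>A\<^esub> e r)" (is "u = ?v")
    proof (rule coord_eqI[OF u])
      show "?v \<in> carrier A" using r by simp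
      fix t m assume t: "t \<in> carrier G" and m: "m < CHAR('k)"
      have sym: "\<one> = t \<longleftrightarrow> t = \<one>" "r = t \<longleftrightarrow> t = r" by auto
      have v: "coord t m ?v = coord \<one> 1 u * of_bool (t = \<one> \<and> m = 1) +
          coord \<one> 0 u * (of_bool (t = \<one> \<and> m = 0) - of_bool (t = r \<and> m = 0))"
        using r m by (simp add: linear_map_add[OF coord_linear] linear_map_smult[OF coord_linear] coord_x coord_e
          linear_map_minus[OF coord_linear k_algebra_A k_algebra_base_alg] e_one[symmetric] sym)
      consider "m = 0" | "m = 1" | "m > 1" by linarith
      then show "coord t m u = coord t m ?v"
      proof cases
        case 1
        then show ?thesis
          unfolding v using deg0[of t t] deg0[of r \<one>] t r r1
            by (cases "r = \<one>"; cases "t = \<one>") (auto simp: add_eq_0_iff split: if_splits)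
      next
        case 2
        then show ?thesis unfolding v using deg1[OF t] by auto
      next
        case 3
        then show ?thesis unfolding v using high[OF t 3 m] by simp
      qed
    qed
  qed
qed

subsection \<open>The automorphisms moving only the skew primitive generator\<close>

definition shift :: "'k \<Rightarrow> ('g third_gen list \<Rightarrow>\<^sub>0 'k) set \<Rightarrow> ('g third_gen list \<Rightarrow>\<^sub>0 'k) set" where
  "shift c = presented_ext A (third_val (\<lambda>t. e t) (x \<oplus>\<^bsub>A\<^esub> c \<odot>\<^bsub>A\<^esub> (\<one>\<^bsub>A\<^esub> \<ominus>\<^bsub>A\<^esub> e g)))"

text \<open>This is the condition \<open>(c\<^sup>p - c) (1 - g\<^sup>p) = 0\<close>, the same as for the values of \<open>f\<close>.\<close>

definition shift_ok :: "'k \<Rightarrow> bool" where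
  "shift_ok c \<longleftrightarrow> c ^ CHAR('k) = c \<or> g [^] CHAR('k) = \<one>"

text \<open>The element \<open>1 - g\<close> commutes with the group, so adding a multiple of it to \<open>x\<close> does not affect the
  commutation rule of \<open>x\<close> with the group elements; \<open>skew_shift_power_CHAR\<close> takes care of \<open>x\<^sup>p = x\<close>.\<close>

lemma shift:
  assumes "shift_ok c"
  shows "alg_hom A A (shift c)" "t \<in> carrier G \<Longrightarrow> shift c (e t) = e t"
    "shift c x = x \<oplus>\<^bsub>A\<^esub> c \<odot>\<^bsub>A\<^esub> (\<one>\<^bsub>A\<^esub> \<ominus>\<^bsub>A\<^esub> e g)"
proof -
  have "(x \<oplus>\<^bsub>A\<^esub> c \<odot>\<^bsub>A\<^esub> (\<one>\<^bsub>A\<^esub> \<ominus>\<^bsub>A\<^esub> e g)) [^]\<^bsub>A\<^esub> CHAR('k) = x \<oplus>\<^bsub>A\<^esub> c \<odot>\<^bsub>A\<^esub> (\<one>\<^bsub>A\<^esub> \<ominus>\<^bsub>A\<^esub> e g)"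
    by (rule A.skew_shift_power_CHAR[OF prime_CHAR x_closed e_closed[OF g_closed] g_x x_pow])
       (use assms in \<open>auto simp: shift_ok_def e_pow e_one\<close>)
  moreover have "e t \<otimes>\<^bsub>A\<^esub> (x \<oplus>\<^bsub>A\<^esub> c \<odot>\<^bsub>A\<^esub> (\<one>\<^bsub>A\<^esub> \<ominus>\<^bsub>A\<^esub> e g)) = (x \<oplus>\<^bsub>A\<^esub> c \<odot>\<^bsub>A\<^esub> (\<one>\<^bsub>A\<^esub> \<ominus>\<^bsub>A\<^esub> e g)) \<otimes>\<^bsub>A\<^esub> e t \<oplus>\<^bsub>A\<^esub>
      f t \<odot>\<^bsub>A\<^esub> (e t \<otimes>\<^bsub>A\<^esub> (\<one>\<^bsub>A\<^esub> \<ominus>\<^bsub>A\<^esub> e g))" if t: "t \<in> carrier G" for t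
  proof -
    have "e t \<otimes>\<^bsub>A\<^esub> e g = e g \<otimes>\<^bsub>A\<^esub> e t" using t by (simp add: e_mult[symmetric] g_central)
    then have "e t \<otimes>\<^bsub>A\<^esub> (\<one>\<^bsub>A\<^esub> \<ominus>\<^bsub>A\<^esub> e g) = (\<one>\<^bsub>A\<^esub> \<ominus>\<^bsub>A\<^esub> e g) \<otimes>\<^bsub>A\<^esub> e t"
      using t by (simp add: A.minus_eq_smult A.l_distr A.r_distr A.smult_mult_left A.smult_mult_right)
    then show ?thesis
      using t e_x[OF t] by (simp add: A.r_distr A.l_distr A.smult_mult_left A.smult_mult_right A.a_ac)
  qed
  ultimately have "third_rep A (\<lambda>t. e t) (x \<oplus>\<^bsub>A\<^esub> c \<odot>\<^bsub>A\<^esub> (\<one>\<^bsub>A\<^esub> \<ominus>\<^bsub>A\<^esub> e g))"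
    by (simp add: third_rep_def e_one e_mult)
  from third_ext[OF k_algebra_A this]
  show "alg_hom A A (shift c)" "t \<in> carrier G \<Longrightarrow> shift c (e t) = e t"
    "shift c x = x \<oplus>\<^bsub>A\<^esub> c \<odot>\<^bsub>A\<^esub> (\<one>\<^bsub>A\<^esub> \<ominus>\<^bsub>A\<^esub> e g)"
    by (simp_all add: shift_def)
qed

lemma shift_linear: "shift_ok c \<Longrightarrow> linear_map A A (shift c)"
  by (rule alg_homD(1)[OF shift(1)])

lemma shift_closed: "shift_ok c \<Longrightarrow> u \<in> carrier A \<Longrightarrow> shift c u \<in> carrier A"
  by (rule linear_map_closed[OF shift_linear])

lemma shift_g: "shift_ok c \<Longrightarrow> shift c (\<one>\<^bsub>A\<^esub> \<ominus>\<^bsub>A\<^esub> e g) = \<one>\<^bsub>A\<^esub> \<ominus>\<^bsub>A\<^esub> e g"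
  by (simp add: linear_map_minus[OF shift_linear k_algebra_A k_algebra_A] alg_homD(3)[OF shift(1)] shift(2))

lemma shift_add:
  assumes c: "shift_ok c" and d: "shift_ok d" and cd: "shift_ok (c + d)" and u: "u \<in> carrier A"
  shows "shift c (shift d u) = shift (c + d) u"
proof (rule third_alg_hom_eqI[OF alg_hom_compose[OF shift(1)[OF d] shift(1)[OF c]] shift(1)[OF cd] _ _ u])
  show "shift c (shift d x) = shift (c + d) x"
    by (simp add: shift c d cd linear_map_add[OF shift_linear] linear_map_smult[OF shift_linear] shift_g A.smult_add_left A.a_ac)
qed (simp add: shift c d cd)

lemma shift_zero: "u \<in> carrier A \<Longrightarrow> shift 0 u = u"
proof -
  have ok: "shift_ok 0" using p_pos by (simp add: shift_ok_def power_0_left)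
  show "u \<in> carrier A \<Longrightarrow> shift 0 u = u"
    by (rule third_alg_hom_eqI[OF shift(1)[OF ok] alg_homI[OF linear_map_id]]) (simp_all add: shift ok)
qed

lemma counit_shift: "shift_ok c \<Longrightarrow> u \<in> carrier A \<Longrightarrow> eps (shift c u) = eps u"
  by (rule third_alg_hom_eqI[OF alg_hom_compose[OF shift(1) counit_H(1)] counit_H(1)])
     (simp_all add: shift linear_map_add[OF counit_linear] linear_map_smult[OF counit_linear] counit_H
       linear_map_minus[OF counit_linear k_algebra_A k_algebra_base_alg] alg_homD(3)[OF counit_H(1)])

lemma comult_shift:
  assumes c: "shift_ok c" and u: "u \<in> carrier A"
  shows "\<Delta> (shift c u) = tlift T (\<lambda>a b. pure A A (shift c a) (shift c b)) (\<Delta> u)"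
proof -
  interpret TA: k_algebra T by simp
  have b: "bilinear_map A A T (\<lambda>a b. pure A A (shift c a) (shift c b))"
    by (intro bilinear_mapI lin shift_linear shift_closed c k_algebra_A)
  have h: "alg_hom T T (tlift T (\<lambda>a b. pure A A (shift c a) (shift c b)))"
    by (rule T.tlift_alg_hom[OF k_algebra_T b])
       (simp_all add: alg_homD[OF shift(1)[OF c]] T.tensor_one T.pure_mult)
  show ?thesis
  proof (rule third_alg_hom_eqI[OF alg_hom_compose[OF shift(1)[OF c] comult_H(1)] alg_hom_compose[OF comult_H(1) h] _ _ u])
    show "\<Delta> (shift c (e t)) = tlift T (\<lambda>a b. pure A A (shift c a) (shift c b)) (\<Delta> (e t))" if "t \<in> carrier G" for t
      using that by (simp add: shift c comult_H T.tlift(2)[OF k_algebra_T b])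
    let ?p = "pure A A" and ?y = "\<one>\<^bsub>A\<^esub> \<ominus>\<^bsub>A\<^esub> e g"
    have y: "?y \<in> carrier A" by simp
    have d1: "\<Delta> \<one>\<^bsub>A\<^esub> = ?p \<one>\<^bsub>A\<^esub> \<one>\<^bsub>A\<^esub>" by (simp add: alg_homD(3)[OF comult_H(1)] T.tensor_one)
    have dy: "\<Delta> ?y = ?p ?y \<one>\<^bsub>A\<^esub> \<oplus>\<^bsub>T\<^esub> ?p (e g) ?y"
    proof -
      have "\<Delta> ?y = ?p \<one>\<^bsub>A\<^esub> \<one>\<^bsub>A\<^esub> \<oplus>\<^bsub>T\<^esub> (- 1) \<odot>\<^bsub>T\<^esub> ?p (e g) (e g)"
        by (simp add: linear_map_minus[OF comult_linear k_algebra_A k_algebra_T] d1 comult_H(2) TA.minus_eq_smult)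
      also have "\<dots> = (?p \<one>\<^bsub>A\<^esub> \<one>\<^bsub>A\<^esub> \<oplus>\<^bsub>T\<^esub> (- 1) \<odot>\<^bsub>T\<^esub> ?p (e g) \<one>\<^bsub>A\<^esub>) \<oplus>\<^bsub>T\<^esub> (?p (e g) \<one>\<^bsub>A\<^esub> \<oplus>\<^bsub>T\<^esub> (- 1) \<odot>\<^bsub>T\<^esub> ?p (e g) (e g))"
        using TA.cancel_middle[of "\<zero>\<^bsub>T\<^esub>" "\<zero>\<^bsub>T\<^esub>" "?p \<one>\<^bsub>A\<^esub> \<one>\<^bsub>A\<^esub>" "?p (e g) \<one>\<^bsub>A\<^esub>" "(- 1) \<odot>\<^bsub>T\<^esub> ?p (e g) (e g)" 1] by simp
      also have "\<dots> = ?p ?y \<one>\<^bsub>A\<^esub> \<oplus>\<^bsub>T\<^esub> ?p (e g) ?y"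
        by (simp add: A.minus_eq_smult linear_map_add[OF T.pure_linear_left] linear_map_smult[OF T.pure_linear_left]
          linear_map_add[OF T.pure_linear_right] linear_map_smult[OF T.pure_linear_right])
      finally show ?thesis .
    qed
    have "\<Delta> (shift c x) = (?p x \<one>\<^bsub>A\<^esub> \<oplus>\<^bsub>T\<^esub> ?p (e g) x) \<oplus>\<^bsub>T\<^esub> c \<odot>\<^bsub>T\<^esub> (?p ?y \<one>\<^bsub>A\<^esub> \<oplus>\<^bsub>T\<^esub> ?p (e g) ?y)"
      using y by (simp add: shift c linear_map_add[OF comult_linear] linear_map_smult[OF comult_linear] dy comult_H(3))
    also have "\<dots> = ?p (shift c x) \<one>\<^bsub>A\<^esub> \<oplus>\<^bsub>T\<^esub> ?p (e g) (shift c x)"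
      using y by (simp add: shift c linear_map_add[OF T.pure_linear_left] linear_map_smult[OF T.pure_linear_left]
          linear_map_add[OF T.pure_linear_right] linear_map_smult[OF T.pure_linear_right] TA.smult_add_right TA.a_ac)
    also have "\<dots> = tlift T (\<lambda>a b. ?p (shift c a) (shift c b)) (\<Delta> x)"
      using linear_map_add[OF T.tlift(1)[OF k_algebra_T b]]
      by (simp add: comult_H(3) T.tlift(2)[OF k_algebra_T b] shift(2) c alg_homD(3)[OF shift(1)[OF c]])
    finally show "\<Delta> (shift c x) = tlift T (\<lambda>a b. ?p (shift c a) (shift c b)) (\<Delta> x)" .
  qed
qed

end

section \<open>Group Hopf algebras\<close>

lemma group_hopf_simps [simp]:
  "carrier (group_hopf C) = carrier (monoid_algebra C)" "mult (group_hopf C) = mult (monoid_algebra C)"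
  "one (group_hopf C) = one (monoid_algebra C)" "zero (group_hopf C) = zero (monoid_algebra C)"
  "add (group_hopf C) = add (monoid_algebra C)" "smult (group_hopf C) = smult (monoid_algebra C)"
  by (simp_all add: group_hopf_def Let_def module.defs)

lemma finsum_monoid_algebra:
  fixes F :: "'i \<Rightarrow> 'm \<Rightarrow>\<^sub>0 'k::field"
  assumes "F \<in> S \<rightarrow> carrier (monoid_algebra M)"
  shows "finsum (monoid_algebra M) F S = sum F S"
proof -
  interpret abelian_group "monoid_algebra M :: ('k, _) module" by (rule monoid_algebra_abelian_group)
  show ?thesis using assms
    by (induction S rule: infinite_finite_induct) (simp_all add: Pi_def del: monoid_algebra_simps(1))
qed

locale group_Hopf = C: group C for C :: "('c, 'm) monoid_scheme" +
  fixes K :: "'k::field itself"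
begin

abbreviation "KC \<equiv> monoid_algebra C :: ('k, 'c \<Rightarrow>\<^sub>0 'k) module"
abbreviation "HC \<equiv> group_hopf C :: ('k, 'c \<Rightarrow>\<^sub>0 'k) hopf"
abbreviation "TC \<equiv> tensor KC KC"

lemma k_algebra_KC [simp]: "k_algebra KC"
  by (rule k_algebra_monoid_algebra) (rule C.monoid_axioms)

lemma k_algebra_HC [simp]: "k_algebra HC"
  by (rule k_algebra_cong[OF k_algebra_KC]) simp_all

sublocale KC: k_algebra KC by simp

sublocale TC: tensor_pair KC KC
  by (rule tensor_pair.intro) simp_all

lemma k_algebra_TC [simp]: "k_algebra TC" by simp

lemma delta_in [simp]: "t \<in> carrier C \<Longrightarrow> delta t \<in> carrier KC"
  by simp

lemma tensor_HC: "tensor HC HC = TC" "tensor HC TC = tensor KC TC" "pure HC HC = pure KC KC" "pure HC TC = pure KC TC"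
  by (rule tensor_cong tensor_cong_linear(2); simp)+

lemma tlift_HC: "tlift HC \<beta> = tlift KC \<beta>"
  by (rule tlift_target_cong) simp_all

lemma delta_mult_KC: "delta s \<otimes>\<^bsub>KC\<^esub> delta t = delta (s \<otimes>\<^bsub>C\<^esub> t)"
  by (simp add: monoid_algebra_mult_single)

lemma comult_HC:
  "alg_hom KC TC (comult HC)" "t \<in> carrier C \<Longrightarrow> comult HC (delta t) = pure KC KC (delta t) (delta t)"
proof -
  let ?b = "\<lambda>t. pure KC KC (delta t) (delta t)"
  have eq: "comult HC = lin_ext TC ?b"
    by (rule ext) (simp add: group_hopf_def Let_def module.defs lin_ext_def)
  have "alg_hom KC TC (lin_ext TC ?b)"
    by (rule lin_ext_alg_hom[OF k_algebra_TC])
       (use C.monoid_axioms TC.pure_closed[OF delta_in delta_in] in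
         \<open>simp_all add: TC.tensor_one TC.pure_mult delta_mult_KC del: monoid_algebra_simps(1)\<close>)
  then show "alg_hom KC TC (comult HC)" by (simp only: eq)
  show "t \<in> carrier C \<Longrightarrow> comult HC (delta t) = pure KC KC (delta t) (delta t)"
    unfolding eq using TC.pure_closed[OF delta_in[of t] delta_in[of t]] k_algebra.smult_one[OF k_algebra_TC]
    by (simp add: lin_ext_single)
qed

lemma counit_HC:
  "alg_hom KC base_alg (counit HC)" "t \<in> carrier C \<Longrightarrow> counit HC (delta t) = 1"
proof -
  have eq: "counit HC = lin_ext base_alg (\<lambda>_. 1)"
    by (rule ext) (simp add: group_hopf_def Let_def module.defs lin_ext_def)
  show "alg_hom KC base_alg (counit HC)"
    unfolding eq by (rule lin_ext_alg_hom) (simp_all add: C.monoid_axioms)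
  show "t \<in> carrier C \<Longrightarrow> counit HC (delta t) = 1"
    unfolding eq by (simp add: lin_ext_single)
qed

lemma antipode_HC:
  "linear_map KC KC (antipode HC)" "t \<in> carrier C \<Longrightarrow> antipode HC (delta t) = delta (inv\<^bsub>C\<^esub> t)"
proof -
  have eq: "antipode HC a = lin_ext KC (\<lambda>t. delta (inv\<^bsub>C\<^esub> t)) a" if "a \<in> carrier KC" for a
    unfolding lin_ext_def using that
    by (subst finsum_monoid_algebra) (auto simp: group_hopf_def Let_def module.defs split: if_splits)
  have lin: "linear_map KC KC (lin_ext KC (\<lambda>t. delta (inv\<^bsub>C\<^esub> t)))"
    by (rule linear_map_lin_ext) auto
  show "linear_map KC KC (antipode HC)"
  proof (rule linear_mapI)
    fix a c assume a: "a \<in> carrier KC"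
    show "antipode HC a \<in> carrier KC" unfolding eq[OF a] by (rule linear_map_closed[OF lin a])
    show "antipode HC (c \<odot>\<^bsub>KC\<^esub> a) = c \<odot>\<^bsub>KC\<^esub> antipode HC a"
      unfolding eq[OF a] eq[OF KC.smult_closed[OF a]] by (rule linear_map_smult[OF lin a])
  next
    fix a b assume a: "a \<in> carrier KC" and b: "b \<in> carrier KC"
    show "antipode HC (a \<oplus>\<^bsub>KC\<^esub> b) = antipode HC a \<oplus>\<^bsub>KC\<^esub> antipode HC b"
      unfolding eq[OF a] eq[OF b] eq[OF KC.a_closed[OF a b]] by (rule linear_map_add[OF lin a b])
  qed
  show "t \<in> carrier C \<Longrightarrow> antipode HC (delta t) = delta (inv\<^bsub>C\<^esub> t)"
    by (subst eq) (simp_all add: lin_ext_single)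
qed

lemmas comult_HC_linear = alg_homD(1)[OF comult_HC(1)]
lemmas counit_HC_linear = alg_homD(1)[OF counit_HC(1)]

lemma HC_maps_linear [lin]:
  "linear_map Z KC \<phi> \<Longrightarrow> linear_map Z TC (\<lambda>z. comult HC (\<phi> z))"
  "linear_map Z KC \<phi> \<Longrightarrow> linear_map Z base_alg (\<lambda>z. counit HC (\<phi> z))"
  "linear_map Z KC \<phi> \<Longrightarrow> linear_map Z KC (\<lambda>z. antipode HC (\<phi> z))"
  using linear_map_compose comult_HC_linear counit_HC_linear antipode_HC(1) by blast+

lemma KC_eqI:
  assumes "k_algebra V" "linear_map KC V \<phi>" "linear_map KC V \<psi>" "\<And>t. t \<in> carrier C \<Longrightarrow> \<phi> (delta t) = \<psi> (delta t)"
    "a \<in> carrier KC"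
  shows "\<phi> a = \<psi> a"
  by (rule linear_map_eq_on_monoid_algebra[OF assms(2,3,4,5,1)])

theorem hopf_algebra_HC: "hopf_algebra HC"
proof (rule hopf_algebra.intro[OF k_algebra_HC], rule hopf_algebra_axioms.intro)
  note simps [simp] = comult_HC(2) counit_HC(2) antipode_HC(2) delta_mult_KC
  note cl [simp] = linear_map_closed[OF comult_HC_linear] linear_map_closed[OF antipode_HC(1)]
  note [simp del] = monoid_algebra_simps(1,3,4,5)
  show "alg_hom HC (tensor HC HC) (comult HC)"
    using comult_HC(1) alg_hom_cong[of HC KC TC TC] unfolding tensor_HC by simp
  show "alg_hom HC base_alg (counit HC)"
    using counit_HC(1) alg_hom_cong[of HC KC base_alg base_alg] by simp
  show "linear_map HC HC (antipode HC)"
    using antipode_HC(1) linear_map_cong[of HC KC HC KC] by simp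
  fix u assume "u \<in> carrier HC"
  then have u: "u \<in> carrier KC" by simp
  have V: "k_algebra (tensor KC TC)" by simp
  have b1: "bilinear_map KC KC (tensor KC TC) (\<lambda>a b. pure KC TC a (comult HC b))"
    by (intro bilinear_mapI lin; simp)
  have b2: "bilinear_map KC KC (tensor KC TC) (\<lambda>c d. pure KC TC c (pure KC KC d b))" if "b \<in> carrier KC" for b
    using that by (intro bilinear_mapI lin; simp)
  have b3: "bilinear_map KC KC (tensor KC TC) (\<lambda>a b. tlift (tensor KC TC) (\<lambda>c d. pure KC TC c (pure KC KC d b)) (comult HC a))"
  proof (rule bilinear_mapI)
    fix a assume a: "a \<in> carrier KC"
    show "linear_map KC (tensor KC TC) (\<lambda>b. tlift (tensor KC TC) (\<lambda>c d. pure KC TC c (pure KC KC d b)) (comult HC a))"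
      by (rule TC.tlift_param[OF V k_algebra_KC linear_map_closed[OF comult_HC_linear a] b2], assumption, intro lin, simp_all)
  next
    fix b assume b: "b \<in> carrier KC"
    show "linear_map KC (tensor KC TC) (\<lambda>a. tlift (tensor KC TC) (\<lambda>c d. pure KC TC c (pure KC KC d b)) (comult HC a))"
      by (rule linear_map_tlift[OF k_algebra_KC k_algebra_KC V comult_HC_linear b2[OF b]])
  qed
  have "tlift (tensor KC TC) (\<lambda>a b. pure KC TC a (comult HC b)) (comult HC u) =
      tlift (tensor KC TC) (\<lambda>a b. tlift (tensor KC TC) (\<lambda>c d. pure KC TC c (pure KC KC d b)) (comult HC a)) (comult HC u)"
  proof (rule KC_eqI[OF V _ _ _ u])
    fix t assume "t \<in> carrier C"
    then show "tlift (tensor KC TC) (\<lambda>a b. pure KC TC a (comult HC b)) (comult HC (delta t)) =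
        tlift (tensor KC TC) (\<lambda>a b. tlift (tensor KC TC) (\<lambda>c d. pure KC TC c (pure KC KC d b)) (comult HC a)) (comult HC (delta t))"
      by (simp add: TC.tlift(2)[OF V b1] TC.tlift(2)[OF V b2] TC.tlift(2)[OF V b3])
  qed (rule linear_map_tlift[OF k_algebra_KC k_algebra_KC V comult_HC_linear] b1 b3)+
  then show "tlift (tensor HC (tensor HC HC)) (\<lambda>a b. pure HC (tensor HC HC) a (comult HC b)) (comult HC u) =
    tlift (tensor HC (tensor HC HC)) (\<lambda>a b. tlift (tensor HC (tensor HC HC))
      (\<lambda>c d. pure HC (tensor HC HC) c (pure HC HC d b)) (comult HC a)) (comult HC u)"
    unfolding tensor_HC .
  have b: "bilinear_map KC KC KC (\<lambda>a b. counit HC a \<odot>\<^bsub>KC\<^esub> b)" "bilinear_map KC KC KC (\<lambda>a b. counit HC b \<odot>\<^bsub>KC\<^esub> a)"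
    "bilinear_map KC KC KC (\<lambda>a b. antipode HC a \<otimes>\<^bsub>KC\<^esub> b)" "bilinear_map KC KC KC (\<lambda>a b. a \<otimes>\<^bsub>KC\<^esub> antipode HC b)"
    by (intro bilinear_mapI lin; simp)+
  note bt = linear_map_tlift[OF k_algebra_KC k_algebra_KC k_algebra_KC comult_HC_linear]
  have cl: "linear_map KC KC (\<lambda>u. counit HC u \<odot>\<^bsub>KC\<^esub> \<one>\<^bsub>KC\<^esub>)" by (intro lin; simp)
  show "tlift HC (\<lambda>a b. counit HC a \<odot>\<^bsub>HC\<^esub> b) (comult HC u) = u"
    unfolding tlift_HC group_hopf_simps
    by (rule KC_eqI[OF k_algebra_KC bt[OF b(1)] linear_map_id _ u]) (simp add: TC.tlift(2)[OF k_algebra_KC b(1)])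
  show "tlift HC (\<lambda>a b. counit HC b \<odot>\<^bsub>HC\<^esub> a) (comult HC u) = u"
    unfolding tlift_HC group_hopf_simps
    by (rule KC_eqI[OF k_algebra_KC bt[OF b(2)] linear_map_id _ u]) (simp add: TC.tlift(2)[OF k_algebra_KC b(2)])
  show "tlift HC (\<lambda>a b. antipode HC a \<otimes>\<^bsub>HC\<^esub> b) (comult HC u) = counit HC u \<odot>\<^bsub>HC\<^esub> \<one>\<^bsub>HC\<^esub>"
    unfolding tlift_HC group_hopf_simps
    by (rule KC_eqI[OF k_algebra_KC bt[OF b(3)] cl _ u]) (simp add: TC.tlift(2)[OF k_algebra_KC b(3)])
  show "tlift HC (\<lambda>a b. a \<otimes>\<^bsub>HC\<^esub> antipode HC b) (comult HC u) = counit HC u \<odot>\<^bsub>HC\<^esub> \<one>\<^bsub>HC\<^esub>"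
    unfolding tlift_HC group_hopf_simps
    by (rule KC_eqI[OF k_algebra_KC bt[OF b(4)] cl _ u]) (simp add: TC.tlift(2)[OF k_algebra_KC b(4)])
qed

end

section \<open>Matched pairs\<close>

lemma tlift_inner_pure:
  assumes A: "k_algebra A" "k_algebra B" and A': "k_algebra A'" "k_algebra B'" and V: "k_algebra V"
    and X: "X \<in> carrier (tensor A B)" and ab: "a \<in> carrier A'" "b \<in> carrier B'"
    and in_bilin: "\<And>u v. u \<in> carrier A \<Longrightarrow> v \<in> carrier B \<Longrightarrow> bilinear_map A' B' V (\<beta> u v)"
    and out_bilin: "bilinear_map A B V (\<lambda>u v. \<beta> u v a b)"
  shows "tlift V (\<lambda>u v. tlift V (\<beta> u v) (pure A' B' a b)) X = tlift V (\<lambda>u v. \<beta> u v a b) X"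
proof -
  interpret AB: tensor_pair A B using A by (rule tensor_pair.intro)
  interpret AB': tensor_pair A' B' using A' by (rule tensor_pair.intro)
  show ?thesis
    by (rule AB.tlift_cong[OF X V out_bilin, symmetric]) (simp add: AB'.tlift(2)[OF V in_bilin] ab)
qed

lemma tlift_post:
  assumes A: "k_algebra A" "k_algebra B" and V: "k_algebra V" "k_algebra V'"
    and X: "X \<in> carrier (tensor A B)" and \<beta>: "bilinear_map A B V \<beta>" and L: "linear_map V V' L"
  shows "L (tlift V \<beta> X) = tlift V' (\<lambda>a b. L (\<beta> a b)) X"
proof -
  interpret AB: tensor_pair A B using A by (rule tensor_pair.intro)
  have b: "bilinear_map A B V' (\<lambda>a b. L (\<beta> a b))"
    by (intro bilinear_mapI linear_map_compose[OF _ L] bilinear_mapD[OF \<beta>])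
  show ?thesis
    by (rule AB.linear_map_eq_on_tensor[OF linear_map_compose[OF AB.tlift(1)[OF V(1) \<beta>] L] AB.tlift(1)[OF V(2) b] _ X])
       (simp add: AB.tlift(2)[OF V(1) \<beta>] AB.tlift(2)[OF V(2) b])
qed

lemma nested_tlift_bilinear:
  assumes A: "k_algebra A" "k_algebra B" and A': "k_algebra A'" "k_algebra B'" and V: "k_algebra V"
    and Y: "Y \<in> carrier (tensor A' B')"
    and b1: "\<And>u v. u \<in> carrier A \<Longrightarrow> v \<in> carrier B \<Longrightarrow> bilinear_map A' B' V (\<beta> u v)"
    and b2: "\<And>a b. a \<in> carrier A' \<Longrightarrow> b \<in> carrier B' \<Longrightarrow> bilinear_map A B V (\<lambda>u v. \<beta> u v a b)"
  shows "bilinear_map A B V (\<lambda>u v. tlift V (\<beta> u v) Y)"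
proof (rule bilinear_mapI)
  interpret AB': tensor_pair A' B' using A' by (rule tensor_pair.intro)
  show "linear_map B V (\<lambda>v. tlift V (\<beta> u v) Y)" if "u \<in> carrier A" for u
    by (rule AB'.tlift_param[OF V A(2) Y b1[OF that]]) (simp_all add: bilinear_mapD(1)[OF b2] that)
  show "linear_map A V (\<lambda>u. tlift V (\<beta> u v) Y)" if "v \<in> carrier B" for v
    by (rule AB'.tlift_param[OF V A(1) Y b1[OF _ that]]) (simp_all add: bilinear_mapD(2)[OF b2] that)
qed

lemma nested_tlift_linear:
  assumes A: "k_algebra A" "k_algebra B" and A': "k_algebra A'" "k_algebra B'" and V: "k_algebra V"
    and Z: "k_algebra Z" and X: "X \<in> carrier (tensor A B)" and \<psi>: "linear_map Z (tensor A' B') \<psi>"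
    and b1: "\<And>u v. u \<in> carrier A \<Longrightarrow> v \<in> carrier B \<Longrightarrow> bilinear_map A' B' V (\<beta> u v)"
    and b2: "\<And>a b. a \<in> carrier A' \<Longrightarrow> b \<in> carrier B' \<Longrightarrow> bilinear_map A B V (\<lambda>u v. \<beta> u v a b)"
  shows "linear_map Z V (\<lambda>z. tlift V (\<lambda>u v. tlift V (\<beta> u v) (\<psi> z)) X)"
proof -
  interpret AB: tensor_pair A B using A by (rule tensor_pair.intro)
  show ?thesis
    by (rule AB.tlift_param[OF V Z X])
       (simp_all add: nested_tlift_bilinear[OF A A' V _ b1 b2] linear_map_closed[OF \<psi>]
        linear_map_tlift[OF A' V \<psi> b1])
qed

locale third_with_group = third_type G g f + group_Hopf C "TYPE('k)"
  for G :: "('g, 'm) monoid_scheme" (structure) and g and f :: "'g \<Rightarrow> 'k::field"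
    and C :: "('c, 'n) monoid_scheme"
begin

lemma mixed_tensor: "tensor H HC = tensor A KC" "pure H HC = pure A KC" "tensor HC H = tensor KC A" "pure HC H = pure KC A"
  by (rule tensor_cong tensor_cong_linear(2); simp)+

sublocale AC: tensor_pair A KC
  by (rule tensor_pair.intro) simp_all

sublocale W: tensor_pair KC A
  by (rule tensor_pair.intro) simp_all

lemma k_algebra_AC [simp]: "k_algebra (tensor A KC)" and k_algebra_W [simp]: "k_algebra (tensor KC A)"
  by simp_all

lemma lookup_linear [lin]: "linear_map KC base_alg (\<lambda>a. Poly_Mapping.lookup a s)"
  by (rule linear_mapI) (simp_all add: lookup_add)

end

locale third_matched_pair = third_with_group G g f C + M: matched_pair "group_hopf C" "third_hopf G g f" lact ract
  for G :: "('g, 'm) monoid_scheme" (structure) and g and f :: "'g \<Rightarrow> 'k::field"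
    and C :: "('c, 'n) monoid_scheme" and lact ract +
  assumes g_generates: "\<And>t. t \<in> carrier G \<Longrightarrow> \<exists>j::nat. t = g [^] j"
begin

lemma lact_bilinear: "bilinear_map A KC KC lact"
  using M.l.act_bilinear bilinear_map_cong[of H A HC KC HC KC] by simp

lemma ract_bilinear: "bilinear_map A KC A ract"
  using M.r.act_bilinear bilinear_map_cong[of H A HC KC H A] by simp

lemmas lact_closed [simp] = bilinear_map_closed[OF lact_bilinear]
lemmas ract_closed [simp] = bilinear_map_closed[OF ract_bilinear]
lemmas act_lin [lin] = bilinear_map_linear_comp[OF lact_bilinear] bilinear_map_linear_comp[OF ract_bilinear]
lemmas ract_add = linear_map_add[OF bilinear_mapD(2)[OF ract_bilinear]]
lemmas ract_smult = linear_map_smult[OF bilinear_mapD(2)[OF ract_bilinear]]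

declare monoid_algebra_simps [simp del]

lemma KC_simps [simp]: "\<one>\<^bsub>KC\<^esub> = delta \<one>\<^bsub>C\<^esub>" "delta s \<otimes>\<^bsub>KC\<^esub> delta t = delta (s \<otimes>\<^bsub>C\<^esub> t)"
  by (simp_all add: monoid_algebra_simps delta_mult_KC)

lemma ract_one: "u \<in> carrier A \<Longrightarrow> ract u (delta \<one>\<^bsub>C\<^esub>) = u"
  using M.r.act_one[of u] by simp

lemma ract_delta_mult: "u \<in> carrier A \<Longrightarrow> s \<in> carrier C \<Longrightarrow> t \<in> carrier C \<Longrightarrow>
    ract u (delta (s \<otimes>\<^bsub>C\<^esub> t)) = ract (ract u (delta s)) (delta t)"
  using M.r.act_mult[of u "delta s" "delta t"] by simp

lemma ract_inv: "u \<in> carrier A \<Longrightarrow> t \<in> carrier C \<Longrightarrow> ract (ract u (delta t)) (delta (inv\<^bsub>C\<^esub> t)) = u"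
  using ract_delta_mult[of u t "inv\<^bsub>C\<^esub> t"] by (simp add: ract_one)

lemma lact_unit_1: "a \<in> carrier KC \<Longrightarrow> lact \<one>\<^bsub>A\<^esub> a = a"
  using M.l.act_one[of a] by simp

lemma ract_unit: "t \<in> carrier C \<Longrightarrow> ract \<one>\<^bsub>A\<^esub> (delta t) = \<one>\<^bsub>A\<^esub>"
  using M.ract_unit[of "delta t"] by (simp add: counit_HC)

lemma one_ne_g: "\<one> \<noteq> g"
proof
  assume "\<one> = g"
  then have "f \<one> = f g" by (rule arg_cong)
  then show False by simp
qed

text \<open>Only the comultiplication of \<open>x\<close> contributes more than one term to the compatibility axiom here, as
  \<open>t\<close> is group-like.\<close>

lemma compat_x:
  assumes t: "t \<in> carrier C"
  shows "pure A KC (ract x (delta t)) (delta t) \<oplus>\<^bsub>tensor A KC\<^esub> pure A KC (ract (e g) (delta t)) (lact x (delta t)) =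
    pure A KC \<one>\<^bsub>A\<^esub> (lact x (delta t)) \<oplus>\<^bsub>tensor A KC\<^esub> pure A KC (ract x (delta t)) (lact (e g) (delta t))"
proof -
  let ?V = "tensor A KC" and ?d = "delta t :: 'c \<Rightarrow>\<^sub>0 'k"
  let ?b = "\<lambda>u1 u2 a1 a2. pure A KC (ract u1 a1) (lact u2 a2)"
  let ?b' = "\<lambda>u1 u2 a1 a2. pure A KC (ract u2 a2) (lact u1 a1)"
  have d: "?d \<in> carrier KC" using t by simp
  have inb: "bilinear_map KC KC ?V (?b u1 u2)" "bilinear_map KC KC ?V (?b' u1 u2)"
    if "u1 \<in> carrier A" "u2 \<in> carrier A" for u1 u2
    using that by (intro bilinear_mapI lin; simp)+
  have outb: "bilinear_map A A ?V (\<lambda>u1 u2. ?b u1 u2 ?d ?d)" "bilinear_map A A ?V (\<lambda>u1 u2. ?b' u1 u2 ?d ?d)"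
    using d by (intro bilinear_mapI lin; simp)+
  note ip = tlift_inner_pure[OF k_algebra_A k_algebra_A k_algebra_KC k_algebra_KC k_algebra_AC comult_closed[OF x_closed] d d]
  have "tlift ?V (\<lambda>u1 u2. ?b u1 u2 ?d ?d) (\<Delta> x) = tlift ?V (\<lambda>u1 u2. ?b' u1 u2 ?d ?d) (\<Delta> x)"
    using M.actions_compat[of x ?d] d ip[OF inb(1) outb(1)] ip[OF inb(2) outb(2)]
    by (simp add: mixed_tensor comult_HC(2)[OF t])
  then show ?thesis
    using t by (simp add: comult_H(3) linear_map_add[OF T.tlift(1)[OF k_algebra_AC outb(1)]]
      linear_map_add[OF T.tlift(1)[OF k_algebra_AC outb(2)]] T.tlift(2)[OF k_algebra_AC outb(1)]
      T.tlift(2)[OF k_algebra_AC outb(2)] lact_unit_1 ract_unit)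
qed

text \<open>Apply the coordinate at \<open>s\<close> to the second factor of \<open>compat_x\<close> and let the inverse of \<open>t\<close> act on the
  first one. The result is a relation between \<open>x\<close>, \<open>e g\<close> and \<open>1\<close>. Its coefficients at \<open>x\<close> give the first
  claim and those at \<open>e g\<close> the second one, for all \<open>s\<close>.\<close>

lemma lact_generators:
  assumes t: "t \<in> carrier C"
  shows "lact (e g) (delta t) = delta t" "lact x (delta t) = \<zero>\<^bsub>KC\<^esub>"
proof -
  let ?d = "delta t :: 'c \<Rightarrow>\<^sub>0 'k"
  let ?i = "delta (inv\<^bsub>C\<^esub> t) :: 'c \<Rightarrow>\<^sub>0 'k"
  let ?l = "Poly_Mapping.lookup"
  have contract: "?l ?d s \<odot>\<^bsub>A\<^esub> ract x ?d \<oplus>\<^bsub>A\<^esub> ?l (lact x ?d) s \<odot>\<^bsub>A\<^esub> ract (e g) ?d =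
      ?l (lact x ?d) s \<odot>\<^bsub>A\<^esub> \<one>\<^bsub>A\<^esub> \<oplus>\<^bsub>A\<^esub> ?l (lact (e g) ?d) s \<odot>\<^bsub>A\<^esub> ract x ?d" for s
  proof -
    have b: "bilinear_map A KC A (\<lambda>u a. ?l a s \<odot>\<^bsub>A\<^esub> u)"
      by (intro bilinear_mapI lin; simp)
    show ?thesis
      using arg_cong[OF compat_x[OF t], of "tlift A (\<lambda>u a. ?l a s \<odot>\<^bsub>A\<^esub> u)"] t
      by (simp add: linear_map_add[OF AC.tlift(1)[OF k_algebra_A b]] AC.tlift(2)[OF k_algebra_A b])
  qed
  have act: "?l ?d s \<odot>\<^bsub>A\<^esub> x \<oplus>\<^bsub>A\<^esub> ?l (lact x ?d) s \<odot>\<^bsub>A\<^esub> e g =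
      ?l (lact x ?d) s \<odot>\<^bsub>A\<^esub> \<one>\<^bsub>A\<^esub> \<oplus>\<^bsub>A\<^esub> ?l (lact (e g) ?d) s \<odot>\<^bsub>A\<^esub> x" for s
    using arg_cong[OF contract[of s], of "\<lambda>u. ract u ?i"] t
    by (simp add: ract_add ract_smult ract_inv ract_unit)
  have c: "coord r m (?l ?d s \<odot>\<^bsub>A\<^esub> x \<oplus>\<^bsub>A\<^esub> ?l (lact x ?d) s \<odot>\<^bsub>A\<^esub> e g) =
      coord r m (?l (lact x ?d) s \<odot>\<^bsub>A\<^esub> e \<one> \<oplus>\<^bsub>A\<^esub> ?l (lact (e g) ?d) s \<odot>\<^bsub>A\<^esub> x)" for r m s
    using act[of s] by (simp add: e_one)
  have "?l ?d s = ?l (lact (e g) ?d) s" for s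
    using c[of \<one> 1 s] CHAR_gt_1
    by (simp add: linear_map_add[OF coord_linear] linear_map_smult[OF coord_linear] coord_x coord_e)
  then show "lact (e g) ?d = ?d" by (intro poly_mapping_eqI) simp
  have "?l (lact x ?d) s = 0" for s
    using c[of g 0 s] p_pos one_ne_g
    by (simp add: linear_map_add[OF coord_linear] linear_map_smult[OF coord_linear] coord_x coord_e)
  then show "lact x ?d = \<zero>\<^bsub>KC\<^esub>" by (intro poly_mapping_eqI) (simp add: monoid_algebra_simps)
qed

theorem lact_trivial:
  assumes u: "u \<in> carrier A" and a: "a \<in> carrier KC"
  shows "lact u a = eps u \<odot>\<^bsub>KC\<^esub> a"
proof -
  have l_mult: "lact (u \<otimes>\<^bsub>A\<^esub> v) a = lact u (lact v a)"
    if "u \<in> carrier A" "v \<in> carrier A" "a \<in> carrier KC" for u v a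
    using M.l.act_mult[of u v a] that by simp
  have pow: "lact (e (g [^] (j::nat))) (delta t) = delta t" if t: "t \<in> carrier C" for j t
  proof (induction j)
    case 0
    then show ?case using t by (simp add: e_one lact_unit_1)
  next
    case (Suc j)
    then show ?case using t by (simp add: e_mult l_mult lact_generators)
  qed
  have delta: "lact u (delta t) = eps u \<odot>\<^bsub>KC\<^esub> delta t" if t: "t \<in> carrier C" for t
    using u
  proof (induction rule: third_induct_left)
    case one
    then show ?case using t by (simp add: lact_unit_1 alg_homD(3)[OF counit_H(1)])
  next
    case (elt s u)
    obtain j :: nat where s: "s = g [^] j" using g_generates elt by blast
    have "lact (e s \<otimes>\<^bsub>A\<^esub> u) (delta t) = eps u \<odot>\<^bsub>KC\<^esub> lact (e s) (delta t)"
      using elt t linear_map_smult[OF bilinear_mapD(1)[OF lact_bilinear]] by (simp add: l_mult)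
    then show ?case
      using elt pow[OF t] by (simp add: s alg_homD(2)[OF counit_H(1)] counit_H)
  next
    case (gen u)
    then show ?case
      using t linear_map_smult[OF bilinear_mapD(1)[OF lact_bilinear]]
      by (simp add: l_mult lact_generators alg_homD(2)[OF counit_H(1)] counit_H)
  next
    case (add u v)
    then show ?case
      using t linear_map_add[OF bilinear_mapD(2)[OF lact_bilinear]]
      by (simp add: linear_map_add[OF counit_linear] KC.smult_add_left)
  next
    case (smult c u)
    then show ?case
      using t linear_map_smult[OF bilinear_mapD(2)[OF lact_bilinear]]
      by (simp add: linear_map_smult[OF counit_linear] KC.smult_smult)
  qed
  show ?thesis
    by (rule KC_eqI[OF k_algebra_KC bilinear_mapD(1)[OF lact_bilinear u] linear_map_smult_const[OF k_algebra_KC linear_map_id] delta a])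
qed

text \<open>For a trivial left action the rule for \<open>(u v) \<triangleleft> t\<close> in a matched pair collapses to multiplicativity, by
  the counit axiom.\<close>

lemma ract_alg_hom:
  assumes t: "t \<in> carrier C"
  shows "alg_hom A A (\<lambda>u. ract u (delta t))"
proof (rule alg_homI)
  let ?d = "delta t :: 'c \<Rightarrow>\<^sub>0 'k"
  have d: "?d \<in> carrier KC" using t by simp
  show "linear_map A A (\<lambda>u. ract u ?d)" by (rule bilinear_mapD(2)[OF ract_bilinear d])
  show "ract \<one>\<^bsub>A\<^esub> ?d = \<one>\<^bsub>A\<^esub>" by (rule ract_unit[OF t])
  fix u v assume u: "u \<in> carrier A" and v: "v \<in> carrier A"
  let ?b = "\<lambda>v1 v2 a1 a2. ract u (lact v1 a1) \<otimes>\<^bsub>A\<^esub> ract v2 a2"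
  have inb: "bilinear_map KC KC A (?b v1 v2)" if "v1 \<in> carrier A" "v2 \<in> carrier A" for v1 v2
    using that u by (intro bilinear_mapI lin; simp)
  have outb: "bilinear_map A A A (\<lambda>v1 v2. ?b v1 v2 ?d ?d)"
    using d u by (intro bilinear_mapI lin; simp)
  have cb: "bilinear_map A A A (\<lambda>v1 v2. eps v1 \<odot>\<^bsub>A\<^esub> v2)"
    by (intro bilinear_mapI lin; simp)
  have L: "linear_map A A (\<lambda>w. ract u ?d \<otimes>\<^bsub>A\<^esub> ract w ?d)"
    using d u by (intro lin; simp)
  have "ract (u \<otimes>\<^bsub>A\<^esub> v) ?d = tlift A (\<lambda>v1 v2. tlift A (?b v1 v2) (pure KC KC ?d ?d)) (\<Delta> v)"
    using M.ract_mult[of u v ?d] u v d by (simp add: tlift_H comult_HC(2)[OF t])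
  also have "\<dots> = tlift A (\<lambda>v1 v2. ?b v1 v2 ?d ?d) (\<Delta> v)"
    by (rule tlift_inner_pure[OF k_algebra_A k_algebra_A k_algebra_KC k_algebra_KC k_algebra_A comult_closed[OF v] d d inb outb])
  also have "\<dots> = tlift A (\<lambda>v1 v2. ract u ?d \<otimes>\<^bsub>A\<^esub> ract (eps v1 \<odot>\<^bsub>A\<^esub> v2) ?d) (\<Delta> v)"
    by (rule T.tlift_cong[OF comult_closed[OF v] k_algebra_A outb])
       (use d u linear_map_smult[OF bilinear_mapD(1)[OF ract_bilinear u]] in
         \<open>simp add: lact_trivial ract_smult A.smult_mult_left A.smult_mult_right\<close>)
  also have "\<dots> = ract u ?d \<otimes>\<^bsub>A\<^esub> ract (tlift A (\<lambda>v1 v2. eps v1 \<odot>\<^bsub>A\<^esub> v2) (\<Delta> v)) ?d"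
    by (rule tlift_post[OF k_algebra_A k_algebra_A k_algebra_A k_algebra_A comult_closed[OF v] cb L, symmetric])
  also have "\<dots> = ract u ?d \<otimes>\<^bsub>A\<^esub> ract v ?d" by (simp only: counit_left_A[OF v])
  finally show "ract (u \<otimes>\<^bsub>A\<^esub> v) ?d = ract u ?d \<otimes>\<^bsub>A\<^esub> ract v ?d" .
qed

lemma ract_comult:
  assumes t: "t \<in> carrier C" and u: "u \<in> carrier A"
  shows "\<Delta> (ract u (delta t)) = tlift T (\<lambda>a b. pure A A (ract a (delta t)) (ract b (delta t))) (\<Delta> u)"
proof -
  let ?d = "delta t :: 'c \<Rightarrow>\<^sub>0 'k"
  let ?b = "\<lambda>u1 u2 a1 a2. pure A A (ract u1 a1) (ract u2 a2)"
  have d: "?d \<in> carrier KC" using t by simp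
  have inb: "bilinear_map KC KC T (?b v1 v2)" if "v1 \<in> carrier A" "v2 \<in> carrier A" for v1 v2
    using that u by (intro bilinear_mapI lin; simp)
  have outb: "bilinear_map A A T (\<lambda>v1 v2. ?b v1 v2 ?d ?d)"
    using d u by (intro bilinear_mapI lin; simp)
  have "\<Delta> (ract u ?d) = tlift T (\<lambda>v1 v2. tlift T (?b v1 v2) (pure KC KC ?d ?d)) (\<Delta> u)"
    using M.r.act_comult[of u ?d] u d by (simp add: tensor_H comult_HC(2)[OF t])
  also have "\<dots> = tlift T (\<lambda>v1 v2. ?b v1 v2 ?d ?d) (\<Delta> u)"
    by (rule tlift_inner_pure[OF k_algebra_A k_algebra_A k_algebra_KC k_algebra_KC k_algebra_T comult_closed[OF u] d d inb outb])
  finally show ?thesis .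
qed

text \<open>A group element acts by a Hopf automorphism, so it sends \<open>g\<close> to a group-like element and \<open>x\<close>
  to a skew primitive one; the classification of these elements leaves one parameter.\<close>

theorem ract_form:
  assumes t: "t \<in> carrier C"
  obtains c where "ract (e g) (delta t) = e g" "ract x (delta t) = x \<oplus>\<^bsub>A\<^esub> c \<odot>\<^bsub>A\<^esub> (\<one>\<^bsub>A\<^esub> \<ominus>\<^bsub>A\<^esub> e g)"
proof -
  let ?d = "delta t :: 'c \<Rightarrow>\<^sub>0 'k"
  let ?i = "delta (inv\<^bsub>C\<^esub> t) :: 'c \<Rightarrow>\<^sub>0 'k"
  let ?\<phi> = "\<lambda>u. ract u ?d"
  have d: "?d \<in> carrier KC" "?i \<in> carrier KC" using t by simp_all
  note h = alg_homD[OF ract_alg_hom[OF t]]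
  have outb: "bilinear_map A A T (\<lambda>a b. pure A A (?\<phi> a) (?\<phi> b))"
    using d by (intro bilinear_mapI lin; simp)
  have "\<Delta> (?\<phi> (e g)) = pure A A (?\<phi> (e g)) (?\<phi> (e g))"
    by (simp add: ract_comult[OF t] comult_H(2) T.tlift(2)[OF k_algebra_T outb])
  moreover have "?\<phi> (e g) \<noteq> \<zero>\<^bsub>A\<^esub>"
  proof
    assume "?\<phi> (e g) = \<zero>\<^bsub>A\<^esub>"
    then have "e g = \<zero>\<^bsub>A\<^esub>"
      using ract_inv[OF e_closed[OF g_closed] t] linear_map_zero[OF bilinear_mapD(2)[OF ract_bilinear d(2)] k_algebra_A k_algebra_A] by simp
    then show False using coord_e[OF g_closed p_pos, of g] by simp
  qed
  ultimately obtain r where r: "r \<in> carrier G" "?\<phi> (e g) = e r"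
    using grouplike_imp_elt[of "?\<phi> (e g)"] d by auto
  have "\<Delta> (?\<phi> x) = pure A A (?\<phi> x) \<one>\<^bsub>A\<^esub> \<oplus>\<^bsub>T\<^esub> pure A A (e r) (?\<phi> x)"
    by (simp add: ract_comult[OF t] comult_H(3) linear_map_add[OF T.tlift(1)[OF k_algebra_T outb]]
      T.tlift(2)[OF k_algebra_T outb] r h(3))
  then obtain a b where ab: "?\<phi> x = a \<odot>\<^bsub>A\<^esub> x \<oplus>\<^bsub>A\<^esub> b \<odot>\<^bsub>A\<^esub> (\<one>\<^bsub>A\<^esub> \<ominus>\<^bsub>A\<^esub> e r)" "a \<noteq> 0 \<Longrightarrow> r = g"
    using skew_primitive_form[of "?\<phi> x" r] d r by auto
  have r_back: "ract (e r) ?i = e g" using ract_inv[OF e_closed[OF g_closed] t] r by simp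
  have "x = a \<odot>\<^bsub>A\<^esub> ract x ?i \<oplus>\<^bsub>A\<^esub> b \<odot>\<^bsub>A\<^esub> (\<one>\<^bsub>A\<^esub> \<ominus>\<^bsub>A\<^esub> e g)"
    using ract_inv[OF x_closed t] r d t
    by (simp add: ab(1) ract_add ract_smult r_back ract_unit
      linear_map_minus[OF bilinear_mapD(2)[OF ract_bilinear d(2)] k_algebra_A k_algebra_A])
  then have "coord \<one> 1 x = coord \<one> 1 (a \<odot>\<^bsub>A\<^esub> ract x ?i \<oplus>\<^bsub>A\<^esub> b \<odot>\<^bsub>A\<^esub> (\<one>\<^bsub>A\<^esub> \<ominus>\<^bsub>A\<^esub> e g))" by (rule arg_cong)
  then have "1 = a * coord \<one> 1 (ract x ?i)"
    using CHAR_gt_1 d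
    by (simp add: linear_map_add[OF coord_linear] linear_map_smult[OF coord_linear] coord_x coord_e e_one[symmetric]
        linear_map_minus[OF coord_linear k_algebra_A k_algebra_base_alg])
  then have rg: "r = g" using ab(2) by (metis mult_zero_left zero_neq_one)
  have gg: "g \<otimes> g \<noteq> g" using one_ne_g by auto
  \<comment> \<open>The relation between \<open>g\<close> and \<open>x\<close> is inhomogeneous and so fixes the leading coefficient.\<close>
  have y: "e g \<otimes>\<^bsub>A\<^esub> (\<one>\<^bsub>A\<^esub> \<ominus>\<^bsub>A\<^esub> e g) = (\<one>\<^bsub>A\<^esub> \<ominus>\<^bsub>A\<^esub> e g) \<otimes>\<^bsub>A\<^esub> e g"
    by (simp add: A.minus_eq_smult A.l_distr A.r_distr A.smult_mult_left A.smult_mult_right)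
  have "?\<phi> (e g \<otimes>\<^bsub>A\<^esub> x) = ?\<phi> (x \<otimes>\<^bsub>A\<^esub> e g \<oplus>\<^bsub>A\<^esub> (e g \<otimes>\<^bsub>A\<^esub> (\<one>\<^bsub>A\<^esub> \<ominus>\<^bsub>A\<^esub> e g)))"
    using e_x[OF g_closed] by simp
  then have "e g \<otimes>\<^bsub>A\<^esub> ?\<phi> x = ?\<phi> x \<otimes>\<^bsub>A\<^esub> e g \<oplus>\<^bsub>A\<^esub> (e g \<otimes>\<^bsub>A\<^esub> (\<one>\<^bsub>A\<^esub> \<ominus>\<^bsub>A\<^esub> e g))"
    by (simp add: h(2) linear_map_add[OF h(1)] r(2) rg h(3) linear_map_minus[OF h(1) k_algebra_A k_algebra_A])
  then have "a \<odot>\<^bsub>A\<^esub> (e g \<otimes>\<^bsub>A\<^esub> x) \<oplus>\<^bsub>A\<^esub> b \<odot>\<^bsub>A\<^esub> (e g \<otimes>\<^bsub>A\<^esub> (\<one>\<^bsub>A\<^esub> \<ominus>\<^bsub>A\<^esub> e g)) =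
     (a \<odot>\<^bsub>A\<^esub> (x \<otimes>\<^bsub>A\<^esub> e g) \<oplus>\<^bsub>A\<^esub> (e g \<otimes>\<^bsub>A\<^esub> (\<one>\<^bsub>A\<^esub> \<ominus>\<^bsub>A\<^esub> e g))) \<oplus>\<^bsub>A\<^esub> b \<odot>\<^bsub>A\<^esub> (e g \<otimes>\<^bsub>A\<^esub> (\<one>\<^bsub>A\<^esub> \<ominus>\<^bsub>A\<^esub> e g))"
    unfolding ab(1) rg
    by (simp add: A.r_distr A.l_distr A.smult_mult_left A.smult_mult_right y[symmetric] A.a_ac)
  then have "a \<odot>\<^bsub>A\<^esub> (e g \<otimes>\<^bsub>A\<^esub> x) = a \<odot>\<^bsub>A\<^esub> (x \<otimes>\<^bsub>A\<^esub> e g) \<oplus>\<^bsub>A\<^esub> (e g \<otimes>\<^bsub>A\<^esub> (\<one>\<^bsub>A\<^esub> \<ominus>\<^bsub>A\<^esub> e g))"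
    by (subst (asm) A.add.right_cancel) simp_all
  then have "a \<odot>\<^bsub>A\<^esub> (x \<otimes>\<^bsub>A\<^esub> e g) \<oplus>\<^bsub>A\<^esub> a \<odot>\<^bsub>A\<^esub> (e g \<otimes>\<^bsub>A\<^esub> (\<one>\<^bsub>A\<^esub> \<ominus>\<^bsub>A\<^esub> e g)) = a \<odot>\<^bsub>A\<^esub> (x \<otimes>\<^bsub>A\<^esub> e g) \<oplus>\<^bsub>A\<^esub> (e g \<otimes>\<^bsub>A\<^esub> (\<one>\<^bsub>A\<^esub> \<ominus>\<^bsub>A\<^esub> e g))"
    unfolding e_x[OF g_closed] by (simp add: A.smult_add_right)
  then have "a \<odot>\<^bsub>A\<^esub> (e g \<otimes>\<^bsub>A\<^esub> (\<one>\<^bsub>A\<^esub> \<ominus>\<^bsub>A\<^esub> e g)) = e g \<otimes>\<^bsub>A\<^esub> (\<one>\<^bsub>A\<^esub> \<ominus>\<^bsub>A\<^esub> e g)"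
    by simp
  then have "coord g 0 (a \<odot>\<^bsub>A\<^esub> (e g \<otimes>\<^bsub>A\<^esub> (\<one>\<^bsub>A\<^esub> \<ominus>\<^bsub>A\<^esub> e g))) = coord g 0 (e g \<otimes>\<^bsub>A\<^esub> (\<one>\<^bsub>A\<^esub> \<ominus>\<^bsub>A\<^esub> e g))" by (rule arg_cong)
  then have "a = 1"
    using gg p_pos
    by (simp add: linear_map_smult[OF coord_linear] A.minus_eq_smult A.r_distr A.smult_mult_right e_mult[symmetric]
      linear_map_add[OF coord_linear] coord_e)
  then show thesis using that[of b] ab(1) r rg by simp
qed

lemma ract_elt:
  assumes t: "t \<in> carrier C" and s: "s \<in> carrier G"
  shows "ract (e s) (delta t) = e s"
proof -
  obtain j :: nat where j: "s = g [^] j" using g_generates s by blast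
  have "ract (e (g [^] j)) (delta t) = e (g [^] j)" for j :: nat
  proof (induction j)
    case 0
    then show ?case using t by (simp add: e_one ract_unit)
  next
    case (Suc j)
    then show ?case
      using ract_form[OF t] by (metis G.nat_pow_Suc G.nat_pow_closed alg_homD(2)[OF ract_alg_hom[OF t]] e_closed e_mult g_closed)
  qed
  then show ?thesis by (simp add: j)
qed

lemma ract_pow:
  assumes h: "h \<in> carrier C" and a: "ract x (delta h) = x \<oplus>\<^bsub>A\<^esub> \<alpha> \<odot>\<^bsub>A\<^esub> (\<one>\<^bsub>A\<^esub> \<ominus>\<^bsub>A\<^esub> e g)"
  shows "ract x (delta (h [^]\<^bsub>C\<^esub> (i::nat))) = x \<oplus>\<^bsub>A\<^esub> (of_nat i * \<alpha>) \<odot>\<^bsub>A\<^esub> (\<one>\<^bsub>A\<^esub> \<ominus>\<^bsub>A\<^esub> e g)"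
proof (induction i)
  case 0
  then show ?case by (simp add: ract_one)
next
  case (Suc i)
  have y: "ract (\<one>\<^bsub>A\<^esub> \<ominus>\<^bsub>A\<^esub> e g) (delta h) = \<one>\<^bsub>A\<^esub> \<ominus>\<^bsub>A\<^esub> e g"
    using h by (simp add: linear_map_minus[OF bilinear_mapD(2)[OF ract_bilinear] k_algebra_A k_algebra_A] ract_unit ract_elt)
  have "ract x (delta (h [^]\<^bsub>C\<^esub> Suc i)) = ract (x \<oplus>\<^bsub>A\<^esub> (of_nat i * \<alpha>) \<odot>\<^bsub>A\<^esub> (\<one>\<^bsub>A\<^esub> \<ominus>\<^bsub>A\<^esub> e g)) (delta h)"
    using h Suc by (simp add: ract_delta_mult)
  also have "\<dots> = (x \<oplus>\<^bsub>A\<^esub> \<alpha> \<odot>\<^bsub>A\<^esub> (\<one>\<^bsub>A\<^esub> \<ominus>\<^bsub>A\<^esub> e g)) \<oplus>\<^bsub>A\<^esub> (of_nat i * \<alpha>) \<odot>\<^bsub>A\<^esub> (\<one>\<^bsub>A\<^esub> \<ominus>\<^bsub>A\<^esub> e g)"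
    using h by (simp add: ract_add ract_smult y a)
  also have "\<dots> = x \<oplus>\<^bsub>A\<^esub> (of_nat (Suc i) * \<alpha>) \<odot>\<^bsub>A\<^esub> (\<one>\<^bsub>A\<^esub> \<ominus>\<^bsub>A\<^esub> e g)"
    by (simp add: A.a_assoc A.smult_add_left[symmetric] algebra_simps)
  finally show ?case .
qed

lemma ract_unique:
  assumes t: "t \<in> carrier C" and a: "ract x (delta t) = x \<oplus>\<^bsub>A\<^esub> c \<odot>\<^bsub>A\<^esub> (\<one>\<^bsub>A\<^esub> \<ominus>\<^bsub>A\<^esub> e g)" and c: "shift_ok c"
    and u: "u \<in> carrier A"
  shows "ract u (delta t) = shift c u"
  by (rule third_alg_hom_eqI[OF ract_alg_hom[OF t] shift(1)[OF c] _ _ u]) (simp_all add: t ract_elt shift c a)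

text \<open>The unit of \<open>C\<close> acts trivially, and the coordinate of \<open>1 - g\<close> at \<open>g\<close> is not zero.\<close>

lemma parameter_torsion:
  assumes h: "h \<in> carrier C" and a: "ract x (delta h) = x \<oplus>\<^bsub>A\<^esub> \<alpha> \<odot>\<^bsub>A\<^esub> (\<one>\<^bsub>A\<^esub> \<ominus>\<^bsub>A\<^esub> e g)" and n: "h [^]\<^bsub>C\<^esub> (n::nat) = \<one>\<^bsub>C\<^esub>"
  shows "of_nat n * \<alpha> = 0"
proof -
  have "x = x \<oplus>\<^bsub>A\<^esub> (of_nat n * \<alpha>) \<odot>\<^bsub>A\<^esub> (\<one>\<^bsub>A\<^esub> \<ominus>\<^bsub>A\<^esub> e g)"
    using ract_pow[OF h a, of n] by (simp add: n ract_one)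
  then have "coord g 0 x = coord g 0 (x \<oplus>\<^bsub>A\<^esub> (of_nat n * \<alpha>) \<odot>\<^bsub>A\<^esub> (\<one>\<^bsub>A\<^esub> \<ominus>\<^bsub>A\<^esub> e g))" by (rule arg_cong)
  then show ?thesis
    using one_ne_g p_pos
    by (simp add: linear_map_add[OF coord_linear] linear_map_smult[OF coord_linear] coord_x coord_e e_one[symmetric]
        linear_map_minus[OF coord_linear k_algebra_A k_algebra_base_alg])
qed

end

subsection \<open>Matched pairs from characters\<close>

context third_with_group
begin

text \<open>Every matched pair axiom is linear in the argument from the group algebra, so it suffices to
  check it on group elements, where the inner Sweedler sum has one term.\<close>

lemma nested_tlift_eqI:
  assumes V: "k_algebra V" and X: "X \<in> carrier T"
    and b1: "\<And>u v. u \<in> carrier A \<Longrightarrow> v \<in> carrier A \<Longrightarrow> bilinear_map KC KC V (\<beta> u v)"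
    and b2: "\<And>a b. a \<in> carrier KC \<Longrightarrow> b \<in> carrier KC \<Longrightarrow> bilinear_map A A V (\<lambda>u v. \<beta> u v a b)"
    and \<phi>: "linear_map KC V \<phi>"
    and eq: "\<And>t. t \<in> carrier C \<Longrightarrow> tlift V (\<lambda>u v. \<beta> u v (delta t) (delta t)) X = \<phi> (delta t)"
    and a: "a \<in> carrier KC"
  shows "tlift V (\<lambda>u v. tlift V (\<beta> u v) (comult HC a)) X = \<phi> a"
proof (rule KC_eqI[OF V nested_tlift_linear[OF k_algebra_A k_algebra_A k_algebra_KC k_algebra_KC V k_algebra_KC X comult_HC_linear b1 b2] \<phi> _ a])
  fix t assume t: "t \<in> carrier C"
  then have d: "delta t \<in> carrier KC" by simp
  show "tlift V (\<lambda>u v. tlift V (\<beta> u v) (comult HC (delta t))) X = \<phi> (delta t)"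
    unfolding comult_HC(2)[OF t] eq[OF t, symmetric]
    by (rule tlift_inner_pure[OF k_algebra_A k_algebra_A k_algebra_KC k_algebra_KC V X d d b1 b2[OF d d]])
qed

lemma tlift_counits: "u \<in> carrier A \<Longrightarrow> tlift base_alg (\<lambda>a b. eps a * eps b) (\<Delta> u) = eps u"
proof -
  assume u: "u \<in> carrier A"
  have b: "bilinear_map A A A (\<lambda>a b. eps a \<odot>\<^bsub>A\<^esub> b)" by (intro bilinear_mapI lin; simp)
  have b': "bilinear_map A A base_alg (\<lambda>a b. eps a * eps b)" by (intro bilinear_mapI lin; simp)
  have "eps u = tlift base_alg (\<lambda>a b. eps (eps a \<odot>\<^bsub>A\<^esub> b)) (\<Delta> u)"
    using tlift_post[OF k_algebra_A k_algebra_A k_algebra_A k_algebra_base_alg comult_closed[OF u] b counit_linear]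
    by (simp add: counit_left_A[OF u])
  also have "\<dots> = tlift base_alg (\<lambda>a b. eps a * eps b) (\<Delta> u)"
    by (rule T.tlift_cong[OF comult_closed[OF u] k_algebra_base_alg b', symmetric])
       (simp add: linear_map_smult[OF counit_linear])
  finally show ?thesis by simp
qed

lemma tlift_counits_smult:
  assumes u: "u \<in> carrier A" and V: "k_algebra V" and w: "w \<in> carrier V"
    and \<beta>: "\<And>a b. a \<in> carrier A \<Longrightarrow> b \<in> carrier A \<Longrightarrow> \<beta> a b = (eps a * eps b) \<odot>\<^bsub>V\<^esub> w"
  shows "tlift V \<beta> (\<Delta> u) = eps u \<odot>\<^bsub>V\<^esub> w"
proof -
  have b: "bilinear_map A A base_alg (\<lambda>a b. eps a * eps b)" by (intro bilinear_mapI lin; simp)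
  have L: "linear_map base_alg V (\<lambda>c. c \<odot>\<^bsub>V\<^esub> w)" by (rule linear_map_smult_fun[OF V linear_map_id w])
  have b': "bilinear_map A A V (\<lambda>a b. (eps a * eps b) \<odot>\<^bsub>V\<^esub> w)"
    by (intro bilinear_mapI linear_map_compose[OF _ L] bilinear_mapD[OF b])
  have "tlift V \<beta> (\<Delta> u) = tlift V (\<lambda>a b. (eps a * eps b) \<odot>\<^bsub>V\<^esub> w) (\<Delta> u)"
    by (rule T.tlift_cong[OF comult_closed[OF u] V b', symmetric]) (simp add: \<beta>)
  also have "\<dots> = tlift base_alg (\<lambda>a b. eps a * eps b) (\<Delta> u) \<odot>\<^bsub>V\<^esub> w"
    by (rule tlift_post[OF k_algebra_A k_algebra_A k_algebra_base_alg V comult_closed[OF u] b L, symmetric])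
  finally show ?thesis by (simp only: tlift_counits[OF u])
qed

lemma tlift_counit_left:
  assumes u: "u \<in> carrier A" and V: "k_algebra V" and L: "linear_map A V L"
    and \<beta>: "\<And>a b. a \<in> carrier A \<Longrightarrow> b \<in> carrier A \<Longrightarrow> \<beta> a b = eps a \<odot>\<^bsub>V\<^esub> L b"
  shows "tlift V \<beta> (\<Delta> u) = L u"
proof -
  have b: "bilinear_map A A A (\<lambda>a b. eps a \<odot>\<^bsub>A\<^esub> b)" by (intro bilinear_mapI lin; simp)
  have b': "bilinear_map A A V (\<lambda>a b. L (eps a \<odot>\<^bsub>A\<^esub> b))"
    by (intro bilinear_mapI linear_map_compose[OF _ L] bilinear_mapD[OF b])
  have "tlift V \<beta> (\<Delta> u) = tlift V (\<lambda>a b. L (eps a \<odot>\<^bsub>A\<^esub> b)) (\<Delta> u)"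
    by (rule T.tlift_cong[OF comult_closed[OF u] V b', symmetric]) (simp add: \<beta> linear_map_smult[OF L])
  also have "\<dots> = L (tlift A (\<lambda>a b. eps a \<odot>\<^bsub>A\<^esub> b) (\<Delta> u))"
    by (rule tlift_post[OF k_algebra_A k_algebra_A k_algebra_A V comult_closed[OF u] b L, symmetric])
  finally show ?thesis by (simp only: counit_left_A[OF u])
qed

lemma tlift_counit_right:
  assumes u: "u \<in> carrier A" and V: "k_algebra V" and L: "linear_map A V L"
    and \<beta>: "\<And>a b. a \<in> carrier A \<Longrightarrow> b \<in> carrier A \<Longrightarrow> \<beta> a b = eps b \<odot>\<^bsub>V\<^esub> L a"
  shows "tlift V \<beta> (\<Delta> u) = L u"
proof -
  have b: "bilinear_map A A A (\<lambda>a b. eps b \<odot>\<^bsub>A\<^esub> a)" by (intro bilinear_mapI lin; simp)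
  have b': "bilinear_map A A V (\<lambda>a b. L (eps b \<odot>\<^bsub>A\<^esub> a))"
    by (intro bilinear_mapI linear_map_compose[OF _ L] bilinear_mapD[OF b])
  have "tlift V \<beta> (\<Delta> u) = tlift V (\<lambda>a b. L (eps b \<odot>\<^bsub>A\<^esub> a)) (\<Delta> u)"
    by (rule T.tlift_cong[OF comult_closed[OF u] V b', symmetric]) (simp add: \<beta> linear_map_smult[OF L])
  also have "\<dots> = L (tlift A (\<lambda>a b. eps b \<odot>\<^bsub>A\<^esub> a) (\<Delta> u))"
    by (rule tlift_post[OF k_algebra_A k_algebra_A k_algebra_A V comult_closed[OF u] b L, symmetric])
  finally show ?thesis by (simp only: counit_right_A[OF u])
qed

end

text \<open>A character of \<open>C\<close> with values in the additive group of \<open>'k\<close>, through which \<open>C\<close> acts by shifts.\<close>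

locale third_character = third_with_group G g f C
  for G :: "('g, 'm) monoid_scheme" (structure) and g and f :: "'g \<Rightarrow> 'k::field"
    and C :: "('c, 'n) monoid_scheme" +
  fixes \<chi> :: "'c \<Rightarrow> 'k"
  assumes \<chi>_mult: "s \<in> carrier C \<Longrightarrow> t \<in> carrier C \<Longrightarrow> \<chi> (s \<otimes>\<^bsub>C\<^esub> t) = \<chi> s + \<chi> t"
    and \<chi>_ok: "t \<in> carrier C \<Longrightarrow> shift_ok (\<chi> t)"
begin

declare monoid_algebra_simps [simp del]

lemma KC_simps [simp]: "\<one>\<^bsub>KC\<^esub> = delta \<one>\<^bsub>C\<^esub>" "delta s \<otimes>\<^bsub>KC\<^esub> delta t = delta (s \<otimes>\<^bsub>C\<^esub> t)"
  by (simp_all add: monoid_algebra_simps delta_mult_KC)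

lemma \<chi>_one: "\<chi> \<one>\<^bsub>C\<^esub> = 0"
proof -
  have "\<chi> \<one>\<^bsub>C\<^esub> + \<chi> \<one>\<^bsub>C\<^esub> = \<chi> \<one>\<^bsub>C\<^esub> + 0" using \<chi>_mult[of "\<one>\<^bsub>C\<^esub>" "\<one>\<^bsub>C\<^esub>"] by simp
  then show ?thesis by (rule add_left_imp_eq)
qed

definition triv where "triv u a = eps u \<odot>\<^bsub>KC\<^esub> a"

definition twist where "twist u a = lin_ext A (\<lambda>t. shift (\<chi> t) u) a"

lemma triv_bilinear: "bilinear_map A KC KC triv"
  unfolding triv_def by (intro bilinear_mapI lin; simp)

lemma twist_bilinear: "bilinear_map A KC A twist"
proof (rule bilinear_mapI)
  fix u assume u: "u \<in> carrier A"
  then show "linear_map KC A (\<lambda>a. twist u a)"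
    unfolding twist_def by (intro linear_map_lin_ext[OF k_algebra_A] funcsetI shift_closed \<chi>_ok)
next
  fix a assume "a \<in> carrier KC"
  then have "t \<in> carrier C" if "t \<in> Poly_Mapping.keys a" for t using that by (auto simp: monoid_algebra_simps)
  then show "linear_map A A (\<lambda>u. twist u a)"
    unfolding twist_def lin_ext_def
    by (intro linear_map_finsum_fun linear_map_smult_const shift_linear \<chi>_ok k_algebra_A) blast
qed

lemma twist_delta: "u \<in> carrier A \<Longrightarrow> t \<in> carrier C \<Longrightarrow> twist u (delta t) = shift (\<chi> t) u"
  unfolding twist_def using shift_closed[OF \<chi>_ok, of t u] by (simp add: lin_ext_single)

lemmas triv_closed [simp] = bilinear_map_closed[OF triv_bilinear]
lemmas twist_closed [simp] = bilinear_map_closed[OF twist_bilinear]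
lemmas act_lin [lin] = bilinear_map_linear_comp[OF triv_bilinear] bilinear_map_linear_comp[OF twist_bilinear]

lemma HC_closed [simp]: "a \<in> carrier KC \<Longrightarrow> comult HC a \<in> carrier TC"
  by (rule linear_map_closed[OF comult_HC_linear])

lemma twist_counit: "u \<in> carrier A \<Longrightarrow> a \<in> carrier KC \<Longrightarrow> eps (twist u a) = eps u * counit HC a"
proof (rule KC_eqI[OF k_algebra_base_alg, of "\<lambda>a. eps (twist u a)" "\<lambda>a. eps u * counit HC a"])
  assume u: "u \<in> carrier A"
  show "linear_map KC base_alg (\<lambda>a. eps (twist u a))" "linear_map KC base_alg (\<lambda>a. eps u * counit HC a)"
    using u by (intro lin; simp)+
  show "eps (twist u (delta t)) = eps u * counit HC (delta t)" if "t \<in> carrier C" for t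
    using that u by (simp add: twist_delta counit_shift \<chi>_ok counit_HC)
qed

lemma triv_delta: "triv u (delta t) = eps u \<odot>\<^bsub>KC\<^esub> delta t"
  by (simp add: triv_def)

lemma left_module_coalgebra: "left_module_coalgebra H HC triv"
proof (rule left_module_coalgebra.intro)
  show "bilinear_map H HC HC triv"
    using triv_bilinear bilinear_map_cong[of H A HC KC HC KC] by simp
  show "triv \<one>\<^bsub>H\<^esub> a = a" if "a \<in> carrier HC" for a
    using that by (simp add: triv_def alg_homD(3)[OF counit_H(1)])
  show "counit HC (triv u a) = eps u * counit HC a" if "a \<in> carrier HC" for u a
    using that by (simp add: triv_def linear_map_smult[OF counit_HC_linear])
  show "triv (u \<otimes>\<^bsub>H\<^esub> v) a = triv u (triv v a)" if "u \<in> carrier H" "v \<in> carrier H" "a \<in> carrier HC" for u v a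
    using that by (simp add: triv_def alg_homD(2)[OF counit_H(1)] KC.smult_smult)
  fix u a assume "u \<in> carrier H" "a \<in> carrier HC"
  then have u: "u \<in> carrier A" and a: "a \<in> carrier KC" by simp_all
  have "tlift TC (\<lambda>u1 u2. tlift TC (\<lambda>a1 a2. pure KC KC (triv u1 a1) (triv u2 a2)) (comult HC a)) (\<Delta> u) = comult HC (triv u a)"
  proof (rule nested_tlift_eqI[OF k_algebra_TC comult_closed[OF u] _ _ _ _ a])
    show "linear_map KC TC (\<lambda>a. comult HC (triv u a))" using u by (intro lin; simp)
    fix t assume t: "t \<in> carrier C"
    then have d: "delta t \<in> carrier KC" by simp
    interpret TCa: k_algebra TC by simp
    have "tlift TC (\<lambda>u1 u2. pure KC KC (triv u1 (delta t)) (triv u2 (delta t))) (\<Delta> u) = eps u \<odot>\<^bsub>TC\<^esub> pure KC KC (delta t) (delta t)"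
      by (rule tlift_counits_smult[OF u k_algebra_TC])
         (use d in \<open>simp_all add: triv_delta linear_map_smult[OF TC.pure_linear_left] linear_map_smult[OF TC.pure_linear_right] TCa.smult_smult mult.commute\<close>)
    then show "tlift TC (\<lambda>u1 u2. pure KC KC (triv u1 (delta t)) (triv u2 (delta t))) (\<Delta> u) = comult HC (triv u (delta t))"
      using d by (simp add: triv_delta linear_map_smult[OF comult_HC_linear] comult_HC(2)[OF t])
  qed (intro bilinear_mapI lin; simp)+
  then show "comult HC (triv u a) = tlift (tensor HC HC) (\<lambda>u1 u2. tlift (tensor HC HC)
      (\<lambda>a1 a2. pure HC HC (triv u1 a1) (triv u2 a2)) (comult HC a)) (\<Delta> u)"
    by (simp add: tensor_HC)
qed

lemma right_module_coalgebra: "right_module_coalgebra HC H twist"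
proof (rule right_module_coalgebra.intro)
  show "bilinear_map H HC H twist"
    using twist_bilinear bilinear_map_cong[of H A HC KC H A] by simp
  show "twist u \<one>\<^bsub>HC\<^esub> = u" if "u \<in> carrier H" for u
    using that by (simp add: twist_delta \<chi>_one shift_zero)
  show "twist u (a \<otimes>\<^bsub>HC\<^esub> b) = twist (twist u a) b"
    if "u \<in> carrier H" "a \<in> carrier HC" "b \<in> carrier HC" for u a b
  proof -
    from that have u: "u \<in> carrier A" and a: "a \<in> carrier KC" and b: "b \<in> carrier KC" by simp_all
    have "twist u (a \<otimes>\<^bsub>KC\<^esub> b) = twist (twist u a) b"
    proof (rule KC_eqI[OF k_algebra_A _ _ _ a])
      show "linear_map KC A (\<lambda>a. twist u (a \<otimes>\<^bsub>KC\<^esub> b))" "linear_map KC A (\<lambda>a. twist (twist u a) b)"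
        using u b by (intro lin; simp)+
      fix s assume s: "s \<in> carrier C"
      show "twist u (delta s \<otimes>\<^bsub>KC\<^esub> b) = twist (twist u (delta s)) b"
      proof (rule KC_eqI[OF k_algebra_A _ _ _ b])
        show "linear_map KC A (\<lambda>b. twist u (delta s \<otimes>\<^bsub>KC\<^esub> b))" "linear_map KC A (\<lambda>b. twist (twist u (delta s)) b)"
          using u s by (intro lin; simp)+
        fix t assume t: "t \<in> carrier C"
        have "shift_ok (\<chi> t + \<chi> s)" using \<chi>_ok[of "s \<otimes>\<^bsub>C\<^esub> t"] s t by (simp add: \<chi>_mult add.commute)
        then show "twist u (delta s \<otimes>\<^bsub>KC\<^esub> delta t) = twist (twist u (delta s)) (delta t)"
          using u s t shift_add[OF \<chi>_ok[OF t] \<chi>_ok[OF s] _ u]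
          by (simp add: twist_delta shift_closed \<chi>_ok \<chi>_mult add.commute)
      qed
    qed
    then show ?thesis by simp
  qed
  fix u a assume "u \<in> carrier H" "a \<in> carrier HC"
  then have u: "u \<in> carrier A" and a: "a \<in> carrier KC" by simp_all
  show "eps (twist u a) = eps u * counit HC a" using u a by (rule twist_counit)
  have "tlift T (\<lambda>u1 u2. tlift T (\<lambda>a1 a2. pure A A (twist u1 a1) (twist u2 a2)) (comult HC a)) (\<Delta> u) = \<Delta> (twist u a)"
  proof (rule nested_tlift_eqI[OF k_algebra_T comult_closed[OF u] _ _ _ _ a])
    show "linear_map KC T (\<lambda>a. \<Delta> (twist u a))" using u by (intro lin; simp)
    fix t assume t: "t \<in> carrier C"
    have b: "bilinear_map A A T (\<lambda>a b. pure A A (shift (\<chi> t) a) (shift (\<chi> t) b))"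
      using t by (intro bilinear_mapI lin shift_linear shift_closed \<chi>_ok k_algebra_A)
    show "tlift T (\<lambda>u1 u2. pure A A (twist u1 (delta t)) (twist u2 (delta t))) (\<Delta> u) = \<Delta> (twist u (delta t))"
      unfolding twist_delta[OF u t] comult_shift[OF \<chi>_ok[OF t] u]
      by (rule T.tlift_cong[OF comult_closed[OF u] k_algebra_T b, symmetric]) (simp add: twist_delta t)
  qed (intro bilinear_mapI lin; simp)+
  then show "\<Delta> (twist u a) = tlift (tensor H H) (\<lambda>u1 u2. tlift (tensor H H)
      (\<lambda>a1 a2. pure H H (twist u1 a1) (twist u2 a2)) (comult HC a)) (\<Delta> u)"
    by (simp add: tensor_H)
qed

text \<open>As the left action is trivial, the axioms on group elements amount to two properties of shifts: they
  are maps of bialgebras, and their scalars add up under composition.\<close>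

theorem matched_pair_twist: "matched_pair HC H triv twist"
proof (rule matched_pair.intro[OF hopf_algebra_HC hopf_algebra_H left_module_coalgebra right_module_coalgebra],
    rule matched_pair_axioms.intro)
  fix u assume "u \<in> carrier H"
  then show "triv u \<one>\<^bsub>HC\<^esub> = eps u \<odot>\<^bsub>HC\<^esub> \<one>\<^bsub>HC\<^esub>" by (simp add: triv_def)
next
  fix a assume a: "a \<in> carrier HC"
  have "twist \<one>\<^bsub>A\<^esub> a = counit HC a \<odot>\<^bsub>A\<^esub> \<one>\<^bsub>A\<^esub>"
  proof (rule KC_eqI[OF k_algebra_A])
    show "linear_map KC A (\<lambda>a. twist \<one>\<^bsub>A\<^esub> a)" "linear_map KC A (\<lambda>a. counit HC a \<odot>\<^bsub>A\<^esub> \<one>\<^bsub>A\<^esub>)"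
      by (intro lin; simp)+
  qed (use a in \<open>simp_all add: twist_delta counit_HC alg_homD(3)[OF shift(1)] \<chi>_ok\<close>)
  then show "twist \<one>\<^bsub>H\<^esub> a = counit HC a \<odot>\<^bsub>H\<^esub> \<one>\<^bsub>H\<^esub>" by simp
next
  fix u a b assume "u \<in> carrier H" "a \<in> carrier HC" "b \<in> carrier HC"
  then have u: "u \<in> carrier A" and a: "a \<in> carrier KC" and b: "b \<in> carrier KC" by simp_all
  have "tlift KC (\<lambda>u1 u2. tlift KC (\<lambda>a1 a2. triv u1 a1 \<otimes>\<^bsub>KC\<^esub> triv (twist u2 a2) b) (comult HC a)) (\<Delta> u) = triv u (a \<otimes>\<^bsub>KC\<^esub> b)"
  proof (rule nested_tlift_eqI[OF k_algebra_KC comult_closed[OF u] _ _ _ _ a])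
    show "linear_map KC KC (\<lambda>a. triv u (a \<otimes>\<^bsub>KC\<^esub> b))" using u b by (intro lin; simp)
    fix t assume t: "t \<in> carrier C"
    have "tlift KC (\<lambda>u1 u2. triv u1 (delta t) \<otimes>\<^bsub>KC\<^esub> triv (twist u2 (delta t)) b) (\<Delta> u) = eps u \<odot>\<^bsub>KC\<^esub> (delta t \<otimes>\<^bsub>KC\<^esub> b)"
      by (rule tlift_counits_smult[OF u k_algebra_KC])
         (use t b in \<open>simp_all add: triv_def twist_delta counit_shift \<chi>_ok KC.smult_mult_left KC.smult_mult_right KC.smult_smult mult.commute\<close>)
    then show "tlift KC (\<lambda>u1 u2. triv u1 (delta t) \<otimes>\<^bsub>KC\<^esub> triv (twist u2 (delta t)) b) (\<Delta> u) = triv u (delta t \<otimes>\<^bsub>KC\<^esub> b)"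
      by (simp add: triv_def)
  qed (use b in \<open>intro bilinear_mapI lin; simp\<close>)+
  then show "triv u (a \<otimes>\<^bsub>HC\<^esub> b) = tlift HC (\<lambda>u1 u2. tlift HC (\<lambda>a1 a2. triv u1 a1 \<otimes>\<^bsub>HC\<^esub> triv (twist u2 a2) b) (comult HC a)) (\<Delta> u)"
    by (simp add: tlift_HC)
next
  fix u v a assume "u \<in> carrier H" "v \<in> carrier H" "a \<in> carrier HC"
  then have u: "u \<in> carrier A" and v: "v \<in> carrier A" and a: "a \<in> carrier KC" by simp_all
  have "tlift A (\<lambda>v1 v2. tlift A (\<lambda>a1 a2. twist u (triv v1 a1) \<otimes>\<^bsub>A\<^esub> twist v2 a2) (comult HC a)) (\<Delta> v) = twist (u \<otimes>\<^bsub>A\<^esub> v) a"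
  proof (rule nested_tlift_eqI[OF k_algebra_A comult_closed[OF v] _ _ _ _ a])
    show "linear_map KC A (\<lambda>a. twist (u \<otimes>\<^bsub>A\<^esub> v) a)" using u v by (intro lin; simp)
    fix t assume t: "t \<in> carrier C"
    have "tlift A (\<lambda>v1 v2. twist u (triv v1 (delta t)) \<otimes>\<^bsub>A\<^esub> twist v2 (delta t)) (\<Delta> v) =
        shift (\<chi> t) u \<otimes>\<^bsub>A\<^esub> shift (\<chi> t) v"
      by (rule tlift_counit_left[OF v k_algebra_A, of "\<lambda>w. shift (\<chi> t) u \<otimes>\<^bsub>A\<^esub> shift (\<chi> t) w"])
         (use t u in \<open>simp_all add: triv_def twist_delta shift_closed \<chi>_ok A.smult_mult_left
            linear_map_smult[OF bilinear_mapD(1)[OF twist_bilinear u]]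
            linear_map_mult_right[OF k_algebra_A shift_linear[OF \<chi>_ok]]\<close>)
    then show "tlift A (\<lambda>v1 v2. twist u (triv v1 (delta t)) \<otimes>\<^bsub>A\<^esub> twist v2 (delta t)) (\<Delta> v) = twist (u \<otimes>\<^bsub>A\<^esub> v) (delta t)"
      using u v t by (simp add: twist_delta alg_homD(2)[OF shift(1)] \<chi>_ok)
  qed (use u in \<open>intro bilinear_mapI lin; simp\<close>)+
  then show "twist (u \<otimes>\<^bsub>H\<^esub> v) a = tlift H (\<lambda>v1 v2. tlift H (\<lambda>a1 a2. twist u (triv v1 a1) \<otimes>\<^bsub>H\<^esub> twist v2 a2) (comult HC a)) (\<Delta> v)"
    by (simp add: tlift_H)
next
  fix u a assume "u \<in> carrier H" "a \<in> carrier HC"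
  then have u: "u \<in> carrier A" and a: "a \<in> carrier KC" by simp_all
  let ?V = "tensor A KC"
  have "tlift ?V (\<lambda>u1 u2. tlift ?V (\<lambda>a1 a2. pure A KC (twist u1 a1) (triv u2 a2)) (comult HC a)) (\<Delta> u) =
      tlift ?V (\<lambda>u1 u2. tlift ?V (\<lambda>a1 a2. pure A KC (twist u2 a2) (triv u1 a1)) (comult HC a)) (\<Delta> u)"
  proof (rule nested_tlift_eqI[OF k_algebra_AC comult_closed[OF u] _ _ _ _ a])
    show "linear_map KC ?V (\<lambda>a. tlift ?V (\<lambda>u1 u2. tlift ?V (\<lambda>a1 a2. pure A KC (twist u2 a2) (triv u1 a1)) (comult HC a)) (\<Delta> u))"
      by (rule nested_tlift_linear[OF k_algebra_A k_algebra_A k_algebra_KC k_algebra_KC k_algebra_AC k_algebra_KC comult_closed[OF u] comult_HC_linear])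
        (intro bilinear_mapI lin; simp)+
    fix t assume t: "t \<in> carrier C"
    then have d: "delta t \<in> carrier KC" by simp
    have L: "linear_map A ?V (\<lambda>u. pure A KC (shift (\<chi> t) u) (delta t))"
      using d t by (intro lin shift_linear \<chi>_ok k_algebra_A k_algebra_KC)
    have 1: "tlift ?V (\<lambda>u1 u2. pure A KC (twist u1 (delta t)) (triv u2 (delta t))) (\<Delta> u) = pure A KC (shift (\<chi> t) u) (delta t)"
      by (rule tlift_counit_right[OF u k_algebra_AC L])
         (use d t in \<open>simp add: twist_delta triv_delta shift_closed \<chi>_ok linear_map_smult[OF AC.pure_linear_right]\<close>)
    have 2: "tlift ?V (\<lambda>u1 u2. pure A KC (twist u2 (delta t)) (triv u1 (delta t))) (\<Delta> u) = pure A KC (shift (\<chi> t) u) (delta t)"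
      by (rule tlift_counit_left[OF u k_algebra_AC L])
         (use d t in \<open>simp add: twist_delta triv_delta shift_closed \<chi>_ok linear_map_smult[OF AC.pure_linear_right]\<close>)
    have 3: "tlift ?V (\<lambda>u1 u2. tlift ?V (\<lambda>a1 a2. pure A KC (twist u2 a2) (triv u1 a1)) (comult HC (delta t))) (\<Delta> u) =
        tlift ?V (\<lambda>u1 u2. pure A KC (twist u2 (delta t)) (triv u1 (delta t))) (\<Delta> u)"
      unfolding comult_HC(2)[OF t]
      by (rule tlift_inner_pure[OF k_algebra_A k_algebra_A k_algebra_KC k_algebra_KC k_algebra_AC comult_closed[OF u] d d])
         (use d in \<open>intro bilinear_mapI lin; simp\<close>)+
    show "tlift ?V (\<lambda>u1 u2. pure A KC (twist u1 (delta t)) (triv u2 (delta t))) (\<Delta> u) =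
      tlift ?V (\<lambda>u1 u2. tlift ?V (\<lambda>a1 a2. pure A KC (twist u2 a2) (triv u1 a1)) (comult HC (delta t))) (\<Delta> u)"
      unfolding 1 3 2 ..
  qed (intro bilinear_mapI lin; simp)+
  then show "tlift (tensor H HC) (\<lambda>u1 u2. tlift (tensor H HC) (\<lambda>a1 a2. pure H HC (twist u1 a1) (triv u2 a2)) (comult HC a)) (\<Delta> u) =
      tlift (tensor H HC) (\<lambda>u1 u2. tlift (tensor H HC) (\<lambda>a1 a2. pure H HC (twist u2 a2) (triv u1 a1)) (comult HC a)) (\<Delta> u)"
    by (simp add: mixed_tensor)
qed

end

section \<open>Bicrossed products\<close>

text \<open>A matched pair is only determined on the carriers. So the actions are functions of their own that
  agree with those of the character there.\<close>

locale third_bicrossed = third_character G g f C \<chi>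
  for G :: "('g, 'm) monoid_scheme" (structure) and g and f :: "'g \<Rightarrow> 'k::field"
    and C :: "('c, 'n) monoid_scheme" and \<chi> +
  fixes lact :: "('g third_gen list \<Rightarrow>\<^sub>0 'k) set \<Rightarrow> ('c \<Rightarrow>\<^sub>0 'k) \<Rightarrow> 'c \<Rightarrow>\<^sub>0 'k"
    and ract :: "('g third_gen list \<Rightarrow>\<^sub>0 'k) set \<Rightarrow> ('c \<Rightarrow>\<^sub>0 'k) \<Rightarrow> ('g third_gen list \<Rightarrow>\<^sub>0 'k) set"
  assumes finite_C: "finite (carrier C)"
    and lact_eq: "u \<in> carrier A \<Longrightarrow> a \<in> carrier KC \<Longrightarrow> lact u a = triv u a"
    and ract_eq: "u \<in> carrier A \<Longrightarrow> a \<in> carrier KC \<Longrightarrow> ract u a = twist u a"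
begin

abbreviation "CG \<equiv> C \<times>\<times> G"

text \<open>In the bicrossed product \<open>x h = h (x + \<chi> h (1 - g))\<close>, so the commutator \<open>h x - x h\<close> is \<open>h (1 - g)\<close>
  times the scalar \<open>- \<chi> h\<close>. This is the commutation rule of a third-type algebra in which \<open>h\<close> has the value \<open>- \<chi> h\<close>.\<close>

definition F :: "'c \<times> 'g \<Rightarrow> 'k" where
  "F cd = f (snd cd) - \<chi> (fst cd)"

lemma pow_CG: "(\<one>\<^bsub>C\<^esub>, g) [^]\<^bsub>CG\<^esub> (n::nat) = (\<one>\<^bsub>C\<^esub>, g [^] n)"
  by (induction n) (simp_all add: DirProd_def)

text \<open>If \<open>g\<^sup>p \<noteq> 1\<close>, then \<open>f\<close> and \<open>\<chi>\<close> have values in the prime field, and so has \<open>F\<close>.\<close>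

lemma datum_F: "third_type_datum CG (\<one>\<^bsub>C\<^esub>, g) F"
proof -
  interpret kCG: k_algebra "monoid_algebra CG :: ('k, _) module"
    by (rule k_algebra_monoid_algebra) (rule DirProd_monoid[OF C.monoid_axioms G.monoid_axioms])
  let ?k = "monoid_algebra CG :: ('k, _) module"
  have pow: "delta (\<one>\<^bsub>C\<^esub>, g) [^]\<^bsub>?k\<^esub> (n::nat) = delta (\<one>\<^bsub>C\<^esub>, g [^] n)" for n
    by (induction n) (simp_all add: nat_pow_def monoid_algebra_mult_single monoid_algebra_simps)
  have cl: "delta cd \<in> carrier ?k" if "cd \<in> carrier CG" for cd
    using that by (simp add: monoid_algebra_simps)
  have "(F cd ^ CHAR('k) - F cd) \<odot>\<^bsub>?k\<^esub> (\<one>\<^bsub>?k\<^esub> \<ominus>\<^bsub>?k\<^esub> delta (\<one>\<^bsub>C\<^esub>, g) [^]\<^bsub>?k\<^esub> CHAR('k)) = \<zero>\<^bsub>?k\<^esub>"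
    if cd: "cd \<in> carrier CG" for cd
  proof (cases "g [^] CHAR('k) = \<one>")
    case True
    then have "\<one>\<^bsub>?k\<^esub> \<ominus>\<^bsub>?k\<^esub> delta (\<one>\<^bsub>C\<^esub>, g) [^]\<^bsub>?k\<^esub> CHAR('k) = \<zero>\<^bsub>?k\<^esub>"
      unfolding pow using kCG.minus_self[OF kCG.one_closed] by (simp add: monoid_algebra_simps DirProd_def)
    then show ?thesis by simp
  next
    case False
    obtain c d where c: "c \<in> carrier C" and d: "d \<in> carrier G" and cd_eq: "cd = (c, d)" using cd by auto
    have "f d ^ CHAR('k) = f d" "\<chi> c ^ CHAR('k) = \<chi> c"
      using f_condition[OF d] \<chi>_ok[OF c] False by (auto simp: shift_ok_def)
    then have "F cd ^ CHAR('k) = F cd"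
      using freshmans_dream[OF prime_CHAR refl, of "f d" "- \<chi> c"]
      by (simp add: F_def cd_eq minus_power_prime_CHAR[OF refl prime_CHAR])
    moreover have "\<one>\<^bsub>?k\<^esub> \<ominus>\<^bsub>?k\<^esub> delta (\<one>\<^bsub>C\<^esub>, g) [^]\<^bsub>?k\<^esub> CHAR('k) \<in> carrier ?k"
      unfolding pow by (intro kCG.minus_closed kCG.one_closed cl) simp
    ultimately show ?thesis by simp
  qed
  then show ?thesis
    unfolding third_type_datum_def Let_def
    using DirProd_group[OF C.group_axioms G.group_axioms] finite_C finite_G
    by (auto simp: hom_def F_def \<chi>_one \<chi>_mult f_mult g_central DirProd_def)
qed

sublocale B: third_type CG "(\<one>\<^bsub>C\<^esub>, g)" F
  by (intro third_type.intro third_type_axioms.intro DirProd_group C.group_axioms G.group_axioms datum_F prime_CHAR)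

definition iota :: "('c \<Rightarrow>\<^sub>0 'k) \<Rightarrow> (('c \<times> 'g) third_gen list \<Rightarrow>\<^sub>0 'k) set" where
  "iota = lin_ext B.A (\<lambda>c. B.e (c, \<one>))"

lemma iota: "alg_hom KC B.A iota" "c \<in> carrier C \<Longrightarrow> iota (delta c) = B.e (c, \<one>)"
proof -
  show "alg_hom KC B.A iota"
    unfolding iota_def
  proof (rule lin_ext_alg_hom[OF B.k_algebra_A _ _ C.monoid_axioms])
    show "B.e (s \<otimes>\<^bsub>C\<^esub> t, \<one>) = B.e (s, \<one>) \<otimes>\<^bsub>B.A\<^esub> B.e (t, \<one>)" if "s \<in> carrier C" "t \<in> carrier C" for s t
      using that B.e_mult[of "(s, \<one>)" "(t, \<one>)"] by simp
    show "B.e (\<one>\<^bsub>C\<^esub>, \<one>) = \<one>\<^bsub>B.A\<^esub>"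
      using B.e_one by simp
  qed simp
  show "c \<in> carrier C \<Longrightarrow> iota (delta c) = B.e (c, \<one>)"
    unfolding iota_def by (simp add: lin_ext_single)
qed

lemma iota_linear: "linear_map KC B.A iota" by (rule alg_homD(1)[OF iota(1)])

lemmas iota_closed [simp] = linear_map_closed[OF iota_linear]

definition emb :: "('g third_gen list \<Rightarrow>\<^sub>0 'k) set \<Rightarrow> (('c \<times> 'g) third_gen list \<Rightarrow>\<^sub>0 'k) set" where
  "emb = presented_ext B.A (third_val (\<lambda>d. B.e (\<one>\<^bsub>C\<^esub>, d)) B.x)"

lemma emb: "alg_hom A B.A emb" "d \<in> carrier G \<Longrightarrow> emb (e d) = B.e (\<one>\<^bsub>C\<^esub>, d)" "emb x = B.x"
proof -
  have "third_rep B.A (\<lambda>d. B.e (\<one>\<^bsub>C\<^esub>, d)) B.x"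
    unfolding third_rep_def
  proof (intro conjI ballI)
    show "B.e (\<one>\<^bsub>C\<^esub>, s \<otimes> t) = B.e (\<one>\<^bsub>C\<^esub>, s) \<otimes>\<^bsub>B.A\<^esub> B.e (\<one>\<^bsub>C\<^esub>, t)" if "s \<in> carrier G" "t \<in> carrier G" for s t
      using that B.e_mult[of "(\<one>\<^bsub>C\<^esub>, s)" "(\<one>\<^bsub>C\<^esub>, t)"] by simp
    show "B.e (\<one>\<^bsub>C\<^esub>, \<one>) = \<one>\<^bsub>B.A\<^esub>"
      using B.e_one by simp
  qed (use B.e_x[of "(\<one>\<^bsub>C\<^esub>, _)"] B.x_pow in \<open>simp_all add: F_def \<chi>_one\<close>)
  from third_ext[OF B.k_algebra_A this]
  show "alg_hom A B.A emb" "d \<in> carrier G \<Longrightarrow> emb (e d) = B.e (\<one>\<^bsub>C\<^esub>, d)" "emb x = B.x"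
    by (simp_all add: emb_def)
qed

lemma emb_linear: "linear_map A B.A emb" by (rule alg_homD(1)[OF emb(1)])

lemmas emb_closed [simp] = linear_map_closed[OF emb_linear]

lemma iota_emb_linear [lin]:
  "linear_map Z KC \<phi> \<Longrightarrow> linear_map Z B.A (\<lambda>z. iota (\<phi> z))"
  "linear_map Z A \<psi> \<Longrightarrow> linear_map Z B.A (\<lambda>z. emb (\<psi> z))"
  by (rule linear_map_compose[OF _ iota_linear], assumption, rule linear_map_compose[OF _ emb_linear], assumption)

abbreviation "WW \<equiv> tensor KC A"

definition Phi :: "(('c \<Rightarrow>\<^sub>0 'k) \<times> ('g third_gen list \<Rightarrow>\<^sub>0 'k) set \<Rightarrow>\<^sub>0 'k) set \<Rightarrow> (('c \<times> 'g) third_gen list \<Rightarrow>\<^sub>0 'k) set" where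
  "Phi = tlift B.A (\<lambda>a u. iota a \<otimes>\<^bsub>B.A\<^esub> emb u)"

lemma Phi_bilinear: "bilinear_map KC A B.A (\<lambda>a u. iota a \<otimes>\<^bsub>B.A\<^esub> emb u)"
  by (intro bilinear_mapI lin; simp)

lemma Phi_linear: "linear_map WW B.A Phi"
  unfolding Phi_def by (rule W.tlift(1)[OF B.k_algebra_A Phi_bilinear])

lemma Phi_pure: "a \<in> carrier KC \<Longrightarrow> u \<in> carrier A \<Longrightarrow> Phi (pure KC A a u) = iota a \<otimes>\<^bsub>B.A\<^esub> emb u"
  unfolding Phi_def by (rule W.tlift(2)[OF B.k_algebra_A Phi_bilinear])

lemmas Phi_closed [simp] = linear_map_closed[OF Phi_linear]

lemma Phi_basis: "c \<in> carrier C \<Longrightarrow> d \<in> carrier G \<Longrightarrow> Phi (pure KC A (delta c) (bas d m)) = B.bas (c, d) m"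
proof -
  assume c: "c \<in> carrier C" and d: "d \<in> carrier G"
  have "B.e (c, \<one>) \<otimes>\<^bsub>B.A\<^esub> B.e (\<one>\<^bsub>C\<^esub>, d) = B.e (c, d)"
    using c d by (simp add: B.e_mult[symmetric])
  then show ?thesis
    using c d by (simp add: Phi_pure iota bas_def alg_homD(2)[OF emb(1)] emb
      alg_hom_rising[OF emb(1) k_algebra_A B.k_algebra_A] B.bas_def B.A.m_assoc[symmetric])
qed

definition Psi where
  "Psi = B.bas_ext WW (\<lambda>cd m. pure KC A (delta (fst cd)) (bas (snd cd) m))"

lemma Psi_linear: "linear_map B.A WW Psi"
  unfolding Psi_def by (rule B.bas_ext_linear) (auto intro!: W.pure_closed)

lemma Psi_bas: "c \<in> carrier C \<Longrightarrow> d \<in> carrier G \<Longrightarrow> m < CHAR('k) \<Longrightarrow> Psi (B.bas (c, d) m) = pure KC A (delta c) (bas d m)"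
  unfolding Psi_def by (subst B.bas_ext_bas) (auto intro!: W.pure_closed)

text \<open>Linear maps out of the tensor product are determined on the products of a group element with a
  basis element.\<close>

lemma W_eqI:
  assumes V: "k_algebra V" and \<phi>: "linear_map WW V \<phi>" and \<psi>: "linear_map WW V \<psi>"
    and eq: "\<And>c u. c \<in> carrier C \<Longrightarrow> u \<in> carrier A \<Longrightarrow> \<phi> (pure KC A (delta c) u) = \<psi> (pure KC A (delta c) u)"
    and w: "w \<in> carrier WW"
  shows "\<phi> w = \<psi> w"
proof (rule W.linear_map_eq_on_tensor[OF \<phi> \<psi> _ w])
  fix a u assume a: "a \<in> carrier KC" and u: "u \<in> carrier A"
  show "\<phi> (pure KC A a u) = \<psi> (pure KC A a u)"
    by (rule KC_eqI[OF V linear_map_compose[OF W.pure_linear_left[OF u] \<phi>]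
        linear_map_compose[OF W.pure_linear_left[OF u] \<psi>] eq[OF _ u] a])
qed

lemma Psi_Phi: "w \<in> carrier WW \<Longrightarrow> Psi (Phi w) = w"
proof (rule W_eqI[OF k_algebra_W linear_map_compose[OF Phi_linear Psi_linear] linear_map_id])
  fix c u assume c: "c \<in> carrier C" and u: "u \<in> carrier A"
  then have d: "delta c \<in> carrier KC" by simp
  note pl = W.pure_linear_right[OF d]
  show "Psi (Phi (pure KC A (delta c) u)) = pure KC A (delta c) u"
    by (rule bas_linear_eqI[OF linear_map_compose[OF linear_map_compose[OF pl Phi_linear] Psi_linear] pl _ u])
       (simp add: Phi_basis Psi_bas c)
qed

lemma Phi_Psi: "v \<in> carrier B.A \<Longrightarrow> Phi (Psi v) = v"
  by (rule B.bas_linear_eqI[OF linear_map_compose[OF Psi_linear Phi_linear] linear_map_id])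
     (auto simp: Phi_basis Psi_bas)

lemma Phi_bij: "bij_betw Phi (carrier WW) (carrier B.A)"
  by (rule bij_betwI[where g = Psi]) (simp_all add: Psi_Phi Phi_Psi linear_map_closed[OF Psi_linear])

lemma Phi_inj: "w \<in> carrier WW \<Longrightarrow> w' \<in> carrier WW \<Longrightarrow> Phi w = Phi w' \<Longrightarrow> w = w'"
  by (metis Psi_Phi)

text \<open>The commutation rule of the bicrossed product, in the algebra of the product group. For the generator
  \<open>x\<close> it is the defining relation of that algebra; it extends to all elements word by word.\<close>

lemma emb_iota:
  assumes t: "t \<in> carrier C" and u: "u \<in> carrier A"
  shows "emb u \<otimes>\<^bsub>B.A\<^esub> iota (delta t) = iota (delta t) \<otimes>\<^bsub>B.A\<^esub> emb (shift (\<chi> t) u)"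
  using u
proof (induction rule: third_induct_left)
  case one
  then show ?case using t by (simp add: alg_homD(3)[OF emb(1)] alg_homD(3)[OF shift(1)] \<chi>_ok)
next
  case (elt s u)
  have es: "B.e (\<one>\<^bsub>C\<^esub>, s) \<otimes>\<^bsub>B.A\<^esub> B.e (t, \<one>) = B.e (t, \<one>) \<otimes>\<^bsub>B.A\<^esub> B.e (\<one>\<^bsub>C\<^esub>, s)"
    using t elt by (simp add: B.e_mult[symmetric])
  have "emb (e s \<otimes>\<^bsub>A\<^esub> u) \<otimes>\<^bsub>B.A\<^esub> iota (delta t) = B.e (\<one>\<^bsub>C\<^esub>, s) \<otimes>\<^bsub>B.A\<^esub> (iota (delta t) \<otimes>\<^bsub>B.A\<^esub> emb (shift (\<chi> t) u))"
    using t elt shift_closed[OF \<chi>_ok[OF t]] by (simp add: alg_homD(2)[OF emb(1)] emb B.A.m_assoc)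
  also have "\<dots> = (B.e (t, \<one>) \<otimes>\<^bsub>B.A\<^esub> B.e (\<one>\<^bsub>C\<^esub>, s)) \<otimes>\<^bsub>B.A\<^esub> emb (shift (\<chi> t) u)"
    using t elt shift_closed[OF \<chi>_ok[OF t]] by (simp add: iota es[symmetric] B.A.m_assoc)
  also have "\<dots> = iota (delta t) \<otimes>\<^bsub>B.A\<^esub> emb (shift (\<chi> t) (e s \<otimes>\<^bsub>A\<^esub> u))"
    using t elt shift_closed[OF \<chi>_ok[OF t]]
    by (simp add: iota alg_homD(2)[OF shift(1)] \<chi>_ok shift alg_homD(2)[OF emb(1)] emb B.A.m_assoc)
  finally show ?case .
next
  case (gen u)
  have xt: "B.x \<otimes>\<^bsub>B.A\<^esub> B.e (t, \<one>) = B.e (t, \<one>) \<otimes>\<^bsub>B.A\<^esub> emb (shift (\<chi> t) x)"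
  proof -
    have et: "(t, \<one>) \<in> carrier CG" using t by simp
    let ?y = "B.e (t, \<one>) \<otimes>\<^bsub>B.A\<^esub> (\<one>\<^bsub>B.A\<^esub> \<ominus>\<^bsub>B.A\<^esub> B.e (\<one>\<^bsub>C\<^esub>, g))"
    have y: "?y \<in> carrier B.A" using et by simp
    have "B.e (t, \<one>) \<otimes>\<^bsub>B.A\<^esub> B.x = B.x \<otimes>\<^bsub>B.A\<^esub> B.e (t, \<one>) \<oplus>\<^bsub>B.A\<^esub> (- \<chi> t) \<odot>\<^bsub>B.A\<^esub> ?y"
      using B.e_x[OF et] by (simp add: F_def)
    then have "B.e (t, \<one>) \<otimes>\<^bsub>B.A\<^esub> B.x \<oplus>\<^bsub>B.A\<^esub> \<chi> t \<odot>\<^bsub>B.A\<^esub> ?y = B.x \<otimes>\<^bsub>B.A\<^esub> B.e (t, \<one>)"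
      using y et by (simp add: B.A.a_assoc B.A.smult_minus_left B.A.l_neg)
    moreover have "emb (shift (\<chi> t) x) = B.x \<oplus>\<^bsub>B.A\<^esub> \<chi> t \<odot>\<^bsub>B.A\<^esub> (\<one>\<^bsub>B.A\<^esub> \<ominus>\<^bsub>B.A\<^esub> B.e (\<one>\<^bsub>C\<^esub>, g))"
      using t by (simp add: shift \<chi>_ok linear_map_add[OF emb_linear] linear_map_smult[OF emb_linear]
        linear_map_minus[OF emb_linear k_algebra_A B.k_algebra_A] emb alg_homD(3)[OF emb(1)])
    ultimately show ?thesis
      using et by (simp add: B.A.r_distr B.A.smult_mult_right)
  qed
  have "emb (x \<otimes>\<^bsub>A\<^esub> u) \<otimes>\<^bsub>B.A\<^esub> iota (delta t) = B.x \<otimes>\<^bsub>B.A\<^esub> (iota (delta t) \<otimes>\<^bsub>B.A\<^esub> emb (shift (\<chi> t) u))"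
    using t gen shift_closed[OF \<chi>_ok[OF t]] by (simp add: alg_homD(2)[OF emb(1)] emb B.A.m_assoc)
  also have "\<dots> = (B.e (t, \<one>) \<otimes>\<^bsub>B.A\<^esub> emb (shift (\<chi> t) x)) \<otimes>\<^bsub>B.A\<^esub> emb (shift (\<chi> t) u)"
    using t gen shift_closed[OF \<chi>_ok[OF t]] by (simp add: iota xt[symmetric] B.A.m_assoc)
  also have "\<dots> = iota (delta t) \<otimes>\<^bsub>B.A\<^esub> emb (shift (\<chi> t) (x \<otimes>\<^bsub>A\<^esub> u))"
    using t gen shift_closed[OF \<chi>_ok[OF t]]
    by (simp add: iota alg_homD(2)[OF shift(1)] \<chi>_ok alg_homD(2)[OF emb(1)] B.A.m_assoc)
  finally show ?case .
next
  case (add u v)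
  then show ?case
    using t shift_closed[OF \<chi>_ok[OF t]]
    by (simp add: linear_map_add[OF emb_linear] linear_map_add[OF shift_linear] \<chi>_ok B.A.l_distr B.A.r_distr)
next
  case (smult c u)
  then show ?case
    using t shift_closed[OF \<chi>_ok[OF t]]
    by (simp add: linear_map_smult[OF emb_linear] linear_map_smult[OF shift_linear] \<chi>_ok B.A.smult_mult_left B.A.smult_mult_right)
qed

subsection \<open>The multiplication\<close>

text \<open>The product of \<open>a \<otimes> u\<close> and \<open>b \<otimes> v\<close> in the bicrossed product. For a group element \<open>b\<close> the Sweedler sums in
  it have disappeared, by \<open>sweedler_prod4\<close>.\<close>

definition prod4 where
  "prod4 a u b v = lin_ext WW (\<lambda>t. pure KC A (a \<otimes>\<^bsub>KC\<^esub> delta t) (shift (\<chi> t) u \<otimes>\<^bsub>A\<^esub> v)) b"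

lemma prod4_bilinear_right:
  assumes a: "a \<in> carrier KC" and u: "u \<in> carrier A"
  shows "bilinear_map KC A WW (prod4 a u)"
proof (rule bilinear_mapI)
  fix b assume "b \<in> carrier KC"
  then have k: "t \<in> carrier C" if "t \<in> Poly_Mapping.keys b" for t using that by (auto simp: monoid_algebra_simps)
  show "linear_map A WW (prod4 a u b)"
    unfolding prod4_def[abs_def] lin_ext_def
    by (intro linear_map_finsum_fun linear_map_smult_const k_algebra_W k_algebra_A linear_map_pure
      linear_map_mult_right linear_map_id) (simp_all add: a u k shift_closed \<chi>_ok)
next
  fix v assume v: "v \<in> carrier A"
  show "linear_map KC WW (\<lambda>b. prod4 a u b v)"
    unfolding prod4_def
    by (rule linear_map_lin_ext[OF k_algebra_W]) (simp add: a u v shift_closed \<chi>_ok)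
qed

lemma prod4_bilinear_left:
  assumes b: "b \<in> carrier KC" and v: "v \<in> carrier A"
  shows "bilinear_map KC A WW (\<lambda>a u. prod4 a u b v)"
proof -
  from b have k: "t \<in> carrier C" if "t \<in> Poly_Mapping.keys b" for t using that by (auto simp: monoid_algebra_simps)
  show ?thesis
    unfolding prod4_def lin_ext_def
    by (intro bilinear_mapI linear_map_finsum_fun linear_map_smult_const k_algebra_W k_algebra_A k_algebra_KC linear_map_pure
      linear_map_mult_left linear_map_id shift_linear) (simp_all add: v k shift_closed \<chi>_ok)
qed

lemma prod4_delta:
  "a \<in> carrier KC \<Longrightarrow> u \<in> carrier A \<Longrightarrow> t \<in> carrier C \<Longrightarrow> v \<in> carrier A \<Longrightarrow>
    prod4 a u (delta t) v = pure KC A (a \<otimes>\<^bsub>KC\<^esub> delta t) (shift (\<chi> t) u \<otimes>\<^bsub>A\<^esub> v)"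
  unfolding prod4_def using k_algebra.smult_one[OF k_algebra_W]
  by (subst lin_ext_single) (simp_all add: shift_closed \<chi>_ok)

lemma sweedler_prod4:
  assumes a: "a \<in> carrier KC" and u: "u \<in> carrier A" and b: "b \<in> carrier KC" and v: "v \<in> carrier A"
  shows "tlift WW (\<lambda>u1 u2. tlift WW (\<lambda>b1 b2. pure KC A (a \<otimes>\<^bsub>KC\<^esub> lact u1 b1) (ract u2 b2 \<otimes>\<^bsub>A\<^esub> v)) (comult HC b)) (\<Delta> u) =
    prod4 a u b v"
proof -
  let ?b = "\<lambda>u1 u2 b1 b2. pure KC A (a \<otimes>\<^bsub>KC\<^esub> triv u1 b1) (twist u2 b2 \<otimes>\<^bsub>A\<^esub> v)"
  let ?b' = "\<lambda>u1 u2 b1 b2. pure KC A (a \<otimes>\<^bsub>KC\<^esub> lact u1 b1) (ract u2 b2 \<otimes>\<^bsub>A\<^esub> v)"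
  have b1: "bilinear_map KC KC WW (?b u1 u2)" if "u1 \<in> carrier A" "u2 \<in> carrier A" for u1 u2
    using that a v by (intro bilinear_mapI lin; simp)
  have b2: "bilinear_map A A WW (\<lambda>u1 u2. ?b u1 u2 b1 b2)" if "b1 \<in> carrier KC" "b2 \<in> carrier KC" for b1 b2
    using that a v by (intro bilinear_mapI lin; simp)
  note bb = HC_closed[OF b]
  have "tlift WW (\<lambda>u1 u2. tlift WW (?b' u1 u2) (comult HC b)) (\<Delta> u) =
      tlift WW (\<lambda>u1 u2. tlift WW (?b u1 u2) (comult HC b)) (\<Delta> u)"
    by (rule T.tlift_cong[OF comult_closed[OF u] k_algebra_W
          nested_tlift_bilinear[OF k_algebra_A k_algebra_A k_algebra_KC k_algebra_KC k_algebra_W bb b1 b2], symmetric],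
        assumption+, rule TC.tlift_cong[OF bb k_algebra_W b1])
       (simp_all add: lact_eq ract_eq)
  also have "\<dots> = prod4 a u b v"
  proof (rule nested_tlift_eqI[OF k_algebra_W comult_closed[OF u] b1 b2 _ _ b])
    show "linear_map KC WW (\<lambda>b. prod4 a u b v)"
      by (rule bilinear_mapD(2)[OF prod4_bilinear_right[OF a u] v])
    fix t assume t: "t \<in> carrier C"
    then have d: "delta t \<in> carrier KC" by simp
    have L: "linear_map A WW (\<lambda>u. pure KC A (a \<otimes>\<^bsub>KC\<^esub> delta t) (shift (\<chi> t) u \<otimes>\<^bsub>A\<^esub> v))"
      using a d v t by (intro lin shift_linear \<chi>_ok k_algebra_A k_algebra_KC KC.m_closed)
    show "tlift WW (\<lambda>u1 u2. ?b u1 u2 (delta t) (delta t)) (\<Delta> u) = prod4 a u (delta t) v"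
      unfolding prod4_delta[OF a u t v]
      by (rule tlift_counit_left[OF u k_algebra_W L])
         (use a d v t in \<open>simp add: twist_delta triv_delta shift_closed \<chi>_ok KC.smult_mult_right linear_map_smult[OF W.pure_linear_left]\<close>)
  qed
  finally show ?thesis .
qed

abbreviation "bm \<equiv> bicrossed_mult HC H lact ract"

lemma bm_eq:
  assumes S: "S \<in> carrier WW" and R: "R \<in> carrier WW"
  shows "bm S R = tlift WW (\<lambda>a u. tlift WW (prod4 a u) R) S"
proof -
  have b2: "bilinear_map KC A WW (\<lambda>a u. tlift WW (prod4 a u) R)"
    by (rule nested_tlift_bilinear[OF k_algebra_KC k_algebra_A k_algebra_KC k_algebra_A k_algebra_W R prod4_bilinear_right prod4_bilinear_left])
  show ?thesis
    unfolding bicrossed_mult_def Let_def mixed_tensor third_hopf_simps group_hopf_simps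
    by (rule W.tlift_cong[OF S k_algebra_W b2, symmetric], rule W.tlift_cong[OF R k_algebra_W prod4_bilinear_right])
       (simp_all add: sweedler_prod4)
qed

lemma bm_linear:
  "R \<in> carrier WW \<Longrightarrow> linear_map WW WW (\<lambda>S. tlift WW (\<lambda>a u. tlift WW (prod4 a u) R) S)"
  "S \<in> carrier WW \<Longrightarrow> linear_map WW WW (\<lambda>R. tlift WW (\<lambda>a u. tlift WW (prod4 a u) R) S)"
proof -
  show "R \<in> carrier WW \<Longrightarrow> linear_map WW WW (\<lambda>S. tlift WW (\<lambda>a u. tlift WW (prod4 a u) R) S)"
    by (rule W.tlift(1)[OF k_algebra_W nested_tlift_bilinear[OF k_algebra_KC k_algebra_A k_algebra_KC k_algebra_A k_algebra_W _ prod4_bilinear_right prod4_bilinear_left]])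
  show "S \<in> carrier WW \<Longrightarrow> linear_map WW WW (\<lambda>R. tlift WW (\<lambda>a u. tlift WW (prod4 a u) R) S)"
    by (rule nested_tlift_linear[OF k_algebra_KC k_algebra_A k_algebra_KC k_algebra_A k_algebra_W k_algebra_W _ linear_map_id prod4_bilinear_right prod4_bilinear_left])
qed

lemma bm_closed: "S \<in> carrier WW \<Longrightarrow> R \<in> carrier WW \<Longrightarrow> bm S R \<in> carrier WW"
  by (simp add: bm_eq linear_map_closed[OF bm_linear(1)])

lemma bm_pure:
  assumes "a \<in> carrier KC" "u \<in> carrier A" "t \<in> carrier C" "v \<in> carrier A"
  shows "bm (pure KC A a u) (pure KC A (delta t) v) = pure KC A (a \<otimes>\<^bsub>KC\<^esub> delta t) (shift (\<chi> t) u \<otimes>\<^bsub>A\<^esub> v)"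
proof -
  have R: "pure KC A (delta t) v \<in> carrier WW" using assms by simp
  have d: "delta t \<in> carrier KC" using assms by simp
  have "bm (pure KC A a u) (pure KC A (delta t) v) =
      tlift WW (\<lambda>a u. tlift WW (prod4 a u) (pure KC A (delta t) v)) (pure KC A a u)"
    using assms by (intro bm_eq R W.pure_closed)
  also have "\<dots> = tlift WW (prod4 a u) (pure KC A (delta t) v)"
    by (rule W.tlift(2)[OF k_algebra_W nested_tlift_bilinear[OF k_algebra_KC k_algebra_A k_algebra_KC k_algebra_A k_algebra_W R prod4_bilinear_right prod4_bilinear_left] assms(1,2)])
  also have "\<dots> = prod4 a u (delta t) v"
    by (rule W.tlift(2)[OF k_algebra_W prod4_bilinear_right[OF assms(1,2)] d assms(4)])
  finally show ?thesis unfolding prod4_delta[OF assms] .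
qed

lemma Phi_mult:
  assumes S: "S \<in> carrier WW" and R: "R \<in> carrier WW"
  shows "Phi (bm S R) = Phi S \<otimes>\<^bsub>B.A\<^esub> Phi R"
proof -
  note h = alg_homD[OF iota(1)] and j = alg_homD[OF emb(1)]
  have pp: "Phi (bm (pure KC A (delta s) u) (pure KC A (delta t) v)) =
      Phi (pure KC A (delta s) u) \<otimes>\<^bsub>B.A\<^esub> Phi (pure KC A (delta t) v)"
    if s: "s \<in> carrier C" and u: "u \<in> carrier A" and t: "t \<in> carrier C" and v: "v \<in> carrier A" for s u t v
  proof -
    have d: "delta s \<in> carrier KC" "delta t \<in> carrier KC" using s t by simp_all
    note sc = shift_closed[OF \<chi>_ok[OF t] u]
    have "Phi (bm (pure KC A (delta s) u) (pure KC A (delta t) v)) =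
        iota (delta s) \<otimes>\<^bsub>B.A\<^esub> (iota (delta t) \<otimes>\<^bsub>B.A\<^esub> emb (shift (\<chi> t) u)) \<otimes>\<^bsub>B.A\<^esub> emb v"
      using d sc u v t s by (simp add: bm_pure Phi_pure j(2) h(2)[OF d, simplified] B.A.m_assoc)
    also have "\<dots> = iota (delta s) \<otimes>\<^bsub>B.A\<^esub> emb u \<otimes>\<^bsub>B.A\<^esub> (iota (delta t) \<otimes>\<^bsub>B.A\<^esub> emb v)"
      using d u v by (simp add: emb_iota[OF t u, symmetric] B.A.m_assoc)
    finally show ?thesis using d u v by (simp add: Phi_pure)
  qed
  have "Phi (tlift WW (\<lambda>a u. tlift WW (prod4 a u) R) S) = Phi S \<otimes>\<^bsub>B.A\<^esub> Phi R"
  proof (rule W_eqI[OF B.k_algebra_A _ _ _ S])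
    show "linear_map WW B.A (\<lambda>S. Phi (tlift WW (\<lambda>a u. tlift WW (prod4 a u) R) S))"
      by (rule linear_map_compose[OF bm_linear(1)[OF R] Phi_linear])
    show "linear_map WW B.A (\<lambda>S. Phi S \<otimes>\<^bsub>B.A\<^esub> Phi R)"
      by (rule linear_map_mult_left[OF B.k_algebra_A Phi_linear Phi_closed[OF R]])
    fix s u assume s: "s \<in> carrier C" and u: "u \<in> carrier A"
    have su: "pure KC A (delta s) u \<in> carrier WW" using s u by simp
    show "Phi (tlift WW (\<lambda>a u. tlift WW (prod4 a u) R) (pure KC A (delta s) u)) = Phi (pure KC A (delta s) u) \<otimes>\<^bsub>B.A\<^esub> Phi R"
    proof (rule W_eqI[OF B.k_algebra_A _ _ _ R])
      show "linear_map WW B.A (\<lambda>R. Phi (tlift WW (\<lambda>a u. tlift WW (prod4 a u) R) (pure KC A (delta s) u)))"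
        by (rule linear_map_compose[OF bm_linear(2)[OF su] Phi_linear])
      show "linear_map WW B.A (\<lambda>R. Phi (pure KC A (delta s) u) \<otimes>\<^bsub>B.A\<^esub> Phi R)"
        by (rule linear_map_mult_right[OF B.k_algebra_A Phi_linear Phi_closed[OF su]])
      fix t v assume t: "t \<in> carrier C" and v: "v \<in> carrier A"
      have "pure KC A (delta t) v \<in> carrier WW" using t v by simp
      then show "Phi (tlift WW (\<lambda>a u. tlift WW (prod4 a u) (pure KC A (delta t) v)) (pure KC A (delta s) u)) =
          Phi (pure KC A (delta s) u) \<otimes>\<^bsub>B.A\<^esub> Phi (pure KC A (delta t) v)"
        using pp[OF s u t v] su by (simp add: bm_eq)
    qed
  qed
  then show ?thesis by (simp add: bm_eq S R)
qed

abbreviation "E \<equiv> bicrossed_product HC H lact ract"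

lemma E_simps [simp]:
  "carrier E = carrier WW" "mult E = bm" "one E = one WW" "zero E = zero WW" "add E = add WW" "smult E = smult WW"
  by (simp_all add: bicrossed_product_def Let_def module.defs mixed_tensor)

text \<open>The isomorphism of vector spaces transports associativity and distributivity.\<close>

lemma Phi_one: "Phi \<one>\<^bsub>WW\<^esub> = \<one>\<^bsub>B.A\<^esub>"
  using alg_homD(3)[OF iota(1)] alg_homD(3)[OF emb(1)]
  by (simp add: W.tensor_one Phi_pure)

lemma k_algebra_E: "k_algebra E"
proof -
  interpret Wk: k_algebra WW by simp
  note add = linear_map_add[OF Phi_linear] and sm = linear_map_smult[OF Phi_linear]
  have ag: "abelian_group E"
  proof (rule abelian_groupI)
    show "\<exists>y\<in>carrier E. y \<oplus>\<^bsub>E\<^esub> w = \<zero>\<^bsub>E\<^esub>" if "w \<in> carrier E" for w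
      using that Wk.a_inv_closed[of w] Wk.l_neg[of w] by (intro bexI[of _ "\<ominus>\<^bsub>WW\<^esub> w"]) simp_all
    show "v \<oplus>\<^bsub>E\<^esub> w = w \<oplus>\<^bsub>E\<^esub> v" if "v \<in> carrier E" "w \<in> carrier E" for v w
      using that Wk.a_comm[of v w] by simp
  qed (simp_all add: Wk.a_assoc)
  have R: "ring E"
  proof (rule ringI)
    show "abelian_group E" by (rule ag)
    show "Group.monoid E"
      by (rule Group.monoidI; (rule Phi_inj)?) (simp_all add: Phi_mult Phi_one bm_closed B.A.m_assoc)
  qed (rule Phi_inj; simp add: Phi_mult add bm_closed B.A.l_distr B.A.r_distr)+
  show ?thesis
  proof (rule k_algebra.intro[OF R])
    show "module base_alg E"
      by (rule moduleI[OF cring_base_alg ag])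
         (simp_all add: Wk.smult_add_left Wk.smult_add_right Wk.smult_smult)
  qed (rule Phi_inj; simp add: Phi_mult sm bm_closed B.A.smult_mult_left B.A.smult_mult_right)+
qed

lemma Phi_alg_hom: "alg_hom E B.A Phi"
  by (intro alg_homI) (use Phi_linear linear_map_cong[of E WW B.A B.A] in \<open>simp_all add: Phi_mult Phi_one\<close>)

subsection \<open>The coalgebra structure\<close>

abbreviation "W2 \<equiv> tensor WW WW"

text \<open>The bicrossed product has the vector space of the tensor product, and the linear structure of its
  tensor square depends on nothing else.\<close>

lemma tensor_E: "pure E E = pure WW WW" "carrier (tensor E E) = carrier W2" "add (tensor E E) = add W2"
  "smult (tensor E E) = smult W2" "zero (tensor E E) = zero W2"
  by (rule tensor_cong_linear; simp)+

sublocale W2: tensor_pair WW WW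
  by (rule tensor_pair.intro) simp_all

lemma k_algebra_W2 [simp]: "k_algebra W2" by simp

lemma comult_E_def: "comult E = tlift W2 (\<lambda>a u. tlift W2 (\<lambda>a1 a2. tlift W2 (\<lambda>u1 u2.
    pure WW WW (pure KC A a1 u1) (pure KC A a2 u2)) (\<Delta> u)) (comult HC a))"
  by (simp add: bicrossed_product_def Let_def module.defs mixed_tensor)

abbreviation "cop4 \<equiv> \<lambda>a1 a2 u1 u2. pure WW WW (pure KC A a1 u1) (pure KC A a2 u2)"

lemma cop4_bilinear: "a1 \<in> carrier KC \<Longrightarrow> a2 \<in> carrier KC \<Longrightarrow> bilinear_map A A W2 (cop4 a1 a2)"
  "u1 \<in> carrier A \<Longrightarrow> u2 \<in> carrier A \<Longrightarrow> bilinear_map KC KC W2 (\<lambda>a1 a2. cop4 a1 a2 u1 u2)"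
  by (intro bilinear_mapI lin; simp)+

lemma comult_E_bilinear: "bilinear_map KC A W2 (\<lambda>a u. tlift W2 (\<lambda>a1 a2. tlift W2 (cop4 a1 a2) (\<Delta> u)) (comult HC a))"
proof (rule bilinear_mapI)
  fix a assume a: "a \<in> carrier KC"
  show "linear_map A W2 (\<lambda>u. tlift W2 (\<lambda>a1 a2. tlift W2 (cop4 a1 a2) (\<Delta> u)) (comult HC a))"
    by (rule nested_tlift_linear[OF k_algebra_KC k_algebra_KC k_algebra_A k_algebra_A k_algebra_W2 k_algebra_A HC_closed[OF a] comult_linear cop4_bilinear])
next
  fix u assume u: "u \<in> carrier A"
  show "linear_map KC W2 (\<lambda>a. tlift W2 (\<lambda>a1 a2. tlift W2 (cop4 a1 a2) (\<Delta> u)) (comult HC a))"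
    by (rule linear_map_tlift[OF k_algebra_KC k_algebra_KC k_algebra_W2 comult_HC_linear])
       (rule nested_tlift_bilinear[OF k_algebra_KC k_algebra_KC k_algebra_A k_algebra_A k_algebra_W2 comult_closed[OF u] cop4_bilinear])
qed

lemma comult_E_linear: "linear_map WW W2 (comult E)"
  unfolding comult_E_def by (rule W.tlift(1)[OF k_algebra_W2 comult_E_bilinear])

lemma comult_E_pure:
  assumes c: "c \<in> carrier C" and u: "u \<in> carrier A"
  shows "comult E (pure KC A (delta c) u) = tlift W2 (cop4 (delta c) (delta c)) (\<Delta> u)"
proof -
  have d: "delta c \<in> carrier KC" using c by simp
  have "comult E (pure KC A (delta c) u) = tlift W2 (\<lambda>a1 a2. tlift W2 (cop4 a1 a2) (\<Delta> u)) (comult HC (delta c))"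
    unfolding comult_E_def by (rule W.tlift(2)[OF k_algebra_W2 comult_E_bilinear d u])
  also have "\<dots> = tlift W2 (cop4 (delta c) (delta c)) (\<Delta> u)"
    unfolding comult_HC(2)[OF c]
    by (rule TC.tlift(2)[OF k_algebra_W2 nested_tlift_bilinear[OF k_algebra_KC k_algebra_KC k_algebra_A k_algebra_A k_algebra_W2 comult_closed[OF u] cop4_bilinear] d d])
  finally show ?thesis .
qed

lemma emb_comult:
  assumes u: "u \<in> carrier A"
  shows "B.\<Delta> (emb u) = tlift B.T (\<lambda>a b. pure B.A B.A (emb a) (emb b)) (\<Delta> u)"
proof -
  have b: "bilinear_map A A B.T (\<lambda>a b. pure B.A B.A (emb a) (emb b))"
    by (intro bilinear_mapI lin; simp)
  note j = alg_homD[OF emb(1)]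
  have h: "alg_hom T B.T (tlift B.T (\<lambda>a b. pure B.A B.A (emb a) (emb b)))"
    by (rule T.tlift_alg_hom[OF B.k_algebra_T b]) (simp_all add: j B.T.tensor_one B.T.pure_mult)
  show ?thesis
    by (rule third_alg_hom_eqI[OF alg_hom_compose[OF emb(1) B.comult_H(1)] alg_hom_compose[OF comult_H(1) h] _ _ u])
       (simp_all add: emb B.comult_H comult_H T.tlift(2)[OF B.k_algebra_T b] linear_map_add[OF alg_homD(1)[OF h]] j(3))
qed

lemma Phi_comult:
  assumes w: "w \<in> carrier WW"
  shows "B.\<Delta> (Phi w) = tlift B.T (\<lambda>a b. pure B.A B.A (Phi a) (Phi b)) (comult E w)"
proof (rule W_eqI[OF B.k_algebra_T _ _ _ w])
  interpret BT: k_algebra B.T by simp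
  have pb: "bilinear_map WW WW B.T (\<lambda>a b. pure B.A B.A (Phi a) (Phi b))"
    by (intro bilinear_mapI lin Phi_linear; simp)
  show "linear_map WW B.T (\<lambda>w. B.\<Delta> (Phi w))" by (rule linear_map_compose[OF Phi_linear B.comult_linear])
  show "linear_map WW B.T (\<lambda>w. tlift B.T (\<lambda>a b. pure B.A B.A (Phi a) (Phi b)) (comult E w))"
    by (rule linear_map_compose[OF comult_E_linear W2.tlift(1)[OF B.k_algebra_T pb]])
  fix c u assume c: "c \<in> carrier C" and u: "u \<in> carrier A"
  have d: "delta c \<in> carrier KC" using c by simp
  let ?i = "B.e (c, \<one>)"
  have i: "?i \<in> carrier B.A" using c by simp
  have eb: "bilinear_map A A B.T (\<lambda>a b. pure B.A B.A (emb a) (emb b))"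
    by (intro bilinear_mapI lin; simp)
  have "B.\<Delta> (Phi (pure KC A (delta c) u)) = pure B.A B.A ?i ?i \<otimes>\<^bsub>B.T\<^esub> tlift B.T (\<lambda>a b. pure B.A B.A (emb a) (emb b)) (\<Delta> u)"
    using c d u by (simp add: Phi_pure iota alg_homD(2)[OF B.comult_H(1)] B.comult_H(2) emb_comult)
  also have "\<dots> = tlift B.T (\<lambda>a b. pure B.A B.A ?i ?i \<otimes>\<^bsub>B.T\<^esub> pure B.A B.A (emb a) (emb b)) (\<Delta> u)"
    by (rule tlift_post[OF k_algebra_A k_algebra_A B.k_algebra_T B.k_algebra_T comult_closed[OF u] eb])
       (rule linear_map_mult_right[OF B.k_algebra_T linear_map_id], simp add: i)
  also have "\<dots> = tlift B.T (\<lambda>u1 u2. pure B.A B.A (Phi (pure KC A (delta c) u1)) (Phi (pure KC A (delta c) u2))) (\<Delta> u)"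
  proof (rule T.tlift_cong[OF comult_closed[OF u] B.k_algebra_T])
    show "bilinear_map A A B.T (\<lambda>a b. pure B.A B.A ?i ?i \<otimes>\<^bsub>B.T\<^esub> pure B.A B.A (emb a) (emb b))"
      using i by (intro bilinear_mapI lin; simp)
  qed (simp add: Phi_pure d iota c i B.T.pure_mult)
  also have "\<dots> = tlift B.T (\<lambda>a b. pure B.A B.A (Phi a) (Phi b)) (tlift W2 (cop4 (delta c) (delta c)) (\<Delta> u))"
  proof -
    have "tlift B.T (\<lambda>a b. pure B.A B.A (Phi a) (Phi b)) (tlift W2 (cop4 (delta c) (delta c)) (\<Delta> u)) =
       tlift B.T (\<lambda>u1 u2. tlift B.T (\<lambda>a b. pure B.A B.A (Phi a) (Phi b)) (cop4 (delta c) (delta c) u1 u2)) (\<Delta> u)"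
      by (rule tlift_post[OF k_algebra_A k_algebra_A k_algebra_W2 B.k_algebra_T comult_closed[OF u] cop4_bilinear(1)[OF d d] W2.tlift(1)[OF B.k_algebra_T pb]])
    also have "\<dots> = tlift B.T (\<lambda>u1 u2. pure B.A B.A (Phi (pure KC A (delta c) u1)) (Phi (pure KC A (delta c) u2))) (\<Delta> u)"
    proof (rule T.tlift_cong[OF comult_closed[OF u] B.k_algebra_T, symmetric])
      show "bilinear_map A A B.T (\<lambda>u1 u2. pure B.A B.A (Phi (pure KC A (delta c) u1)) (Phi (pure KC A (delta c) u2)))"
        by (intro bilinear_mapI linear_map_pure B.k_algebra_A linear_map_compose[OF W.pure_linear_right[OF d] Phi_linear]) (simp_all add: d)
    qed (simp add: W2.tlift(2)[OF B.k_algebra_T pb] d)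
    finally show ?thesis by simp
  qed
  finally show "B.\<Delta> (Phi (pure KC A (delta c) u)) = tlift B.T (\<lambda>a b. pure B.A B.A (Phi a) (Phi b)) (comult E (pure KC A (delta c) u))"
    unfolding comult_E_pure[OF c u] .
qed

lemma Phi_counit:
  assumes w: "w \<in> carrier WW"
  shows "B.eps (Phi w) = counit E w"
proof -
  have E: "counit E = tlift base_alg (\<lambda>a u. counit HC a * eps u)"
    by (simp add: bicrossed_product_def Let_def module.defs)
  have b: "bilinear_map KC A base_alg (\<lambda>a u. counit HC a * eps u)"
    by (intro bilinear_mapI lin)
  have je: "B.eps (emb u) = eps u" if "u \<in> carrier A" for u
    by (rule third_alg_hom_eqI[OF alg_hom_compose[OF emb(1) B.counit_H(1)] counit_H(1) _ _ that])
       (simp_all add: emb counit_H B.counit_H)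
  show ?thesis
    unfolding E
    by (rule W_eqI[OF k_algebra_base_alg linear_map_compose[OF Phi_linear B.counit_linear] W.tlift(1)[OF k_algebra_base_alg b] _ w])
       (simp add: W.tlift(2)[OF k_algebra_base_alg b] Phi_pure iota counit_HC alg_homD(2)[OF B.counit_H(1)] B.counit_H je)
qed

lemma Phi_antipode:
  assumes w: "w \<in> carrier WW"
  shows "B.ap (Phi w) = Phi (antipode E w)"
proof -
  let ?s = "\<lambda>a u. bm (pure KC A \<one>\<^bsub>KC\<^esub> (ap u)) (pure KC A (antipode HC a) \<one>\<^bsub>A\<^esub>)"
  have E: "antipode E = tlift WW ?s"
    by (simp add: bicrossed_product_def Let_def module.defs mixed_tensor)
  have hc: "a \<in> carrier KC \<Longrightarrow> antipode HC a \<in> carrier KC" for a by (rule linear_map_closed[OF antipode_HC(1)])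
  have one: "delta \<one>\<^bsub>C\<^esub> \<in> carrier KC" by simp
  have b: "bilinear_map KC A WW ?s"
  proof (rule bilinear_mapI)
    fix a assume a: "a \<in> carrier KC"
    have c: "pure KC A (antipode HC a) \<one>\<^bsub>A\<^esub> \<in> carrier WW" using hc[OF a] by simp
    have s1: "linear_map A WW (\<lambda>u. pure KC A \<one>\<^bsub>KC\<^esub> (ap u))"
      by (rule linear_map_compose[OF antipode_linear W.pure_linear_right[OF KC.one_closed]])
    have "linear_map A WW (\<lambda>u. tlift WW (\<lambda>b v. tlift WW (prod4 b v) (pure KC A (antipode HC a) \<one>\<^bsub>A\<^esub>)) (pure KC A \<one>\<^bsub>KC\<^esub> (ap u)))"
      by (rule linear_map_compose[OF s1 bm_linear(1)[OF c]])
    then show "linear_map A WW (\<lambda>u. ?s a u)"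
      unfolding linear_map_def using c one by (simp add: bm_eq Pi_def)
  next
    fix u assume u: "u \<in> carrier A"
    have c: "pure KC A \<one>\<^bsub>KC\<^esub> (ap u) \<in> carrier WW" using u one by simp
    have s2: "linear_map KC WW (\<lambda>a. pure KC A (antipode HC a) \<one>\<^bsub>A\<^esub>)"
      by (rule linear_map_compose[OF antipode_HC(1) W.pure_linear_left[OF A.one_closed]])
    have "linear_map KC WW (\<lambda>a. tlift WW (\<lambda>b v. tlift WW (prod4 b v) (pure KC A (antipode HC a) \<one>\<^bsub>A\<^esub>)) (pure KC A \<one>\<^bsub>KC\<^esub> (ap u)))"
      by (rule linear_map_compose[OF s2 bm_linear(2)[OF c]])
    then show "linear_map KC WW (\<lambda>a. ?s a u)"
      unfolding linear_map_def using c hc by (simp add: bm_eq Pi_def)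
  qed
  have js: "B.ap (emb u) = emb (ap u)" if "u \<in> carrier A" for u
  proof (rule third_alg_hom_eqI[OF alg_hom_compose[OF emb(1) B.antipode_H(1)] _ _ _ that])
    have "alg_hom (op_alg A) (op_alg B.A) emb"
      using alg_homD[OF emb(1)] linear_map_cong[of "op_alg A" A "op_alg B.A" B.A] by (intro alg_homI) simp_all
    then show "alg_hom A (op_alg B.A) (\<lambda>u. emb (ap u))" by (rule alg_hom_compose[OF antipode_H(1)])
    have inv: "inv\<^bsub>CG\<^esub> (\<one>\<^bsub>C\<^esub>, d) = (\<one>\<^bsub>C\<^esub>, inv d)" if "d \<in> carrier G" for d
      using that by (simp add: inv_DirProd[OF C.group_axioms G.group_axioms])
    show "B.ap (emb (e t)) = emb (ap (e t))" if "t \<in> carrier G" for t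
      using that by (simp add: emb antipode_H B.antipode_H inv)
    show "B.ap (emb x) = emb (ap x)"
      by (simp add: emb antipode_H B.antipode_H inv linear_map_uminus[OF emb_linear k_algebra_A B.k_algebra_A] alg_homD(2)[OF emb(1)])
  qed
  show ?thesis
    unfolding E
  proof (rule W_eqI[OF B.k_algebra_A linear_map_compose[OF Phi_linear B.antipode_linear] linear_map_compose[OF W.tlift(1)[OF k_algebra_W b] Phi_linear] _ w])
    fix c u assume c: "c \<in> carrier C" and u: "u \<in> carrier A"
    have d: "delta c \<in> carrier KC" "delta (inv\<^bsub>C\<^esub> c) \<in> carrier KC" using c by simp_all
    have inv: "inv\<^bsub>CG\<^esub> (c, \<one>) = (inv\<^bsub>C\<^esub> c, \<one>)"
      using c by (simp add: inv_DirProd[OF C.group_axioms G.group_axioms])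
    have "Phi (?s (delta c) u) = (iota \<one>\<^bsub>KC\<^esub> \<otimes>\<^bsub>B.A\<^esub> emb (ap u)) \<otimes>\<^bsub>B.A\<^esub> (iota (delta (inv\<^bsub>C\<^esub> c)) \<otimes>\<^bsub>B.A\<^esub> emb \<one>\<^bsub>A\<^esub>)"
      using u d one by (simp add: Phi_mult Phi_pure antipode_HC(2)[OF c])
    also have "\<dots> = emb (ap u) \<otimes>\<^bsub>B.A\<^esub> B.e (inv\<^bsub>C\<^esub> c, \<one>)"
      using u c unfolding alg_homD(3)[OF iota(1)] alg_homD(3)[OF emb(1)] by (simp add: iota)
    also have "\<dots> = B.ap (Phi (pure KC A (delta c) u))"
      using u c d by (simp add: Phi_pure iota B.antipode_mult B.antipode_H inv js)
    finally show "B.ap (Phi (pure KC A (delta c) u)) = Phi (tlift WW ?s (pure KC A (delta c) u))"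
      unfolding W.tlift(2)[OF k_algebra_W b d(1) u] by (rule sym)
  qed
qed

theorem hopf_iso_Phi: "Phi \<in> hopf_iso E B.H"
proof -
  have "alg_hom E B.H Phi" using Phi_alg_hom alg_hom_cong[of E E B.H B.A] by simp
  moreover have "bij_betw Phi (carrier E) (carrier B.H)" using Phi_bij by simp
  moreover have "B.\<Delta> (Phi u) = tlift (tensor B.H B.H) (\<lambda>a b. pure B.H B.H (Phi a) (Phi b)) (comult E u)"
    if "u \<in> carrier E" for u
    using that by (simp add: Phi_comult B.tensor_H)
  ultimately show ?thesis
    by (simp add: hopf_iso_def Phi_counit Phi_antipode)
qed

end

section \<open>Cyclic groups\<close>

lemma (in Group.monoid) pow_mod_eq:
  assumes y: "y \<in> carrier G" and yn: "y [^] (n::nat) = \<one>" and ij: "i mod n = j mod n"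
  shows "y [^] (i::nat) = y [^] j"
proof -
  have "y [^] k = y [^] (k mod n)" for k
  proof -
    have "y [^] k = y [^] (n * (k div n) + k mod n)" by simp
    also have "\<dots> = (y [^] n) [^] (k div n) \<otimes> y [^] (k mod n)"
      using y by (simp only: nat_pow_mult[symmetric] nat_pow_pow)
    also have "\<dots> = y [^] (k mod n)" using y by (simp add: yn)
    finally show ?thesis .
  qed
  then show ?thesis using ij by metis
qed

locale cyclic_group = group C for C :: "('c, 'n) monoid_scheme" (structure) +
  fixes h :: 'c and n :: nat
  assumes h: "h \<in> carrier C" and gen: "generate C {h} = carrier C" and order: "order C = n" and n_pos: "n > 0"
begin

lemma finite_carrier: "finite (carrier C)"
  using order n_pos by (simp add: order_def card_ge_0_finite)

lemma pow_cancel: "h [^] (i::nat) = h [^] (i + d) \<Longrightarrow> h [^] (d::nat) = \<one>"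
proof -
  assume "h [^] i = h [^] (i + d)"
  then have "h [^] i \<otimes> h [^] d = h [^] i \<otimes> \<one>" using nat_pow_mult[OF h, of i d] h by simp
  then show ?thesis using h by simp
qed

lemma pow_n: "h [^] n = \<one>"
  and pow_eq_one_ge: "\<lbrakk>0 < k; h [^] (k::nat) = \<one>\<rbrakk> \<Longrightarrow> n \<le> k"
  and exists_pow: "c \<in> carrier C \<Longrightarrow> \<exists>i::nat. c = h [^] i"
proof -
  have "\<not> inj (\<lambda>i::nat. h [^] i)"
    using finite_subset[OF _ finite_carrier, of "range (\<lambda>i::nat. h [^] i)"] h finite_imageD[of "\<lambda>i::nat. h [^] i" UNIV]
    by (auto simp: image_subset_iff)
  then obtain i j :: nat where ij: "i < j" "h [^] i = h [^] j" by (metis linorder_injI)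
  have "h [^] (j - i) = \<one>" by (rule pow_cancel[of i]) (use ij in simp)
  then have ex: "\<exists>m>0. h [^] (m::nat) = \<one>" using ij by (intro exI[of _ "j - i"]) simp
  \<comment> \<open>The least period \<open>m\<close> is the number of distinct powers, which is the order \<open>n\<close> of the group.\<close>
  define m where "m = (LEAST m. 0 < m \<and> h [^] (m::nat) = \<one>)"
  have m: "0 < m" "h [^] m = \<one>" using LeastI_ex[OF ex] by (simp_all add: m_def)
  have least: "m \<le> k" if "0 < k" "h [^] k = \<one>" for k :: nat
    unfolding m_def by (rule Least_le) (use that in simp)
  have reach: "\<exists>i<m. c = h [^] i" if "c \<in> carrier C" for c
  proof -
    from that obtain k :: int where k: "c = h [^] k" using generate_pow[OF h] gen by auto
    have "h [^] k = h [^] (int m * (k div int m) + k mod int m)" by simp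
    also have "\<dots> = (h [^] int m) [^] (k div int m) \<otimes> h [^] (k mod int m)"
      using h by (simp only: int_pow_mult int_pow_pow)
    also have "h [^] int m = \<one>" using m by (simp only: int_pow_int)
    also have "\<one> [^] (k div int m) \<otimes> h [^] (k mod int m) = h [^] nat (k mod int m)"
      using h m int_pow_int[of C h "nat (k mod int m)"] by simp
    finally show ?thesis using k m by (intro exI[of _ "nat (k mod int m)"]) (simp add: nat_less_iff)
  qed
  have "inj_on (\<lambda>i. h [^] i) {..<m}"
  proof (rule linorder_inj_onI)
    fix i j :: nat assume "i < j" "i \<in> {..<m}" "j \<in> {..<m}"
    then show "h [^] i \<noteq> h [^] j"
      using least[of "j - i"] pow_cancel[of i "j - i"] by auto
  qed auto
  then have "card ((\<lambda>i. h [^] i) ` {..<m}) = m" by (simp add: card_image)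
  moreover have "(\<lambda>i. h [^] i) ` {..<m} = carrier C" using reach h by auto
  ultimately have "n = m" using order by (simp add: order_def)
  with m least reach show "h [^] n = \<one>" "\<lbrakk>0 < k; h [^] (k::nat) = \<one>\<rbrakk> \<Longrightarrow> n \<le> k"
    "c \<in> carrier C \<Longrightarrow> \<exists>i::nat. c = h [^] i" by blast+
qed

lemma pow_eqD: "h [^] (i::nat) = h [^] j \<Longrightarrow> i mod n = j mod n"
proof (induction i j rule: linorder_wlog)
  case (le i j)
  have "h [^] (j - i) = \<one>" by (rule pow_cancel[of i]) (use le in simp)
  then have "h [^] ((j - i) mod n) = \<one>"
    using pow_mod_eq[OF h pow_n, of "(j - i) mod n" "j - i"] by simp
  then have "(j - i) mod n = 0"
    using pow_eq_one_ge[of "(j - i) mod n"] n_pos by (metis gr0I leD mod_less_divisor)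
  then show ?case using le(1) by (metis dvd_eq_mod_eq_0 mod_eq_dvd_iff_nat)
qed metis

text \<open>A discrete logarithm; only its residue class modulo \<open>n\<close> is meaningful.\<close>

definition log :: "'c \<Rightarrow> nat" where
  "log c = (LEAST i. h [^] i = c)"

lemma pow_log: "c \<in> carrier C \<Longrightarrow> h [^] log c = c"
  unfolding log_def using exists_pow[of c] by (metis (mono_tags, lifting) LeastI)

lemma log_pow: "log (h [^] (i::nat)) mod n = i mod n"
  using h by (intro pow_eqD pow_log) simp

lemma log_one: "log \<one> mod n = 0"
  using log_pow[of 0] by simp

lemma log_mult: "a \<in> carrier C \<Longrightarrow> b \<in> carrier C \<Longrightarrow> log (a \<otimes> b) mod n = (log a + log b) mod n"
  using log_pow[of "log a + log b"] h by (simp add: nat_pow_mult[symmetric] pow_log)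

end

section \<open>Matched pairs of a cyclic group algebra with the Radford algebra\<close>

definition bicrossed_val :: "'a \<Rightarrow> 'a \<Rightarrow> 'a \<Rightarrow> bicrossed_gen \<Rightarrow> 'a" where
  "bicrossed_val g h x y = (case y of Gen_g \<Rightarrow> g | Gen_h \<Rightarrow> h | Gen_x \<Rightarrow> x)"

lemma bicrossed_val_simps [simp]:
  "bicrossed_val g h x Gen_g = g" "bicrossed_val g h x Gen_h = h" "bicrossed_val g h x Gen_x = x"
  by (simp_all add: bicrossed_val_def)

lemma (in k_algebra) minus_eq_zero_iff: "a \<in> carrier A \<Longrightarrow> b \<in> carrier A \<Longrightarrow> a \<ominus> b = \<zero> \<longleftrightarrow> a = b"
  using eq_of_minus_eq_zero minus_self by blast

text \<open>Both directions are used: for the images of the generators in a third-type algebra, and for the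
  generators of the presented algebra.\<close>

lemma (in k_algebra) bicrossed_rels_iff:
  assumes c: "g \<in> carrier A" "h \<in> carrier A" "x \<in> carrier A"
  shows "(\<forall>r\<in>bicrossed_rels p n \<alpha>. free_ext A (bicrossed_val g h x) r = \<zero>) \<longleftrightarrow>
    g [^] p = \<one> \<and> h [^] n = \<one> \<and> g \<otimes> h = h \<otimes> g \<and> x [^] p = x \<and>
    g \<otimes> x = x \<otimes> g \<oplus> g \<otimes> (\<one> \<ominus> g) \<and> h \<otimes> x = x \<otimes> h \<oplus> (- \<alpha>) \<odot> (h \<otimes> (\<one> \<ominus> g))"
proof -
  let ?v = "bicrossed_val g h x"
  have v: "?v ` UNIV \<subseteq> carrier A" using c by (auto simp: bicrossed_val_def split: bicrossed_gen.splits)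
  interpret F: k_algebra "free_algebra UNIV :: ('k, bicrossed_gen list \<Rightarrow>\<^sub>0 'k) module" by (rule k_algebra_free_algebra)
  note hom = free_ext_alg_hom[OF k_algebra_axioms v]
  have var_c: "var y \<in> carrier (free_algebra UNIV)" for y :: bicrossed_gen by (simp add: free_algebra_simps)
  have ev: "free_ext A ?v (var y) = ?v y" for y
    using v by (intro free_ext_var k_algebra_axioms) blast
  note simps = linear_map_minus[OF alg_homD(1)[OF hom] F.k_algebra_axioms k_algebra_axioms] alg_homD(2,3)[OF hom]
    linear_map_smult[OF alg_homD(1)[OF hom]] alg_hom_pow[OF hom F.k_algebra_axioms k_algebra_axioms] ev var_c
  have move: "(a \<ominus> b) \<ominus> y = \<zero> \<longleftrightarrow> a = b \<oplus> y" if "a \<in> carrier A" "b \<in> carrier A" "y \<in> carrier A" for a b y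
  proof -
    have "(a \<ominus> b) \<ominus> y = a \<ominus> (b \<oplus> y)" using that by (simp add: minus_eq minus_add a_ac)
    then show ?thesis using minus_eq_zero_iff[of a "b \<oplus> y"] that by simp
  qed
  have "(x \<otimes> h \<ominus> h \<otimes> x) \<ominus> \<alpha> \<odot> (h \<otimes> (\<one> \<ominus> g)) = \<zero> \<longleftrightarrow> h \<otimes> x = x \<otimes> h \<oplus> (- \<alpha>) \<odot> (h \<otimes> (\<one> \<ominus> g))"
  proof -
    let ?y = "\<alpha> \<odot> (h \<otimes> (\<one> \<ominus> g))"
    have y: "?y \<in> carrier A" using c by simp
    have "(x \<otimes> h = h \<otimes> x \<oplus> ?y) \<longleftrightarrow> (h \<otimes> x = x \<otimes> h \<oplus> (\<ominus> ?y))"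
      using c y a_assoc[of "h \<otimes> x" ?y "\<ominus> ?y"] a_assoc[of "x \<otimes> h" "\<ominus> ?y" ?y]
      by (metis a_inv_closed l_neg m_closed r_neg r_zero)
    then show ?thesis using c y move[of "x \<otimes> h" "h \<otimes> x" ?y] by (simp add: smult_minus_left)
  qed
  then show ?thesis
    using c move[of "g \<otimes> x" "x \<otimes> g" "g \<otimes> (\<one> \<ominus> g)"]
    by (simp add: bicrossed_rels_def Let_def simps minus_eq_zero_iff)
qed

text \<open>Elements \<open>u\<close> with \<open>u x = x u + a u z\<close> are closed under multiplication, and the coefficients \<open>a\<close> add up.\<close>

lemma (in k_algebra) skew_mult:
  assumes c: "u \<in> carrier A" "v \<in> carrier A" "x \<in> carrier A" "z \<in> carrier A"
    and u: "u \<otimes> x = x \<otimes> u \<oplus> a \<odot> (u \<otimes> z)" and v: "v \<otimes> x = x \<otimes> v \<oplus> b \<odot> (v \<otimes> z)" and vz: "z \<otimes> v = v \<otimes> z"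
  shows "(u \<otimes> v) \<otimes> x = x \<otimes> (u \<otimes> v) \<oplus> (a + b) \<odot> ((u \<otimes> v) \<otimes> z)"
proof -
  have "(u \<otimes> v) \<otimes> x = (u \<otimes> x) \<otimes> v \<oplus> b \<odot> ((u \<otimes> v) \<otimes> z)"
    using c by (simp add: m_assoc v r_distr smult_mult_right)
  also have "(u \<otimes> x) \<otimes> v = x \<otimes> (u \<otimes> v) \<oplus> a \<odot> ((u \<otimes> v) \<otimes> z)"
    using c by (simp add: u l_distr smult_mult_left m_assoc vz)
  finally show ?thesis using c by (simp add: a_assoc smult_add_left)
qed

lemma (in k_algebra) skew_pow:
  assumes c: "u \<in> carrier A" "x \<in> carrier A" "z \<in> carrier A"
    and u: "u \<otimes> x = x \<otimes> u \<oplus> a \<odot> (u \<otimes> z)" and uz: "z \<otimes> u = u \<otimes> z"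
  shows "u [^] (i::nat) \<otimes> x = x \<otimes> u [^] i \<oplus> (of_nat i * a) \<odot> (u [^] i \<otimes> z)"
proof (induction i)
  case (Suc i)
  have "(u [^] i \<otimes> u) \<otimes> x = x \<otimes> (u [^] i \<otimes> u) \<oplus> (of_nat i * a + a) \<odot> ((u [^] i \<otimes> u) \<otimes> z)"
    using c by (intro skew_mult Suc u uz) simp_all
  then show ?case by (simp add: algebra_simps)
qed (use c in simp)

locale cyclic_third = third_with_group G g f C + CC: cyclic_group C h n + GG: cyclic_group G g "CHAR('k)"
  for G :: "('g, 'm) monoid_scheme" (structure) and g and f :: "'g \<Rightarrow> 'k::field"
    and C :: "('c, 'n) monoid_scheme" and h n
begin

lemma f_pow: "f (g [^] (j::nat)) = of_nat j"
  by (induction j) (simp_all add: f_mult)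

lemma shift_ok [simp]: "shift_ok c"
  using GG.pow_n by (simp add: shift_ok_def)

text \<open>This makes \<open>h\<^sup>i \<mapsto> i \<alpha>\<close> well defined.\<close>

lemma of_nat_mult_mod:
  assumes "of_nat n * \<alpha> = (0::'k)" and ij: "i mod n = j mod n"
  shows "of_nat i * \<alpha> = of_nat j * \<alpha>"
proof -
  have "of_nat k * \<alpha> = of_nat (k mod n) * \<alpha>" for k
  proof -
    have "of_nat k * \<alpha> = of_nat (n * (k div n) + k mod n) * \<alpha>" by simp
    also have "\<dots> = of_nat (k div n) * (of_nat n * \<alpha>) + of_nat (k mod n) * \<alpha>"
      unfolding of_nat_add of_nat_mult by (simp add: algebra_simps)
    finally show ?thesis using assms(1) by simp
  qed
  then show ?thesis using ij by metis
qed

definition character :: "'k \<Rightarrow> 'c \<Rightarrow> 'k" where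
  "character \<alpha> c = of_nat (CC.log c) * \<alpha>"

lemma character_pow: "of_nat n * \<alpha> = 0 \<Longrightarrow> character \<alpha> (h [^]\<^bsub>C\<^esub> (i::nat)) = of_nat i * \<alpha>"
  unfolding character_def by (rule of_nat_mult_mod) (simp_all add: CC.log_pow)

lemma third_character: "of_nat n * \<alpha> = 0 \<Longrightarrow> third_character G g f C (character \<alpha>)"
proof (intro third_character.intro third_with_group_axioms third_character_axioms.intro)
  fix s t assume n: "of_nat n * \<alpha> = 0" and s: "s \<in> carrier C" and t: "t \<in> carrier C"
  have "of_nat (CC.log (s \<otimes>\<^bsub>C\<^esub> t)) * \<alpha> = of_nat (CC.log s + CC.log t) * \<alpha>"
    by (rule of_nat_mult_mod[OF n CC.log_mult[OF s t]])
  then show "character \<alpha> (s \<otimes>\<^bsub>C\<^esub> t) = character \<alpha> s + character \<alpha> t"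
    by (simp add: character_def algebra_simps)
qed simp

abbreviation "param \<equiv> has_parameter h g (third_elt G g f) H"

lemma param_iff: "param act \<alpha> \<longleftrightarrow>
    act (e g) (delta h) = e g \<and> act x (delta h) = x \<oplus>\<^bsub>A\<^esub> \<alpha> \<odot>\<^bsub>A\<^esub> (\<one>\<^bsub>A\<^esub> \<ominus>\<^bsub>A\<^esub> e g)"
  by (simp add: has_parameter_def a_minus_def a_inv_def m_inv_def)

lemma third_matched_pair: "matched_pair HC H lact ract \<Longrightarrow> third_matched_pair G g f C lact ract"
  by (intro third_matched_pair.intro third_with_group_axioms third_matched_pair_axioms.intro GG.exists_pow)

lemma parameter_exists:
  assumes "matched_pair HC H lact ract"
  shows "\<exists>\<alpha>. param ract \<alpha>"
proof -
  interpret mp: third_matched_pair G g f C lact ract by (rule third_matched_pair[OF assms])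
  show ?thesis
    by (rule mp.ract_form[OF CC.h]) (unfold param_iff, blast)
qed

lemma matched_pair_determined:
  assumes mp: "matched_pair HC H lact ract" and \<alpha>: "param ract \<alpha>"
  shows "of_nat n * \<alpha> = 0"
    and "u \<in> carrier A \<Longrightarrow> a \<in> carrier KC \<Longrightarrow> lact u a = third_character.triv G g f C u a"
    and "u \<in> carrier A \<Longrightarrow> a \<in> carrier KC \<Longrightarrow> ract u a = third_character.twist G g f (character \<alpha>) u a"
proof -
  interpret mp: third_matched_pair G g f C lact ract by (rule third_matched_pair[OF mp])
  have \<alpha>': "ract x (delta h) = x \<oplus>\<^bsub>A\<^esub> \<alpha> \<odot>\<^bsub>A\<^esub> (\<one>\<^bsub>A\<^esub> \<ominus>\<^bsub>A\<^esub> e g)" using \<alpha> by (simp add: param_iff)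
  show n: "of_nat n * \<alpha> = 0" by (rule mp.parameter_torsion[OF CC.h \<alpha>' CC.pow_n])
  interpret ch: third_character G g f C "character \<alpha>" by (rule third_character[OF n])
  show "lact u a = ch.triv u a" if "u \<in> carrier A" "a \<in> carrier KC"
    using mp.lact_trivial[OF that] by (simp add: ch.triv_def)
  assume u: "u \<in> carrier A" and a: "a \<in> carrier KC"
  show "ract u a = ch.twist u a"
  proof (rule KC_eqI[OF k_algebra_A bilinear_mapD(1)[OF mp.ract_bilinear u] bilinear_mapD(1)[OF ch.twist_bilinear u] _ a])
    fix t assume t: "t \<in> carrier C"
    then obtain i :: nat where i: "t = h [^]\<^bsub>C\<^esub> i" using CC.exists_pow by blast
    show "ract u (delta t) = ch.twist u (delta t)"
      unfolding ch.twist_delta[OF u t]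
      by (rule mp.ract_unique[OF t _ shift_ok u]) (unfold i character_pow[OF n], rule mp.ract_pow[OF CC.h \<alpha>'])
  qed
qed

lemma matched_pair_exists:
  assumes n: "of_nat n * \<alpha> = (0::'k)"
  shows "\<exists>lact ract. matched_pair HC H lact ract \<and> param ract \<alpha>"
proof -
  interpret ch: third_character G g f C "character \<alpha>" by (rule third_character[OF n])
  have "character \<alpha> h = \<alpha>" using character_pow[OF n, of 1] CC.h by simp
  then have "param ch.twist \<alpha>"
    using CC.h by (simp add: param_iff ch.twist_delta shift)
  then show ?thesis using ch.matched_pair_twist by blast
qed

lemma parameter_set:
  "{\<alpha>. \<exists>lact ract. matched_pair HC H lact ract \<and> param ract \<alpha>} = {\<alpha>. of_nat n * \<alpha> = 0}"
  using matched_pair_determined(1) matched_pair_exists by blast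

end

locale cyclic_bicrossed = cyclic_third G g f C h n + third_bicrossed G g f C "cyclic_third.character C h \<alpha>" lact ract
  for G :: "('g, 'm) monoid_scheme" (structure) and g and f :: "'g \<Rightarrow> 'k::field"
    and C :: "('c, 'n) monoid_scheme" and h n \<alpha> lact ract +
  assumes torsion: "of_nat n * \<alpha> = 0"
begin

lemma F_pow: "F (h [^]\<^bsub>C\<^esub> (i::nat), g [^] (j::nat)) = of_nat j - of_nat i * \<alpha>"
  by (simp add: F_def f_pow character_pow torsion)

abbreviation "rels \<equiv> bicrossed_rels CHAR('k) n \<alpha>"

lemma rels_carrier: "rels \<subseteq> carrier (free_algebra UNIV)"
proof -
  interpret FA: k_algebra "free_algebra UNIV :: ('k, bicrossed_gen list \<Rightarrow>\<^sub>0 'k) module" by (rule k_algebra_free_algebra)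
  have "var y \<in> carrier (free_algebra UNIV :: ('k, bicrossed_gen list \<Rightarrow>\<^sub>0 'k) module)" for y
    by (simp add: free_algebra_simps)
  then show ?thesis unfolding bicrossed_rels_def Let_def by simp
qed

sublocale Q: presentation UNIV rels
  by unfold_locales (rule rels_carrier)

sublocale QA: k_algebra Q.P by (rule Q.k_algebra_P)

abbreviation "gB \<equiv> B.e (\<one>\<^bsub>C\<^esub>, g)"
abbreviation "hB \<equiv> B.e (h, \<one>)"

lemma pow_h: "(h, \<one>) [^]\<^bsub>CG\<^esub> (i::nat) = (h [^]\<^bsub>C\<^esub> i, \<one>)"
  by (induction i) (simp_all add: DirProd_def)

lemma e_as_power:
  "hB [^]\<^bsub>B.A\<^esub> (i::nat) \<otimes>\<^bsub>B.A\<^esub> gB [^]\<^bsub>B.A\<^esub> (j::nat) = B.e (h [^]\<^bsub>C\<^esub> i, g [^] j)"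
  using B.e_pow[of "(h, \<one>)" i] B.e_pow[of "(\<one>\<^bsub>C\<^esub>, g)" j] B.e_mult[of "(h [^]\<^bsub>C\<^esub> i, \<one>)" "(\<one>\<^bsub>C\<^esub>, g [^] j)"] CC.h
  by (simp add: pow_h pow_CG)

lemma relations_hold: "\<forall>r\<in>rels. free_ext B.A (bicrossed_val gB hB B.x) r = \<zero>\<^bsub>B.A\<^esub>"
proof -
  have gh: "(\<one>\<^bsub>C\<^esub>, g) \<in> carrier CG" "(h, \<one>) \<in> carrier CG" using CC.h by simp_all
  have F: "F (\<one>\<^bsub>C\<^esub>, g) = 1" "F (h, \<one>) = - \<alpha>"
    using F_pow[of 0 1] F_pow[of 1 0] CC.h by simp_all
  have one: "B.e (\<one>\<^bsub>C\<^esub>, \<one>) = \<one>\<^bsub>B.A\<^esub>" using B.e_one by simp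
  have c: "gB \<in> carrier B.A" "hB \<in> carrier B.A" using gh by (simp_all only: B.e_closed)
  have comm: "gB \<otimes>\<^bsub>B.A\<^esub> hB = hB \<otimes>\<^bsub>B.A\<^esub> gB"
    using B.e_mult[OF gh] B.e_mult[OF gh(2,1)] CC.h by simp
  show ?thesis
    unfolding B.A.bicrossed_rels_iff[OF c B.x_closed]
    using B.e_x[OF gh(1)] B.e_x[OF gh(2)] B.e_pow[OF gh(1)] B.e_pow[OF gh(2)] B.x_pow c comm
    by (simp add: F pow_h pow_CG GG.pow_n CC.pow_n one)
qed

abbreviation "gQ \<equiv> Q.gen Gen_g"
abbreviation "hQ \<equiv> Q.gen Gen_h"
abbreviation "xQ \<equiv> Q.gen Gen_x"

lemma Q_closed [simp]: "Q.gen y \<in> carrier Q.P"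
  by (rule Q.gen_closed) simp

lemma Q_relations:
  "gQ [^]\<^bsub>Q.P\<^esub> CHAR('k) = \<one>\<^bsub>Q.P\<^esub>" "hQ [^]\<^bsub>Q.P\<^esub> n = \<one>\<^bsub>Q.P\<^esub>"
  "gQ \<otimes>\<^bsub>Q.P\<^esub> hQ = hQ \<otimes>\<^bsub>Q.P\<^esub> gQ" "xQ [^]\<^bsub>Q.P\<^esub> CHAR('k) = xQ"
  "gQ \<otimes>\<^bsub>Q.P\<^esub> xQ = xQ \<otimes>\<^bsub>Q.P\<^esub> gQ \<oplus>\<^bsub>Q.P\<^esub> gQ \<otimes>\<^bsub>Q.P\<^esub> (\<one>\<^bsub>Q.P\<^esub> \<ominus>\<^bsub>Q.P\<^esub> gQ)"
  "hQ \<otimes>\<^bsub>Q.P\<^esub> xQ = xQ \<otimes>\<^bsub>Q.P\<^esub> hQ \<oplus>\<^bsub>Q.P\<^esub> (- \<alpha>) \<odot>\<^bsub>Q.P\<^esub> (hQ \<otimes>\<^bsub>Q.P\<^esub> (\<one>\<^bsub>Q.P\<^esub> \<ominus>\<^bsub>Q.P\<^esub> gQ))"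
proof -
  have v: "bicrossed_val gQ hQ xQ = Q.gen"
    by (rule ext) (simp add: bicrossed_val_def split: bicrossed_gen.split)
  have "\<forall>r\<in>rels. free_ext Q.P (bicrossed_val gQ hQ xQ) r = \<zero>\<^bsub>Q.P\<^esub>"
    unfolding v
  proof
    fix r assume r: "r \<in> rels"
    then have "r \<in> carrier Q.F" using rels_carrier by blast
    then show "free_ext Q.P Q.gen r = \<zero>\<^bsub>Q.P\<^esub>" by (simp only: Q.free_ext_gen Q.proj_rel[OF r])
  qed
  note r = this[unfolded QA.bicrossed_rels_iff[OF Q_closed Q_closed Q_closed]]
  show "gQ [^]\<^bsub>Q.P\<^esub> CHAR('k) = \<one>\<^bsub>Q.P\<^esub>" "hQ [^]\<^bsub>Q.P\<^esub> n = \<one>\<^bsub>Q.P\<^esub>"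
    "gQ \<otimes>\<^bsub>Q.P\<^esub> hQ = hQ \<otimes>\<^bsub>Q.P\<^esub> gQ" "xQ [^]\<^bsub>Q.P\<^esub> CHAR('k) = xQ"
    "gQ \<otimes>\<^bsub>Q.P\<^esub> xQ = xQ \<otimes>\<^bsub>Q.P\<^esub> gQ \<oplus>\<^bsub>Q.P\<^esub> gQ \<otimes>\<^bsub>Q.P\<^esub> (\<one>\<^bsub>Q.P\<^esub> \<ominus>\<^bsub>Q.P\<^esub> gQ)"
    "hQ \<otimes>\<^bsub>Q.P\<^esub> xQ = xQ \<otimes>\<^bsub>Q.P\<^esub> hQ \<oplus>\<^bsub>Q.P\<^esub> (- \<alpha>) \<odot>\<^bsub>Q.P\<^esub> (hQ \<otimes>\<^bsub>Q.P\<^esub> (\<one>\<^bsub>Q.P\<^esub> \<ominus>\<^bsub>Q.P\<^esub> gQ))"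
    using r by blast+
qed

definition eQ where
  "eQ cd = hQ [^]\<^bsub>Q.P\<^esub> CC.log (fst cd) \<otimes>\<^bsub>Q.P\<^esub> gQ [^]\<^bsub>Q.P\<^esub> GG.log (snd cd)"

text \<open>In the presented algebra a group element is represented by \<open>h\<^sup>i g\<^sup>j\<close>, where the exponents matter only
  modulo \<open>n\<close> and \<open>p\<close>, and its commutator with \<open>x\<close> follows from those of \<open>h\<close> and \<open>g\<close>.\<close>

lemma third_rep_Q: "B.third_rep Q.P eQ xQ"
  unfolding B.third_rep_def
proof (intro conjI ballI)
  let ?z = "\<one>\<^bsub>Q.P\<^esub> \<ominus>\<^bsub>Q.P\<^esub> gQ"
  note hmod = QA.pow_mod_eq[OF Q_closed Q_relations(2)] and gmod = QA.pow_mod_eq[OF Q_closed Q_relations(1)]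
  have h0: "hQ [^]\<^bsub>Q.P\<^esub> CC.log \<one>\<^bsub>C\<^esub> = \<one>\<^bsub>Q.P\<^esub>" using hmod[of "CC.log \<one>\<^bsub>C\<^esub>" 0] CC.log_one by simp
  have g0: "gQ [^]\<^bsub>Q.P\<^esub> GG.log \<one> = \<one>\<^bsub>Q.P\<^esub>" using gmod[of "GG.log \<one>" 0] GG.log_one by simp
  have g1: "gQ [^]\<^bsub>Q.P\<^esub> GG.log g = gQ" using gmod[of "GG.log g" 1] GG.log_pow[of 1] by simp
  have eg: "eQ (\<one>\<^bsub>C\<^esub>, g) = gQ" by (simp add: eQ_def h0 g1)
  have comm: "gQ [^]\<^bsub>Q.P\<^esub> (j::nat) \<otimes>\<^bsub>Q.P\<^esub> hQ [^]\<^bsub>Q.P\<^esub> (i::nat) = hQ [^]\<^bsub>Q.P\<^esub> i \<otimes>\<^bsub>Q.P\<^esub> gQ [^]\<^bsub>Q.P\<^esub> j" for i j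
    using QA.group_commutes_pow[OF QA.group_commutes_pow[OF Q_relations(3) Q_closed Q_closed, of j, symmetric] Q_closed]
    by simp
  show "eQ t \<in> carrier Q.P" for t by (simp add: eQ_def)
  show "xQ \<in> carrier Q.P" by simp
  show "eQ \<one>\<^bsub>CG\<^esub> = \<one>\<^bsub>Q.P\<^esub>" by (simp add: eQ_def h0 g0)
  show "xQ [^]\<^bsub>Q.P\<^esub> CHAR('k) = xQ" by (rule Q_relations)
  fix s assume s: "s \<in> carrier CG"
  have zg: "?z \<otimes>\<^bsub>Q.P\<^esub> gQ = gQ \<otimes>\<^bsub>Q.P\<^esub> ?z" by (simp add: a_minus_def QA.l_distr QA.r_distr QA.l_minus QA.r_minus)
  have zh: "?z \<otimes>\<^bsub>Q.P\<^esub> hQ = hQ \<otimes>\<^bsub>Q.P\<^esub> ?z" by (simp add: a_minus_def QA.l_distr QA.r_distr QA.l_minus QA.r_minus Q_relations(3))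
  have zc: "?z \<in> carrier Q.P" by simp
  have "eQ s \<otimes>\<^bsub>Q.P\<^esub> xQ = xQ \<otimes>\<^bsub>Q.P\<^esub> eQ s \<oplus>\<^bsub>Q.P\<^esub>
      (of_nat (CC.log (fst s)) * (- \<alpha>) + of_nat (GG.log (snd s)) * 1) \<odot>\<^bsub>Q.P\<^esub> (eQ s \<otimes>\<^bsub>Q.P\<^esub> ?z)"
    unfolding eQ_def
    by (rule QA.skew_mult[OF _ _ Q_closed zc QA.skew_pow[OF Q_closed Q_closed zc Q_relations(6) zh] QA.skew_pow[OF Q_closed Q_closed zc _ zg]])
       (use QA.group_commutes_pow[OF zg[symmetric]] Q_relations(5) in \<open>simp_all\<close>)
  moreover have "F s = of_nat (CC.log (fst s)) * (- \<alpha>) + of_nat (GG.log (snd s)) * 1"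
    using s F_pow[of "CC.log (fst s)" "GG.log (snd s)"] by (auto simp: CC.pow_log GG.pow_log)
  ultimately show "eQ s \<otimes>\<^bsub>Q.P\<^esub> xQ = xQ \<otimes>\<^bsub>Q.P\<^esub> eQ s \<oplus>\<^bsub>Q.P\<^esub> F s \<odot>\<^bsub>Q.P\<^esub> (eQ s \<otimes>\<^bsub>Q.P\<^esub> (\<one>\<^bsub>Q.P\<^esub> \<ominus>\<^bsub>Q.P\<^esub> eQ (\<one>\<^bsub>C\<^esub>, g)))"
    by (simp only: eg)
  fix t assume t: "t \<in> carrier CG"
  obtain a b a' b' where st: "s = (a, b)" "t = (a', b')" "a \<in> carrier C" "b \<in> carrier G" "a' \<in> carrier C" "b' \<in> carrier G"
    using s t by auto
  have "eQ (s \<otimes>\<^bsub>CG\<^esub> t) = hQ [^]\<^bsub>Q.P\<^esub> (CC.log a + CC.log a') \<otimes>\<^bsub>Q.P\<^esub> gQ [^]\<^bsub>Q.P\<^esub> (GG.log b + GG.log b')"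
    using st hmod[OF CC.log_mult[of a a']] gmod[OF GG.log_mult[of b b']] by (simp add: eQ_def)
  also have "\<dots> = hQ [^]\<^bsub>Q.P\<^esub> CC.log a \<otimes>\<^bsub>Q.P\<^esub> (hQ [^]\<^bsub>Q.P\<^esub> CC.log a' \<otimes>\<^bsub>Q.P\<^esub> gQ [^]\<^bsub>Q.P\<^esub> GG.log b) \<otimes>\<^bsub>Q.P\<^esub> gQ [^]\<^bsub>Q.P\<^esub> GG.log b'"
    by (simp add: QA.nat_pow_mult[symmetric] QA.m_assoc)
  also have "\<dots> = hQ [^]\<^bsub>Q.P\<^esub> CC.log a \<otimes>\<^bsub>Q.P\<^esub> (gQ [^]\<^bsub>Q.P\<^esub> GG.log b \<otimes>\<^bsub>Q.P\<^esub> hQ [^]\<^bsub>Q.P\<^esub> CC.log a') \<otimes>\<^bsub>Q.P\<^esub> gQ [^]\<^bsub>Q.P\<^esub> GG.log b'"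
    by (simp only: comm)
  also have "\<dots> = eQ s \<otimes>\<^bsub>Q.P\<^esub> eQ t"
    by (simp add: eQ_def st QA.m_assoc)
  finally show "eQ (s \<otimes>\<^bsub>CG\<^esub> t) = eQ s \<otimes>\<^bsub>Q.P\<^esub> eQ t" .
qed

text \<open>The relations of each algebra hold in the other one, which gives mutually inverse maps that exchange
  the generators.\<close>

theorem presentation_B: "has_presentation B.A UNIV (bicrossed_val gB hB B.x) rels"
proof (rule Q.has_presentationI[OF B.k_algebra_A])
  let ?v = "bicrossed_val gB hB B.x" and ?\<rho> = "presented_ext Q.P (third_val eQ xQ)"
  note \<rho> = B.third_ext[OF Q.k_algebra_P third_rep_Q]
  have c: "gB \<in> carrier B.A" "hB \<in> carrier B.A" using CC.h by simp_all
  show v: "?v ` UNIV \<subseteq> carrier B.A" using c by (auto simp: bicrossed_val_def split: bicrossed_gen.split)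
  show rel: "free_ext B.A ?v r = \<zero>\<^bsub>B.A\<^esub>" if "r \<in> rels" for r using relations_hold that by blast
  show "alg_hom B.A Q.P ?\<rho>" by (rule \<rho>(1))
  note hmod = QA.pow_mod_eq[OF Q_closed Q_relations(2)] and gmod = QA.pow_mod_eq[OF Q_closed Q_relations(1)]
  have h0: "hQ [^]\<^bsub>Q.P\<^esub> CC.log \<one>\<^bsub>C\<^esub> = \<one>\<^bsub>Q.P\<^esub>" using hmod[of "CC.log \<one>\<^bsub>C\<^esub>" 0] CC.log_one by simp
  have g0: "gQ [^]\<^bsub>Q.P\<^esub> GG.log \<one> = \<one>\<^bsub>Q.P\<^esub>" using gmod[of "GG.log \<one>" 0] GG.log_one by simp
  have h1: "hQ [^]\<^bsub>Q.P\<^esub> CC.log h = hQ" using hmod[of "CC.log h" 1] CC.log_pow[of 1] CC.h by simp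
  have g1: "gQ [^]\<^bsub>Q.P\<^esub> GG.log g = gQ" using gmod[of "GG.log g" 1] GG.log_pow[of 1] by simp
  show "?\<rho> (?v y) = Q.gen y" for y
    using CC.h by (cases y) (simp_all add: \<rho> eQ_def h0 g0 h1 g1)
  have ext: "alg_hom Q.P B.A (presented_ext B.A ?v)" "\<And>y. presented_ext B.A ?v (Q.gen y) = ?v y"
    using Q.presented_ext[OF B.k_algebra_A v rel] by blast+
  show "presented_ext B.A ?v (?\<rho> u) = u" if u: "u \<in> carrier B.A" for u
  proof (rule B.third_alg_hom_eqI[OF alg_hom_compose[OF \<rho>(1) ext(1)] alg_homI[OF linear_map_id] _ _ u])
    fix cd assume cd: "cd \<in> carrier CG"
    then obtain c d where cd': "cd = (c, d)" "c \<in> carrier C" "d \<in> carrier G" by auto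
    have "presented_ext B.A ?v (?\<rho> (B.e cd)) = hB [^]\<^bsub>B.A\<^esub> CC.log c \<otimes>\<^bsub>B.A\<^esub> gB [^]\<^bsub>B.A\<^esub> GG.log d"
      unfolding \<rho>(2)[OF cd]
      by (simp add: eQ_def cd'(1) alg_homD(2)[OF ext(1)] alg_hom_pow[OF ext(1) Q.k_algebra_P B.k_algebra_A] ext(2))
    then show "presented_ext B.A ?v (?\<rho> (B.e cd)) = B.e cd"
      using cd' by (simp only: e_as_power CC.pow_log GG.pow_log)
  qed (simp_all add: \<rho> ext(2))
qed

abbreviation "gE \<equiv> pure KC A \<one>\<^bsub>KC\<^esub> (e g)"
abbreviation "hE \<equiv> pure KC A (delta h) \<one>\<^bsub>A\<^esub>"
abbreviation "xE \<equiv> pure KC A \<one>\<^bsub>KC\<^esub> x"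

lemma Phi_generators: "Phi gE = gB" "Phi hE = hB" "Phi xE = B.x"
  using CC.h alg_homD(3)[OF iota(1)] alg_homD(3)[OF emb(1)] by (simp_all add: Phi_pure emb iota)

theorem presentation_E: "has_presentation E UNIV (bicrossed_val gE hE xE) rels"
proof (rule has_presentation_transport[OF k_algebra_E B.k_algebra_A Phi_alg_hom])
  show "bij_betw Phi (carrier E) (carrier B.A)" using Phi_bij by simp
  show "bicrossed_val gE hE xE ` UNIV \<subseteq> carrier E"
    using CC.h by (auto simp: bicrossed_val_def split: bicrossed_gen.split)
  have "(\<lambda>y. Phi (bicrossed_val gE hE xE y)) = bicrossed_val gB hB B.x"
    using Phi_generators by (intro ext) (simp add: bicrossed_val_def split: bicrossed_gen.split)
  then show "has_presentation B.A UNIV (\<lambda>y. Phi (bicrossed_val gE hE xE y)) rels"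
    using presentation_B by simp
qed

lemma comult_generators:
  "comult E gE = pure WW WW gE gE" "comult E hE = pure WW WW hE hE"
  "comult E xE = pure WW WW xE \<one>\<^bsub>WW\<^esub> \<oplus>\<^bsub>W2\<^esub> pure WW WW gE xE"
proof -
  have d1: "delta \<one>\<^bsub>C\<^esub> \<in> carrier KC" and dh: "delta h \<in> carrier KC" using CC.h by simp_all
  note b = cop4_bilinear(1)[OF d1 d1] and bh = cop4_bilinear(1)[OF dh dh]
  show "comult E gE = pure WW WW gE gE"
    by (simp add: comult_E_pure comult_H T.tlift(2)[OF k_algebra_W2 b])
  show "comult E hE = pure WW WW hE hE"
    using CC.h by (simp add: comult_E_pure alg_homD(3)[OF comult_H(1)] T.tensor_one T.tlift(2)[OF k_algebra_W2 bh])
  show "comult E xE = pure WW WW xE \<one>\<^bsub>WW\<^esub> \<oplus>\<^bsub>W2\<^esub> pure WW WW gE xE"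
    by (simp add: comult_E_pure comult_H linear_map_add[OF T.tlift(1)[OF k_algebra_W2 b]] T.tlift(2)[OF k_algebra_W2 b] W.tensor_one)
qed

end

theorem theorem5p2:
  fixes p n :: nat
    and C :: "'c monoid" and h :: 'c
    and D :: "'d monoid" and g :: 'd
    and f :: "'d \<Rightarrow> 'k::alg_closed_field"
  assumes "CHAR('k) = p" and "p > 0"
    and "group C" and "h \<in> carrier C" and "generate C {h} = carrier C"
    and "order C = n" and "n > 0"
    and "group D" and "g \<in> carrier D" and "generate D {g} = carrier D"
    and "order D = p"
    and "third_type_datum D g f"
  shows
    "let A = (group_hopf C :: ('k, 'c \<Rightarrow>\<^sub>0 'k) hopf);
         R = third_hopf D g f;
         e = third_elt D g f;
         param = (has_parameter h g e R :: _ \<Rightarrow> 'k \<Rightarrow> bool)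
     in
       (\<forall>lact ract. matched_pair A R lact ract \<longrightarrow> (\<exists>\<alpha>. param ract \<alpha>)) \<and>
       (\<forall>lact ract lact' ract' \<alpha>.
          matched_pair A R lact ract \<and> param ract \<alpha> \<and>
          matched_pair A R lact' ract' \<and> param ract' \<alpha> \<longrightarrow>
          (\<forall>u\<in>carrier R. \<forall>a\<in>carrier A. lact u a = lact' u a \<and> ract u a = ract' u a)) \<and>
       (\<not> p dvd n \<longrightarrow>
          {\<alpha>. \<exists>lact ract. matched_pair A R lact ract \<and> param ract \<alpha>} = {0}) \<and>
       (p dvd n \<longrightarrow>
          {\<alpha>. \<exists>lact ract. matched_pair A R lact ract \<and> param ract \<alpha>} = UNIV) \<and>
       (\<forall>lact ract \<alpha>. matched_pair A R lact ract \<and> param ract \<alpha> \<longrightarrow>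
          (let E = bicrossed_product A R lact ract;
               gE = pure A R \<one>\<^bsub>A\<^esub> (e (Elt g));
               hE = pure A R (delta h) \<one>\<^bsub>R\<^esub>;
               xE = pure A R \<one>\<^bsub>A\<^esub> (e Xgen)
           in
             has_presentation E UNIV
               (\<lambda>y. case y of Gen_g \<Rightarrow> gE | Gen_h \<Rightarrow> hE | Gen_x \<Rightarrow> xE) (bicrossed_rels p n \<alpha>) \<and>
             comult E gE = pure E E gE gE \<and>
             comult E hE = pure E E hE hE \<and>
             comult E xE = pure E E xE \<one>\<^bsub>E\<^esub> \<oplus>\<^bsub>tensor E E\<^esub> pure E E gE xE \<and>
             (\<exists>F. (\<forall>i j :: nat. F (h [^]\<^bsub>C\<^esub> i, g [^]\<^bsub>D\<^esub> j) = of_nat j - of_nat i * \<alpha>) \<and>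
                  third_type_datum (C \<times>\<times> D) (\<one>\<^bsub>C\<^esub>, g) F \<and>
                  hopf_iso E (third_hopf (C \<times>\<times> D) (\<one>\<^bsub>C\<^esub>, g) F) \<noteq> {})))"
proof -
  have prime: "prime CHAR('k)" by (rule prime_CHAR_semidom) (simp add: assms(1,2))
  interpret cyclic_third D g f C h n
    by (intro cyclic_third.intro third_with_group.intro third_type.intro third_type_axioms.intro group_Hopf.intro
          cyclic_group.intro cyclic_group_axioms.intro)
       (use assms prime in simp_all)
  have bicrossed: "let E = bicrossed_product HC H lact ract;
         gE = pure HC H \<one>\<^bsub>HC\<^esub> (e g);
         hE = pure HC H (delta h) \<one>\<^bsub>H\<^esub>;
         xE = pure HC H \<one>\<^bsub>HC\<^esub> x
     in
       has_presentation E UNIV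
         (\<lambda>y. case y of Gen_g \<Rightarrow> gE | Gen_h \<Rightarrow> hE | Gen_x \<Rightarrow> xE) (bicrossed_rels p n \<alpha>) \<and>
       comult E gE = pure E E gE gE \<and>
       comult E hE = pure E E hE hE \<and>
       comult E xE = pure E E xE \<one>\<^bsub>E\<^esub> \<oplus>\<^bsub>tensor E E\<^esub> pure E E gE xE \<and>
       (\<exists>F. (\<forall>i j :: nat. F (h [^]\<^bsub>C\<^esub> i, g [^]\<^bsub>D\<^esub> j) = of_nat j - of_nat i * \<alpha>) \<and>
            third_type_datum (C \<times>\<times> D) (\<one>\<^bsub>C\<^esub>, g) F \<and>
            hopf_iso E (third_hopf (C \<times>\<times> D) (\<one>\<^bsub>C\<^esub>, g) F) \<noteq> {})"
    if mp: "matched_pair HC H lact ract" and \<alpha>: "param ract \<alpha>" for lact ract \<alpha>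
  proof -
    note det = matched_pair_determined[OF mp \<alpha>]
    interpret ch: third_character D g f C "character \<alpha>" by (rule third_character[OF det(1)])
    interpret cb: cyclic_bicrossed D g f C h n \<alpha> lact ract
      by (intro cyclic_bicrossed.intro cyclic_third_axioms third_bicrossed.intro third_bicrossed_axioms.intro
            ch.third_character_axioms cyclic_bicrossed_axioms.intro CC.finite_carrier det)
    have "cb.F (h [^]\<^bsub>C\<^esub> i, g [^]\<^bsub>D\<^esub> j) = of_nat j - of_nat i * \<alpha>" for i j :: nat
      by (rule cb.F_pow)
    moreover have "hopf_iso cb.E (third_hopf (C \<times>\<times> D) (\<one>\<^bsub>C\<^esub>, g) cb.F) \<noteq> {}"
      using cb.hopf_iso_Phi by blast
    ultimately have iso: "\<exists>F. (\<forall>i j :: nat. F (h [^]\<^bsub>C\<^esub> i, g [^]\<^bsub>D\<^esub> j) = of_nat j - of_nat i * \<alpha>) \<and>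
        third_type_datum (C \<times>\<times> D) (\<one>\<^bsub>C\<^esub>, g) F \<and> hopf_iso cb.E (third_hopf (C \<times>\<times> D) (\<one>\<^bsub>C\<^esub>, g) F) \<noteq> {}"
      using cb.datum_F by blast
    have units: "\<one>\<^bsub>HC\<^esub> = \<one>\<^bsub>KC\<^esub>" "\<one>\<^bsub>H\<^esub> = \<one>\<^bsub>A\<^esub>" by simp_all
    show ?thesis
      unfolding Let_def mixed_tensor cb.tensor_E units cb.E_simps bicrossed_val_def[symmetric, abs_def]
      using cb.presentation_E[unfolded assms(1)] cb.comult_generators iso by blast
  qed
  have unique: "lact u a = lact' u a \<and> ract u a = ract' u a"
    if "matched_pair HC H lact ract" "param ract \<alpha>" "matched_pair HC H lact' ract'" "param ract' \<alpha>"
      "u \<in> carrier H" "a \<in> carrier HC" for lact ract lact' ract' \<alpha> u a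
    using that matched_pair_determined(2,3)[of lact ract \<alpha> u a] matched_pair_determined(2,3)[of lact' ract' \<alpha> u a] by simp
  have torsion: "{\<alpha>::'k. of_nat n * \<alpha> = 0} = (if p dvd n then UNIV else {0})"
    using of_nat_eq_0_iff_char_dvd[of n, where 'a = 'k] assms(1) by auto
  show ?thesis
    unfolding Let_def parameter_set torsion
    by (intro conjI)
       (use parameter_exists in blast, use unique in blast, simp, simp, use bicrossed[unfolded Let_def] in blast)
qed

end
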